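(* Let $g\ge2$, let $\omega\in V_2$ be the Virasoro conformal vector and $C$ the central charge. The genus $g$ Virasoro $(n+1)$-point differential, with $\omega$ inserted at $x,y_1,\ldots,y_n$, obeys, for all admissible module labels $\boldsymbol\alpha,\boldsymbol\beta$, $$\mathcal F_{\boldsymbol{\alpha\beta}}(\omega,x;\omega,y_1;\ldots;\omega,y_n)=\nabla^{(2,\ldots,2)}_{\boldsymbol y}(x)\,\mathcal F_{\boldsymbol{\alpha\beta}}(\omega,y_1;\ldots;\omega,y_n)+\frac C2\sum_{k=1}^n\omega_2(x,y_k)\,\mathcal F_{\boldsymbol{\alpha\beta}}(\omega,y_1;\ldots;\widehat{\omega,y_k};\ldots;\omega,y_n),$$ where the caret denotes omission of the $\omega$ insertion at $y_k$ and $(2,\ldots,2)$ is an $n$-tuple.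
   Context: **VOA.** $V=(V,Y,\mathbf{1},\omega)$ is a simple vertex operator algebra over $\mathbb{C}$ of strong CFT type ($V=\bigoplus_{n\ge0}V_n$, $\dim V_n<\infty$, $V_0=\mathbb{C}\mathbf{1}$, $L(1)V_1=0$), isomorphic to its contragredient module; $Y(\omega,z)=\sum_nL(n)z^{-n-2}$, $[L(m),L(n)]=(m-n)L(m+n)+\frac C2\binom{m+1}3\delta_{m,-n}$. $\langle\cdot,\cdot\rangle$ is the unique non-degenerate invariant bilinear form on $V$ with $\langle\mathbf 1,\mathbf 1\rangle=1$: $\langle Y(u,z)v,w\rangle=\langle v,Y(e^{zL(1)}(-z^{-2})^{L(0)}u,z^{-1})w\rangle$. **Modules and intertwiners.** $\{(Y_\alpha,\mathcal W_\alpha)\}_{\alpha\in\mathcal A}$ are the inequivalent irreducible ordinary $V$-modules, $\mathcal W_0=V$, $\mathcal W_\alpha=\bigoplus_{n\ge0}\mathcal W_{\alpha,n+h_\alpha}$ with finite-dimensional $L(0)$-eigenspaces of weight $n+h_\alpha$, $h_\alpha\in\mathbb C$. $\mathcal W_{\alpha'}$ is the contragredient module; $\langle\cdot,\cdot\rangle$ also denotes the canonical pairing. $\mathcal Y^\gamma_{\alpha\beta}$ is an intertwining operator of type $\binom{\gamma}{\alpha\ \beta}$ (Frenkel–Huang–Lepowsky), $N^\gamma_{\alpha\beta}$ the dimension of the space of these. It is assumed that $N^\gamma_{\alpha0}=\delta_{\alpha\gamma}$, $N^0_{\alpha\beta}=\delta_{\alpha\beta'}$. Normalizations: $\mathcal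 Y^\beta_{0\beta}=Y_\beta$; $\mathcal Y^\alpha_{\alpha0}(v_\alpha,z)u=e^{zL(-1)}Y_\alpha(u,-z)v_\alpha$; $\langle u,\mathcal Y^0_{\alpha\alpha'}(v_\alpha,z)v_{\alpha'}\rangle=\langle\mathcal Y^\alpha_{\alpha0}(e^{zL(1)}(-z^{-2})^{L(0)}v_\alpha,z^{-1})u,v_{\alpha'}\rangle$; for other types an intertwining operator is fixed. **Correlation forms.** Let $\mathcal I=\{\pm1,\ldots,\pm g\}$, with formal variables $w_a$ ($a\in\mathcal I$), $\rho_a=\rho_{-a}$. For labels $\boldsymbol\alpha=\alpha_1,\ldots,\alpha_g$ let $\{b_a\}$ be a homogeneous basis of $\mathcal W_{\alpha_a}$, $\{b_a'\}$ the dual basis of $\mathcal W_{\alpha_a'}$, $b_{-a}:=\rho_a^{\mathrm{wt}(b_a)}b_a'$. For labels $\boldsymbol\beta=\beta_1,\ldots,\beta_{2g-1}$ with $\beta_1=\alpha_1'$, $\beta_{2g-1}=\alpha_g'$, $\mathcal Y^{\boldsymbol\beta}_{\boldsymbol{\alpha\alpha'}}(\boldsymbol b,\boldsymbol w)=\mathcal Y^0_{\alpha_1\beta_1}(b_1,w_1)\mathcal Y^{\beta_1}_{\alpha_1'\beta_2}(b_{-1},w_{-1})\cdots\mathcal Y^{\beta_{2g-2}}_{\alpha_g\beta_{2g-1}}(b_g,w_g)\mathcal Y^{\beta_{2g-1}}_{\alpha_g'0}(b_{-g},w_{-g})$. For $v_k\in V$, $$\mathcal F_{\boldsymbol{\alpha\beta}}(v_1,y_1;\ldots;v_n,y_n)=\sum_{b_1,\ldots,b_g}\langle\mathbf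 1,Y(v_1,y_1)\cdots Y(v_n,y_n)\,\mathcal Y^{\boldsymbol\beta}_{\boldsymbol{\alpha\alpha'}}(\boldsymbol b,\boldsymbol w)\mathbf 1\rangle\prod_kdy_k^{\mathrm{wt}(v_k)}.$$ **Differential operators.** For Schottky parameters satisfying $|w_a-w_b|>|\rho_a|^{1/2}+|\rho_b|^{1/2}$ for $a\ne b$ in $\mathcal I$, $\Gamma$ is the free (Schottky) group generated by $\gamma_az=w_{-a}+\rho_a/(z-w_a)$, $a=1,\ldots,g$, with limit set $\Lambda(\Gamma)$. The Bers quasiform is $\Psi_2(x,y)=\sum_{\gamma\in\Gamma}\Pi_2(\gamma x,y)$, $\Pi_2(x,y)=\pi_2(x,y)dx^2dy^{-1}$, $\pi_2(x,y)=\frac1{x-y}\prod_{\ell=0}^2\frac{y-A_\ell}{x-A_\ell}$ with $A_0,A_1,A_2$ distinct points of $\Lambda(\Gamma)$. The holomorphic $2$-forms $\Theta_{2,a}^\ell(x)$ ($a=1,\ldots,g$; $\ell=0,1,2$) are defined by $\Psi_2(x,\gamma_ay)-\Psi_2(x,y)=-\sum_{\ell=0}^2\Theta_{2,a}^\ell(x)(y-w_a)^\ell dy^{-1}$. With $\partial_a^0=\partial_{w_a}$, $\partial_a^1=\rho_a\partial_{\rho_a}$, $\partial_a^2=\rho_a\partial_{w_{-a}}$, put $\nabla(x)=\sum_{a=1}^g\sum_{\ell=0}^2\Theta_{2,a}^\ell(x)\partial_a^\ell$. On forms $H(\boldsymbol y)=h(\boldsymbol y)\prod_kdy_k^{m_k}$,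 with $\Psi_2=\psi_2(x,y)dx^2dy^{-1}$, $$\nabla^{(\boldsymbol m)}_{\boldsymbol y}(x)H=\Big[\nabla(x)h+dx^2\sum_k\big(\psi_2(x,y_k)\partial_{y_k}h+m_k(\partial_{y_k}\psi_2(x,y_k))h\big)\Big]\prod_kdy_k^{m_k},$$ where $\nabla(x)$ acts on the Schottky-parameter dependence of $h$ at fixed $\boldsymbol y$. The symmetric $(2,2)$-form is $$\omega_2(x,y)=\tfrac1{3!}\partial_y^3\psi_2(x,y)\,dx^2dy^2=\sum_{\gamma\in\Gamma}\frac{d(\gamma x)^2dy^2}{(\gamma x-y)^4}.$$ **Expansions in $\rho$.** The identity is formal, $\Psi_2,\Theta_{2,a}^\ell$ being represented by the following expansions in the $\rho_a$ ($f^{(i)}=\frac1{i!}\partial^if$, $h^{(i,j)}=\frac1{i!j!}\partial_x^i\partial_y^jh$). Write $\pi_2(x,y)=\frac1{x-y}+\sum_{\ell=0}^2f_\ell(x)y^\ell$. For $a,b\in\mathcal I$, $m,n\ge0$ let $L_b^n(x)=\rho_b^{n/2}\pi_2^{(0,n)}(x,w_b)dx^2$, $R_a^m(y)=\rho_a^{(m+1)/2}\pi_2^{(m,0)}(w_{-a},y)dy^{-1}$, $A_{ab}^{mn}=\rho_a^{(m+1)/2}\rho_b^{n/2}\pi_2^{(m,n)}(w_{-a},w_b)$ if $a\ne-b$, $A_{a,-a}^{mn}=\rho_a^{(m+n+1)/2}\sum_{\ell=0}^2\binom{\ell}{n}f_\ell^{(m)}(w_{-a})w_{-a}^{\ell-n}$,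 $\Delta_{ab}^{mn}=\delta_{m,n+3}\delta_{ab}$, $\widetilde L=L\Delta$, $\widetilde A=A\Delta$, $(I-\widetilde A)^{-1}=\sum_{k\ge0}\widetilde A^k$. Then $\Psi_2=\Pi_2+\widetilde L(x)(I-\widetilde A)^{-1}R(y)$ and $\Theta_{2,a}^\ell(x)=T_a^\ell(x)+\rho_a^{1-\ell}T_{-a}^{2-\ell}(x)$ with $T_a^\ell(x)=\rho_a^{-\ell/2}\big(L(x)+\widetilde L(x)(I-\widetilde A)^{-1}A\big)_a^\ell$. *)

theory Defs
  imports "HOL-Analysis.Analysis" "HOL-Library.Groups_Big_Fun" "HOL-Library.FuncSet"
begin

section \<open>Vertex operator algebras, modules, intertwining operators\<close>

text \<open>
  All vertex operators and intertwining operators are given by their modes: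
  \<open>I v k u\<close> is \<open>v\<^sub>k u\<close>, the coefficient of \<open>z\<close> to the power \<open>- k - 1\<close> in \<open>I(v,z)u\<close>, for complex
  \<open>k\<close>. For the operators \<open>Y\<close> of an algebra or a module only integral modes are non-zero.
  All spaces are subspaces of one ambient complex vector space with scalar
  multiplication \<open>s\<close>. \<open>Sum_any\<close> is the sum of a family with finite support; wherever it is
  used below the support is finite. Writing \<open>\<omega>\<close> for the conformal vector, \<open>L(n) = \<omega>\<^sub>n\<^sub>+\<^sub>1\<close>.
\<close>

type_synonym 'a modes = "'a \<Rightarrow> complex \<Rightarrow> 'a \<Rightarrow> 'a"

definition Lmode :: "'a modes \<Rightarrow> 'a \<Rightarrow> int \<Rightarrow> 'a \<Rightarrow> 'a" where
  "Lmode Y \<omega> n u = Y \<omega> (of_int n + 1) u"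

definition weight_space ::
    "(complex \<Rightarrow> 'a \<Rightarrow> 'a) \<Rightarrow> 'a \<Rightarrow> 'a set \<Rightarrow> 'a modes \<Rightarrow> complex \<Rightarrow> 'a set" where
  "weight_space s \<omega> M Y h = {u \<in> M. Lmode Y \<omega> 0 u = s h u}"

text \<open>
  The Jacobi identity
  \[ z_0^{-1}\delta(\tfrac{z_1-z_2}{z_0}) Y_3(v,z_1)I(w,z_2)u
     - z_0^{-1}\delta(\tfrac{z_2-z_1}{-z_0}) I(w,z_2)Y_2(v,z_1)u
     = z_2^{-1}\delta(\tfrac{z_1-z_0}{z_2}) I(Y_1(v,z_0)w,z_2)u \]
  read off at the coefficient of \<open>z\<^sub>0\<close>, \<open>z\<^sub>1\<close>, \<open>z\<^sub>2\<close> to the powers \<open>-l-1\<close>, \<open>-m-1\<close>, \<open>-k-1\<close>.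
\<close>

definition jacobi ::
    "(complex \<Rightarrow> 'a::ab_group_add \<Rightarrow> 'a) \<Rightarrow> 'a modes \<Rightarrow> 'a modes \<Rightarrow> 'a modes \<Rightarrow> 'a modes \<Rightarrow>
     'a \<Rightarrow> 'a \<Rightarrow> 'a \<Rightarrow> bool" where
  "jacobi s Y1 Y2 Y3 I v w u \<longleftrightarrow> (\<forall>(l::int) (m::int) (k::complex).
     Sum_any (\<lambda>i::nat. s ((-1) ^ i * (of_int l gchoose i))
       (Y3 v (of_int m + of_int l - of_nat i) (I w (k + of_nat i) u)
        - s ((-1) powi l) (I w (of_int l + k - of_nat i) (Y2 v (of_int m + of_nat i) u))))
   = Sum_any (\<lambda>i::nat. s (of_int m gchoose i)
       (I (Y1 v (of_int l + of_nat i) w) (of_int m + k - of_nat i) u)))"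

text \<open>
  The intertwining operators of type \<open>M3\<close> over \<open>M1 M2\<close>, for an algebra with underlying space
  \<open>V\<close>. Operators are extended by \<open>0\<close> outside \<open>M1\<close> and \<open>M2\<close>, so that equality of operators is
  equality of functions.
\<close>

definition intertwiners ::
    "(complex \<Rightarrow> 'a::ab_group_add \<Rightarrow> 'a) \<Rightarrow> 'a \<Rightarrow> 'a set \<Rightarrow> 'a set \<Rightarrow> 'a modes \<Rightarrow> 'a set \<Rightarrow> 'a modes
     \<Rightarrow> 'a set \<Rightarrow> 'a modes \<Rightarrow> 'a modes set" where
  "intertwiners s \<omega> V M1 Y1 M2 Y2 M3 Y3 = {I.
     (\<forall>v k u. v \<notin> M1 \<or> u \<notin> M2 \<longrightarrow> I v k u = 0) \<and>
     (\<forall>v\<in>M1. \<forall>u\<in>M2. \<forall>k. I v k u \<in> M3) \<and>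
     (\<forall>v\<in>M1. \<forall>v'\<in>M1. \<forall>u\<in>M2. \<forall>k c.
        I (v + v') k u = I v k u + I v' k u \<and> I (s c v) k u = s c (I v k u)) \<and>
     (\<forall>v\<in>M1. \<forall>u\<in>M2. \<forall>u'\<in>M2. \<forall>k c.
        I v k (u + u') = I v k u + I v k u' \<and> I v k (s c u) = s c (I v k u)) \<and>
     (\<forall>v\<in>M1. \<forall>u\<in>M2. \<forall>k. \<exists>N::nat. \<forall>j\<ge>N. I v (k + of_nat j) u = 0) \<and>
     (\<forall>v\<in>V. \<forall>w\<in>M1. \<forall>u\<in>M2. jacobi s Y1 Y2 Y3 I v w u) \<and>
     (\<forall>v\<in>M1. \<forall>u\<in>M2. \<forall>k. I (Lmode Y1 \<omega> (-1) v) k u = s (- k) (I v (k - 1) u))}"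

text \<open>
  An ordinary module \<open>M\<close>, graded by \<open>L(0)\<close>-eigenvalues in \<open>h + \<nat>\<close>. Its vertex operator is
  an intertwining operator of type \<open>M\<close> over \<open>V M\<close> with integral modes. For \<open>M = V\<close>,
  \<open>h = 0\<close> these are the corresponding axioms of the algebra itself.
\<close>

definition ordinary_module ::
    "(complex \<Rightarrow> 'a::ab_group_add \<Rightarrow> 'a) \<Rightarrow> 'a \<Rightarrow> 'a \<Rightarrow> 'a set \<Rightarrow> 'a modes \<Rightarrow> complex
     \<Rightarrow> 'a set \<Rightarrow> 'a modes \<Rightarrow> bool" where
  "ordinary_module s vac \<omega> V Y h M YM \<longleftrightarrow>
     module.subspace s M \<and>
     YM \<in> intertwiners s \<omega> V V Y M YM M YM \<and>
     (\<forall>v k u. k \<notin> \<int> \<longrightarrow> YM v k u = 0) \<and>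
     (\<forall>u\<in>M. \<forall>k. YM vac k u = (if k = -1 then u else 0)) \<and>
     M = module.span s (\<Union>n::nat. weight_space s \<omega> M YM (h + of_nat n)) \<and>
     (\<forall>c. \<exists>B. finite B \<and> weight_space s \<omega> M YM c = module.span s B)"

definition irreducible_module ::
    "(complex \<Rightarrow> 'a::ab_group_add \<Rightarrow> 'a) \<Rightarrow> 'a set \<Rightarrow> 'a set \<Rightarrow> 'a modes \<Rightarrow> bool" where
  "irreducible_module s V M YM \<longleftrightarrow> M \<noteq> {0} \<and>
     (\<forall>N. module.subspace s N \<and> N \<subseteq> M \<and> (\<forall>v\<in>V. \<forall>k. \<forall>u\<in>N. YM v k u \<in> N) \<longrightarrow> N = {0} \<or> N = M)"

definition module_isomorphic ::
    "(complex \<Rightarrow> 'a::ab_group_add \<Rightarrow> 'a) \<Rightarrow> 'a set \<Rightarrow> 'a set \<Rightarrow> 'a modes \<Rightarrow> 'a set \<Rightarrow> 'a modes \<Rightarrow> bool"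
  where
  "module_isomorphic s V M YM N YN \<longleftrightarrow> (\<exists>\<phi>. bij_betw \<phi> M N \<and>
     (\<forall>u\<in>M. \<forall>u'\<in>M. \<phi> (u + u') = \<phi> u + \<phi> u') \<and> (\<forall>c. \<forall>u\<in>M. \<phi> (s c u) = s c (\<phi> u)) \<and>
     (\<forall>v\<in>V. \<forall>k. \<forall>u\<in>M. \<phi> (YM v k u) = YN v k (\<phi> u)))"

definition simple_strong_cft_voa ::
    "(complex \<Rightarrow> 'a::ab_group_add \<Rightarrow> 'a) \<Rightarrow> 'a \<Rightarrow> 'a \<Rightarrow> complex \<Rightarrow> 'a set \<Rightarrow> 'a modes \<Rightarrow> bool" where
  "simple_strong_cft_voa s vac \<omega> C V Y \<longleftrightarrow>
     ordinary_module s vac \<omega> V Y 0 V Y \<and>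
     vac \<in> V \<and> \<omega> \<in> weight_space s \<omega> V Y 2 \<and>
     (\<forall>v\<in>V. Y v (-1) vac = v \<and> (\<forall>n::nat. Y v (of_nat n) vac = 0)) \<and>
     (\<forall>m n. \<forall>v\<in>V. Lmode Y \<omega> m (Lmode Y \<omega> n v) - Lmode Y \<omega> n (Lmode Y \<omega> m v)
        = s (of_int (m - n)) (Lmode Y \<omega> (m + n) v)
          + s (if m = - n then C / 2 * (of_int (m + 1) gchoose 3) else 0) v) \<and>
     weight_space s \<omega> V Y 0 = module.span s {vac} \<and>
     (\<forall>v \<in> weight_space s \<omega> V Y 1. Lmode Y \<omega> 1 v = 0) \<and>
     irreducible_module s V V Y"

text \<open>
  For \<open>v\<close> of weight \<open>h\<close>: the coefficient of \<open>z\<close> to the power \<open>-k-1\<close> in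
  \<open>I(e\<^bsup>zL(1)\<^esup> (-z\<^sup>-\<^sup>2)\<^bsup>L(0)\<^esup> v, z\<^sup>-\<^sup>1) u\<close>, with \<open>(-z\<^sup>-\<^sup>2)\<^sup>h = e\<^bsup>\<i>\<pi>h\<^esup> z\<^bsup>-2h\<^esup>\<close> (the branch matters
  only for non-integral \<open>h\<close>). \<open>Y1\<close> is the module structure on the space containing \<open>v\<close>.
\<close>

definition opposite ::
    "(complex \<Rightarrow> 'a::ab_group_add \<Rightarrow> 'a) \<Rightarrow> 'a \<Rightarrow> 'a modes \<Rightarrow> 'a modes \<Rightarrow> complex \<Rightarrow> 'a modes" where
  "opposite s \<omega> Y1 I h v k u = s (exp (\<i> * of_real pi * h))
     (Sum_any (\<lambda>i::nat. s (1 / fact i)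
        (I ((Lmode Y1 \<omega> 1 ^^ i) v) (2 * h - k - of_nat i - 2) u)))"

section \<open>The family of irreducible modules with chosen intertwining operators\<close>

text \<open>
  \<open>iop D \<alpha> \<beta> \<gamma>\<close> is the chosen intertwining operator of type \<open>\<gamma>\<close> over \<open>\<alpha> \<beta>\<close>, and \<open>pairing D \<alpha>\<close>
  is the pairing of \<open>space D \<alpha>\<close> (left) with \<open>space D (contra D \<alpha>)\<close> (right).
  The algebra \<open>V\<close> is \<open>space D (unit_label D)\<close>.
\<close>

record ('i, 'a) voa_family =
  smult :: "complex \<Rightarrow> 'a \<Rightarrow> 'a"
  vacuum :: 'a
  conformal :: 'a
  central_charge :: complex
  labels :: "'i set"
  unit_label :: 'i
  contra :: "'i \<Rightarrow> 'i"
  space :: "'i \<Rightarrow> 'a set"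
  vop :: "'i \<Rightarrow> 'a modes"
  pairing :: "'i \<Rightarrow> 'a \<Rightarrow> 'a \<Rightarrow> complex"
  iop :: "'i \<Rightarrow> 'i \<Rightarrow> 'i \<Rightarrow> 'a modes"

abbreviation algebra_space :: "('i, 'a) voa_family \<Rightarrow> 'a set" where
  "algebra_space D \<equiv> space D (unit_label D)"

abbreviation algebra_vop :: "('i, 'a) voa_family \<Rightarrow> 'a modes" where
  "algebra_vop D \<equiv> vop D (unit_label D)"

definition weight_part :: "('i, 'a) voa_family \<Rightarrow> 'i \<Rightarrow> complex \<Rightarrow> 'a set" where
  "weight_part D \<alpha> h = weight_space (smult D) (conformal D) (space D \<alpha>) (vop D \<alpha>) h"

definition intertwiner_space ::
    "('i, 'a::ab_group_add) voa_family \<Rightarrow> 'i \<Rightarrow> 'i \<Rightarrow> 'i \<Rightarrow> 'a modes set" where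
  "intertwiner_space D \<alpha> \<beta> \<gamma> = intertwiners (smult D) (conformal D) (algebra_space D)
     (space D \<alpha>) (vop D \<alpha>) (space D \<beta>) (vop D \<beta>) (space D \<gamma>) (vop D \<gamma>)"

text \<open>The space of intertwining operators has a basis \<open>J 0, \<dots>, J (N - 1)\<close>.\<close>

definition fusion_number ::
    "('i, 'a::ab_group_add) voa_family \<Rightarrow> 'i \<Rightarrow> 'i \<Rightarrow> 'i \<Rightarrow> nat \<Rightarrow> bool" where
  "fusion_number D \<alpha> \<beta> \<gamma> N \<longleftrightarrow> (\<exists>J :: nat \<Rightarrow> 'a modes.
     (\<forall>i<N. J i \<in> intertwiner_space D \<alpha> \<beta> \<gamma>) \<and>
     (\<forall>I \<in> intertwiner_space D \<alpha> \<beta> \<gamma>. \<exists>!c :: nat \<Rightarrow> complex.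
        (\<forall>i\<ge>N. c i = 0) \<and> I = (\<lambda>v k u. \<Sum>i<N. smult D (c i) (J i v k u))))"

text \<open>
  The last condition says that every irreducible ordinary module occurs. An irreducible
  ordinary module has countable dimension, hence has a copy inside the ambient space.
\<close>

definition irreducibles :: "('i, 'a::ab_group_add) voa_family \<Rightarrow> bool" where
  "irreducibles D \<longleftrightarrow>
     unit_label D \<in> labels D \<and>
     (\<forall>\<alpha> \<in> labels D. (\<exists>h. ordinary_module (smult D) (vacuum D) (conformal D)
          (algebra_space D) (algebra_vop D) h (space D \<alpha>) (vop D \<alpha>)) \<and>
        irreducible_module (smult D) (algebra_space D) (space D \<alpha>) (vop D \<alpha>)) \<and>
     (\<forall>\<alpha> \<in> labels D. \<forall>\<beta> \<in> labels D. \<alpha> \<noteq> \<beta> \<longrightarrow> \<not> module_isomorphic (smult D) (algebra_space D)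
        (space D \<alpha>) (vop D \<alpha>) (space D \<beta>) (vop D \<beta>)) \<and>
     (\<forall>h M YM. ordinary_module (smult D) (vacuum D) (conformal D)
          (algebra_space D) (algebra_vop D) h M YM \<and>
        irreducible_module (smult D) (algebra_space D) M YM \<longrightarrow>
        (\<exists>\<alpha> \<in> labels D. module_isomorphic (smult D) (algebra_space D)
           M YM (space D \<alpha>) (vop D \<alpha>)))"

text \<open>
  \<open>\<alpha>'\<close> labels the contragredient of \<open>\<alpha>\<close>. The pairings of \<open>\<alpha>\<close> with \<open>\<alpha>'\<close> and of \<open>\<alpha>'\<close> with
  \<open>\<alpha>\<close> are not related to each other: for \<open>\<alpha> = \<alpha>'\<close> the invariant form may be
  skew-symmetric. On \<open>V\<close> the pairing is the invariant form normalised on the vacuum.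
\<close>

definition contragredients :: "('i, 'a::ab_group_add) voa_family \<Rightarrow> bool" where
  "contragredients D \<longleftrightarrow>
     contra D (unit_label D) = unit_label D \<and>
     pairing D (unit_label D) (vacuum D) (vacuum D) = 1 \<and>
     (\<forall>\<alpha> \<in> labels D. contra D \<alpha> \<in> labels D \<and> contra D (contra D \<alpha>) = \<alpha> \<and>
       (let p = pairing D \<alpha>; M = space D \<alpha>; M' = space D (contra D \<alpha>) in
         (\<forall>u\<in>M. \<forall>v\<in>M. \<forall>u'\<in>M'. \<forall>c.
            p (u + v) u' = p u u' + p v u' \<and> p (smult D c u) u' = c * p u u') \<and>
         (\<forall>u\<in>M. \<forall>u'\<in>M'. \<forall>v'\<in>M'. \<forall>c.
            p u (u' + v') = p u u' + p u v' \<and> p u (smult D c u') = c * p u u') \<and>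
         (\<forall>u\<in>M. (\<forall>u'\<in>M'. p u u' = 0) \<longrightarrow> u = 0) \<and>
         (\<forall>u'\<in>M'. (\<forall>u\<in>M. p u u' = 0) \<longrightarrow> u' = 0) \<and>
         (\<forall>h. \<forall>v \<in> weight_part D (unit_label D) h. \<forall>u\<in>M. \<forall>u'\<in>M'. \<forall>k.
            p (vop D \<alpha> v k u) u' =
            p u (opposite (smult D) (conformal D) (algebra_vop D) (vop D (contra D \<alpha>)) h v k u'))))"

definition normalised_intertwiners :: "('i, 'a::ab_group_add) voa_family \<Rightarrow> bool" where
  "normalised_intertwiners D \<longleftrightarrow>
     (\<forall>\<alpha> \<in> labels D. \<forall>\<beta> \<in> labels D. \<forall>\<gamma> \<in> labels D. iop D \<alpha> \<beta> \<gamma> \<in> intertwiner_space D \<alpha> \<beta> \<gamma>) \<and>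
     (\<forall>\<beta> \<in> labels D. iop D (unit_label D) \<beta> \<beta> = vop D \<beta>) \<and>
     (\<forall>\<alpha> \<in> labels D. \<forall>v \<in> space D \<alpha>. \<forall>u \<in> algebra_space D.
        (\<forall>k. k \<notin> \<int> \<longrightarrow> iop D \<alpha> (unit_label D) \<alpha> v k u = 0) \<and>
        (\<forall>n::int. iop D \<alpha> (unit_label D) \<alpha> v (of_int n) u =
           Sum_any (\<lambda>i::nat. smult D ((-1) powi (n + int i + 1) / fact i)
             ((Lmode (vop D \<alpha>) (conformal D) (-1) ^^ i) (vop D \<alpha> u (of_int n + of_nat i) v))))) \<and>
     (\<forall>\<alpha> \<in> labels D. \<forall>h. \<forall>v \<in> weight_part D \<alpha> h. \<forall>v' \<in> space D (contra D \<alpha>).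
        \<forall>u \<in> algebra_space D. \<forall>k.
        pairing D (unit_label D) u (iop D \<alpha> (contra D \<alpha>) (unit_label D) v k v') =
        pairing D \<alpha> (opposite (smult D) (conformal D) (vop D \<alpha>)
          (iop D \<alpha> (unit_label D) \<alpha>) h v k u) v')"

definition voa_setting :: "('i, 'a::ab_group_add) voa_family \<Rightarrow> bool" where
  "voa_setting D \<longleftrightarrow>
     vector_space (smult D) \<and>
     simple_strong_cft_voa (smult D) (vacuum D) (conformal D) (central_charge D)
       (algebra_space D) (algebra_vop D) \<and>
     irreducibles D \<and> contragredients D \<and>
     (\<forall>\<alpha> \<in> labels D. \<forall>\<gamma> \<in> labels D.
        fusion_number D \<alpha> (unit_label D) \<gamma> (if \<alpha> = \<gamma> then 1 else 0)) \<and>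
     (\<forall>\<alpha> \<in> labels D. \<forall>\<beta> \<in> labels D.
        fusion_number D \<alpha> \<beta> (unit_label D) (if \<alpha> = contra D \<beta> then 1 else 0)) \<and>
     normalised_intertwiners D"

section \<open>Formal series\<close>

text \<open>
  The formal variables \<open>x\<close>, \<open>y\<^sub>k\<close>, \<open>w\<^sub>a\<close>, \<open>\<rho>\<^sub>a\<close> (the last with \<open>a > 0\<close>, since
  \<open>\<rho>\<^sub>-\<^sub>a = \<rho>\<^sub>a\<close>). A formal series with complex exponents assigns to an exponent vector its
  coefficient.
\<close>

datatype fvar = Xv | Yv nat | Wv int | Rv int

type_synonym fseries = "(fvar \<Rightarrow> complex) \<Rightarrow> complex"

definition monom1 :: "fvar \<Rightarrow> complex \<Rightarrow> fseries" where
  "monom1 p c = (\<lambda>e. if e = (\<lambda>_. 0)(p := c) then 1 else 0)"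

definition const_series :: "complex \<Rightarrow> fseries" where
  "const_series c = (\<lambda>e. if e = (\<lambda>_. 0) then c else 0)"

definition fmult :: "fseries \<Rightarrow> fseries \<Rightarrow> fseries" (infixl "\<star>" 70) where
  "F \<star> G = (\<lambda>e. Sum_any (\<lambda>d. F d * G (\<lambda>q. e q - d q)))"

definition deriv_series :: "fvar \<Rightarrow> fseries \<Rightarrow> fseries" where
  "deriv_series p F = (\<lambda>e. (e p + 1) * F (e(p := e p + 1)))"

definition hderiv :: "fvar \<Rightarrow> nat \<Rightarrow> fseries \<Rightarrow> fseries" where
  "hderiv p m F = (\<lambda>e. (deriv_series p ^^ m) F e / fact m)"

text \<open>
  Rational functions are expanded in the region in which the operator products are written,
  \<open>|x| > |y\<^sub>1| > |y\<^sub>2| > \<dots> > |w\<^sub>1| > |w\<^sub>-\<^sub>1| > |w\<^sub>2| > |w\<^sub>-\<^sub>2| > \<dots>\<close>;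
  \<open>outer p q\<close> means \<open>|p| > |q|\<close>.
\<close>

fun position :: "fvar \<Rightarrow> nat \<times> nat" where
  "position Xv = (0, 0)"
| "position (Yv k) = (1, k)"
| "position (Wv a) = (2, if a > 0 then 2 * nat a else 2 * nat (- a) + 1)"
| "position (Rv a) = (3, nat a)"

definition outer :: "fvar \<Rightarrow> fvar \<Rightarrow> bool" where
  "outer p q \<longleftrightarrow> fst (position p) < fst (position q) \<or>
     fst (position p) = fst (position q) \<and> snd (position p) < snd (position q)"

definition inv_diff :: "fvar \<Rightarrow> fvar \<Rightarrow> fseries" where
  "inv_diff p q = (\<lambda>e.
     if outer p q
     then (if \<exists>i::nat. e = (\<lambda>_. 0)(p := - 1 - of_nat i, q := of_nat i) then 1 else 0)
     else (if \<exists>i::nat. e = (\<lambda>_. 0)(p := of_nat i, q := - 1 - of_nat i) then - 1 else 0))"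

text \<open>Two-sided Laurent series: \<open>c\<close> may be non-zero for infinitely many exponents of either sign.\<close>

definition laurent :: "fvar \<Rightarrow> (int \<Rightarrow> complex) \<Rightarrow> fseries" where
  "laurent p c = (\<lambda>e. if (\<forall>q. q \<noteq> p \<longrightarrow> e q = 0) \<and> e p \<in> \<int> then c \<lfloor>Re (e p)\<rfloor> else 0)"

section \<open>Genus \<open>g\<close> correlation forms\<close>

definition idx :: "nat \<Rightarrow> int set" where
  "idx g = {a. a \<noteq> 0 \<and> \<bar>a\<bar> \<le> int g}"

definition dual_homogeneous_bases ::
    "('i, 'a::ab_group_add) voa_family \<Rightarrow> 'i \<Rightarrow> 'a set \<Rightarrow> ('a \<Rightarrow> 'a) \<Rightarrow> bool" where
  "dual_homogeneous_bases D \<alpha> B B' \<longleftrightarrow>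
     B \<subseteq> (\<Union>h. weight_part D \<alpha> h) \<and>
     \<not> module.dependent (smult D) B \<and> module.span (smult D) B = space D \<alpha> \<and>
     (\<forall>b\<in>B. B' b \<in> space D (contra D \<alpha>)) \<and>
     (\<forall>b\<in>B. \<forall>c\<in>B. pairing D \<alpha> b (B' c) = (if b = c then 1 else 0))"

text \<open>
  The product of the modes of the \<open>2g\<close> intertwining operators that contribute to the
  exponent vector \<open>e\<close>; the intermediate labels are \<open>\<beta>\<^sub>1, \<dots>, \<beta>\<^bsub>2g-1\<^esub>\<close>, preceded and
  followed by the label of \<open>V\<close>.
\<close>

definition handle_modes ::
    "('i, 'a::ab_group_add) voa_family \<Rightarrow> nat \<Rightarrow> (nat \<Rightarrow> 'i) \<Rightarrow> (nat \<Rightarrow> 'i) \<Rightarrow> (nat \<Rightarrow> 'a \<Rightarrow> 'a)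
     \<Rightarrow> (nat \<Rightarrow> 'a) \<Rightarrow> (fvar \<Rightarrow> complex) \<Rightarrow> ('a \<Rightarrow> 'a) list" where
  "handle_modes D g \<alpha> \<beta> B' b e =
     (let bt = (\<lambda>k. if k = 0 \<or> k = 2 * g then unit_label D else \<beta> k) in
      concat (map (\<lambda>a.
        [iop D (\<alpha> a) (bt (2 * a - 1)) (bt (2 * a - 2))
           (b a) (- e (Wv (int a)) - 1),
         iop D (contra D (\<alpha> a)) (bt (2 * a)) (bt (2 * a - 1))
           (B' a (b a)) (- e (Wv (- int a)) - 1)]) [1..<Suc g]))"

text \<open>
  The coefficient function of the correlation form with insertions \<open>vs\<close> (vectors paired with
  their variables, in order); the form itself is this series times the product of
  the \<open>dy\<close> to the weights of the insertions. Since \<open>b\<^sub>-\<^sub>a\<close> carries \<open>\<rho>\<^sub>a\<close> to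
  the power \<open>wt(b\<^sub>a)\<close>, only basis vectors of weight \<open>e(\<rho>\<^sub>a)\<close> contribute to the coefficient at \<open>e\<close>.
\<close>

definition correlation ::
    "('i, 'a::ab_group_add) voa_family \<Rightarrow> nat \<Rightarrow> (nat \<Rightarrow> 'i) \<Rightarrow> (nat \<Rightarrow> 'i) \<Rightarrow> (nat \<Rightarrow> 'a set)
     \<Rightarrow> (nat \<Rightarrow> 'a \<Rightarrow> 'a) \<Rightarrow> ('a \<times> fvar) list \<Rightarrow> fseries" where
  "correlation D g \<alpha> \<beta> B B' vs = (\<lambda>e.
     if \<forall>p. p \<notin> snd ` set vs \<union> Wv ` idx g \<union> Rv ` {1..int g} \<longrightarrow> e p = 0
     then \<Sum>b \<in> PiE {1..g} (\<lambda>a. B a \<inter> weight_part D (\<alpha> a) (e (Rv (int a)))).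
            pairing D (unit_label D) (vacuum D)
              (foldr (\<lambda>T u. T u)
                 (map (\<lambda>(v, p). algebra_vop D v (- e p - 1)) vs @ handle_modes D g \<alpha> \<beta> B' b e)
                 (vacuum D))
     else 0)"

section \<open>Schottky groups and limit points\<close>

definition schottky_parameters :: "nat \<Rightarrow> (int \<Rightarrow> complex) \<Rightarrow> (int \<Rightarrow> complex) \<Rightarrow> bool" where
  "schottky_parameters g w \<rho> \<longleftrightarrow>
     (\<forall>a \<in> idx g. \<rho> a \<noteq> 0 \<and> \<rho> (- a) = \<rho> a) \<and>
     (\<forall>a \<in> idx g. \<forall>b \<in> idx g. a \<noteq> b \<longrightarrow>
        cmod (w a - w b) > sqrt (cmod (\<rho> a)) + sqrt (cmod (\<rho> b)))"

text \<open>
  \<open>\<gamma>\<^sub>a\<close> on the Riemann sphere, \<open>None\<close> being the point at infinity; the inverse of \<open>\<gamma>\<^sub>a\<close> is \<open>\<gamma>\<^sub>-\<^sub>a\<close>.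
\<close>

definition schottky_map ::
    "(int \<Rightarrow> complex) \<Rightarrow> (int \<Rightarrow> complex) \<Rightarrow> int \<Rightarrow> complex option \<Rightarrow> complex option" where
  "schottky_map w \<rho> a z = (case z of
       None \<Rightarrow> Some (w (- a))
     | Some u \<Rightarrow> if u = w a then None else Some (w (- a) + \<rho> a / (u - w a)))"

inductive_set schottky_group ::
    "nat \<Rightarrow> (int \<Rightarrow> complex) \<Rightarrow> (int \<Rightarrow> complex) \<Rightarrow> (complex option \<Rightarrow> complex option) set"
  for g w \<rho> where
  schottky_id: "id \<in> schottky_group g w \<rho>"
| schottky_comp: "a \<in> idx g \<Longrightarrow> \<gamma> \<in> schottky_group g w \<rho> \<Longrightarrow>
     schottky_map w \<rho> a \<circ> \<gamma> \<in> schottky_group g w \<rho>"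

text \<open>The point at infinity is not a limit point, so the limit set is a set of complex numbers.\<close>

definition limit_set :: "nat \<Rightarrow> (int \<Rightarrow> complex) \<Rightarrow> (int \<Rightarrow> complex) \<Rightarrow> complex set" where
  "limit_set g w \<rho> = {p. \<exists>z \<gamma> u. inj \<gamma> \<and> (\<forall>n::nat. \<gamma> n \<in> schottky_group g w \<rho> \<and> \<gamma> n z = Some (u n)) \<and>
     u \<longlonglongrightarrow> p}"

section \<open>The expansions of the Bers quasiform\<close>

text \<open>
  \<open>times_linear a c\<close> are the coefficients of the Laurent series \<open>(x - a) c(x)\<close>.
  \<open>bers_coefficients A f\<close> states that the formal Laurent series \<open>f\<^sub>0, f\<^sub>1, f\<^sub>2\<close> satisfy
  \[ \frac1{x-y} + \sum_{\ell=0}^2 f_\ell(x) y^\ell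
     = \frac1{x-y} \prod_{\ell=0}^2 \frac{y-A_\ell}{x-A_\ell} \]
  with denominators cleared, for every \<open>y\<close> (both sides being polynomial in \<open>y\<close>). Thus \<open>f\<close> may be
  the expansion of the rational functions \<open>f\<^sub>\<ell>\<close> in any of the annuli cut out by the \<open>|A\<^sub>\<ell>|\<close>.
\<close>

definition times_linear :: "complex \<Rightarrow> (int \<Rightarrow> complex) \<Rightarrow> int \<Rightarrow> complex" where
  "times_linear a c = (\<lambda>k. c (k - 1) - a * c k)"

definition bers_coefficients :: "(nat \<Rightarrow> complex) \<Rightarrow> (nat \<Rightarrow> int \<Rightarrow> complex) \<Rightarrow> bool" where
  "bers_coefficients A f \<longleftrightarrow> (\<forall>y.
     times_linear (A 0) (times_linear (A 1) (times_linear (A 2)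
       (\<lambda>k. (if k = 0 then 1 else 0) + times_linear y (\<lambda>j. \<Sum>l\<le>2. f l j * y ^ l) k)))
     = (\<lambda>k. if k = 0 then \<Prod>l\<le>2. (y - A l) else 0))"

text \<open>
  In what follows \<open>f p l\<close> is the series by which \<open>f\<^sub>l\<close> is represented when it is evaluated at the
  variable \<open>p\<close>; different variables may lie in different annuli. The \<open>A\<^sub>\<ell>\<close> are constants
  for the formal variables, as \<open>\<nabla>\<close> never differentiates the quasiform with respect to the
  Schottky parameters.
\<close>

definition pi2 :: "(fvar \<Rightarrow> nat \<Rightarrow> int \<Rightarrow> complex) \<Rightarrow> fvar \<Rightarrow> fvar \<Rightarrow> fseries" where
  "pi2 f p q = (\<lambda>e. inv_diff p q e + (\<Sum>l\<le>2. (laurent p (f p l) \<star> monom1 q (of_nat l)) e))"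

definition pi2_deriv ::
    "(fvar \<Rightarrow> nat \<Rightarrow> int \<Rightarrow> complex) \<Rightarrow> nat \<Rightarrow> nat \<Rightarrow> fvar \<Rightarrow> fvar \<Rightarrow> fseries" where
  "pi2_deriv f m n p q = hderiv p m (hderiv q n (pi2 f p q))"

definition rho_pow :: "int \<Rightarrow> complex \<Rightarrow> fseries" where
  "rho_pow a c = monom1 (Rv \<bar>a\<bar>) c"

text \<open>Rows, columns and matrices are indexed by pairs \<open>(a, m)\<close> with \<open>a \<in> idx g\<close>.\<close>

definition Lrow :: "(fvar \<Rightarrow> nat \<Rightarrow> int \<Rightarrow> complex) \<Rightarrow> int \<times> nat \<Rightarrow> fseries" where
  "Lrow f = (\<lambda>(b, n). rho_pow b (of_nat n / 2) \<star> pi2_deriv f 0 n Xv (Wv b))"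

definition Rcol :: "(fvar \<Rightarrow> nat \<Rightarrow> int \<Rightarrow> complex) \<Rightarrow> fvar \<Rightarrow> int \<times> nat \<Rightarrow> fseries" where
  "Rcol f y = (\<lambda>(a, m). rho_pow a ((of_nat m + 1) / 2) \<star> pi2_deriv f m 0 (Wv (- a)) y)"

definition Amat :: "(fvar \<Rightarrow> nat \<Rightarrow> int \<Rightarrow> complex) \<Rightarrow> int \<times> nat \<Rightarrow> int \<times> nat \<Rightarrow> fseries" where
  "Amat f = (\<lambda>(a, m) (b, n).
     if b \<noteq> - a
     then rho_pow a ((of_nat m + 1) / 2) \<star> rho_pow b (of_nat n / 2)
            \<star> pi2_deriv f m n (Wv (- a)) (Wv b)
     else rho_pow a ((of_nat m + of_nat n + 1) / 2) \<star>
            (\<lambda>e. \<Sum>l\<le>2. of_nat (l choose n) *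
               (hderiv (Wv (- a)) m (laurent (Wv (- a)) (f (Wv (- a)) l))
                  \<star> monom1 (Wv (- a)) (of_nat l - of_nat n)) e))"

definition Delta :: "int \<times> nat \<Rightarrow> int \<times> nat \<Rightarrow> fseries" where
  "Delta = (\<lambda>(a, m) (b, n). const_series (if m = n + 3 \<and> a = b then 1 else 0))"

definition row_times_col ::
    "nat \<Rightarrow> (int \<times> nat \<Rightarrow> fseries) \<Rightarrow> (int \<times> nat \<Rightarrow> fseries) \<Rightarrow> fseries" where
  "row_times_col g r c = (\<lambda>e. Sum_any (\<lambda>i. if fst i \<in> idx g then (r i \<star> c i) e else 0))"

definition row_times_mat ::
    "nat \<Rightarrow> (int \<times> nat \<Rightarrow> fseries) \<Rightarrow> (int \<times> nat \<Rightarrow> int \<times> nat \<Rightarrow> fseries)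
     \<Rightarrow> int \<times> nat \<Rightarrow> fseries" where
  "row_times_mat g r M = (\<lambda>j. row_times_col g r (\<lambda>i. M i j))"

definition mat_times_mat ::
    "nat \<Rightarrow> (int \<times> nat \<Rightarrow> int \<times> nat \<Rightarrow> fseries) \<Rightarrow> (int \<times> nat \<Rightarrow> int \<times> nat \<Rightarrow> fseries)
     \<Rightarrow> int \<times> nat \<Rightarrow> int \<times> nat \<Rightarrow> fseries" where
  "mat_times_mat g M N = (\<lambda>i. row_times_mat g (M i) N)"

fun mat_pow ::
    "nat \<Rightarrow> (int \<times> nat \<Rightarrow> int \<times> nat \<Rightarrow> fseries) \<Rightarrow> nat \<Rightarrow> int \<times> nat \<Rightarrow> int \<times> nat \<Rightarrow> fseries" where
  "mat_pow g M 0 = (\<lambda>i j. const_series (if i = j then 1 else 0))"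
| "mat_pow g M (Suc k) = mat_times_mat g M (mat_pow g M k)"

definition geometric ::
    "nat \<Rightarrow> (int \<times> nat \<Rightarrow> int \<times> nat \<Rightarrow> fseries) \<Rightarrow> int \<times> nat \<Rightarrow> int \<times> nat \<Rightarrow> fseries" where
  "geometric g M = (\<lambda>i j e. Sum_any (\<lambda>k. mat_pow g M k i j e))"

definition Ltilde_resolvent ::
    "nat \<Rightarrow> (fvar \<Rightarrow> nat \<Rightarrow> int \<Rightarrow> complex) \<Rightarrow> int \<times> nat \<Rightarrow> fseries" where
  "Ltilde_resolvent g f =
     row_times_mat g (row_times_mat g (Lrow f) Delta)
       (geometric g (mat_times_mat g (Amat f) Delta))"

text \<open>
  The series below are the coefficient functions of the forms of the same name:
  \<open>psi2 g f y\<close> of \<open>\<Psi>\<^sub>2(x,y)\<close>, \<open>Theta2 g f a l\<close> of \<open>\<Theta>\<^sub>2\<^sub>,\<^sub>a\<close> with upper index \<open>l\<close>, and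
  \<open>omega2 g f y\<close> of \<open>\<omega>\<^sub>2(x,y)\<close>.
\<close>

definition psi2 :: "nat \<Rightarrow> (fvar \<Rightarrow> nat \<Rightarrow> int \<Rightarrow> complex) \<Rightarrow> fvar \<Rightarrow> fseries" where
  "psi2 g f y = (\<lambda>e. pi2 f Xv y e + row_times_col g (Ltilde_resolvent g f) (Rcol f y) e)"

definition T2 :: "nat \<Rightarrow> (fvar \<Rightarrow> nat \<Rightarrow> int \<Rightarrow> complex) \<Rightarrow> int \<Rightarrow> nat \<Rightarrow> fseries" where
  "T2 g f a l = rho_pow a (- of_nat l / 2) \<star>
     (\<lambda>e. Lrow f (a, l) e + row_times_mat g (Ltilde_resolvent g f) (Amat f) (a, l) e)"

definition Theta2 :: "nat \<Rightarrow> (fvar \<Rightarrow> nat \<Rightarrow> int \<Rightarrow> complex) \<Rightarrow> int \<Rightarrow> nat \<Rightarrow> fseries" where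
  "Theta2 g f a l =
     (\<lambda>e. T2 g f a l e + (rho_pow a (1 - of_nat l) \<star> T2 g f (- a) (2 - l)) e)"

definition omega2 :: "nat \<Rightarrow> (fvar \<Rightarrow> nat \<Rightarrow> int \<Rightarrow> complex) \<Rightarrow> fvar \<Rightarrow> fseries" where
  "omega2 g f y = hderiv y 3 (psi2 g f y)"

section \<open>The differential operator\<close>

definition moduli_deriv :: "int \<Rightarrow> nat \<Rightarrow> fseries \<Rightarrow> fseries" where
  "moduli_deriv a l h =
     (if l = 0 then deriv_series (Wv a) h
      else if l = 1 then rho_pow a 1 \<star> deriv_series (Rv a) h
      else rho_pow a 1 \<star> deriv_series (Wv (- a)) h)"

text \<open>
  The action on the form with coefficient function \<open>h\<close> and degree \<open>m k\<close> in \<open>dy\<^sub>k\<close>, \<open>1 \<le> k \<le> n\<close>.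
  The result is the coefficient of \<open>dx\<^sup>2\<close> times the same product of powers of the \<open>dy\<^sub>k\<close>.
\<close>

definition nabla ::
    "nat \<Rightarrow> (fvar \<Rightarrow> nat \<Rightarrow> int \<Rightarrow> complex) \<Rightarrow> nat \<Rightarrow> (nat \<Rightarrow> nat) \<Rightarrow> fseries \<Rightarrow> fseries" where
  "nabla g f n m h = (\<lambda>e.
     (\<Sum>a\<in>{1..int g}. \<Sum>l\<le>2. (Theta2 g f a l \<star> moduli_deriv a l h) e) +
     (\<Sum>k\<in>{1..n}. (psi2 g f (Yv k) \<star> deriv_series (Yv k) h) e
        + of_nat (m k) * (deriv_series (Yv k) (psi2 g f (Yv k)) \<star> h) e))"

end

theory Submission
  imports Defs
begin

text \<open>
  The vector \<open>\<omega>\<close> at \<open>x\<close> is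
  \<open>\<omega>\<^sub>-\<^sub>1\<close> applied to the vacuum at \<open>x\<close>. The
  correlation form with the additional insertion is therefore obtained from the list of points
  \<open>x, y\<^sub>1, \<dots>, y\<^sub>n, w\<^sub>1, w\<^sub>-\<^sub>1, \<dots>, w\<^sub>g,
  w\<^sub>-\<^sub>g\<close>, with the vacuum at \<open>x\<close> and \<open>\<omega>\<close> at
  each \<open>y\<^sub>k\<close>, by letting a single mode \<open>\<omega>\<^sub>m\<close> act on
  one of the inserted states. The series \<open>hit_series p m\<close> is the result of applying
  \<open>\<omega>\<^sub>m\<close> at the point \<open>p\<close>, summed over the dual bases, and
  the theorem expresses \<open>hit_series Xv (- 1)\<close> through the series with other
  \<open>p\<close> and \<open>m\<close>.

  Three facts about these series carry the proof. The Jacobi identity moves a mode of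
  \<open>\<omega>\<close> from its point past all other operators until it meets the vacuum on
  either side. For a negative mode this is the local Ward identity (\<open>local_ward\<close>,
  \<open>hit_series_ward\<close>): the mode at \<open>p\<close> becomes a sum over the other
  points \<open>q\<close> of derivatives of \<open>1/(p - q)\<close> times non-negative modes at
  \<open>q\<close>. For the modes that kill the vacuum on both sides it is the global identity
  (\<open>global_ward\<close>, \<open>hit_series_global\<close>), that is sl(2) invariance. By
  the global identity any quadratic polynomial in \<open>q\<close> may be added to \<open>1/(p -
  q)\<close>, so the kernel \<open>1/(p - q)\<close> may be replaced by
  \<open>\<pi>\<^sub>2(p,q)\<close> (\<open>pi2_ward\<close>) at the cost of the quadratic
  polynomial itself at the point \<open>p\<close>. The third fact is that
  \<open>\<omega>\<^sub>m\<close> and \<open>\<omega>\<^sub>2\<^sub>-\<^sub>m\<close> are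
  adjoint for the pairing. In the sum over dual bases this exchanges the two ends of a handle: a
  mode \<open>m\<close> at \<open>w\<^sub>a\<close> equals \<open>\<rho>\<^sub>a\<close> to the
  power \<open>m - 1\<close> times a mode \<open>2 - m\<close> at
  \<open>w\<^sub>-\<^sub>a\<close> (\<open>hit_series_adj\<close>).

  The Ward identity at \<open>x\<close> contains three kinds of terms. At
  \<open>y\<^sub>k\<close> only the modes 0, 1 and 3 survive, and they give the derivative,
  twice the form and \<open>C/2\<close> times the form with \<open>\<omega>\<close> removed
  (\<open>hit_series_Y\<close>). At \<open>w\<^sub>a\<close> the modes 0, 1, 2 are, up to powers
  of \<open>\<rho>\<^sub>a\<close>, the derivatives with respect to \<open>w\<^sub>a\<close>,
  \<open>\<rho>\<^sub>a\<close> and \<open>w\<^sub>-\<^sub>a\<close>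
  (\<open>moduli_deriv_hit_series\<close>). The modes at least 3 at \<open>w\<^sub>a\<close> are
  not derivatives, but by adjointness they are negative modes at
  \<open>w\<^sub>-\<^sub>a\<close>, to which the Ward identity applies again. This is a linear
  system \<open>column_equation\<close> for the column \<open>H\<close> of these modes, of the
  form \<open>H = A~ H + S\<close> where the matrix is the truncated moment matrix and
  \<open>S\<close> contains only terms of the first two kinds. The row \<open>Q\<close> that is
  \<open>L~\<close> times the inverse of \<open>1 - A~\<close> satisfies \<open>Q = L~ + Q
  A~\<close>, hence \<open>L~ H = Q H - Q A~ H = Q S\<close> (\<open>resolvent_solves\<close>).
  Substituting this, the coefficients at \<open>y\<^sub>k\<close> become the derivatives of
  \<open>\<psi>\<^sub>2(x,y\<^sub>k)\<close> and those at \<open>w\<^sub>a\<close> become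
  \<open>T\<^sub>a\<close>; combining \<open>a\<close> with \<open>-a\<close> by adjointness
  turns the latter into \<open>\<Theta>\<^sub>2\<close> (\<open>Theta_sum\<close>).

  All series are formal, with infinitely many exponents in both directions, so every product and
  every exchange of sums needs a finiteness argument. It rests on gradings. Read from the left,
  the exponents of an initial segment of the points are bounded above, because intermediate
  states have weights bounded below; the exponents of \<open>\<rho>\<close> are bounded below
  for the same reason; and for the total degree in which \<open>\<rho>\<^sub>a\<close> counts
  twice, each correlation series and each pole is homogeneous. Products of such series are
  finite sums (notion \<open>tame\<close>). The coefficient series \<open>f\<^sub>l\<close> of
  \<open>\<pi>\<^sub>2\<close> may be infinite in both directions, but each degree has only tame
  contributions (notion \<open>slice_tame\<close>), which suffices for one factor in a product
  of tame ones. Each entry of the moment matrix carries a power of \<open>\<rho>\<close> that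
  grows with its indices, which makes the infinite matrix products and the geometric series
  locally finite.
\<close>

section \<open>Sums with finitely many non-zero terms\<close>

lemma Sum_any_cmult: "Sum_any (\<lambda>x. c * f x) = (c::complex) * Sum_any f"
proof (cases "c = 0")
  case False
  then have "{x. c * f x \<noteq> 0} = {x. f x \<noteq> 0}" by auto
  then show ?thesis by (simp add: Sum_any.expand_set sum_distrib_left)
qed simp

lemma Sum_any_multc: "Sum_any (\<lambda>x. f x * c) = Sum_any f * (c::complex)"
  using Sum_any_cmult[of c f] by (simp add: mult.commute)

lemma Sum_any_nested:
  fixes h :: "'x \<Rightarrow> 'y \<Rightarrow> 'b::comm_monoid_add"
  assumes "finite {(x, y). h x y \<noteq> 0}"
  shows "Sum_any (\<lambda>x. Sum_any (h x)) = Sum_any (\<lambda>(x, y). h x y)"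
proof -
  let ?C = "(fst ` {(x, y). h x y \<noteq> 0}) \<times> (snd ` {(x, y). h x y \<noteq> 0})"
  have "finite ?C" using assms by blast
  moreover have "{a. \<exists>b. h a b \<noteq> 0} \<times> {b. \<exists>a. h a b \<noteq> 0} \<subseteq> ?C"
    by (force simp: image_iff)
  ultimately show ?thesis by (rule Sum_any.cartesian_product)
qed

lemma Sum_any_nested3:
  fixes h :: "'x \<Rightarrow> 'y \<Rightarrow> 'z \<Rightarrow> 'b::comm_monoid_add"
  assumes fin: "finite {(x, y, z). h x y z \<noteq> 0}"
  shows "Sum_any (\<lambda>x. Sum_any (\<lambda>y. Sum_any (h x y))) = Sum_any (\<lambda>(x, y, z). h x y z)"
proof -
  have "finite {(y, z). h x y z \<noteq> 0}" for x
    by (rule finite_subset[OF _ finite_imageI[OF fin, of snd]]) (force simp: image_iff)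
  then have "Sum_any (\<lambda>x. Sum_any (\<lambda>y. Sum_any (h x y)))
      = Sum_any (\<lambda>x. Sum_any (\<lambda>yz. case yz of (y, z) \<Rightarrow> h x y z))"
    by (simp add: Sum_any_nested)
  also have "\<dots> = Sum_any (\<lambda>(x, yz). case yz of (y, z) \<Rightarrow> h x y z)"
    by (rule Sum_any_nested) (use fin in \<open>simp add: case_prod_unfold\<close>)
  finally show ?thesis by simp
qed

lemma Sum_any_nested4:
  fixes h :: "'x \<Rightarrow> 'y \<Rightarrow> 'z \<Rightarrow> 'w \<Rightarrow> 'b::comm_monoid_add"
  assumes fin: "finite {(x, y, z, w). h x y z w \<noteq> 0}"
  shows "Sum_any (\<lambda>x. Sum_any (\<lambda>y. Sum_any (\<lambda>z. Sum_any (h x y z))))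
    = Sum_any (\<lambda>(x, y, z, w). h x y z w)"
proof -
  have "finite {(y, z, w). h x y z w \<noteq> 0}" for x
    by (rule finite_subset[OF _ finite_imageI[OF fin, of snd]]) (force simp: image_iff)
  then have "Sum_any (\<lambda>x. Sum_any (\<lambda>y. Sum_any (\<lambda>z. Sum_any (h x y z))))
      = Sum_any (\<lambda>x. Sum_any (\<lambda>yz. case yz of (y, z, w) \<Rightarrow> h x y z w))"
    by (simp add: Sum_any_nested3)
  also have "\<dots> = Sum_any (\<lambda>(x, yz). case yz of (y, z, w) \<Rightarrow> h x y z w)"
    by (rule Sum_any_nested) (use fin in \<open>simp add: case_prod_unfold\<close>)
  finally show ?thesis by simp
qed

lemma Sum_any_bij:
  assumes "bij l"
  shows "Sum_any (\<lambda>x. f (l x)) = Sum_any f"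
  by (rule Sum_any.reindex_cong[OF assms, symmetric]) (auto simp: o_def)

lemma Sum_any_sum:
  assumes "finite X" "\<And>x. x \<in> X \<Longrightarrow> finite {i. f x i \<noteq> 0}"
  shows "Sum_any (\<lambda>i. \<Sum>x\<in>X. f x i) = (\<Sum>x\<in>X. Sum_any (f x :: _ \<Rightarrow> 'b::comm_monoid_add))"
  using assms
proof (induction X rule: finite_induct)
  case (insert x X)
  have "{i. (\<Sum>x\<in>X. f x i) \<noteq> 0} \<subseteq> (\<Union>x\<in>X. {i. f x i \<noteq> 0})"
    by (auto dest: sum.not_neutral_contains_not_neutral)
  then have "finite {i. (\<Sum>x\<in>X. f x i) \<noteq> 0}"
    by (rule finite_subset) (use insert in auto)
  with insert show ?case by (simp add: Sum_any.distrib)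
qed simp

lemma Sum_any_single:
  assumes "\<And>x. x \<noteq> a \<Longrightarrow> f x = 0"
  shows "Sum_any f = f a"
proof -
  have "{x. f x \<noteq> 0} \<subseteq> {a}" using assms by auto
  then show ?thesis using Sum_any.expand_superset[of "{a}" f] by simp
qed

lemma Sum_any_unit: "Sum_any (f :: unit \<Rightarrow> _) = f ()"
  by (rule Sum_any_single) simp

lemma Sum_any_Suc:
  fixes f :: "nat \<Rightarrow> 'b::comm_monoid_add"
  assumes "finite {k. f k \<noteq> 0}"
  shows "Sum_any f = f 0 + Sum_any (\<lambda>k. f (Suc k))"
proof -
  obtain N where N: "{k. f k \<noteq> 0} \<subseteq> {..N}" using assms finite_nat_iff_bounded_le by blast
  have "Sum_any f = sum f {..Suc N}"
    by (rule Sum_any.expand_superset) (use N in force)+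
  also have "\<dots> = f 0 + (\<Sum>k\<le>N. f (Suc k))" by (rule sum.atMost_Suc_shift)
  also have "(\<Sum>k\<le>N. f (Suc k)) = Sum_any (\<lambda>k. f (Suc k))"
    by (rule Sum_any.expand_superset[symmetric]) (use N in force)+
  finally show ?thesis .
qed

section \<open>Products and derivatives of formal series\<close>

abbreviation esub :: "(fvar \<Rightarrow> complex) \<Rightarrow> (fvar \<Rightarrow> complex) \<Rightarrow> fvar \<Rightarrow> complex" where
  "esub e d \<equiv> (\<lambda>q. e q - d q)"

lemma fmult_commute: "F \<star> G = G \<star> F"
proof
  fix e
  have "bij (esub e)" by (rule bij_betw_byWitness[of _ "esub e"]) auto
  from Sum_any_bij[OF this, of "\<lambda>d. F d * G (esub e d)"]
  show "(F \<star> G) e = (G \<star> F) e" by (simp add: fmult_def mult.commute)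
qed

lemma monom1_fmult: "(monom1 p c \<star> G) e = G (e(p := e p - c))"
proof -
  let ?a = "(\<lambda>_. 0)(p := c)"
  have a: "esub e ?a = e(p := e p - c)" by auto
  have "(monom1 p c \<star> G) e = monom1 p c ?a * G (esub e ?a)"
    unfolding fmult_def by (rule Sum_any_single) (simp add: monom1_def)
  moreover have "monom1 p c ?a = 1" unfolding monom1_def by (rule if_P) (rule refl)
  ultimately show ?thesis unfolding a by (simp only: mult_1)
qed

lemma const_fmult: "(const_series c \<star> G) e = c * G e"
proof -
  have "(const_series c \<star> G) e = const_series c (\<lambda>_. 0) * G (esub e (\<lambda>_. 0))"
    unfolding fmult_def by (rule Sum_any_single) (simp add: const_series_def)
  then show ?thesis by (simp add: const_series_def)
qed

lemma fmult_const: "(G \<star> const_series c) e = c * G e"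
  by (simp only: fmult_commute[of G] const_fmult)

lemma fmult_zero [simp]: "(\<lambda>_. 0) \<star> G = (\<lambda>_. 0)" "G \<star> (\<lambda>_. 0) = (\<lambda>_. 0)"
  by (auto simp: fmult_def)

lemma monom1_fmult_assoc: "(monom1 p c \<star> F) \<star> G = monom1 p c \<star> (F \<star> G)"
proof
  fix e
  let ?u = "\<lambda>d::fvar \<Rightarrow> complex. d(p := d p + c)"
  have b: "bij ?u" by (rule bij_betw_byWitness[of _ "\<lambda>d. d(p := d p - c)"]) auto
  have "((monom1 p c \<star> F) \<star> G) e = Sum_any (\<lambda>d. F (d(p := d p - c)) * G (esub e d))"
    by (simp add: fmult_def[of "monom1 p c \<star> F"] monom1_fmult)
  also have "\<dots> = Sum_any (\<lambda>d. F d * G (esub e (?u d)))"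
    by (subst Sum_any_bij[OF b, symmetric]) simp
  also have "\<dots> = (F \<star> G) (e(p := e p - c))"
  proof -
    have "esub e (?u d) = esub (e(p := e p - c)) d" for d by auto
    then show ?thesis by (simp only: fmult_def)
  qed
  finally show "((monom1 p c \<star> F) \<star> G) e = (monom1 p c \<star> (F \<star> G)) e" by (simp add: monom1_fmult)
qed

lemma fmult_monom1_assoc: "F \<star> (monom1 p c \<star> G) = (monom1 p c \<star> F) \<star> G"
proof -
  have "F \<star> (monom1 p c \<star> G) = (monom1 p c \<star> G) \<star> F" by (rule fmult_commute)
  also have "\<dots> = monom1 p c \<star> (G \<star> F)" by (rule monom1_fmult_assoc)
  also have "G \<star> F = F \<star> G" by (rule fmult_commute)
  finally show ?thesis by (simp only: monom1_fmult_assoc)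
qed

lemma monom1_monom1: "monom1 p a \<star> (monom1 p b \<star> G) = monom1 p (a + b) \<star> G"
  by (auto simp: fun_eq_iff monom1_fmult algebra_simps)

text \<open>
  Finiteness of every coefficient sum, which distributivity needs: the product itself takes the
  value 0 at exponents with infinitely many contributions.
\<close>
definition convolvable :: "fseries \<Rightarrow> fseries \<Rightarrow> bool" where
  "convolvable F G \<longleftrightarrow> (\<forall>e. finite {d. F d \<noteq> 0 \<and> G (esub e d) \<noteq> 0})"

lemma convolvable_finite: "convolvable F G \<Longrightarrow> finite {d. F d * G (esub e d) \<noteq> 0}"
  by (simp add: convolvable_def)

lemma convolvable_commute:
  assumes "convolvable F G" shows "convolvable G F"
  unfolding convolvable_def
proof
  fix e
  have "{d. G d \<noteq> 0 \<and> F (esub e d) \<noteq> 0} = esub e ` {d. F d \<noteq> 0 \<and> G (esub e d) \<noteq> 0}"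
  proof (rule set_eqI, rule iffI)
    fix d assume "d \<in> {d. G d \<noteq> 0 \<and> F (esub e d) \<noteq> 0}"
    then show "d \<in> esub e ` {d. F d \<noteq> 0 \<and> G (esub e d) \<noteq> 0}"
      by (intro image_eqI[of _ _ "esub e d"]) auto
  qed auto
  then show "finite {d. G d \<noteq> 0 \<and> F (esub e d) \<noteq> 0}"
    using assms by (simp add: convolvable_def)
qed

lemma fmult_sum_right:
  assumes "finite X" "\<And>x. x \<in> X \<Longrightarrow> convolvable F (G x)"
  shows "(F \<star> (\<lambda>e. \<Sum>x\<in>X. c x * G x e)) e = (\<Sum>x\<in>X. c x * (F \<star> G x) e)"
proof -
  have "(F \<star> (\<lambda>e. \<Sum>x\<in>X. c x * G x e)) e
      = Sum_any (\<lambda>d. \<Sum>x\<in>X. c x * (F d * G x (esub e d)))"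
    by (simp add: fmult_def sum_distrib_left mult_ac)
  also have "\<dots> = (\<Sum>x\<in>X. Sum_any (\<lambda>d. c x * (F d * G x (esub e d))))"
    by (rule Sum_any_sum[OF assms(1)])
       (auto intro: rev_finite_subset[OF convolvable_finite[OF assms(2)]])
  finally show ?thesis by (simp add: fmult_def Sum_any_cmult)
qed

lemma fmult_sum_left:
  assumes "finite X" "\<And>x. x \<in> X \<Longrightarrow> convolvable (G x) F"
  shows "((\<lambda>e. \<Sum>x\<in>X. c x * G x e) \<star> F) e = (\<Sum>x\<in>X. c x * (G x \<star> F) e)"
proof -
  have "(F \<star> (\<lambda>e. \<Sum>x\<in>X. c x * G x e)) e = (\<Sum>x\<in>X. c x * (F \<star> G x) e)"
    by (rule fmult_sum_right[OF assms(1)]) (simp add: assms(2) convolvable_commute)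
  then show ?thesis by (simp only: fmult_commute[of _ F])
qed

lemma fmult_add_right:
  assumes "convolvable F G" "convolvable F H"
  shows "(F \<star> (\<lambda>e. G e + H e)) e = (F \<star> G) e + (F \<star> H) e"
  using fmult_sum_right[of "{True, False}" F "\<lambda>b. if b then G else H" "\<lambda>_. 1" e] assms
  by simp

lemma fmult_add_left:
  assumes "convolvable G F" "convolvable H F"
  shows "((\<lambda>e. G e + H e) \<star> F) e = (G \<star> F) e + (H \<star> F) e"
  using fmult_sum_left[of "{True, False}" "\<lambda>b. if b then G else H" F "\<lambda>_. 1" e] assms
  by simp

lemma fmult_cmult_right: "(F \<star> (\<lambda>e. c * G e)) e = c * (F \<star> G) e"
  by (simp add: fmult_def Sum_any_cmult[symmetric] mult_ac)

text \<open>
  The one associativity law behind every rearrangement below: row times (matrix times column).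
  Jointly finite support cannot be weakened to the existence of both iterated sums, since formal
  series that are infinite in both directions do not multiply associatively. The index types are
  arbitrary, so that the unit type and \<open>const_series 1\<close> give the special cases with
  fewer sums.
\<close>
lemma fmult_Sum_any_assoc:
  fixes r :: "'i \<Rightarrow> fseries" and M :: "'i \<Rightarrow> 'j \<Rightarrow> fseries" and c :: "'j \<Rightarrow> fseries"
  assumes fin: "finite {(i, d, j, d'). r i d \<noteq> 0 \<and> M i j d' \<noteq> 0 \<and> c j (\<lambda>q. e q - d q - d' q) \<noteq> 0}"
  shows "Sum_any (\<lambda>i. (r i \<star> (\<lambda>e. Sum_any (\<lambda>j. (M i j \<star> c j) e))) e)
    = Sum_any (\<lambda>j. ((\<lambda>e. Sum_any (\<lambda>i. (r i \<star> M i j) e)) \<star> c j) e)"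
proof -
  let ?h = "\<lambda>i d j d'. r i d * (M i j d' * c j (\<lambda>q. e q - d q - d' q))"
  let ?h' = "\<lambda>j d i d'. r i d' * M i j (esub d d') * c j (esub e d)"
  have "Sum_any (\<lambda>i. (r i \<star> (\<lambda>e. Sum_any (\<lambda>j. (M i j \<star> c j) e))) e)
      = Sum_any (\<lambda>i. Sum_any (\<lambda>d. Sum_any (\<lambda>j. Sum_any (?h i d j))))"
    by (simp add: fmult_def Sum_any_cmult)
  also have "\<dots> = Sum_any (\<lambda>(i, d, j, d'). ?h i d j d')"
    by (rule Sum_any_nested4) (use fin in simp)
  also have "\<dots> = Sum_any (\<lambda>(j, d, i, d'). ?h' j d i d')"
  proof -
    \<comment> \<open>The exponent of the inner product on the right-hand side is the sum of the exponents of the two left factors; this substitution matches the two quadruple sums.\<close>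
    let ?l = "\<lambda>(i, d, j, d'). (j, \<lambda>q. d q + d' q, i, d)"
    have b: "bij (?l :: 'i \<times> (fvar \<Rightarrow> complex) \<times> 'j \<times> (fvar \<Rightarrow> complex) \<Rightarrow> _)"
      by (rule bij_betw_byWitness[of _ "\<lambda>(j, d, i, d'). (i, d', j, esub d d')"]) auto
    have "Sum_any (\<lambda>x. (\<lambda>(j, d, i, d'). ?h' j d i d') (?l x)) = Sum_any (\<lambda>(j, d, i, d'). ?h' j d i d')"
      by (rule Sum_any_bij[OF b])
    then show ?thesis by (simp add: case_prod_unfold diff_diff_eq mult.assoc)
  qed
  also have "\<dots> = Sum_any (\<lambda>j. Sum_any (\<lambda>d. Sum_any (\<lambda>i. Sum_any (?h' j d i))))"
  proof (rule Sum_any_nested4[symmetric])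
    have "{(j, d, i, d'). ?h' j d i d' \<noteq> 0} \<subseteq> (\<lambda>(i, d, j, d'). (j, \<lambda>q. d q + d' q, i, d)) `
      {(i, d, j, d'). r i d \<noteq> 0 \<and> M i j d' \<noteq> 0 \<and> c j (\<lambda>q. e q - d q - d' q) \<noteq> 0}"
    proof clarify
      fix j d i d' assume "?h' j d i d' \<noteq> 0"
      then show "(j, d, i, d') \<in> (\<lambda>(i, d, j, d'). (j, \<lambda>q. d q + d' q, i, d)) `
        {(i, d, j, d'). r i d \<noteq> 0 \<and> M i j d' \<noteq> 0 \<and> c j (\<lambda>q. e q - d q - d' q) \<noteq> 0}"
        by (intro image_eqI[of _ _ "(i, d', j, esub d d')"]) auto
    qed
    then show "finite {(j, d, i, d'). ?h' j d i d' \<noteq> 0}"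
      by (rule finite_subset) (rule finite_imageI[OF fin])
  qed
  also have "\<dots> = Sum_any (\<lambda>j. ((\<lambda>e. Sum_any (\<lambda>i. (r i \<star> M i j) e)) \<star> c j) e)"
    by (simp add: fmult_def Sum_any_multc)
  finally show ?thesis .
qed

lemma fmult_nonzero:
  assumes "(F \<star> G) e \<noteq> 0"
  shows "\<exists>d. F d \<noteq> 0 \<and> G (esub e d) \<noteq> 0"
proof -
  obtain d where "F d * G (esub e d) \<noteq> 0"
    using assms unfolding fmult_def by (rule Sum_any.not_neutral_obtains_not_neutral)
  then show ?thesis by auto
qed

lemma Sum_any_nonzero: "Sum_any f \<noteq> 0 \<Longrightarrow> \<exists>x. f x \<noteq> 0"
  by (erule Sum_any.not_neutral_obtains_not_neutral) blast

lemma deriv_series_pow: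
  "(deriv_series p ^^ m) F e = pochhammer (e p + 1) m * F (e(p := e p + of_nat m))"
proof (induction m arbitrary: e)
  case (Suc m)
  have "(deriv_series p ^^ Suc m) F e = (e p + 1) * (deriv_series p ^^ m) F (e(p := e p + 1))"
    by (simp add: deriv_series_def)
  also have "\<dots> = (e p + 1) * (pochhammer (e p + 1 + 1) m * F (e(p := e p + 1 + of_nat m)))"
    by (simp only: Suc fun_upd_same fun_upd_upd)
  finally show ?case by (simp only: pochhammer_rec of_nat_Suc mult.assoc add.assoc)
qed simp

lemma hderiv_eq: "hderiv p m F e = ((e p + of_nat m) gchoose m) * F (e(p := e p + of_nat m))"
  by (simp add: hderiv_def deriv_series_pow gbinomial_pochhammer' add_ac)

lemma hderiv_0 [simp]: "hderiv p 0 F = F"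
  by (auto simp: fun_eq_iff hderiv_eq)

lemma hderiv_1: "hderiv p 1 F = deriv_series p F"
  by (auto simp: fun_eq_iff hderiv_def)

lemma hderiv_Sum_any: "hderiv p m (\<lambda>e. Sum_any (\<lambda>i. F i e)) = (\<lambda>e. Sum_any (\<lambda>i. hderiv p m (F i) e))"
  by (rule ext) (simp only: hderiv_eq Sum_any_cmult)

lemma hderiv_add: "hderiv p m (\<lambda>e. F e + G e) = (\<lambda>e. hderiv p m F e + hderiv p m G e)"
  by (rule ext) (simp only: hderiv_eq distrib_left)

lemma hderiv_sum: "hderiv p m (\<lambda>e. \<Sum>x\<in>X. c x * F x e) = (\<lambda>e. \<Sum>x\<in>X. c x * hderiv p m (F x) e)"
  by (rule ext) (simp only: hderiv_eq sum_distrib_left mult.left_commute)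

text \<open>
  A factor that is constant in \<open>p\<close> passes through the derivative. Coefficientwise
  this holds without any convergence condition.
\<close>
lemma hderiv_fmult_const:
  assumes "\<And>d. F d \<noteq> 0 \<Longrightarrow> d p = 0"
  shows "hderiv p m (F \<star> G) = F \<star> hderiv p m G"
proof
  fix e
  have key: "((e p + of_nat m) gchoose m) * (F d * G (esub (e(p := e p + of_nat m)) d))
      = F d * hderiv p m G (esub e d)" for d
  proof (cases "F d = 0")
    case False
    then have "esub (e(p := e p + of_nat m)) d = (esub e d)(p := esub e d p + of_nat m)" "d p = 0"
      using assms by auto
    then show ?thesis by (simp add: hderiv_eq)
  qed simp
  have "hderiv p m (F \<star> G) e
      = ((e p + of_nat m) gchoose m) * (F \<star> G) (e(p := e p + of_nat m))"
    by (rule hderiv_eq)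
  also have "\<dots> = (F \<star> hderiv p m G) e"
    by (simp only: fmult_def Sum_any_cmult[symmetric] key)
  finally show "hderiv p m (F \<star> G) e = (F \<star> hderiv p m G) e" .
qed

section \<open>Supports and rearrangement of products\<close>

text \<open>
  The half-integers come from the square roots of \<open>\<rho>\<close> in the moment matrix.
\<close>
definition discrete_below :: "complex set \<Rightarrow> bool" where
  "discrete_below C \<longleftrightarrow> (\<exists>F. finite F \<and> C \<subseteq> {c + of_nat k / 2 |c k. c \<in> F})"

lemma discrete_below_subset: "discrete_below C \<Longrightarrow> C' \<subseteq> C \<Longrightarrow> discrete_below C'"
  unfolding discrete_below_def by blast

lemma discrete_belowI: "finite F \<Longrightarrow> (\<And>x. x \<in> C \<Longrightarrow> \<exists>c\<in>F. \<exists>k::nat. x = c + of_nat k / 2) \<Longrightarrow> discrete_below C"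
  unfolding discrete_below_def by blast

lemma discrete_below_Un: "discrete_below C \<Longrightarrow> discrete_below C' \<Longrightarrow> discrete_below (C \<union> C')"
  unfolding discrete_below_def
proof (elim exE conjE)
  fix F F' assume "finite F" "C \<subseteq> {c + of_nat k / 2 |c k. c \<in> F}" "finite F'" "C' \<subseteq> {c + of_nat k / 2 |c k. c \<in> F'}"
  then show "\<exists>F. finite F \<and> C \<union> C' \<subseteq> {c + of_nat k / 2 |c k. c \<in> F}"
    by (intro exI[of _ "F \<union> F'"]) blast
qed

lemma discrete_below_finite: "finite C \<Longrightarrow> discrete_below C"
  by (rule discrete_belowI[of C]) (auto intro!: bexI exI[of _ "0::nat"])

lemma discrete_below_add:
  assumes "discrete_below C" "discrete_below C'" shows "discrete_below {x + y |x y. x \<in> C \<and> y \<in> C'}"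
proof -
  obtain F F' where F: "finite F" "C \<subseteq> {c + of_nat k / 2 |c k. c \<in> F}"
    "finite F'" "C' \<subseteq> {c + of_nat k / 2 |c k. c \<in> F'}" using assms unfolding discrete_below_def by blast
  show ?thesis
  proof (rule discrete_belowI)
    show "finite ((\<lambda>(x, y). x + y) ` (F \<times> F'))" using F by blast
    fix z assume "z \<in> {x + y |x y. x \<in> C \<and> y \<in> C'}"
    then obtain x y where z: "z = x + y" "x \<in> C" "y \<in> C'" by blast
    obtain c k c' k' where c: "x = c + of_nat k / 2" "y = c' + of_nat k' / 2" "c \<in> F" "c' \<in> F'"
      using z F by blast
    have "z = (c + c') + of_nat (k + k') / 2" using z c by (simp add: add_divide_distrib)
    moreover have "c + c' \<in> (\<lambda>(x, y). x + y) ` (F \<times> F')" using c by force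
    ultimately show "\<exists>c\<in>(\<lambda>(x, y). x + y) ` (F \<times> F'). \<exists>k::nat. z = c + of_nat k / 2" by blast
  qed
qed

lemma discrete_below_decomp:
  assumes "discrete_below C" "discrete_below C'" shows "finite {x \<in> C. z - x \<in> C'}"
proof -
  obtain F F' where F: "finite F" "C \<subseteq> {c + of_nat k / 2 |c k. c \<in> F}"
    "finite F'" "C' \<subseteq> {c + of_nat k / 2 |c k. c \<in> F'}" using assms unfolding discrete_below_def by blast
  let ?X = "\<Union>c\<in>F. \<Union>c'\<in>F'. (\<lambda>k. c + of_nat k / 2) ` {..nat \<lfloor>2 * Re (z - c - c')\<rfloor>}"
  have "{x \<in> C. z - x \<in> C'} \<subseteq> ?X"
  proof
    fix x assume x: "x \<in> {x \<in> C. z - x \<in> C'}"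
    then obtain c k where c: "x = c + of_nat k / 2" "c \<in> F" using F(2) by blast
    from x F(4) obtain c' k' where c': "z - x = c' + of_nat k' / 2" "c' \<in> F'" by blast
    have "z - c - c' = of_nat k / 2 + of_nat k' / 2" using c(1) c'(1) by (simp add: algebra_simps)
    then have "Re (z - c - c') = real k / 2 + real k' / 2" by simp
    then have "int k \<le> \<lfloor>2 * Re (z - c - c')\<rfloor>" by (simp add: le_floor_iff)
    then have "k \<le> nat \<lfloor>2 * Re (z - c - c')\<rfloor>" by linarith
    then show "x \<in> ?X" using c c' by blast
  qed
  then show ?thesis by (rule finite_subset) (use F in blast)
qed

text \<open>
  The Minkowski sum of two sets of exponents, which contains the support of a product.
\<close>
definition esum :: "(fvar \<Rightarrow> complex) set \<Rightarrow> (fvar \<Rightarrow> complex) set \<Rightarrow> (fvar \<Rightarrow> complex) set" where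
  "esum S T = {(\<lambda>q. a q + b q) |a b. a \<in> S \<and> b \<in> T}"

definition supp :: "fseries \<Rightarrow> (fvar \<Rightarrow> complex) set" where
  "supp F = {d. F d \<noteq> 0}"

lemma esumI: "d \<in> S \<Longrightarrow> esub e d \<in> T \<Longrightarrow> e \<in> esum S T"
  unfolding esum_def by (intro CollectI exI[of _ d] exI[of _ "esub e d"]) auto

lemma esumE:
  assumes "e \<in> esum S T"
  obtains a b where "e = (\<lambda>q. a q + b q)" "a \<in> S" "b \<in> T"
  using assms unfolding esum_def by blast

lemma supp_fmult: "supp (F \<star> G) \<subseteq> esum (supp F) (supp G)"
proof
  fix e assume "e \<in> supp (F \<star> G)"
  then obtain d where d: "F d \<noteq> 0" "G (esub e d) \<noteq> 0" using fmult_nonzero unfolding supp_def by blast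
  then show "e \<in> esum (supp F) (supp G)" by (intro esumI) (auto simp: supp_def)
qed

lemma esum_mono: "S \<subseteq> S' \<Longrightarrow> T \<subseteq> T' \<Longrightarrow> esum S T \<subseteq> esum S' T'"
  unfolding esum_def by blast

text \<open>
  \<open>P\<close> is the set of insertion points, which \<open>outer\<close> orders from left
  to right; \<open>R\<close> is the set of the variables \<open>\<rho>\<^sub>a\<close>.
\<close>
locale variables =
  fixes P R :: "fvar set"
  assumes fin: "finite P" "finite R" and disj: "P \<inter> R = {}"
begin

text \<open>
  An initial segment of the points, read from the left in the product of operators.
\<close>
definition outer_closed :: "fvar set \<Rightarrow> bool" where
  "outer_closed U \<longleftrightarrow> U \<subseteq> P \<and> (\<forall>p\<in>U. \<forall>q\<in>P. outer q p \<longrightarrow> q \<in> U)"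

text \<open>
  The sign makes heights bounded below: an initial segment of a product of operators ends at an
  intermediate module, whose weights are bounded below, and the weight reached there is the
  height up to the weights of the inserted states. A pole \<open>1/(p - q)\<close> expanded for
  the outer variable has non-negative heights.
\<close>
definition height :: "fvar set \<Rightarrow> (fvar \<Rightarrow> complex) \<Rightarrow> complex" where
  "height U d = - (\<Sum>p\<in>U. d p)"

text \<open>
  A set of exponents on which all heights and all exponents of \<open>\<rho>\<close> are bounded
  below in a discrete sense. Two such sets have only finitely many pairs with a given sum.
\<close>
definition cone_bounded :: "(fvar \<Rightarrow> complex) set \<Rightarrow> bool" where
  "cone_bounded S \<longleftrightarrow> (\<forall>d\<in>S. \<forall>p. p \<notin> P \<union> R \<longrightarrow> d p = 0) \<and> (\<forall>U. outer_closed U \<longrightarrow> discrete_below (height U ` S)) \<and>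
     (\<forall>r\<in>R. discrete_below ((\<lambda>d. d r) ` S))"

text \<open>
  The scaling degree: a simultaneous dilation of all points scales \<open>\<rho>\<^sub>a\<close>
  quadratically, as \<open>\<gamma>\<^sub>a z = w\<^sub>-\<^sub>a + \<rho>\<^sub>a/(z -
  w\<^sub>a)\<close> shows.
\<close>
definition total_degree :: "(fvar \<Rightarrow> complex) \<Rightarrow> complex" where
  "total_degree d = (\<Sum>p\<in>P. d p) + 2 * (\<Sum>r\<in>R. d r)"

definition tame :: "(fvar \<Rightarrow> complex) set \<Rightarrow> bool" where
  "tame S \<longleftrightarrow> cone_bounded S \<and> finite (total_degree ` S)"

text \<open>
  The weaker condition satisfied by the coefficient series \<open>f\<^sub>l\<close>, which may
  be infinite in both directions in their single variable. At a fixed total degree a series in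
  one variable is a monomial.
\<close>
definition slice_tame :: "(fvar \<Rightarrow> complex) set \<Rightarrow> bool" where
  "slice_tame S \<longleftrightarrow> (\<forall>c. tame {d \<in> S. total_degree d = c})"

lemma height_add: "height U (\<lambda>q. a q + b q) = height U a + height U b"
  by (simp add: height_def sum.distrib)

lemma height_diff: "height U (\<lambda>q. a q - b q) = height U a - height U b"
  by (simp add: height_def sum_subtractf)

lemma total_degree_add: "total_degree (\<lambda>q. a q + b q) = total_degree a + total_degree b"
  by (simp add: total_degree_def sum.distrib algebra_simps)

lemma total_degree_diff: "total_degree (\<lambda>q. a q - b q) = total_degree a - total_degree b"
  by (simp add: total_degree_def sum_subtractf algebra_simps)

lemma cone_bounded_subset: "cone_bounded S \<Longrightarrow> T \<subseteq> S \<Longrightarrow> cone_bounded T"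
  unfolding cone_bounded_def
  by (intro conjI ballI allI impI; (elim conjE)?)
     (blast, (rule discrete_below_subset[OF _ image_mono], blast, assumption)+)

lemma tame_subset: "tame S \<Longrightarrow> T \<subseteq> S \<Longrightarrow> tame T"
  unfolding tame_def by (intro conjI; elim conjE) (rule cone_bounded_subset, assumption+, rule finite_subset[OF image_mono])

lemma slice_tame_subset: "slice_tame S \<Longrightarrow> T \<subseteq> S \<Longrightarrow> slice_tame T"
  unfolding slice_tame_def
proof
  fix c assume "\<forall>c. tame {d \<in> S. total_degree d = c}" "T \<subseteq> S"
  then show "tame {d \<in> T. total_degree d = c}" by (auto intro: tame_subset[of "{d \<in> S. total_degree d = c}"])
qed

lemma cone_bounded_Un: "cone_bounded S \<Longrightarrow> cone_bounded T \<Longrightarrow> cone_bounded (S \<union> T)"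
  unfolding cone_bounded_def by (simp add: image_Un discrete_below_Un ball_Un)

lemma tame_Un: "tame S \<Longrightarrow> tame T \<Longrightarrow> tame (S \<union> T)"
  unfolding tame_def by (auto simp: image_Un cone_bounded_Un)

lemma tame_empty: "tame {}"
  by (auto simp: tame_def cone_bounded_def intro!: discrete_below_finite)

lemma tame_UN: "finite X \<Longrightarrow> (\<And>x. x \<in> X \<Longrightarrow> tame (S x)) \<Longrightarrow> tame (\<Union>x\<in>X. S x)"
  by (induction X rule: finite_induct) (auto simp: tame_empty intro!: tame_Un)

lemma tame_slice_tame: "tame S \<Longrightarrow> slice_tame S"
  unfolding slice_tame_def by (auto intro: tame_subset)

lemma slice_tame_Un: "slice_tame S \<Longrightarrow> slice_tame T \<Longrightarrow> slice_tame (S \<union> T)"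
proof -
  assume "slice_tame S" "slice_tame T"
  moreover have "{d \<in> S \<union> T. total_degree d = c} = {d \<in> S. total_degree d = c} \<union> {d \<in> T. total_degree d = c}" for c by auto
  ultimately show ?thesis unfolding slice_tame_def by (simp add: tame_Un)
qed

lemma slice_tame_UN: "finite X \<Longrightarrow> (\<And>x. x \<in> X \<Longrightarrow> slice_tame (S x)) \<Longrightarrow> slice_tame (\<Union>x\<in>X. S x)"
  by (induction X rule: finite_induct) (auto simp: tame_slice_tame[OF tame_empty] intro!: slice_tame_Un)

lemma cone_bounded_add:
  assumes "cone_bounded S" "cone_bounded T" shows "cone_bounded (esum S T)"
  unfolding cone_bounded_def
proof (intro conjI allI ballI impI)
  fix d p assume "d \<in> esum S T" "p \<notin> P \<union> R"
  then show "d p = 0" using assms unfolding esum_def cone_bounded_def by force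
next
  fix U assume U: "outer_closed U"
  show "discrete_below (height U ` esum S T)"
    by (rule discrete_below_subset[OF discrete_below_add[of "height U ` S" "height U ` T"]])
       (use assms U in \<open>(simp add: cone_bounded_def; fail) | (force simp: height_add elim!: esumE)\<close>)+
next
  fix r assume r: "r \<in> R"
  show "discrete_below ((\<lambda>d. d r) ` esum S T)"
    by (rule discrete_below_subset[OF discrete_below_add[of "(\<lambda>d. d r) ` S" "(\<lambda>d. d r) ` T"]])
       (use assms r in \<open>auto simp: cone_bounded_def elim!: esumE\<close>)
qed

lemma tame_add:
  assumes "tame S" "tame T" shows "tame (esum S T)"
proof -
  have "total_degree ` esum S T \<subseteq> (\<lambda>(x, y). x + y) ` (total_degree ` S \<times> total_degree ` T)"
    by (force simp: esum_def total_degree_add image_iff)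
  moreover have "finite ((\<lambda>(x, y). x + y) ` (total_degree ` S \<times> total_degree ` T))" using assms by (auto simp: tame_def)
  ultimately have "finite (total_degree ` esum S T)" by (rule finite_subset)
  then show ?thesis using assms by (simp add: tame_def cone_bounded_add)
qed

lemma tame_finite: "finite S \<Longrightarrow> (\<And>d p. d \<in> S \<Longrightarrow> p \<notin> P \<union> R \<Longrightarrow> d p = 0) \<Longrightarrow> tame S"
  by (auto simp: tame_def cone_bounded_def intro!: discrete_below_finite)

lemma outer_closed_le: "outer_closed {q \<in> P. q = p \<or> outer q p}" "outer_closed {q \<in> P. outer q p}"
  by (auto simp: outer_closed_def outer_def)

text \<open>
  Each exponent is a difference of heights of two initial segments; hence finitely many heights
  leave finitely many exponents.
\<close>
lemma height_le:
  assumes "p \<in> P"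
  shows "d p = height {q \<in> P. outer q p} d - height {q \<in> P. q = p \<or> outer q p} d"
proof -
  have "{q \<in> P. q = p \<or> outer q p} = insert p {q \<in> P. outer q p}" "p \<notin> {q \<in> P. outer q p}"
    using assms by (auto simp: outer_def)
  then show ?thesis using fin by (simp add: height_def)
qed

text \<open>
  All heights of a summand are bounded below by membership in \<open>S\<close> and above by
  membership of the complementary exponent in \<open>T\<close>, and lie in a discrete set; so
  finitely many values remain for each exponent.
\<close>
lemma cone_bounded_decomp:
  assumes S: "cone_bounded S" and T: "cone_bounded T"
  shows "finite {d \<in> S. esub e d \<in> T}"
proof -
  let ?D = "{d \<in> S. esub e d \<in> T}"
  have h: "finite (height U ` ?D)" if "outer_closed U" for U
    by (rule finite_subset[OF _ discrete_below_decomp[of "height U ` S" "height U ` T" "height U e"]])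
       (use S T that in \<open>auto simp: cone_bounded_def height_diff[symmetric]\<close>)
  have r: "finite ((\<lambda>d. d r) ` ?D)" if "r \<in> R" for r
    by (rule finite_subset[OF _ discrete_below_decomp[of "(\<lambda>d. d r) ` S" "(\<lambda>d. d r) ` T" "e r"]])
       (use S T that in \<open>auto simp: cone_bounded_def\<close>)
  have p: "finite ((\<lambda>d. d p) ` ?D)" if "p \<in> P" for p
  proof (rule finite_subset)
    show "(\<lambda>d. d p) ` ?D \<subseteq> (\<lambda>(x, y). x - y) ` (height {q \<in> P. outer q p} ` ?D
        \<times> height {q \<in> P. q = p \<or> outer q p} ` ?D)"
      by (subst height_le[OF that]) force
  qed (use h[OF outer_closed_le(1), of p] h[OF outer_closed_le(2), of p] in blast)
  let ?V = "\<Union>p\<in>P \<union> R. (\<lambda>d. d p) ` ?D"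
  have "finite ?V" using fin r p by blast
  then have "finite {d. \<forall>p. (p \<in> P \<union> R \<longrightarrow> d p \<in> ?V) \<and> (p \<notin> P \<union> R \<longrightarrow> d p = 0)}"
    using fin by (intro finite_set_of_finite_funs) auto
  then show ?thesis by (rule rev_finite_subset) (use S in \<open>auto simp: cone_bounded_def\<close>)
qed

lemma cone_bounded_decomp3:
  assumes "cone_bounded S" "cone_bounded T" "cone_bounded U"
  shows "finite {(d, d'). d \<in> S \<and> d' \<in> T \<and> (\<lambda>q. e q - d q - d' q) \<in> U}"
proof -
  let ?X = "{d \<in> S. esub e d \<in> esum T U}"
  have "finite ?X" by (intro cone_bounded_decomp cone_bounded_add assms)
  moreover have "finite {d' \<in> T. esub (esub e d) d' \<in> U}" for d by (intro cone_bounded_decomp assms)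
  ultimately have "finite (SIGMA d:?X. {d' \<in> T. esub (esub e d) d' \<in> U})" by (rule finite_SigmaI)
  then show ?thesis
  proof (rule rev_finite_subset, intro subrelI)
    fix d d' assume "(d, d') \<in> {(d, d'). d \<in> S \<and> d' \<in> T \<and> (\<lambda>q. e q - d q - d' q) \<in> U}"
    then have d: "d \<in> S" "d' \<in> T" "(\<lambda>q. e q - d q - d' q) \<in> U" by auto
    from d have "esub e d \<in> esum T U" by (intro esumI)
    then show "(d, d') \<in> (SIGMA d:?X. {d' \<in> T. esub (esub e d) d' \<in> U})" using d by simp
  qed
qed

text \<open>
  The total degree of \<open>e\<close> is given and the two tame factors have finitely many
  degrees, so the middle factor contributes only in finitely many degrees, where it is tame.
\<close>
lemma slice_tame_decomp3:
  assumes S: "tame S" and T: "slice_tame T" and U: "tame U"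
  shows "finite {(d, d'). d \<in> S \<and> d' \<in> T \<and> (\<lambda>q. e q - d q - d' q) \<in> U}"
proof -
  let ?C = "(\<lambda>(x, y). total_degree e - x - y) ` (total_degree ` S \<times> total_degree ` U)"
  let ?T = "\<Union>c\<in>?C. {d \<in> T. total_degree d = c}"
  have "finite ?C" using S U by (auto simp: tame_def)
  then have "tame ?T" by (rule tame_UN) (use T in \<open>auto simp: slice_tame_def\<close>)
  then have "finite {(d, d'). d \<in> S \<and> d' \<in> ?T \<and> (\<lambda>q. e q - d q - d' q) \<in> U}"
    using S U by (intro cone_bounded_decomp3) (auto simp: tame_def)
  then show ?thesis
  proof (rule rev_finite_subset, clarify)
    fix d d' assume d: "d \<in> S" "d' \<in> T" "(\<lambda>q. e q - d q - d' q) \<in> U"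
    have "total_degree d' = total_degree e - total_degree d - total_degree (\<lambda>q. e q - d q - d' q)" by (simp add: total_degree_diff)
    then have "total_degree d' \<in> ?C" using d by force
    then show "d' \<in> ?T" using d by blast
  qed
qed

lemma slice_tame_decomp:
  assumes S: "slice_tame S" and T: "tame T"
  shows "finite {d. d \<in> S \<and> esub e d \<in> T}"
proof -
  have "finite {(d, d'). d \<in> {\<lambda>_. 0} \<and> d' \<in> S \<and> (\<lambda>q. e q - d q - d' q) \<in> T}"
    by (intro slice_tame_decomp3 tame_finite assms) auto
  from finite_imageI[OF this, of snd] show ?thesis
    by (rule rev_finite_subset) force
qed

lemma slice_tame_add:
  assumes S: "tame S" and T: "slice_tame T" shows "slice_tame (esum S T)"
  unfolding slice_tame_def
proof
  fix c
  let ?T = "\<Union>x\<in>total_degree ` S. {d \<in> T. total_degree d = c - x}"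
  have "tame ?T" by (rule tame_UN) (use S T in \<open>auto simp: slice_tame_def tame_def\<close>)
  then have "tame (esum S ?T)" by (intro tame_add S)
  then show "tame {d \<in> esum S T. total_degree d = c}"
    by (rule tame_subset) (force simp: esum_def total_degree_add algebra_simps)
qed

lemma tame_convolvable: "slice_tame (supp F) \<Longrightarrow> tame (supp G) \<Longrightarrow> convolvable F G"
  unfolding convolvable_def using slice_tame_decomp[of "supp F" "supp G"] by (simp add: supp_def)

text \<open>
  The supports have a common bound, and a given exponent occurs in finitely many members: the
  conditions under which a row can be multiplied with a matrix or a column.
\<close>
definition tame_family :: "('i \<Rightarrow> fseries) \<Rightarrow> bool" where
  "tame_family x \<longleftrightarrow> tame (\<Union>i. supp (x i)) \<and> (\<forall>d. finite {i. x i d \<noteq> 0})"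

lemma tame_familyD: "tame_family x \<Longrightarrow> tame (supp (x i))"
  unfolding tame_family_def by (blast intro: tame_subset)

lemma row_mat_finite:
  fixes r :: "'i \<Rightarrow> fseries" and M :: "'i \<Rightarrow> 'j \<Rightarrow> fseries" and c :: "'j \<Rightarrow> fseries"
  assumes r: "tame_family r" and M: "tame_family (\<lambda>(i, j). M i j)" and c: "tame (\<Union>j. supp (c j))"
  shows "finite {(i, d, j, d'). r i d \<noteq> 0 \<and> M i j d' \<noteq> 0 \<and> c j (\<lambda>q. e q - d q - d' q) \<noteq> 0}"
proof -
  let ?D = "{(d, d'). d \<in> (\<Union>i. supp (r i)) \<and> d' \<in> (\<Union>ij. supp ((\<lambda>(i, j). M i j) ij)) \<and>
      (\<lambda>q. e q - d q - d' q) \<in> (\<Union>j. supp (c j))}"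
  have "finite ?D"
    using r M c by (intro cone_bounded_decomp3) (auto simp: tame_family_def tame_def)
  then have "finite (SIGMA dd:?D. {ij. (\<lambda>(i, j). M i j) ij (snd dd) \<noteq> 0})"
    by (rule finite_SigmaI) (use M in \<open>auto simp: tame_family_def\<close>)
  from finite_imageI[OF this, of "\<lambda>((d, d'), (i, j)). (i, d, j, d')"]
  show ?thesis
    by (rule rev_finite_subset) (force simp: supp_def image_iff)
qed

lemma row_col_finite:
  fixes r :: "'i \<Rightarrow> fseries"
  assumes r: "tame_family r" and M: "slice_tame (\<Union>i. supp (M i))" and c: "tame (supp c)"
  shows "finite {(i, d, j::unit, d'). r i d \<noteq> 0 \<and> M i d' \<noteq> 0 \<and> c (\<lambda>q. e q - d q - d' q) \<noteq> 0}"
proof -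
  let ?D = "{(d, d'). d \<in> (\<Union>i. supp (r i)) \<and> d' \<in> (\<Union>i. supp (M i)) \<and>
      (\<lambda>q. e q - d q - d' q) \<in> supp c}"
  have "finite ?D"
    using r M c by (intro slice_tame_decomp3) (auto simp: tame_family_def)
  then have "finite (SIGMA dd:?D. {i. r i (fst dd) \<noteq> 0})"
    by (rule finite_SigmaI) (use r in \<open>auto simp: tame_family_def\<close>)
  from finite_imageI[OF this, of "\<lambda>((d, d'), i). (i, d, (), d')"]
  show ?thesis
    by (rule rev_finite_subset) (force simp: supp_def image_iff)
qed

text \<open>
  Only one of the three factors may be merely slice-tame. Here it is the middle one, which is
  the role of the coefficients of the source terms below.
\<close>
lemma row_slice_tame_assoc:
  assumes r: "tame_family r" and M: "slice_tame (\<Union>i. supp (M i))" and c: "tame (supp c)"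
  shows "Sum_any (\<lambda>i. (r i \<star> (M i \<star> c)) e) = ((\<lambda>e. Sum_any (\<lambda>i. (r i \<star> M i) e)) \<star> c) e"
  using fmult_Sum_any_assoc[of r "\<lambda>i _::unit. M i" "\<lambda>_. c", OF row_col_finite[OF assms]]
  by (simp add: Sum_any_unit)

lemma row_col_summable:
  assumes r: "tame_family r" and M: "slice_tame (\<Union>i. supp (M i))" and c: "tame (supp c)"
  shows "finite {i. (r i \<star> (M i \<star> c)) e \<noteq> 0}"
proof (rule finite_subset[OF _ finite_imageI[OF row_col_finite[OF assms, of e], of fst]], rule subsetI)
  fix i assume "i \<in> {i. (r i \<star> (M i \<star> c)) e \<noteq> 0}"
  then obtain d where d: "r i d \<noteq> 0" "(M i \<star> c) (esub e d) \<noteq> 0" by (blast dest: fmult_nonzero)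
  from d(2) obtain d' where "M i d' \<noteq> 0" "c (esub (esub e d) d') \<noteq> 0" by (blast dest: fmult_nonzero)
  then have "(i, d, (), d') \<in> {(i, d, j::unit, d'). r i d \<noteq> 0 \<and> M i d' \<noteq> 0 \<and> c (\<lambda>q. e q - d q - d' q) \<noteq> 0}"
    using d by simp
  then show "i \<in> fst ` {(i, d, j::unit, d'). r i d \<noteq> 0 \<and> M i d' \<noteq> 0 \<and> c (\<lambda>q. e q - d q - d' q) \<noteq> 0}"
    by (rule rev_image_eqI) simp
qed

lemma row_col_summable':
  assumes r: "tame_family r" and c: "slice_tame (\<Union>i. supp (c i))"
  shows "finite {i. (r i \<star> c i) e \<noteq> 0}"
proof -
  have "tame (supp (const_series 1))"
    by (rule tame_finite[OF finite_subset[of _ "{\<lambda>_. 0}"]])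
       (auto simp: supp_def const_series_def split: if_splits)
  moreover have "c i \<star> const_series 1 = c i" for i by (rule ext) (simp add: fmult_const)
  ultimately show ?thesis using row_col_summable[OF r c, of "const_series 1" e] by simp
qed

lemma supp_row_col: "supp (\<lambda>e. Sum_any (\<lambda>i. (r i \<star> c i) e)) \<subseteq> esum (\<Union>i. supp (r i)) (\<Union>i. supp (c i))"
proof
  fix e assume "e \<in> supp (\<lambda>e. Sum_any (\<lambda>i. (r i \<star> c i) e))"
  then obtain i where "e \<in> supp (r i \<star> c i)" unfolding supp_def by (auto dest: Sum_any_nonzero)
  then have "e \<in> esum (supp (r i)) (supp (c i))" using supp_fmult by blast
  then show "e \<in> esum (\<Union>i. supp (r i)) (\<Union>i. supp (c i))" unfolding esum_def by blast
qed

lemma tame_family_row_mat: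
  assumes r: "tame_family r" and M: "tame_family (\<lambda>(i, j). M i j)"
  shows "tame_family (\<lambda>j e. Sum_any (\<lambda>i. (r i \<star> M i j) e))"
proof -
  have t: "tame (esum (\<Union>i. supp (r i)) (\<Union>(i, j). supp (M i j)))"
    using r M by (intro tame_add) (auto simp: tame_family_def case_prod_unfold)
  have "(\<Union>j. supp (\<lambda>e. Sum_any (\<lambda>i. (r i \<star> M i j) e))) \<subseteq> esum (\<Union>i. supp (r i)) (\<Union>(i, j). supp (M i j))"
    using supp_row_col[of r "\<lambda>i. M i j" for j] unfolding esum_def by fast
  then have "tame (\<Union>j. supp (\<lambda>e. Sum_any (\<lambda>i. (r i \<star> M i j) e)))" by (rule tame_subset[OF t])
  moreover have "finite {j. Sum_any (\<lambda>i. (r i \<star> M i j) e) \<noteq> 0}" for e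
  proof -
    let ?D = "{d \<in> (\<Union>i. supp (r i)). esub e d \<in> (\<Union>ij. supp ((\<lambda>(i, j). M i j) ij))}"
    have "finite ?D" using r M by (intro cone_bounded_decomp) (auto simp: tame_family_def tame_def)
    then have "finite (\<Union>d\<in>?D. snd ` {ij. (\<lambda>(i, j). M i j) ij (esub e d) \<noteq> 0})"
      using M by (auto simp: tame_family_def)
    then show ?thesis
    proof (rule rev_finite_subset, intro subsetI)
      fix j assume "j \<in> {j. Sum_any (\<lambda>i. (r i \<star> M i j) e) \<noteq> 0}"
      then obtain i d where "r i d \<noteq> 0" "M i j (esub e d) \<noteq> 0"
        by (auto dest!: Sum_any_nonzero fmult_nonzero)
      then show "j \<in> (\<Union>d\<in>?D. snd ` {ij. (\<lambda>(i, j). M i j) ij (esub e d) \<noteq> 0})"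
        by (force simp: supp_def image_iff)
    qed
  qed
  ultimately show ?thesis by (simp add: tame_family_def)
qed

end

section \<open>Modules and intertwining operators\<close>

definition additive_on :: "'a::ab_group_add set \<Rightarrow> ('a \<Rightarrow> 'b::ab_group_add) \<Rightarrow> bool" where
  "additive_on M T \<longleftrightarrow> (\<forall>x\<in>M. \<forall>y\<in>M. T (x + y) = T x + T y)"

locale voa_data =
  fixes D :: "('i, 'a::ab_group_add) voa_family"
  assumes setting: "voa_setting D"
begin

sublocale VS: vector_space "smult D"
  using setting by (simp add: voa_setting_def)

abbreviation one :: 'i where "one \<equiv> unit_label D"
abbreviation vac :: 'a where "vac \<equiv> vacuum D"
abbreviation sc :: "complex \<Rightarrow> 'a \<Rightarrow> 'a" where "sc \<equiv> smult D"
abbreviation om :: "'i \<Rightarrow> int \<Rightarrow> 'a \<Rightarrow> 'a" where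
  "om \<alpha> n u \<equiv> vop D \<alpha> (conformal D) (of_int n) u"
abbreviation wp :: "'i \<Rightarrow> complex \<Rightarrow> 'a set" where "wp \<equiv> weight_part D"

text \<open>
  A number \<open>h\<close> with all weights of the module in \<open>h + \<nat>\<close>; it
  serves as a lower bound for weights.
\<close>
definition hw :: "'i \<Rightarrow> complex" where
  "hw \<alpha> = (SOME h. ordinary_module (smult D) (vacuum D) (conformal D)
          (algebra_space D) (algebra_vop D) h (space D \<alpha>) (vop D \<alpha>))"

lemma irr: "irreducibles D" and con: "contragredients D" and nor: "normalised_intertwiners D"
  and cft: "simple_strong_cft_voa (smult D) (vacuum D) (conformal D) (central_charge D)
       (algebra_space D) (algebra_vop D)"
  using setting by (simp_all add: voa_setting_def)

lemma one_label: "one \<in> labels D"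
  using irr by (simp add: irreducibles_def)

lemma contra_label: "\<alpha> \<in> labels D \<Longrightarrow> contra D \<alpha> \<in> labels D"
  using con by (simp add: contragredients_def)

lemma contra_one: "contra D one = one"
  using con by (simp add: contragredients_def)

lemma module_hw:
  assumes "\<alpha> \<in> labels D"
  shows "ordinary_module (smult D) (vacuum D) (conformal D)
          (algebra_space D) (algebra_vop D) (hw \<alpha>) (space D \<alpha>) (vop D \<alpha>)"
proof -
  have "\<exists>h. ordinary_module (smult D) (vacuum D) (conformal D)
          (algebra_space D) (algebra_vop D) h (space D \<alpha>) (vop D \<alpha>)"
    using irr assms by (simp add: irreducibles_def)
  then show ?thesis unfolding hw_def by (rule someI_ex)
qed

lemma subspace_space: "\<alpha> \<in> labels D \<Longrightarrow> VS.subspace (space D \<alpha>)"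
  using module_hw by (simp add: ordinary_module_def)

lemma zero_space: "\<alpha> \<in> labels D \<Longrightarrow> 0 \<in> space D \<alpha>"
  using subspace_space VS.subspace_0 by blast

lemma add_space: "\<alpha> \<in> labels D \<Longrightarrow> u \<in> space D \<alpha> \<Longrightarrow> v \<in> space D \<alpha> \<Longrightarrow> u + v \<in> space D \<alpha>"
  using subspace_space VS.subspace_add by blast

lemma diff_space: "\<alpha> \<in> labels D \<Longrightarrow> u \<in> space D \<alpha> \<Longrightarrow> v \<in> space D \<alpha> \<Longrightarrow> u - v \<in> space D \<alpha>"
  using subspace_space VS.subspace_diff by blast

lemma scale_space: "\<alpha> \<in> labels D \<Longrightarrow> u \<in> space D \<alpha> \<Longrightarrow> sc c u \<in> space D \<alpha>"
  using subspace_space VS.subspace_scale by blast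

lemma sum_space: "\<alpha> \<in> labels D \<Longrightarrow> (\<And>x. x \<in> X \<Longrightarrow> f x \<in> space D \<alpha>) \<Longrightarrow> sum f X \<in> space D \<alpha>"
  using subspace_space VS.subspace_sum by blast

lemma Sum_any_space: "\<alpha> \<in> labels D \<Longrightarrow> (\<And>x. f x \<in> space D \<alpha>) \<Longrightarrow> Sum_any f \<in> space D \<alpha>"
  unfolding Sum_any.expand_set by (rule sum_space)

lemma additive_on_0: "additive_on M T \<Longrightarrow> 0 \<in> M \<Longrightarrow> T 0 = 0"
  unfolding additive_on_def by (metis add_cancel_left_left)

lemma additive_on_sum:
  assumes T: "additive_on (space D \<alpha>) T" and \<alpha>: "\<alpha> \<in> labels D" and f: "\<And>x. x \<in> X \<Longrightarrow> f x \<in> space D \<alpha>"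
  shows "T (sum f X) = (\<Sum>x\<in>X. T (f x))"
proof (cases "finite X")
  case True
  then show ?thesis using f
  proof (induction X rule: finite_induct)
    case empty
    show ?case using additive_on_0[OF T zero_space[OF \<alpha>]] by simp
  next
    case (insert x X)
    then have "sum f X \<in> space D \<alpha>" by (auto intro: sum_space[OF \<alpha>])
    then show ?case using insert T by (simp add: additive_on_def)
  qed
next
  case False
  then show ?thesis using additive_on_0[OF T zero_space[OF \<alpha>]] by simp
qed

lemma additive_on_Sum_any:
  assumes T: "additive_on (space D \<alpha>) T" and \<alpha>: "\<alpha> \<in> labels D" and f: "\<And>x. f x \<in> space D \<alpha>"
    and fin: "finite {x. f x \<noteq> 0}"
  shows "T (Sum_any f) = Sum_any (\<lambda>x. T (f x))"
proof -
  have "T (Sum_any f) = (\<Sum>x\<in>{x. f x \<noteq> 0}. T (f x))"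
    unfolding Sum_any.expand_set by (rule additive_on_sum[OF T \<alpha> f])
  also have "\<dots> = Sum_any (\<lambda>x. T (f x))"
    by (rule Sum_any.expand_superset[symmetric]) (use fin additive_on_0[OF T zero_space[OF \<alpha>]] in auto)
  finally show ?thesis .
qed

lemma additive_on_diff:
  assumes T: "additive_on (space D \<alpha>) T" and \<alpha>: "\<alpha> \<in> labels D" and "u \<in> space D \<alpha>" "v \<in> space D \<alpha>"
  shows "T (u - v) = T u - T v"
proof -
  have "T (u - v + v) = T (u - v) + T v"
    using T assms(3,4) diff_space[OF \<alpha>] unfolding additive_on_def by blast
  then show ?thesis by (simp add: algebra_simps)
qed

context
  fixes I \<alpha> \<beta> \<gamma>
  assumes I: "I \<in> intertwiner_space D \<alpha> \<beta> \<gamma>"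
    and lab: "\<alpha> \<in> labels D" "\<beta> \<in> labels D" "\<gamma> \<in> labels D"
begin

lemma int_closed: "v \<in> space D \<alpha> \<Longrightarrow> u \<in> space D \<beta> \<Longrightarrow> I v k u \<in> space D \<gamma>"
  using I by (simp add: intertwiner_space_def intertwiners_def)

lemma int_add1: "v \<in> space D \<alpha> \<Longrightarrow> v' \<in> space D \<alpha> \<Longrightarrow> u \<in> space D \<beta> \<Longrightarrow> I (v + v') k u = I v k u + I v' k u"
  using I by (simp add: intertwiner_space_def intertwiners_def)

lemma int_scale1: "v \<in> space D \<alpha> \<Longrightarrow> u \<in> space D \<beta> \<Longrightarrow> I (sc c v) k u = sc c (I v k u)"
  using I by (simp add: intertwiner_space_def intertwiners_def)

lemma int_add2: "v \<in> space D \<alpha> \<Longrightarrow> u \<in> space D \<beta> \<Longrightarrow> u' \<in> space D \<beta> \<Longrightarrow> I v k (u + u') = I v k u + I v k u'"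
  using I by (simp add: intertwiner_space_def intertwiners_def)

lemma int_scale2: "v \<in> space D \<alpha> \<Longrightarrow> u \<in> space D \<beta> \<Longrightarrow> I v k (sc c u) = sc c (I v k u)"
  using I by (simp add: intertwiner_space_def intertwiners_def)

lemma int_trunc: "v \<in> space D \<alpha> \<Longrightarrow> u \<in> space D \<beta> \<Longrightarrow> \<exists>N::nat. \<forall>j\<ge>N. I v (k + of_nat j) u = 0"
  using I by (simp add: intertwiner_space_def intertwiners_def)

lemma int_Lm1: "v \<in> space D \<alpha> \<Longrightarrow> u \<in> space D \<beta> \<Longrightarrow> I (om \<alpha> 0 v) k u = sc (- k) (I v (k - 1) u)"
  using I by (simp add: intertwiner_space_def intertwiners_def Lmode_def)

lemma int_jacobi: "v \<in> algebra_space D \<Longrightarrow> w \<in> space D \<alpha> \<Longrightarrow> u \<in> space D \<beta> \<Longrightarrow>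
    jacobi sc (vop D \<alpha>) (vop D \<beta>) (vop D \<gamma>) I v w u"
  using I unfolding intertwiner_space_def intertwiners_def by blast

lemma int_zero1: "u \<in> space D \<beta> \<Longrightarrow> I 0 k u = 0"
  using int_scale1[of 0 u 0 k] zero_space lab by simp

lemma int_zero2: "v \<in> space D \<alpha> \<Longrightarrow> I v k 0 = 0"
  using int_scale2[of v 0 k 0] zero_space lab by simp

lemma int_additive_on2: "v \<in> space D \<alpha> \<Longrightarrow> additive_on (space D \<beta>) (I v k)"
  by (simp add: additive_on_def int_add2)

end

lemma vop_int: "\<alpha> \<in> labels D \<Longrightarrow> vop D \<alpha> \<in> intertwiner_space D one \<alpha> \<alpha>"
  using module_hw by (simp add: ordinary_module_def intertwiner_space_def)

lemma iop_int: "\<alpha> \<in> labels D \<Longrightarrow> \<beta> \<in> labels D \<Longrightarrow> \<gamma> \<in> labels D \<Longrightarrow> iop D \<alpha> \<beta> \<gamma> \<in> intertwiner_space D \<alpha> \<beta> \<gamma>"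
  using nor by (simp add: normalised_intertwiners_def)

lemma vac_mode: "\<alpha> \<in> labels D \<Longrightarrow> u \<in> space D \<alpha> \<Longrightarrow> vop D \<alpha> vac k u = (if k = -1 then u else 0)"
  using module_hw by (simp add: ordinary_module_def)

lemma vac_space: "vac \<in> space D one"
  using cft by (simp add: simple_strong_cft_voa_def)

lemma wp_iff: "u \<in> wp \<alpha> h \<longleftrightarrow> u \<in> space D \<alpha> \<and> om \<alpha> 1 u = sc h u"
  by (simp add: weight_part_def weight_space_def Lmode_def)

lemma omega_wp: "conformal D \<in> wp one 2"
  using cft by (simp add: simple_strong_cft_voa_def weight_part_def)

lemma omega_space: "conformal D \<in> space D one"
  using omega_wp by (simp add: wp_iff)

lemma om_space: "\<alpha> \<in> labels D \<Longrightarrow> u \<in> space D \<alpha> \<Longrightarrow> om \<alpha> n u \<in> space D \<alpha>"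
  by (rule int_closed[OF vop_int one_label]) (auto simp: omega_space)

lemma om_additive_on: "\<alpha> \<in> labels D \<Longrightarrow> additive_on (space D \<alpha>) (om \<alpha> n)"
  by (rule int_additive_on2[OF vop_int one_label]) (auto simp: omega_space)

lemma om_scale: "\<alpha> \<in> labels D \<Longrightarrow> u \<in> space D \<alpha> \<Longrightarrow> om \<alpha> n (sc c u) = sc c (om \<alpha> n u)"
  by (rule int_scale2[OF vop_int one_label]) (auto simp: omega_space)

lemmas L0_additive_on = om_additive_on[of _ 1, simplified]
lemmas L0_scale = om_scale[of _ _ 1, simplified]
lemma L0_zero: "\<alpha> \<in> labels D \<Longrightarrow> vop D \<alpha> (conformal D) 1 0 = 0"
  by (rule additive_on_0[OF L0_additive_on zero_space])

lemma om_trunc: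
  assumes "\<alpha> \<in> labels D" "u \<in> space D \<alpha>"
  shows "finite {i::nat. om \<alpha> (int i) u \<noteq> 0}"
proof -
  obtain N where N: "\<forall>j\<ge>N. vop D \<alpha> (conformal D) (0 + of_nat j) u = 0"
    using int_trunc[OF vop_int[OF assms(1)] one_label assms(1,1) omega_space assms(2)] by blast
  have "{i::nat. om \<alpha> (int i) u \<noteq> 0} \<subseteq> {..<N}" using N by (force simp: not_le)
  then show ?thesis using finite_subset by blast
qed

text \<open>
  The Jacobi identity at \<open>l = 0\<close>, where only one term survives on the side of the
  products.
\<close>
lemma commutator:
  assumes I: "I \<in> intertwiner_space D \<alpha> \<beta> \<gamma>" and lab: "\<alpha> \<in> labels D" "\<beta> \<in> labels D" "\<gamma> \<in> labels D"
    and v: "v \<in> space D \<alpha>" and u: "u \<in> space D \<beta>"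
  shows "om \<gamma> n (I v k u) = I v k (om \<beta> n u) +
    Sum_any (\<lambda>i. sc (of_int n gchoose i) (I (om \<alpha> (int i) v) (of_int n + k - of_nat i) u))"
proof -
  let ?f = "\<lambda>i. sc ((- 1) ^ i * (of_int 0 gchoose i))
           (vop D \<gamma> (conformal D) (of_int n + of_int 0 - of_nat i) (I v (k + of_nat i) u) -
            sc ((- 1) powi 0)
             (I v (of_int 0 + k - of_nat i) (vop D \<beta> (conformal D) (of_int n + of_nat i) u)))"
  have "Sum_any ?f = Sum_any (\<lambda>i. sc (of_int n gchoose i)
         (I (vop D \<alpha> (conformal D) (of_int 0 + of_nat i) v) (of_int n + k - of_nat i) u))"
    using int_jacobi[OF I lab omega_space v u, unfolded jacobi_def] by blast
  moreover have "Sum_any ?f = ?f 0"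
    by (rule Sum_any_single) (simp add: gbinomial_0_left)
  ultimately show ?thesis by (simp add: algebra_simps)
qed

text \<open>
  The Jacobi identity at \<open>m = 0\<close> and a negative \<open>l\<close>: a negative mode
  of \<open>\<omega>\<close> applied to the inserted state is split into modes acting from the
  left and modes acting from the right of the operator.
\<close>
lemma iterate:
  assumes I: "I \<in> intertwiner_space D \<alpha> \<beta> \<gamma>" and lab: "\<alpha> \<in> labels D" "\<beta> \<in> labels D" "\<gamma> \<in> labels D"
    and v: "v \<in> space D \<alpha>" and u: "u \<in> space D \<beta>"
  shows "I (om \<alpha> (- int r - 1) v) k u = Sum_any (\<lambda>i. sc ((- 1) ^ i * ((- of_nat r - 1) gchoose i))
     (om \<gamma> (- int r - 1 - int i) (I v (k + of_nat i) u)
      + sc ((- 1) ^ r) (I v (k - of_nat r - 1 - of_nat i) (om \<beta> (int i) u))))"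
proof -
  let ?l = "- int r - 1"
  let ?f = "\<lambda>i. sc (of_int 0 gchoose i)
         (I (vop D \<alpha> (conformal D) (of_int ?l + of_nat i) v) (of_int 0 + k - of_nat i) u)"
  have "Sum_any (\<lambda>i. sc ((- 1) ^ i * (of_int ?l gchoose i))
           (vop D \<gamma> (conformal D) (of_int 0 + of_int ?l - of_nat i) (I v (k + of_nat i) u) -
            sc ((- 1) powi ?l)
             (I v (of_int ?l + k - of_nat i) (vop D \<beta> (conformal D) (of_int 0 + of_nat i) u)))) = Sum_any ?f"
    using int_jacobi[OF I lab omega_space v u, unfolded jacobi_def] by blast
  moreover have "Sum_any ?f = ?f 0"
    by (rule Sum_any_single) (simp add: gbinomial_0_left)
  moreover have "(- 1) powi ?l = - ((- 1 :: complex) ^ r)"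
  proof -
    have "?l = - int (Suc r)" by simp
    then have "(- 1) powi ?l = inverse ((- 1 :: complex) ^ Suc r)" by (simp only: power_int_minus power_int_of_nat)
    then show ?thesis by (cases "even r") auto
  qed
  ultimately show ?thesis by (simp add: algebra_simps)
qed

lemma iterate_finite:
  assumes I: "I \<in> intertwiner_space D \<alpha> \<beta> \<gamma>" and lab: "\<alpha> \<in> labels D" "\<beta> \<in> labels D" "\<gamma> \<in> labels D"
    and v: "v \<in> space D \<alpha>" and u: "u \<in> space D \<beta>"
  shows "finite {i. om \<gamma> (- int r - 1 - int i) (I v (k + of_nat i) u) \<noteq> 0}"
    "finite {i. I v (k - of_nat r - 1 - of_nat i) (om \<beta> (int i) u) \<noteq> 0}"
proof -
  obtain N where N: "\<forall>j\<ge>N. I v (k + of_nat j) u = 0" using int_trunc[OF I lab v u] by blast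
  have "{i. om \<gamma> (- int r - 1 - int i) (I v (k + of_nat i) u) \<noteq> 0} \<subseteq> {..<N}"
    using N int_zero2[OF vop_int one_label _ _ omega_space] lab by (force simp: not_le)
  then show "finite {i. om \<gamma> (- int r - 1 - int i) (I v (k + of_nat i) u) \<noteq> 0}"
    using finite_subset by blast
  show "finite {i. I v (k - of_nat r - 1 - of_nat i) (om \<beta> (int i) u) \<noteq> 0}"
    by (rule finite_subset[OF _ om_trunc[OF lab(2) u]]) (auto simp: int_zero2[OF I lab v])
qed

text \<open>
  The commutator with \<open>L(0) = \<omega>\<^sub>1\<close>, where the translation property
  evaluates the term \<open>L(-1)v\<close>.
\<close>
lemma int_weight:
  assumes I: "I \<in> intertwiner_space D \<alpha> \<beta> \<gamma>" and lab: "\<alpha> \<in> labels D" "\<beta> \<in> labels D" "\<gamma> \<in> labels D"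
    and v: "v \<in> wp \<alpha> a" and u: "u \<in> wp \<beta> b"
  shows "I v k u \<in> wp \<gamma> (a + b - k - 1)"
proof -
  have v': "v \<in> space D \<alpha>" and u': "u \<in> space D \<beta>" using v u by (auto simp: wp_iff)
  let ?f = "\<lambda>i. sc (of_int 1 gchoose i) (I (om \<alpha> (int i) v) (of_int 1 + k - of_nat i) u)"
  have "Sum_any ?f = sum ?f {..1}"
  proof (rule Sum_any.expand_superset)
    show "{i. ?f i \<noteq> 0} \<subseteq> {..1}"
    proof
      fix i assume "i \<in> {i. ?f i \<noteq> 0}"
      then have "(1 gchoose i :: complex) \<noteq> 0" by auto
      then have "of_nat (1 choose i) \<noteq> (0::complex)" by (metis binomial_gbinomial of_nat_1)
      then show "i \<in> {..1}" by (cases "i \<le> 1") (auto simp: binomial_eq_0)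
    qed
  qed simp
  also have "\<dots> = sc (- (1 + k)) (I v k u) + sc a (I v k u)"
    using int_Lm1[OF I lab v' u', of "1 + k"] v int_scale1[OF I lab v' u'] by (simp add: wp_iff)
  finally have "om \<gamma> 1 (I v k u) = sc b (I v k u) + (sc (- (1 + k)) (I v k u) + sc a (I v k u))"
    using commutator[OF I lab v' u', of 1 k] u int_scale2[OF I lab v' u'] by (simp add: wp_iff)
  then have "om \<gamma> 1 (I v k u) = sc (b + (- (1 + k)) + a) (I v k u)"
    by (simp only: VS.scale_left_distrib add.assoc)
  then show ?thesis using int_closed[OF I lab v' u'] by (simp add: wp_iff algebra_simps)
qed

lemma om_weight: "\<alpha> \<in> labels D \<Longrightarrow> u \<in> wp \<alpha> a \<Longrightarrow> om \<alpha> n u \<in> wp \<alpha> (a - of_int n + 1)"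
  using int_weight[OF vop_int one_label _ _ omega_wp, of \<alpha> u a "of_int n"] by (simp add: algebra_simps)

text \<open>
  Eigenvectors of \<open>L(0)\<close> for distinct eigenvalues are independent; applying
  \<open>L(0) - y\<close> removes one of them.
\<close>
lemma wp_independent:
  assumes \<alpha>: "\<alpha> \<in> labels D"
  shows "finite S \<Longrightarrow> (\<And>x. x \<in> S \<Longrightarrow> f x \<in> wp \<alpha> x) \<Longrightarrow> sum f S = 0 \<Longrightarrow> x \<in> S \<Longrightarrow> f x = 0"
proof (induction S arbitrary: f x rule: finite_induct)
  case (insert y S)
  have sp: "f x \<in> space D \<alpha>" if "x \<in> insert y S" for x using insert.prems(1)[OF that] by (simp add: wp_iff)
  have "0 = om \<alpha> 1 (sum f (insert y S)) - sc y (sum f (insert y S))"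
    using insert.prems(2) L0_zero[OF \<alpha>] by simp
  also have "\<dots> = (\<Sum>x\<in>insert y S. sc x (f x)) - (\<Sum>x\<in>insert y S. sc y (f x))"
    by (subst additive_on_sum[OF om_additive_on]) (use \<alpha> sp insert.prems(1) in \<open>auto simp: VS.scale_sum_right wp_iff intro!: arg_cong2[of _ _ _ _ minus] sum.cong\<close>)
  also have "\<dots> = (\<Sum>x\<in>insert y S. sc (x - y) (f x))"
    by (simp only: sum_subtractf VS.scale_left_diff_distrib)
  also have "\<dots> = (\<Sum>x\<in>S. sc (x - y) (f x))"
    using insert.hyps by simp
  finally have z: "(\<Sum>x\<in>S. sc (x - y) (f x)) = 0" by simp
  have "sc (x - y) (f x) = 0" if "x \<in> S" for x
  proof (rule insert.IH[OF _ z that])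
    fix x assume "x \<in> S"
    then show "sc (x - y) (f x) \<in> wp \<alpha> x"
      using insert.prems(1)[of x] \<alpha> by (simp add: wp_iff scale_space L0_scale VS.scale_left_commute mult.commute)
  qed
  then have S: "f x = 0" if "x \<in> S" for x using insert.hyps that by force
  then have "f y = 0" using insert by simp
  then show ?case using S insert.prems by auto
qed simp

lemma wp_subspace: "\<alpha> \<in> labels D \<Longrightarrow> VS.subspace (wp \<alpha> h)"
  by (rule VS.subspaceI)
     (use L0_additive_on[of \<alpha>] in \<open>auto simp: wp_iff zero_space add_space scale_space L0_scale additive_on_def VS.scale_right_distrib L0_zero mult.commute\<close>)

lemma space_decomp:
  assumes \<alpha>: "\<alpha> \<in> labels D" and u: "u \<in> space D \<alpha>"
  shows "\<exists>X f. finite X \<and> X \<subseteq> {hw \<alpha> + of_nat n |n. True} \<and> (\<forall>x\<in>X. f x \<in> wp \<alpha> x) \<and> u = sum f X"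
proof -
  have "u \<in> VS.span (\<Union>n::nat. wp \<alpha> (hw \<alpha> + of_nat n))"
    using module_hw[OF \<alpha>] u by (auto simp: ordinary_module_def weight_part_def)
  then show ?thesis
  proof (induction rule: VS.span_induct_alt)
    case base
    show ?case by (rule exI[of _ "{}"]) auto
  next
    case (step c x y)
    then obtain n :: nat where n: "x \<in> wp \<alpha> (hw \<alpha> + of_nat n)" by blast
    obtain X f where X: "finite X" "X \<subseteq> {hw \<alpha> + of_nat n |n. True}" "\<forall>x\<in>X. f x \<in> wp \<alpha> x" "y = sum f X"
      using step by blast
    let ?h = "hw \<alpha> + of_nat n"
    have cx: "sc c x \<in> wp \<alpha> ?h" using n wp_subspace[OF \<alpha>] VS.subspace_scale by blast
    show ?case
    proof (cases "?h \<in> X")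
      case True
      show ?thesis
      proof (intro exI[of _ X] exI[of _ "f(?h := f ?h + sc c x)"] conjI ballI)
        show "sc c x + y = sum (f(?h := f ?h + sc c x)) X"
          using X True by (simp add: sum.remove[of X ?h])
        fix z assume "z \<in> X" then show "(f(?h := f ?h + sc c x)) z \<in> wp \<alpha> z"
          using X cx wp_subspace[OF \<alpha>] VS.subspace_add by auto
      qed (use X in auto)
    next
      case False
      show ?thesis
      proof (intro exI[of _ "insert ?h X"] exI[of _ "f(?h := sc c x)"] conjI ballI)
        have "sum (f(?h := sc c x)) X = sum f X" using False by (intro sum.cong) auto
        then show "sc c x + y = sum (f(?h := sc c x)) (insert ?h X)"
          using X False by simp
        fix z assume "z \<in> insert ?h X" then show "(f(?h := sc c x)) z \<in> wp \<alpha> z"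
          using X cx by auto
      qed (use X in auto)
    qed
  qed
qed

text \<open>
  A module is spanned by its weight spaces of weights in \<open>hw + \<nat>\<close>, and a
  further weight would contradict independence. These lower bounds are the source of all
  finiteness statements about heights.
\<close>
lemma wp_hw:
  assumes \<alpha>: "\<alpha> \<in> labels D" and u: "u \<in> wp \<alpha> c" and "u \<noteq> 0"
  shows "\<exists>n::nat. c = hw \<alpha> + of_nat n"
proof (rule ccontr)
  assume c: "\<not> ?thesis"
  obtain X f where X: "finite X" "X \<subseteq> {hw \<alpha> + of_nat n |n. True}" "\<forall>x\<in>X. f x \<in> wp \<alpha> x" "u = sum f X"
    using space_decomp[OF \<alpha>, of u] u by (auto simp: wp_iff)
  have c_notin: "c \<notin> X" using c X by blast
  let ?f = "f(c := - u)"
  have "sum ?f X = sum f X" by (rule sum.cong) (use c_notin in auto)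
  then have "sum ?f (insert c X) = - u + sum f X" using c_notin X(1) by (simp only: sum.insert fun_upd_same not_False_eq_True)
  then have "sum ?f (insert c X) = 0" using X by simp
  moreover have "?f x \<in> wp \<alpha> x" if "x \<in> insert c X" for x
    using that X u wp_subspace[OF \<alpha>] VS.subspace_neg by auto
  ultimately have "?f c = 0" using wp_independent[OF \<alpha>, of "insert c X" ?f c] X by blast
  then show False using \<open>u \<noteq> 0\<close> by simp
qed

end

text \<open>
  The operators at the listed points can be composed: the operator at \<open>p\<close> has
  states in the module \<open>lab p\<close>, acts on the module \<open>src p\<close>, and its
  target is the module on which the preceding operator acts.
\<close>
fun chain :: "('i, 'a::ab_group_add) voa_family \<Rightarrow> (fvar \<Rightarrow> 'a modes) \<Rightarrow> (fvar \<Rightarrow> 'i) \<Rightarrow> (fvar \<Rightarrow> 'i) \<Rightarrow> fvar list \<Rightarrow> 'i \<Rightarrow> 'i \<Rightarrow> bool" where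
  "chain D op lab src [] \<gamma> \<beta> \<longleftrightarrow> \<gamma> = \<beta> \<and> \<beta> \<in> labels D"
| "chain D op lab src (p # ps) \<gamma> \<beta> \<longleftrightarrow> \<gamma> \<in> labels D \<and> lab p \<in> labels D \<and> src p \<in> labels D \<and>
     op p \<in> intertwiner_space D (lab p) (src p) \<gamma> \<and> chain D op lab src ps (src p) \<beta>"

text \<open>
  The coefficient of the product of all \<open>p\<close> to the power \<open>e p\<close> is the
  composition of the modes with index \<open>- e p - 1\<close>.
\<close>
definition apply_ops :: "(fvar \<Rightarrow> 'a modes) \<Rightarrow> (fvar \<Rightarrow> 'a) \<Rightarrow> (fvar \<Rightarrow> complex) \<Rightarrow> fvar list \<Rightarrow> 'a \<Rightarrow> 'a" where
  "apply_ops op \<sigma> e ps u = foldr (\<lambda>p. op p (\<sigma> p) (- e p - 1)) ps u"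

lemma apply_ops_Nil [simp]: "apply_ops op \<sigma> e [] u = u"
  and apply_ops_Cons [simp]: "apply_ops op \<sigma> e (p # ps) u = op p (\<sigma> p) (- e p - 1) (apply_ops op \<sigma> e ps u)"
  and apply_ops_append: "apply_ops op \<sigma> e (as @ bs) u = apply_ops op \<sigma> e as (apply_ops op \<sigma> e bs u)"
  by (simp_all add: apply_ops_def)

lemma apply_ops_cong: "(\<And>p. p \<in> set ps \<Longrightarrow> \<sigma> p = \<sigma>' p) \<Longrightarrow> (\<And>p. p \<in> set ps \<Longrightarrow> e p = e' p) \<Longrightarrow>
    apply_ops op \<sigma> e ps u = apply_ops op \<sigma>' e' ps u"
  by (induction ps) simp_all

lemma apply_ops_upd [simp]:
  "q \<notin> set ps \<Longrightarrow> apply_ops op (\<sigma>(q := x)) e ps u = apply_ops op \<sigma> e ps u"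
  "q \<notin> set ps \<Longrightarrow> apply_ops op \<sigma> (e(q := c)) ps u = apply_ops op \<sigma> e ps u"
  by (rule apply_ops_cong; auto)+

context voa_data
begin

section \<open>The vacuum and the invariant pairing\<close>

lemma vac_om_nonneg: "om one (int n) vac = 0"
proof -
  have "vop D one (conformal D) (of_nat n) vac = 0"
    using cft omega_space by (simp add: simple_strong_cft_voa_def)
  then show ?thesis by simp
qed

lemma vac_om_m1: "om one (- 1) vac = conformal D"
  using cft omega_space by (simp add: simple_strong_cft_voa_def)

lemma vac_wp: "vac \<in> wp one 0"
  using vac_om_nonneg[of 1] vac_space by (simp add: wp_iff)

text \<open>
  The Virasoro relations applied to \<open>\<omega> = L(-2)\<close> on the vacuum:
  \<open>\<omega>\<^sub>1\<omega> = 2\<omega>\<close>, \<open>\<omega>\<^sub>3\<omega> =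
  C/2\<close> times the vacuum, and zero otherwise except for
  \<open>\<omega>\<^sub>0\<omega>\<close>.
\<close>
lemma om_omega: "om one (int n) (conformal D) =
   (if n = 0 then om one 0 (conformal D) else if n = 1 then sc 2 (conformal D)
    else if n = 3 then sc (central_charge D / 2) vac else 0)"
proof -
  have V: "Lmode (algebra_vop D) (conformal D) m (Lmode (algebra_vop D) (conformal D) (- 2) vac)
      - Lmode (algebra_vop D) (conformal D) (- 2) (Lmode (algebra_vop D) (conformal D) m vac)
      = sc (of_int (m + 2)) (Lmode (algebra_vop D) (conformal D) (m - 2) vac)
        + sc (if m = 2 then central_charge D / 2 * (of_int (m + 1) gchoose 3) else 0) vac" for m
    using cft vac_space unfolding simple_strong_cft_voa_def by (metis (no_types, lifting) ab_group_add_class.ab_diff_conv_add_uminus diff_minus_eq_add minus_equation_iff uminus_add_conv_diff)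
  have L: "Lmode (algebra_vop D) (conformal D) (int n - 1) u = om one (int n) u" for n u
    by (simp add: Lmode_def)
  have Lm2: "Lmode (algebra_vop D) (conformal D) (- 2) vac = conformal D"
    using vac_om_m1 by (simp add: Lmode_def)
  have Lm2z: "Lmode (algebra_vop D) (conformal D) (- 2) 0 = 0"
    using additive_on_0[OF om_additive_on[of one "- 1"] zero_space] one_label by (simp add: Lmode_def)
  have key: "om one (int n) (conformal D) = sc (of_int (int n + 1)) (Lmode (algebra_vop D) (conformal D) (int n - 3) vac)
        + sc (if n = 3 then central_charge D / 2 * (of_int (int n) gchoose 3) else 0) vac"
  proof -
    have i: "int n - 1 - 2 = int n - 3" "int n - 1 + 2 = int n + 1" "(int n - 1 = 2) = (n = 3)"
      "int n - 1 + 1 = int n" by auto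
    show ?thesis using V[of "int n - 1", unfolded i Lm2 L vac_om_nonneg Lm2z] by simp
  qed
  consider "n = 0" | "n = 1" | "n = 2" | "n \<ge> 3" by linarith
  then show ?thesis
  proof cases
    case 3
    have "Lmode (algebra_vop D) (conformal D) (- 1) vac = om one (int 0) vac" by (simp add: Lmode_def)
    then show ?thesis using key 3 vac_om_nonneg[of 0] by simp
  next
    case 4
    have "Lmode (algebra_vop D) (conformal D) (int n - 3) vac = om one (int (n - 2)) vac"
      using 4 by (simp add: Lmode_def of_nat_diff)
    then have "Lmode (algebra_vop D) (conformal D) (int n - 3) vac = 0"
      by (simp only: vac_om_nonneg)
    moreover have "(3 gchoose 3 :: complex) = 1" by (simp add: gbinomial_pochhammer' pochhammer_rec numeral_eq_Suc)
    ultimately show ?thesis using key 4 by (simp add: vac_om_nonneg)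
  qed (use omega_wp in \<open>simp_all add: wp_iff\<close>)
qed

lemma pairing_facts:
  assumes "\<alpha> \<in> labels D"
  shows "u \<in> space D \<alpha> \<Longrightarrow> v \<in> space D \<alpha> \<Longrightarrow> u' \<in> space D (contra D \<alpha>) \<Longrightarrow>
      pairing D \<alpha> (u + v) u' = pairing D \<alpha> u u' + pairing D \<alpha> v u'"
    and "u \<in> space D \<alpha> \<Longrightarrow> u' \<in> space D (contra D \<alpha>) \<Longrightarrow> pairing D \<alpha> (sc c u) u' = c * pairing D \<alpha> u u'"
    and "u \<in> space D \<alpha> \<Longrightarrow> u' \<in> space D (contra D \<alpha>) \<Longrightarrow> v' \<in> space D (contra D \<alpha>) \<Longrightarrow>
      pairing D \<alpha> u (u' + v') = pairing D \<alpha> u u' + pairing D \<alpha> u v'"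
    and "u \<in> space D \<alpha> \<Longrightarrow> u' \<in> space D (contra D \<alpha>) \<Longrightarrow> pairing D \<alpha> u (sc c u') = c * pairing D \<alpha> u u'"
    and "u' \<in> space D (contra D \<alpha>) \<Longrightarrow> (\<And>u. u \<in> space D \<alpha> \<Longrightarrow> pairing D \<alpha> u u' = 0) \<Longrightarrow> u' = 0"
    and "v \<in> wp one h \<Longrightarrow> u \<in> space D \<alpha> \<Longrightarrow> u' \<in> space D (contra D \<alpha>) \<Longrightarrow>
      pairing D \<alpha> (vop D \<alpha> v k u) u' =
            pairing D \<alpha> u (opposite (smult D) (conformal D) (algebra_vop D) (vop D (contra D \<alpha>)) h v k u')"
proof -
  note big = bspec[OF con[unfolded contragredients_def Let_def, THEN conjunct2, THEN conjunct2] assms,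
      THEN conjunct2, THEN conjunct2]
  note c1 = big[THEN conjunct1] and c2 = big[THEN conjunct2, THEN conjunct1]
    and c4 = big[THEN conjunct2, THEN conjunct2, THEN conjunct2, THEN conjunct1]
    and c5 = big[THEN conjunct2, THEN conjunct2, THEN conjunct2, THEN conjunct2]
  show "u \<in> space D \<alpha> \<Longrightarrow> v \<in> space D \<alpha> \<Longrightarrow> u' \<in> space D (contra D \<alpha>) \<Longrightarrow>
      pairing D \<alpha> (u + v) u' = pairing D \<alpha> u u' + pairing D \<alpha> v u'"
    using c1 by simp
  show "u \<in> space D \<alpha> \<Longrightarrow> u' \<in> space D (contra D \<alpha>) \<Longrightarrow> pairing D \<alpha> (sc c u) u' = c * pairing D \<alpha> u u'"
    using c1 by simp
  show "u \<in> space D \<alpha> \<Longrightarrow> u' \<in> space D (contra D \<alpha>) \<Longrightarrow> v' \<in> space D (contra D \<alpha>) \<Longrightarrow>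
      pairing D \<alpha> u (u' + v') = pairing D \<alpha> u u' + pairing D \<alpha> u v'"
    using c2 by simp
  show "u \<in> space D \<alpha> \<Longrightarrow> u' \<in> space D (contra D \<alpha>) \<Longrightarrow> pairing D \<alpha> u (sc c u') = c * pairing D \<alpha> u u'"
    using c2 by simp
  show "u' \<in> space D (contra D \<alpha>) \<Longrightarrow> (\<And>u. u \<in> space D \<alpha> \<Longrightarrow> pairing D \<alpha> u u' = 0) \<Longrightarrow> u' = 0"
    using c4 by simp
  show "v \<in> wp one h \<Longrightarrow> u \<in> space D \<alpha> \<Longrightarrow> u' \<in> space D (contra D \<alpha>) \<Longrightarrow>
      pairing D \<alpha> (vop D \<alpha> v k u) u' =
            pairing D \<alpha> u (opposite (smult D) (conformal D) (algebra_vop D) (vop D (contra D \<alpha>)) h v k u')"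
    using c5 by simp
qed

lemma pairing_zero: "\<alpha> \<in> labels D \<Longrightarrow> u' \<in> space D (contra D \<alpha>) \<Longrightarrow> pairing D \<alpha> 0 u' = 0"
  using pairing_facts(2)[of \<alpha> 0 u' 0] zero_space[of \<alpha>] by simp

text \<open>
  Since \<open>\<omega>\<close> is quasiprimary of weight 2, \<open>L(1)\<omega> = 0\<close>
  leaves a single term of the opposite vertex operator.
\<close>
lemma omega_opposite:
  assumes "\<alpha> \<in> labels D" "u \<in> space D \<alpha>"
  shows "opposite (smult D) (conformal D) (algebra_vop D) (vop D \<alpha>) 2 (conformal D) (of_int m) u
    = om \<alpha> (2 - m) u"
proof -
  have L1: "(Lmode (algebra_vop D) (conformal D) 1 ^^ i) (conformal D) = 0" if "i > 0" for i
    using that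
  proof (induction i)
    case (Suc i)
    have "Lmode (algebra_vop D) (conformal D) 1 (conformal D) = om one (int 2) (conformal D)"
      by (simp add: Lmode_def)
    then have *: "Lmode (algebra_vop D) (conformal D) 1 (conformal D) = 0" by (simp only: om_omega) simp
    have "Lmode (algebra_vop D) (conformal D) 1 0 = 0"
      using additive_on_0[OF om_additive_on[of one 2] zero_space] one_label by (simp add: Lmode_def)
    then show ?case using Suc * by (cases "i = 0") auto
  qed simp
  let ?f = "\<lambda>i::nat. sc (1 / fact i)
        (vop D \<alpha> ((Lmode (algebra_vop D) (conformal D) 1 ^^ i) (conformal D)) (2 * 2 - of_int m - of_nat i - 2) u)"
  have "Sum_any ?f = ?f 0"
    by (rule Sum_any_single)
       (simp add: L1 int_zero1[OF vop_int one_label _ _ assms(2)] assms(1))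
  moreover have "exp (\<i> * complex_of_real pi * 2) = 1"
    by (simp add: exp_eq_1 mult_ac)
  ultimately show ?thesis by (simp add: opposite_def)
qed

lemma pairing_adjoint:
  assumes "\<alpha> \<in> labels D" "u \<in> space D \<alpha>" "u' \<in> space D (contra D \<alpha>)"
  shows "pairing D \<alpha> (om \<alpha> m u) u' = pairing D \<alpha> u (om (contra D \<alpha>) (2 - m) u')"
  using pairing_facts(6)[OF assms(1) omega_wp assms(2,3), of "of_int m"]
  by (simp add: omega_opposite contra_label assms)

definition vacuum_value :: "'a \<Rightarrow> complex" where
  "vacuum_value u = pairing D one vac u"

lemma vacuum_value_additive_on: "additive_on (space D one) vacuum_value"
  using pairing_facts(3)[OF one_label vac_space] by (simp add: additive_on_def vacuum_value_def contra_one)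

lemma vacuum_value_scale: "u \<in> space D one \<Longrightarrow> vacuum_value (sc c u) = c * vacuum_value u"
  using pairing_facts(4)[OF one_label vac_space] by (simp add: vacuum_value_def contra_one)

text \<open>
  The adjoint mode is non-negative, so it annihilates the vacuum on the left.
\<close>
lemma vacuum_value_om: "u \<in> space D one \<Longrightarrow> m \<le> 2 \<Longrightarrow> vacuum_value (om one m u) = 0"
proof -
  assume u: "u \<in> space D one" and m: "m \<le> 2"
  have "om one (2 - m) vac = 0" using vac_om_nonneg[of "nat (2 - m)"] m by simp
  then have "pairing D one 0 u = vacuum_value (om one (2 - (2 - m)) u)"
    using pairing_adjoint[of one vac u "2 - m"] u by (simp add: one_label vac_space contra_one vacuum_value_def)
  then show "vacuum_value (om one m u) = 0" using pairing_zero[OF one_label] u by (simp add: contra_one)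
qed

lemma vacuum_value_weight: "u \<in> wp one h \<Longrightarrow> vacuum_value u \<noteq> 0 \<Longrightarrow> h = 0"
  using vacuum_value_om[of u 1] vacuum_value_scale[of u h] by (auto simp: wp_iff)

section \<open>Modes acting on products of intertwining operators\<close>

context
  fixes op :: "fvar \<Rightarrow> 'a modes" and lab src :: "fvar \<Rightarrow> 'i"
begin

lemma chain_append: "chain D op lab src (as @ bs) \<gamma> \<beta> \<longleftrightarrow> (\<exists>\<delta>. chain D op lab src as \<gamma> \<delta> \<and> chain D op lab src bs \<delta> \<beta>)"
  by (induction as arbitrary: \<gamma>) (auto elim: chain.elims)

lemma chain_labels: "chain D op lab src ps \<gamma> \<beta> \<Longrightarrow> \<gamma> \<in> labels D \<and> \<beta> \<in> labels D"
  by (induction ps arbitrary: \<gamma>) auto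

lemma apply_ops_space: "chain D op lab src ps \<gamma> \<beta> \<Longrightarrow> (\<And>p. p \<in> set ps \<Longrightarrow> \<sigma> p \<in> space D (lab p)) \<Longrightarrow> u \<in> space D \<beta> \<Longrightarrow>
    apply_ops op \<sigma> e ps u \<in> space D \<gamma>"
proof (induction ps arbitrary: \<gamma>)
  case (Cons p ps)
  then show ?case by (auto intro!: int_closed[of "op p" "lab p" "src p"])
qed simp

lemma apply_ops_additive_on: "chain D op lab src ps \<gamma> \<beta> \<Longrightarrow> (\<And>p. p \<in> set ps \<Longrightarrow> \<sigma> p \<in> space D (lab p)) \<Longrightarrow>
    additive_on (space D \<beta>) (apply_ops op \<sigma> e ps)"
proof (induction ps arbitrary: \<gamma>)
  case (Cons p ps)
  then have IH: "additive_on (space D \<beta>) (apply_ops op \<sigma> e ps)" using Cons.IH[of "src p"] by simp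
  show ?case unfolding additive_on_def
  proof (intro ballI)
    fix x y assume xy: "x \<in> space D \<beta>" "y \<in> space D \<beta>"
    have "apply_ops op \<sigma> e ps x \<in> space D (src p)" "apply_ops op \<sigma> e ps y \<in> space D (src p)"
      using Cons xy by (auto intro!: apply_ops_space)
    then show "apply_ops op \<sigma> e (p # ps) (x + y) = apply_ops op \<sigma> e (p # ps) x + apply_ops op \<sigma> e (p # ps) y"
      using IH xy Cons.prems int_add2[of "op p" "lab p" "src p" \<gamma>] by (simp add: additive_on_def)
  qed
qed (simp add: additive_on_def)

lemma apply_ops_scale: "chain D op lab src ps \<gamma> \<beta> \<Longrightarrow> (\<And>p. p \<in> set ps \<Longrightarrow> \<sigma> p \<in> space D (lab p)) \<Longrightarrow>
    u \<in> space D \<beta> \<Longrightarrow> apply_ops op \<sigma> e ps (sc c u) = sc c (apply_ops op \<sigma> e ps u)"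
proof (induction ps arbitrary: \<gamma>)
  case (Cons p ps)
  have "apply_ops op \<sigma> e ps u \<in> space D (src p)"
      using Cons by (auto intro!: apply_ops_space)
  then show ?case using Cons.prems Cons.IH[of "src p"] int_scale2[of "op p" "lab p" "src p" \<gamma>] by simp
qed simp

lemma apply_ops_state_add:
  assumes "chain D op lab src ps \<gamma> \<beta>" "distinct ps" "\<And>p. p \<in> set ps \<Longrightarrow> \<sigma> p \<in> space D (lab p)"
    "u \<in> space D \<beta>" "q \<in> set ps"
  shows "additive_on (space D (lab q)) (\<lambda>x. apply_ops op (\<sigma>(q := x)) e ps u)"
  using assms
proof (induction ps arbitrary: \<gamma>)
  case (Cons p ps)
  show ?case
  proof (cases "p = q")
    case True
    then have "apply_ops op \<sigma> e ps u \<in> space D (src q)" using Cons by (auto intro!: apply_ops_space)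
    moreover have eq: "apply_ops op (\<sigma>(q := x)) e (p # ps) u = op q x (- e q - 1) (apply_ops op \<sigma> e ps u)" for x
      using True Cons.prems(2) by (simp del: fun_upd_apply add: fun_upd_same)
    ultimately show ?thesis using Cons.prems True int_add1[of "op q" "lab q" "src q" \<gamma>]
      by (simp add: additive_on_def eq del: apply_ops_Cons fun_upd_apply)
  next
    case False
    then have IH: "additive_on (space D (lab q)) (\<lambda>x. apply_ops op (\<sigma>(q := x)) e ps u)"
      by (intro Cons.IH[of "src p"]) (use Cons.prems in auto)
    have "apply_ops op (\<sigma>(q := x)) e ps u \<in> space D (src p)" if "x \<in> space D (lab q)" for x
      using Cons.prems that by (auto intro!: apply_ops_space)
    moreover have eq: "apply_ops op (\<sigma>(q := x)) e (p # ps) u = op p (\<sigma> p) (- e p - 1) (apply_ops op (\<sigma>(q := x)) e ps u)" for x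
      using False by simp
    ultimately show ?thesis using IH Cons.prems int_add2[of "op p" "lab p" "src p" \<gamma>]
      by (simp add: additive_on_def eq del: apply_ops_Cons fun_upd_apply)
  qed
qed simp

lemma apply_ops_state_scale:
  assumes "chain D op lab src ps \<gamma> \<beta>" "distinct ps" "\<And>p. p \<in> set ps \<Longrightarrow> \<sigma> p \<in> space D (lab p)"
    "u \<in> space D \<beta>" "q \<in> set ps" "x \<in> space D (lab q)"
  shows "apply_ops op (\<sigma>(q := sc c x)) e ps u = sc c (apply_ops op (\<sigma>(q := x)) e ps u)"
  using assms
proof (induction ps arbitrary: \<gamma>)
  case (Cons p ps)
  show ?case
  proof (cases "p = q")
    case True
    then have "apply_ops op \<sigma> e ps u \<in> space D (src q)" using Cons by (auto intro!: apply_ops_space)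
    moreover have eq: "apply_ops op (\<sigma>(q := x)) e (p # ps) u = op q x (- e q - 1) (apply_ops op \<sigma> e ps u)" for x
      using True Cons.prems(2) by (simp del: fun_upd_apply add: fun_upd_same)
    ultimately show ?thesis using Cons.prems True int_scale1[of "op q" "lab q" "src q" \<gamma>]
      by (simp add: eq del: apply_ops_Cons fun_upd_apply)
  next
    case False
    then have "apply_ops op (\<sigma>(q := x)) e ps u \<in> space D (src p)"
      using Cons.prems by (auto intro!: apply_ops_space)
    moreover have eq: "apply_ops op (\<sigma>(q := x)) e (p # ps) u = op p (\<sigma> p) (- e p - 1) (apply_ops op (\<sigma>(q := x)) e ps u)" for x
      using False by simp
    ultimately show ?thesis using Cons.prems Cons.IH[of "src p"] False int_scale2[of "op p" "lab p" "src p" \<gamma>]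
      by (simp add: eq del: apply_ops_Cons fun_upd_apply)
  qed
qed simp

lemma apply_ops_weight: "chain D op lab src ps \<gamma> \<beta> \<Longrightarrow> distinct ps \<Longrightarrow>
    (\<And>p. p \<in> set ps \<Longrightarrow> \<sigma> p \<in> wp (lab p) (wt p)) \<Longrightarrow> u \<in> wp \<beta> h \<Longrightarrow>
    apply_ops op \<sigma> e ps u \<in> wp \<gamma> (h + (\<Sum>p\<in>set ps. wt p + e p))"
proof (induction ps arbitrary: \<gamma>)
  case (Cons p ps)
  then have "apply_ops op \<sigma> e ps u \<in> wp (src p) (h + (\<Sum>p\<in>set ps. wt p + e p))"
    using Cons.IH[of "src p"] by simp
  then have "apply_ops op \<sigma> e (p # ps) u \<in> wp \<gamma> (wt p + (h + (\<Sum>p\<in>set ps. wt p + e p)) - (- e p - 1) - 1)"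
    unfolding apply_ops_Cons using Cons.prems by (intro int_weight[of "op p" "lab p" "src p"]) auto
  then show ?case using Cons.prems by (simp add: algebra_simps)
qed simp

text \<open>
  Induction along the product: moving \<open>\<omega>\<^sub>n\<close> one operator to the right
  costs the commutator term at that operator, in which modes of \<open>\<omega>\<close> act on
  the inserted state.
\<close>
lemma apply_ops_commutator:
  assumes "chain D op lab src ps \<gamma> \<beta>" "distinct ps" "\<And>p. p \<in> set ps \<Longrightarrow> \<sigma> p \<in> space D (lab p)" "u \<in> space D \<beta>"
  shows "om \<gamma> n (apply_ops op \<sigma> e ps u) = apply_ops op \<sigma> e ps (om \<beta> n u) +
    (\<Sum>q\<in>set ps. Sum_any (\<lambda>m. sc (of_int n gchoose m)
       (apply_ops op (\<sigma>(q := om (lab q) (int m) (\<sigma> q))) (e(q := e q - of_int n + of_nat m)) ps u)))"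
  using assms
proof (induction ps arbitrary: \<gamma>)
  case Nil
  then show ?case by simp
next
  case (Cons p ps)
  let ?I = "op p (\<sigma> p) (- e p - 1)"
  let ?w = "apply_ops op \<sigma> e ps u"
  let ?t = "\<lambda>q m. sc (of_int n gchoose m)
       (apply_ops op (\<sigma>(q := om (lab q) (int m) (\<sigma> q))) (e(q := e q - of_int n + of_nat m)) ps u)"
  let ?S = "\<lambda>q m. sc (of_int n gchoose m)
       (apply_ops op (\<sigma>(q := om (lab q) (int m) (\<sigma> q))) (e(q := e q - of_int n + of_nat m)) (p # ps) u)"
  have c: "chain D op lab src ps (src p) \<beta>" "lab p \<in> labels D" "src p \<in> labels D" "\<gamma> \<in> labels D"
    "op p \<in> intertwiner_space D (lab p) (src p) \<gamma>" "\<sigma> p \<in> space D (lab p)" "p \<notin> set ps" "distinct ps"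
    using Cons.prems by auto
  note I = c(5,2,3,4)
  have \<sigma>: "\<sigma> q \<in> space D (lab q)" if "q \<in> set ps" for q using Cons.prems that by simp
  have lab: "lab q \<in> labels D" if "q \<in> set ps" for q
  proof -
    from that obtain as bs where "ps = as @ q # bs" by (blast dest: split_list)
    then show ?thesis using c(1) by (auto simp: chain_append)
  qed
  have w: "?w \<in> space D (src p)" by (rule apply_ops_space[OF c(1) \<sigma>]) (use Cons.prems in auto)
  have \<beta>: "\<beta> \<in> labels D" using chain_labels[OF c(1)] by simp
  have wn: "apply_ops op \<sigma> e ps (om \<beta> n u) \<in> space D (src p)"
    by (rule apply_ops_space[OF c(1) \<sigma>]) (use Cons.prems \<beta> om_space in auto)
  have vs: "apply_ops op (\<sigma>(q := om (lab q) (int m) (\<sigma> q))) e' ps u \<in> space D (src p)" if "q \<in> set ps" for q m e'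
    using Cons.prems that \<sigma> om_space[OF lab[OF that] \<sigma>[OF that], of "int m"]
    by (intro apply_ops_space[OF c(1)]) auto
  have ts: "?t q m \<in> space D (src p)" if "q \<in> set ps" for q m
    by (rule scale_space[OF c(3) vs[OF that]])
  have fin: "finite {m. ?t q m \<noteq> 0}" if "q \<in> set ps" for q
  proof (rule finite_subset[OF _ om_trunc[OF lab[OF that] \<sigma>[OF that]]])
    have "apply_ops op (\<sigma>(q := 0)) e' ps u = 0" for e'
      using additive_on_0[OF apply_ops_state_add[OF c(1,8) \<sigma> Cons.prems(4) that] zero_space[OF lab[OF that]]] by simp
    then show "{m. ?t q m \<noteq> 0} \<subseteq> {i. om (lab q) (int i) (\<sigma> q) \<noteq> 0}" by fastforce
  qed
  have "om \<gamma> n (?I ?w) = ?I (om (src p) n ?w) +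
     Sum_any (\<lambda>i. sc (of_int n gchoose i) (op p (om (lab p) (int i) (\<sigma> p)) (of_int n + (- e p - 1) - of_nat i) ?w))"
    by (rule commutator[OF I c(6) w])
  also have "om (src p) n ?w = apply_ops op \<sigma> e ps (om \<beta> n u) + (\<Sum>q\<in>set ps. Sum_any (?t q))"
    by (rule Cons.IH[OF c(1,8) \<sigma> Cons.prems(4)])
  also have "?I \<dots> = ?I (apply_ops op \<sigma> e ps (om \<beta> n u)) + ?I (\<Sum>q\<in>set ps. Sum_any (?t q))"
    by (rule int_add2[OF I c(6) wn]) (intro sum_space[OF c(3)] Sum_any_space[OF c(3)] ts; assumption)
  also have "?I (\<Sum>q\<in>set ps. Sum_any (?t q)) = (\<Sum>q\<in>set ps. ?I (Sum_any (?t q)))"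
    by (rule additive_on_sum[OF int_additive_on2[OF I c(6)] c(3)]) (intro Sum_any_space[OF c(3)] ts; assumption)
  also have "\<dots> = (\<Sum>q\<in>set ps. Sum_any (\<lambda>m. ?I (?t q m)))"
    by (intro sum.cong refl additive_on_Sum_any[OF int_additive_on2[OF I c(6)] c(3)] ts fin)
  also have "\<dots> = (\<Sum>q\<in>set ps. Sum_any (\<lambda>m. sc (of_int n gchoose m)
       (apply_ops op (\<sigma>(q := om (lab q) (int m) (\<sigma> q))) (e(q := e q - of_int n + of_nat m)) (p # ps) u)))"
  proof (intro sum.cong refl arg_cong[of _ _ Sum_any] ext)
    fix q m assume q: "q \<in> set ps"
    then have "q \<noteq> p" using c(7) by auto
    then show "?I (?t q m) = sc (of_int n gchoose m)
       (apply_ops op (\<sigma>(q := om (lab q) (int m) (\<sigma> q))) (e(q := e q - of_int n + of_nat m)) (p # ps) u)"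
      using int_scale2[OF I c(6) vs[OF q]] by simp
  qed
  also have "(\<lambda>i. sc (of_int n gchoose i) (op p (om (lab p) (int i) (\<sigma> p)) (of_int n + (- e p - 1) - of_nat i) ?w))
     = (\<lambda>m. sc (of_int n gchoose m)
       (apply_ops op (\<sigma>(p := om (lab p) (int m) (\<sigma> p))) (e(p := e p - of_int n + of_nat m)) (p # ps) u))"
    using c(7) by (auto simp: algebra_simps)
  finally have *: "om \<gamma> n (?I ?w) = ?I (apply_ops op \<sigma> e ps (om \<beta> n u)) + (\<Sum>q\<in>set ps. Sum_any (?S q)) + Sum_any (?S p)" .
  show ?case
    unfolding apply_ops_Cons[of op \<sigma> e p ps] list.set(2) sum.insert[OF finite_set c(7)] *
    by (simp only: add.assoc add.commute add.left_commute)
qed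

end

end

section \<open>Derivatives of the simple pole\<close>

lemma finite_nat_below: "finite {i::nat. \<exists>n::nat. Z - of_nat i = (of_nat n :: complex)}"
proof (rule finite_subset)
  show "{i::nat. \<exists>n::nat. Z - of_nat i = (of_nat n :: complex)} \<subseteq> {..nat \<lceil>Re Z\<rceil>}"
  proof
    fix i assume "i \<in> {i::nat. \<exists>n::nat. Z - of_nat i = (of_nat n :: complex)}"
    then obtain n :: nat where "Z - of_nat i = of_nat n" by blast
    then have "Z = of_nat (i + n)" by (simp add: algebra_simps)
    then have "Re Z = real (i + n)" by simp
    then show "i \<in> {..nat \<lceil>Re Z\<rceil>}" by simp linarith
  qed
qed simp

text \<open>
  Reduces a convolution with a series supported on a one-parameter family of exponents to a sum
  over the parameter.
\<close>
lemma Sum_any_range: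
  assumes "\<And>x. f x \<noteq> 0 \<Longrightarrow> x \<in> range g" "inj g"
  shows "Sum_any f = Sum_any (\<lambda>i. f (g i))"
proof -
  have eq: "{x. f x \<noteq> 0} = g ` {i. f (g i) \<noteq> 0}" using assms(1) by blast
  show ?thesis unfolding Sum_any.expand_set eq
    by (subst sum.reindex) (use assms(2) in \<open>auto simp: inj_on_def\<close>)
qed

text \<open>
  The mixed derivatives (divided by factorials) of \<open>1/(p - q)\<close>, expanded in the
  region given by the order of the points.
\<close>
abbreviation pole_deriv :: "fvar \<Rightarrow> fvar \<Rightarrow> nat \<Rightarrow> nat \<Rightarrow> fseries" where
  "pole_deriv p q r m \<equiv> hderiv p r (hderiv q m (inv_diff p q))"

lemma pole_deriv_eq: "p \<noteq> q \<Longrightarrow> pole_deriv p q r m d = ((d p + of_nat r) gchoose r) * (((d q + of_nat m) gchoose m) *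
    inv_diff p q (d(p := d p + of_nat r, q := d q + of_nat m)))"
  by (simp add: hderiv_eq)

lemma pole_deriv_outer_supp:
  assumes "outer p q" "pole_deriv p q r m d \<noteq> 0"
  shows "\<exists>i::nat. d = (\<lambda>_. 0)(p := - 1 - of_nat i - of_nat r, q := of_nat i - of_nat m) \<and> m \<le> i"
proof -
  have pq: "p \<noteq> q" using assms(1) by (auto simp: outer_def)
  have g: "((d q + of_nat m) gchoose m) \<noteq> 0" using assms(2) pq by (simp add: pole_deriv_eq)
  have "inv_diff p q (d(p := d p + of_nat r, q := d q + of_nat m)) \<noteq> 0"
    using assms(2) pq by (simp add: pole_deriv_eq)
  then obtain i where i: "d(p := d p + of_nat r, q := d q + of_nat m) = (\<lambda>_. 0)(p := - 1 - of_nat i, q := of_nat i)"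
    using assms(1) by (auto simp: inv_diff_def split: if_splits)
  have "d p + of_nat r = - 1 - of_nat i" "d q + of_nat m = of_nat i"
    using fun_cong[OF i, of p] fun_cong[OF i, of q] pq by auto
  moreover have "d x = 0" if "x \<noteq> p" "x \<noteq> q" for x using fun_cong[OF i, of x] that by auto
  ultimately have "d = (\<lambda>_. 0)(p := - 1 - of_nat i - of_nat r, q := of_nat i - of_nat m)" "d q + of_nat m = of_nat i"
    using pq by (auto simp: fun_eq_iff algebra_simps)
  moreover have "m \<le> i"
  proof (rule ccontr)
    assume "\<not> m \<le> i"
    then have "(of_nat i gchoose m :: complex) = 0"
      by (metis binomial_eq_0 binomial_gbinomial not_le of_nat_0)
    then show False using g calculation by simp
  qed
  ultimately show ?thesis by blast
qed

lemma pole_deriv_inner_supp: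
  assumes "outer q p" "pole_deriv p q r m d \<noteq> 0"
  shows "\<exists>i::nat. d = (\<lambda>_. 0)(p := of_nat i, q := - 1 - of_nat r - of_nat i - of_nat m)"
proof -
  have pq: "p \<noteq> q" "\<not> outer p q" using assms(1) by (auto simp: outer_def)
  have g: "((d p + of_nat r) gchoose r) \<noteq> 0" using assms(2) pq by (simp add: pole_deriv_eq)
  have "inv_diff p q (d(p := d p + of_nat r, q := d q + of_nat m)) \<noteq> 0"
    using assms(2) pq by (simp add: pole_deriv_eq)
  then obtain i where i: "d(p := d p + of_nat r, q := d q + of_nat m) = (\<lambda>_. 0)(p := of_nat i, q := - 1 - of_nat i)"
    using pq by (auto simp: inv_diff_def split: if_splits)
  have *: "d p + of_nat r = of_nat i" "d q + of_nat m = - 1 - of_nat i"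
    using fun_cong[OF i, of p] fun_cong[OF i, of q] pq by auto
  have "d x = 0" if "x \<noteq> p" "x \<noteq> q" for x using fun_cong[OF i, of x] that by auto
  moreover have ri: "r \<le> i"
  proof (rule ccontr)
    assume "\<not> r \<le> i"
    then have "(of_nat i gchoose r :: complex) = 0"
      by (metis binomial_eq_0 binomial_gbinomial not_le of_nat_0)
    then show False using g * by simp
  qed
  moreover have "d p = of_nat (i - r)" using *(1) ri by (simp add: of_nat_diff algebra_simps)
  moreover have "d q = - 1 - of_nat r - of_nat (i - r) - of_nat m" using *(2) ri by (simp add: of_nat_diff algebra_simps)
  ultimately have "d = (\<lambda>_. 0)(p := of_nat (i - r), q := - 1 - of_nat r - of_nat (i - r) - of_nat m)"
    using pq by (auto simp: fun_eq_iff)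
  then show ?thesis by blast
qed

lemma pole_deriv_outer:
  assumes "outer p q"
  shows "(pole_deriv p q r m \<star> H) e = Sum_any (\<lambda>i. ((- 1 - of_nat i) gchoose r) * (of_nat i gchoose m) *
     H (e(p := e p + 1 + of_nat i + of_nat r, q := e q - of_nat i + of_nat m)))"
proof -
  have pq: "p \<noteq> q" using assms(1) by (auto simp: outer_def)
  let ?g = "\<lambda>i::nat. (\<lambda>_. 0)(p := - 1 - of_nat i - of_nat r, q := of_nat i - of_nat m :: complex)"
  have "inj ?g"
  proof (rule injI)
    fix i j assume "?g i = ?g j"
    from fun_cong[OF this, of q] show "i = j" by simp
  qed
  moreover have "d \<in> range ?g" if "pole_deriv p q r m d * H (esub e d) \<noteq> 0" for d
    using pole_deriv_outer_supp[OF assms, of r m d] that by auto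
  ultimately have "(pole_deriv p q r m \<star> H) e = Sum_any (\<lambda>i. pole_deriv p q r m (?g i) * H (esub e (?g i)))"
    unfolding fmult_def by (intro Sum_any_range)
  also have "\<dots> = Sum_any (\<lambda>i. ((- 1 - of_nat i) gchoose r) * (of_nat i gchoose m) *
     H (e(p := e p + 1 + of_nat i + of_nat r, q := e q - of_nat i + of_nat m)))"
  proof (intro arg_cong[of _ _ Sum_any] ext)
    fix i
    have "(?g i)(p := ?g i p + of_nat r, q := ?g i q + of_nat m) = (\<lambda>_. 0)(p := - 1 - of_nat i, q := of_nat i)"
      using pq by (auto simp: fun_eq_iff)
    then have "inv_diff p q ((?g i)(p := ?g i p + of_nat r, q := ?g i q + of_nat m)) = 1"
      unfolding inv_diff_def using assms by (metis (mono_tags, lifting))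
    then have "pole_deriv p q r m (?g i) = ((- 1 - of_nat i) gchoose r) * (of_nat i gchoose m)"
      unfolding pole_deriv_eq[OF pq] using pq by simp
    moreover have "esub e (?g i) = e(p := e p + 1 + of_nat i + of_nat r, q := e q - of_nat i + of_nat m)"
      using pq by (auto simp: fun_eq_iff)
    ultimately show "pole_deriv p q r m (?g i) * H (esub e (?g i)) = ((- 1 - of_nat i) gchoose r) * (of_nat i gchoose m) *
     H (e(p := e p + 1 + of_nat i + of_nat r, q := e q - of_nat i + of_nat m))" by (simp only:)
  qed
  finally show ?thesis .
qed

lemma pole_deriv_inner:
  assumes "outer q p"
  shows "(pole_deriv p q r m \<star> H) e = Sum_any (\<lambda>i. - ((of_nat (r + i) gchoose r) * ((- 1 - of_nat r - of_nat i) gchoose m) *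
     H (e(p := e p - of_nat i, q := e q + 1 + of_nat r + of_nat i + of_nat m))))"
proof -
  have pq: "p \<noteq> q" "\<not> outer p q" using assms(1) by (auto simp: outer_def)
  let ?g = "\<lambda>i::nat. (\<lambda>_. 0)(p := of_nat i, q := - 1 - of_nat r - of_nat i - of_nat m :: complex)"
  have "inj ?g"
  proof (rule injI)
    fix i j assume "?g i = ?g j"
    from fun_cong[OF this, of q] show "i = j" by simp
  qed
  moreover have "d \<in> range ?g" if "pole_deriv p q r m d * H (esub e d) \<noteq> 0" for d
    using pole_deriv_inner_supp[OF assms, of r m d] that by auto
  ultimately have "(pole_deriv p q r m \<star> H) e = Sum_any (\<lambda>i. pole_deriv p q r m (?g i) * H (esub e (?g i)))"
    unfolding fmult_def by (intro Sum_any_range)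
  also have "\<dots> = Sum_any (\<lambda>i. - ((of_nat (r + i) gchoose r) * ((- 1 - of_nat r - of_nat i) gchoose m) *
     H (e(p := e p - of_nat i, q := e q + 1 + of_nat r + of_nat i + of_nat m))))"
  proof (intro arg_cong[of _ _ Sum_any] ext)
    fix i
    have "(?g i)(p := ?g i p + of_nat r, q := ?g i q + of_nat m) = (\<lambda>_. 0)(p := of_nat (r + i), q := - 1 - of_nat (r + i))"
      using pq by (auto simp: fun_eq_iff)
    then have *: "inv_diff p q ((?g i)(p := ?g i p + of_nat r, q := ?g i q + of_nat m)) = - 1"
      unfolding inv_diff_def using pq(2) by (metis (mono_tags, lifting))
    then have "pole_deriv p q r m (?g i) = - ((of_nat (r + i) gchoose r) * ((- 1 - of_nat r - of_nat i) gchoose m))"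
    proof -
      have "?g i p + of_nat r = of_nat (r + i)" "?g i q + of_nat m = - 1 - of_nat r - of_nat i"
        using pq by simp_all
      then show ?thesis unfolding pole_deriv_eq[OF pq(1)] using * by (simp only: mult_minus1_right mult_minus_right mult_1_right)
    qed
    moreover have "esub e (?g i) = e(p := e p - of_nat i, q := e q + 1 + of_nat r + of_nat i + of_nat m)"
      using pq by (auto simp: fun_eq_iff)
    ultimately show "pole_deriv p q r m (?g i) * H (esub e (?g i)) =
      - ((of_nat (r + i) gchoose r) * ((- 1 - of_nat r - of_nat i) gchoose m) *
       H (e(p := e p - of_nat i, q := e q + 1 + of_nat r + of_nat i + of_nat m)))" by (simp only: mult_minus_left)
  qed
  finally show ?thesis .
qed

text \<open>
  Both expansion regions of the pole lead to the same binomial coefficient as the iterate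
  formula. This is why the two sides of the product of operators combine into one kernel.
\<close>
lemma gchoose_signs:
  "(- 1) ^ i * ((- of_nat r - 1) gchoose i) = (of_nat (r + i) gchoose r :: complex)"
  "((- 1 - of_nat i) gchoose r) = (- 1) ^ r * (of_nat (r + i) gchoose r :: complex)"
proof -
  have "- of_nat r - 1 = - (of_nat (Suc r) :: complex)" by simp
  then have "((- of_nat r - 1) gchoose i) = (- 1) ^ i * (of_nat (r + i) gchoose i :: complex)"
    by (simp only: gbinomial_minus) (simp add: algebra_simps)
  moreover have "(- 1) ^ i * (- 1) ^ i = (1 :: complex)" by (simp add: power_mult_distrib[symmetric])
  moreover have "(of_nat (r + i) gchoose i :: complex) = of_nat (r + i) gchoose r"
    using binomial_symmetric[of i "r + i"] by (simp only: binomial_gbinomial[symmetric]) simp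
  ultimately show "(- 1) ^ i * ((- of_nat r - 1) gchoose i) = (of_nat (r + i) gchoose r :: complex)"
    by (simp only: mult.assoc[symmetric] mult_1)
  have "- 1 - of_nat i = - (of_nat (Suc i) :: complex)" by simp
  then show "((- 1 - of_nat i) gchoose r) = (- 1) ^ r * (of_nat (r + i) gchoose r :: complex)"
    by (simp only: gbinomial_minus) (simp add: algebra_simps)
qed

section \<open>Ward identities for products of intertwining operators\<close>

text \<open>
  A product of intertwining operators from the vacuum module to itself, with its points listed
  in operator order.
\<close>
locale correlator = voa_data D for D :: "('i, 'a::ab_group_add) voa_family" +
  fixes op :: "fvar \<Rightarrow> 'a modes" and lab src :: "fvar \<Rightarrow> 'i" and ps :: "fvar list"
  assumes ch: "chain D op lab src ps one one" and dist: "distinct ps" and sorted: "sorted_wrt outer ps"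
begin

definition corr :: "(fvar \<Rightarrow> 'a) \<Rightarrow> fseries" where
  "corr \<sigma> e = vacuum_value (apply_ops op \<sigma> e ps vac)"

abbreviation hit :: "fvar \<Rightarrow> int \<Rightarrow> (fvar \<Rightarrow> 'a) \<Rightarrow> fvar \<Rightarrow> 'a" where
  "hit q m \<sigma> \<equiv> \<sigma>(q := om (lab q) m (\<sigma> q))"

definition states :: "(fvar \<Rightarrow> 'a) \<Rightarrow> bool" where
  "states \<sigma> \<longleftrightarrow> (\<forall>p\<in>set ps. \<sigma> p \<in> space D (lab p))"

definition homog :: "(fvar \<Rightarrow> 'a) \<Rightarrow> (fvar \<Rightarrow> complex) \<Rightarrow> bool" where
  "homog \<sigma> wt \<longleftrightarrow> (\<forall>p\<in>set ps. \<sigma> p \<in> wp (lab p) (wt p))"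

lemma homog_states: "homog \<sigma> wt \<Longrightarrow> states \<sigma>"
  by (simp add: homog_def states_def wp_iff)

lemma lab_label: "q \<in> set ps \<Longrightarrow> lab q \<in> labels D"
proof -
  assume "q \<in> set ps"
  then obtain as bs where "ps = as @ q # bs" by (blast dest: split_list)
  then show ?thesis using ch by (auto simp: chain_append)
qed

lemma hit_states: "states \<sigma> \<Longrightarrow> states (hit q m \<sigma>)"
  using om_space lab_label by (auto simp: states_def)

lemma hit_homog: "homog \<sigma> wt \<Longrightarrow> homog (hit q m \<sigma>) (wt(q := wt q - of_int m + 1))"
  using om_weight[OF lab_label] by (auto simp: homog_def)

lemma corr_additive_on:
  assumes "states \<sigma>" "q \<in> set ps"
  shows "additive_on (space D (lab q)) (\<lambda>x. corr (\<sigma>(q := x)) e)"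
proof -
  have v: "additive_on (space D (lab q)) (\<lambda>x. apply_ops op (\<sigma>(q := x)) e ps vac)"
    by (rule apply_ops_state_add[OF ch dist _ vac_space assms(2)]) (use assms in \<open>simp add: states_def\<close>)
  have "apply_ops op (\<sigma>(q := x)) e ps vac \<in> space D one" if "x \<in> space D (lab q)" for x
    by (rule apply_ops_space[OF ch _ vac_space]) (use assms that in \<open>auto simp: states_def\<close>)
  then show ?thesis using v vacuum_value_additive_on unfolding additive_on_def corr_def by metis
qed

lemma corr_scale:
  assumes "states \<sigma>" "q \<in> set ps" "x \<in> space D (lab q)"
  shows "corr (\<sigma>(q := sc c x)) e = c * corr (\<sigma>(q := x)) e"
proof -
  have "apply_ops op (\<sigma>(q := sc c x)) e ps vac = sc c (apply_ops op (\<sigma>(q := x)) e ps vac)"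
    by (rule apply_ops_state_scale[OF ch dist _ vac_space assms(2,3)]) (use assms in \<open>simp add: states_def\<close>)
  moreover have "apply_ops op (\<sigma>(q := x)) e ps vac \<in> space D one"
    by (rule apply_ops_space[OF ch _ vac_space]) (use assms in \<open>auto simp: states_def\<close>)
  ultimately show ?thesis by (simp add: corr_def vacuum_value_scale)
qed

lemma corr_zero:
  assumes "states \<sigma>" "q \<in> set ps" "\<sigma> q = 0" shows "corr \<sigma> e = 0"
  using additive_on_0[OF corr_additive_on[OF assms(1,2)] zero_space[OF lab_label[OF assms(2)]], of e] assms(3)
  by (metis fun_upd_triv)

lemma corr_cong: "(\<And>p. p \<in> set ps \<Longrightarrow> \<sigma> p = \<sigma>' p) \<Longrightarrow> (\<And>p. p \<in> set ps \<Longrightarrow> e p = e' p) \<Longrightarrow> corr \<sigma> e = corr \<sigma>' e'"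
  unfolding corr_def by (rule arg_cong[of _ _ vacuum_value]) (rule apply_ops_cong)

text \<open>
  The vacuum expectation value vanishes off weight 0.
\<close>
lemma corr_total:
  assumes "homog \<sigma> wt" "corr \<sigma> e \<noteq> 0"
  shows "(\<Sum>p\<in>set ps. wt p + e p) = 0"
proof -
  have "apply_ops op \<sigma> e ps vac \<in> wp one (0 + (\<Sum>p\<in>set ps. wt p + e p))"
    by (rule apply_ops_weight[OF ch dist _ vac_wp]) (use assms in \<open>simp add: homog_def\<close>)
  then show ?thesis using assms(2) vacuum_value_weight by (force simp: corr_def)
qed

text \<open>
  Minus the sum is the weight of the intermediate state between the two parts of the product,
  which lies in a fixed module.
\<close>
lemma corr_prefix:
  assumes ps: "ps = as @ bs"
  shows "\<exists>c. \<forall>\<sigma> wt e. homog \<sigma> wt \<longrightarrow> corr \<sigma> e \<noteq> 0 \<longrightarrow> (\<exists>n::nat. - (\<Sum>p\<in>set as. wt p + e p) = c + of_nat n)"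
proof -
  obtain \<delta> where \<delta>: "chain D op lab src as one \<delta>" "chain D op lab src bs \<delta> one"
    using ch ps by (auto simp: chain_append)
  show ?thesis
  proof (intro exI[of _ "hw \<delta>"] allI impI)
    fix \<sigma> wt e assume h: "homog \<sigma> wt" and nz: "corr \<sigma> e \<noteq> 0"
    let ?u = "apply_ops op \<sigma> e bs vac"
    have hb: "\<sigma> p \<in> wp (lab p) (wt p)" if "p \<in> set ps" for p using h that by (simp add: homog_def)
    have "?u \<in> wp \<delta> (0 + (\<Sum>p\<in>set bs. wt p + e p))"
      by (rule apply_ops_weight[OF \<delta>(2) _ _ vac_wp]) (use hb ps dist in auto)
    moreover have "?u \<noteq> 0"
    proof
      assume "?u = 0"
      then have "corr \<sigma> e = vacuum_value (apply_ops op \<sigma> e as 0)" unfolding corr_def by (simp add: ps apply_ops_append)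
      also have "apply_ops op \<sigma> e as 0 = 0"
        by (rule additive_on_0[OF apply_ops_additive_on[OF \<delta>(1)] zero_space])
           (use hb ps chain_labels[OF \<delta>(1)] in \<open>auto simp: wp_iff\<close>)
      also have "vacuum_value 0 = 0" by (rule additive_on_0[OF vacuum_value_additive_on zero_space[OF one_label]])
      finally show False using nz by simp
    qed
    ultimately obtain n :: nat where "(\<Sum>p\<in>set bs. wt p + e p) = hw \<delta> + of_nat n"
      using wp_hw[of \<delta>] chain_labels[OF \<delta>(1)] by auto
    moreover have "(\<Sum>p\<in>set ps. wt p + e p) = (\<Sum>p\<in>set as. wt p + e p) + (\<Sum>p\<in>set bs. wt p + e p)"
      unfolding ps set_append using dist ps by (intro sum.union_disjoint) auto
    ultimately show "\<exists>n::nat. - (\<Sum>p\<in>set as. wt p + e p) = hw \<delta> + of_nat n"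
      using corr_total[OF h nz] by (intro exI[of _ n]) (simp only: neg_eq_iff_add_eq_0)
  qed
qed

lemma hit_finite:
  assumes "states \<sigma>" "q \<in> set ps"
  shows "finite {m::nat. \<exists>e. corr (hit q (int m) \<sigma>) e \<noteq> 0}"
proof (rule finite_subset[OF _ om_trunc[OF lab_label[OF assms(2)]]])
  show "\<sigma> q \<in> space D (lab q)" using assms by (simp add: states_def)
  show "{m::nat. \<exists>e. corr (hit q (int m) \<sigma>) e \<noteq> 0} \<subseteq> {i. om (lab q) (int i) (\<sigma> q) \<noteq> 0}"
  proof
    fix m assume "m \<in> {m::nat. \<exists>e. corr (hit q (int m) \<sigma>) e \<noteq> 0}"
    then obtain e where "corr (hit q (int m) \<sigma>) e \<noteq> 0" by blast
    then have "hit q (int m) \<sigma> q \<noteq> 0" using corr_zero[OF hit_states[OF assms(1)] assms(2)] by blast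
    then show "m \<in> {i. om (lab q) (int i) (\<sigma> q) \<noteq> 0}" by simp
  qed
qed

text \<open>
  For \<open>n \<le> 2\<close> the mode kills the vacuum on the left, so it can be traded for
  the commutator terms.
\<close>
lemma vacuum_value_commutator:
  assumes "chain D op lab src cs one \<delta>" "distinct cs" "\<And>p. p \<in> set cs \<Longrightarrow> \<sigma> p \<in> space D (lab p)" "u \<in> space D \<delta>"
    "n \<le> 2"
  shows "vacuum_value (apply_ops op \<sigma> e cs (om \<delta> n u)) = - (\<Sum>q\<in>set cs. Sum_any (\<lambda>m. (of_int n gchoose m) *
       vacuum_value (apply_ops op (hit q (int m) \<sigma>) (e(q := e q - of_int n + of_nat m)) cs u)))"
proof -
  let ?v = "\<lambda>q m. apply_ops op (hit q (int m) \<sigma>) (e(q := e q - of_int n + of_nat m)) cs u"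
  let ?t = "\<lambda>q m. sc (of_int n gchoose m) (?v q m)"
  have \<delta>: "\<delta> \<in> labels D" using chain_labels[OF assms(1)] by simp
  have lab: "lab q \<in> labels D" if "q \<in> set cs" for q
  proof -
    from that obtain as bs where "cs = as @ q # bs" by (blast dest: split_list)
    then show ?thesis using assms(1) by (auto simp: chain_append)
  qed
  have vs: "apply_ops op (hit q (int m) \<sigma>) e' cs u \<in> space D one" if "q \<in> set cs" for q m e'
    using that assms(3) om_space[OF lab[OF that] assms(3)[OF that], of "int m"]
    by (intro apply_ops_space[OF assms(1) _ assms(4)]) auto
  have ts: "?t q m \<in> space D one" if "q \<in> set cs" for q m
    by (rule scale_space[OF one_label vs[OF that]])
  have fin: "finite {m. ?t q m \<noteq> 0}" if q: "q \<in> set cs" for q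
  proof (rule finite_subset[OF _ om_trunc[OF lab[OF that] assms(3)[OF that]]])
    have "apply_ops op (\<sigma>(q := 0)) e' cs u = 0" for e'
      by (rule additive_on_0[OF apply_ops_state_add[OF assms(1,2,3,4) q] zero_space[OF lab[OF q]]])
    then show "{m. ?t q m \<noteq> 0} \<subseteq> {i. om (lab q) (int i) (\<sigma> q) \<noteq> 0}" by fastforce
  qed
  have "0 = vacuum_value (om one n (apply_ops op \<sigma> e cs u))"
    by (rule vacuum_value_om[symmetric, OF apply_ops_space[OF assms(1,3,4)] assms(5)])
  also have "om one n (apply_ops op \<sigma> e cs u) = apply_ops op \<sigma> e cs (om \<delta> n u) + (\<Sum>q\<in>set cs. Sum_any (?t q))"
    by (rule apply_ops_commutator[OF assms(1-4)])
  also have "vacuum_value \<dots> = vacuum_value (apply_ops op \<sigma> e cs (om \<delta> n u)) + vacuum_value (\<Sum>q\<in>set cs. Sum_any (?t q))"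
  proof -
    have "apply_ops op \<sigma> e cs (om \<delta> n u) \<in> space D one"
      by (rule apply_ops_space[OF assms(1,3) om_space[OF \<delta> assms(4)]])
    moreover have "(\<Sum>q\<in>set cs. Sum_any (?t q)) \<in> space D one"
      by (intro sum_space[OF one_label] Sum_any_space[OF one_label] ts; assumption)
    ultimately show ?thesis using vacuum_value_additive_on unfolding additive_on_def by blast
  qed
  also have "vacuum_value (\<Sum>q\<in>set cs. Sum_any (?t q)) = (\<Sum>q\<in>set cs. vacuum_value (Sum_any (?t q)))"
    by (rule additive_on_sum[OF vacuum_value_additive_on one_label]) (intro Sum_any_space[OF one_label] ts; assumption)
  also have "\<dots> = (\<Sum>q\<in>set cs. Sum_any (\<lambda>m. vacuum_value (?t q m)))"
    by (intro sum.cong refl additive_on_Sum_any[OF vacuum_value_additive_on one_label] ts fin; assumption)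
  also have "\<dots> = (\<Sum>q\<in>set cs. Sum_any (\<lambda>m. (of_int n gchoose m) * vacuum_value (?v q m)))"
    by (intro sum.cong refl arg_cong[of _ _ Sum_any] ext vacuum_value_scale vs; assumption)
  finally show ?thesis by (simp only: eq_neg_iff_add_eq_0)
qed

text \<open>
  For \<open>0 \<le> l \<le> 2\<close> the mode kills the vacuum on both sides, so the
  commutator terms alone sum to zero: these are the Ward identities of \<open>L(-1)\<close>,
  \<open>L(0)\<close> and \<open>L(1)\<close>.
\<close>
lemma global_ward:
  assumes \<sigma>: "states \<sigma>" and l: "l \<le> 2"
  shows "(\<Sum>q\<in>set ps. Sum_any (\<lambda>m. (of_nat l gchoose m) *
     corr (hit q (int m) \<sigma>) (e(q := e q - of_nat l + of_nat m)))) = 0"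
proof -
  have "vacuum_value (apply_ops op \<sigma> e ps (om one (int l) vac)) = 0"
  proof -
    have "apply_ops op \<sigma> e ps 0 = 0"
      by (rule additive_on_0[OF apply_ops_additive_on[OF ch] zero_space[OF one_label]]) (use \<sigma> in \<open>simp add: states_def\<close>)
    then show ?thesis using additive_on_0[OF vacuum_value_additive_on zero_space[OF one_label]] by (simp only: vac_om_nonneg)
  qed
  then show ?thesis
    using vacuum_value_commutator[OF ch dist _ vac_space, of \<sigma> "int l" e] \<sigma> l
    by (simp add: states_def corr_def)
qed

text \<open>
  By the iterate formula the mode \<open>\<omega>\<close> with index \<open>-r-1\<close> at
  \<open>p\<close> is a sum of modes placed directly to the left and directly to the right of
  the operator at \<open>p\<close>. The left ones are moved to the vacuum on the left, the right
  ones to the vacuum on the right, and both vacua are annihilated. The commutator terms at the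
  points on the left form the expansion of the kernel for \<open>|q| > |p|\<close>, those at the
  points on the right the expansion for \<open>|p| > |q|\<close>; thus the order of the
  operators selects the expansion of \<open>1/(p - q)\<close>.
\<close>
lemma local_ward:
  assumes h: "homog \<sigma> wt" and p: "p \<in> set ps"
  shows "corr (hit p (- int r - 1) \<sigma>) e =
    (\<Sum>q\<in>set ps - {p}. Sum_any (\<lambda>m. (pole_deriv p q r m \<star> corr (hit q (int m) \<sigma>)) e))"
proof -
  note \<sigma> = homog_states[OF h]
  from p obtain as bs where ps: "ps = as @ p # bs" by (blast dest: split_list)
  obtain \<gamma> where \<gamma>: "chain D op lab src as one \<gamma>" "chain D op lab src bs (src p) one"
    "lab p \<in> labels D" "src p \<in> labels D" "\<gamma> \<in> labels D" "op p \<in> intertwiner_space D (lab p) (src p) \<gamma>"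
    using ch ps by (auto simp: chain_append)
  note I = \<gamma>(6,3,4,5)
  have d: "distinct as" "distinct bs" "p \<notin> set as" "p \<notin> set bs" "set as \<inter> set bs = {}"
    using dist ps by auto
  have sas: "\<sigma> q \<in> space D (lab q)" if "q \<in> set ps" for q using \<sigma> that by (simp add: states_def)
  have op: "outer q p" if "q \<in> set as" for q using sorted ps that by (auto simp: sorted_wrt_append)
  have po: "outer p q" if "q \<in> set bs" for q using sorted ps that by (auto simp: sorted_wrt_append)
  have corr_ps: "corr \<tau> e' = vacuum_value (apply_ops op \<tau> e' as (apply_ops op \<tau> e' (p # bs) vac))" for \<tau> e'
    unfolding corr_def by (simp only: ps apply_ops_append)
  let ?k = "- e p - 1"
  let ?u = "apply_ops op \<sigma> e bs vac"
  have u: "?u \<in> space D (src p)" by (rule apply_ops_space[OF \<gamma>(2) _ vac_space]) (use sas ps in auto)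
  let ?L = "\<lambda>i. om \<gamma> (- int r - 1 - int i) (op p (\<sigma> p) (?k + of_nat i) ?u)"
  let ?R = "\<lambda>i. op p (\<sigma> p) (?k - of_nat r - 1 - of_nat i) (om (src p) (int i) ?u)"
  let ?A = "apply_ops op \<sigma> e as"
  define K where "K i = (of_nat (r + i) gchoose r :: complex)" for i
  have sp: "\<sigma> p \<in> space D (lab p)" using sas p by simp
  have finL: "finite {i. ?L i \<noteq> 0}" and finR: "finite {i. ?R i \<noteq> 0}"
    using iterate_finite[OF I sp u] by blast+
  have Ls: "?L i \<in> space D \<gamma>" for i by (intro om_space[OF \<gamma>(5)] int_closed[OF I sp u])
  have Rs: "?R i \<in> space D \<gamma>" for i by (intro int_closed[OF I sp] om_space[OF \<gamma>(4)] u)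
  have A: "additive_on (space D \<gamma>) ?A" by (rule apply_ops_additive_on[OF \<gamma>(1)]) (use sas ps in auto)
  have As: "x \<in> space D \<gamma> \<Longrightarrow> ?A x \<in> space D one" for x
    by (rule apply_ops_space[OF \<gamma>(1)]) (use sas ps in auto)
  have Asc: "x \<in> space D \<gamma> \<Longrightarrow> ?A (sc c x) = sc c (?A x)" for x c
    by (rule apply_ops_scale[OF \<gamma>(1)]) (use sas ps in auto)
  have vA: "additive_on (space D \<gamma>) (\<lambda>x. vacuum_value (?A x))"
    using A As vacuum_value_additive_on unfolding additive_on_def by metis
  have vAs: "x \<in> space D \<gamma> \<Longrightarrow> vacuum_value (?A (sc c x)) = c * vacuum_value (?A x)" for x c
    by (simp add: Asc vacuum_value_scale As)
  have vA0: "vacuum_value (?A 0) = 0" by (rule additive_on_0[OF vA zero_space[OF \<gamma>(5)]])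
  \<comment> \<open>The iterate formula, with the binomial coefficients \<open>K i\<close> brought to the form in which they occur in the pole.\<close>
  have "corr (hit p (- int r - 1) \<sigma>) e = vacuum_value (?A (op p (om (lab p) (- int r - 1) (\<sigma> p)) ?k ?u))"
    using d by (simp add: corr_ps)
  also have "op p (om (lab p) (- int r - 1) (\<sigma> p)) ?k ?u = Sum_any (\<lambda>i. sc (K i) (?L i + sc ((- 1) ^ r) (?R i)))"
    unfolding K_def by (subst iterate[OF I sp u]) (simp only: gchoose_signs)
  also have "vacuum_value (?A \<dots>) = Sum_any (\<lambda>i. vacuum_value (?A (sc (K i) (?L i + sc ((- 1) ^ r) (?R i)))))"
  proof (rule additive_on_Sum_any[OF vA \<gamma>(5)])
    show "finite {i. sc (K i) (?L i + sc ((- 1) ^ r) (?R i)) \<noteq> 0}"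
      by (rule finite_subset[OF _ finite_UnI[OF finL finR]]) auto
  qed (intro scale_space add_space Ls Rs \<gamma>(5))
  also have "\<dots> = Sum_any (\<lambda>i. K i * (vacuum_value (?A (?L i)) + (- 1) ^ r * vacuum_value (?A (?R i))))"
  proof (intro arg_cong[of _ _ Sum_any] ext)
    fix i
    have "vacuum_value (?A (?L i + sc ((- 1) ^ r) (?R i))) = vacuum_value (?A (?L i)) + vacuum_value (?A (sc ((- 1) ^ r) (?R i)))"
      using vA Ls[of i] scale_space[OF \<gamma>(5) Rs[of i]] unfolding additive_on_def by blast
    then show "vacuum_value (?A (sc (K i) (?L i + sc ((- 1) ^ r) (?R i)))) = K i * (vacuum_value (?A (?L i)) + (- 1) ^ r * vacuum_value (?A (?R i)))"
      using vAs[OF add_space[OF \<gamma>(5) Ls scale_space[OF \<gamma>(5) Rs]]] vAs[OF Rs] by simp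
  qed
  finally have 1: "corr (hit p (- int r - 1) \<sigma>) e = Sum_any (\<lambda>i. K i * (vacuum_value (?A (?L i)) + (- 1) ^ r * vacuum_value (?A (?R i))))" .
  \<comment> \<open>The modes on the left of \<open>p\<close> have index at most \<open>-1\<close> and move to the left vacuum.\<close>
  let ?a = "\<lambda>q i m. ((- 1 - of_nat r - of_nat i) gchoose m) *
      corr (hit q (int m) \<sigma>) (e(p := e p - of_nat i, q := e q + 1 + of_nat r + of_nat i + of_nat m))"
  have left: "vacuum_value (?A (?L i)) = - (\<Sum>q\<in>set as. Sum_any (?a q i))" for i
  proof -
    have "vacuum_value (?A (?L i)) = - (\<Sum>q\<in>set as. Sum_any (\<lambda>m. (of_int (- int r - 1 - int i) gchoose m) *
       vacuum_value (apply_ops op (hit q (int m) \<sigma>) (e(q := e q - of_int (- int r - 1 - int i) + of_nat m)) as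
         (op p (\<sigma> p) (?k + of_nat i) ?u))))"
      by (rule vacuum_value_commutator[OF \<gamma>(1) d(1)]) (use sas ps int_closed[OF I sp u] in auto)
    also have "\<dots> = - (\<Sum>q\<in>set as. Sum_any (?a q i))"
    proof (intro arg_cong[of _ _ uminus] sum.cong refl arg_cong[of _ _ Sum_any] ext)
      fix q m assume q: "q \<in> set as"
      let ?e = "e(p := e p - of_nat i, q := e q + 1 + of_nat r + of_nat i + of_nat m)"
      have "q \<noteq> p" "q \<notin> set bs" using q d by auto
      then have "apply_ops op (hit q (int m) \<sigma>) ?e (p # bs) vac = op p (\<sigma> p) (- (e p - of_nat i) - 1) ?u"
        using d by (simp only: apply_ops_Cons apply_ops_upd fun_upd_same fun_upd_other not_sym not_False_eq_True simp_thms)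
      moreover have "apply_ops op (hit q (int m) \<sigma>) ?e as x
          = apply_ops op (hit q (int m) \<sigma>) (e(q := e q - of_int (- int r - 1 - int i) + of_nat m)) as x" for x
        by (rule apply_ops_cong) (use d in \<open>auto simp: algebra_simps\<close>)
      moreover have "?k + of_nat i = - (e p - of_nat i) - 1" by simp
      moreover have "(of_int (- int r - 1 - int i) gchoose m) = ((- 1 - of_nat r - of_nat i :: complex) gchoose m)"
        by (rule arg_cong[of _ _ "\<lambda>x. x gchoose m"]) simp
      ultimately show "(of_int (- int r - 1 - int i) gchoose m) *
        vacuum_value (apply_ops op (hit q (int m) \<sigma>) (e(q := e q - of_int (- int r - 1 - int i) + of_nat m)) as
         (op p (\<sigma> p) (?k + of_nat i) ?u)) = ?a q i m"
        by (simp only: corr_ps)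
    qed
    finally show ?thesis .
  qed
  \<comment> \<open>The modes on the right of \<open>p\<close> are non-negative and move to the right vacuum.\<close>
  let ?b = "\<lambda>q i m. (of_nat i gchoose m) *
      corr (hit q (int m) \<sigma>) (e(p := e p + 1 + of_nat i + of_nat r, q := e q - of_nat i + of_nat m))"
  have right: "vacuum_value (?A (?R i)) = (\<Sum>q\<in>set bs. Sum_any (?b q i))" for i
  proof -
    let ?T = "\<lambda>x. vacuum_value (?A (op p (\<sigma> p) (?k - of_nat r - 1 - of_nat i) x))"
    let ?v = "\<lambda>q m. apply_ops op (hit q (int m) \<sigma>) (e(q := e q - of_int (int i) + of_nat m)) bs vac"
    let ?t = "\<lambda>q m. sc (of_int (int i) gchoose m) (?v q m)"
    have T: "additive_on (space D (src p)) ?T"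
      using vA int_additive_on2[OF I sp] int_closed[OF I sp] unfolding additive_on_def by metis
    have Ts: "?T (sc c x) = c * ?T x" if "x \<in> space D (src p)" for c x
      using int_scale2[OF I sp that] vAs[OF int_closed[OF I sp that]] by simp
    have vs: "apply_ops op (hit q (int m) \<sigma>) e' bs vac \<in> space D (src p)" if "q \<in> set bs" for q m e'
    proof -
      have "om (lab q) (int m) (\<sigma> q) \<in> space D (lab q)"
        by (rule om_space[OF lab_label sas]) (use that ps in auto)
      then show ?thesis
        by (intro apply_ops_space[OF \<gamma>(2) _ vac_space]) (use that sas ps in auto)
    qed
    have ts: "?t q m \<in> space D (src p)" if "q \<in> set bs" for q m
      by (rule scale_space[OF \<gamma>(4) vs[OF that]])
    have fin: "finite {m. ?t q m \<noteq> 0}" if q: "q \<in> set bs" for q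
    proof (rule finite_subset[OF _ om_trunc[OF lab_label sas, of q]])
      have "apply_ops op (\<sigma>(q := 0)) e' bs vac = 0" for e'
        by (rule additive_on_0[OF apply_ops_state_add[OF \<gamma>(2) d(2) _ vac_space q] zero_space[OF lab_label]])
           (use sas q ps in auto)
      then show "{m. ?t q m \<noteq> 0} \<subseteq> {i. om (lab q) (int i) (\<sigma> q) \<noteq> 0}" by fastforce
    qed (use q ps in auto)
    have "apply_ops op \<sigma> e bs (om one (int i) vac) = 0"
      unfolding vac_om_nonneg
      by (rule additive_on_0[OF apply_ops_additive_on[OF \<gamma>(2)] zero_space[OF one_label]]) (use sas ps in auto)
    moreover have "om (src p) (int i) ?u = apply_ops op \<sigma> e bs (om one (int i) vac) + (\<Sum>q\<in>set bs. Sum_any (?t q))"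
      by (rule apply_ops_commutator[OF \<gamma>(2) d(2) _ vac_space]) (use sas ps in auto)
    ultimately have "om (src p) (int i) ?u = (\<Sum>q\<in>set bs. Sum_any (?t q))" by simp
    then have "vacuum_value (?A (?R i)) = ?T (\<Sum>q\<in>set bs. Sum_any (?t q))" by simp
    also have "\<dots> = (\<Sum>q\<in>set bs. ?T (Sum_any (?t q)))"
      by (rule additive_on_sum[OF T \<gamma>(4)]) (intro Sum_any_space[OF \<gamma>(4)] ts; assumption)
    also have "\<dots> = (\<Sum>q\<in>set bs. Sum_any (\<lambda>m. ?T (?t q m)))"
      by (intro sum.cong refl additive_on_Sum_any[OF T \<gamma>(4)] ts fin; assumption)
    also have "\<dots> = (\<Sum>q\<in>set bs. Sum_any (?b q i))"
    proof (intro sum.cong refl arg_cong[of _ _ Sum_any] ext)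
      fix q m assume q: "q \<in> set bs"
      let ?e = "e(p := e p + 1 + of_nat i + of_nat r, q := e q - of_nat i + of_nat m)"
      have qp: "q \<noteq> p" "q \<notin> set as" using q d by auto
      have "apply_ops op (hit q (int m) \<sigma>) ?e as x = ?A x" for x
        using qp d by simp
      moreover have "apply_ops op (hit q (int m) \<sigma>) ?e bs vac = ?v q m"
        by (rule apply_ops_cong) (use d in auto)
      moreover have "?k - of_nat r - 1 - of_nat i = - (e p + 1 + of_nat i + of_nat r) - 1" by simp
      ultimately have "corr (hit q (int m) \<sigma>) ?e = ?T (?v q m)"
        using qp by (simp only: corr_ps apply_ops_Cons fun_upd_other fun_upd_same not_sym simp_thms)
      then show "?T (?t q m) = ?b q i m" using Ts[OF vs[OF q]] by simp
    qed
    finally show ?thesis .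
  qed
  \<comment> \<open>The mode index \<open>m\<close> is bounded by truncation. The index \<open>i\<close> is bounded because it lowers the weight of an intermediate state: the one after \<open>q\<close> if \<open>q\<close> is on the left, the one after \<open>p\<close> otherwise.\<close>
  have fa: "finite {(i, m). ?a q i m \<noteq> 0}" if q: "q \<in> set as" for q
  proof -
    have qps: "q \<in> set ps" using q ps by simp
    from q obtain a1 a2 where as: "as = a1 @ q # a2" by (blast dest: split_list)
    have psa: "ps = (a1 @ [q]) @ a2 @ p # bs" using ps as by simp
    obtain c where c: "\<And>\<sigma> wt e. homog \<sigma> wt \<Longrightarrow> corr \<sigma> e \<noteq> 0 \<Longrightarrow> (\<exists>n::nat. - (\<Sum>p\<in>set (a1 @ [q]). wt p + e p) = c + of_nat n)"
      using corr_prefix[OF psa] by blast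
    have d': "q \<notin> set a1" "p \<notin> set a1" "q \<noteq> p" using d as by auto
    let ?Z = "- (\<Sum>p\<in>set a1. wt p + e p) - (wt q + e q) - 2 - of_nat r - c"
    have "\<exists>n::nat. ?Z - of_nat i = of_nat n" if "?a q i m \<noteq> 0" for i m
    proof -
      let ?e = "e(p := e p - of_nat i, q := e q + 1 + of_nat r + of_nat i + of_nat m)"
      let ?wt = "wt(q := wt q - of_int (int m) + 1)"
      have nz: "corr (hit q (int m) \<sigma>) ?e \<noteq> 0" using that by auto
      obtain n :: nat where n: "- (\<Sum>p\<in>set (a1 @ [q]). ?wt p + ?e p) = c + of_nat n"
        using c[OF hit_homog[OF h, of q "int m"] nz] by blast
      have "(\<Sum>p\<in>set a1. ?wt p + ?e p) = (\<Sum>p\<in>set a1. wt p + e p)"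
        by (rule sum.cong) (use d' in auto)
      moreover have "(\<Sum>p\<in>set (a1 @ [q]). ?wt p + ?e p) = (?wt q + ?e q) + (\<Sum>p\<in>set a1. ?wt p + ?e p)"
        using d' by (simp only: set_append list.set Un_insert_right Un_empty_right sum.insert[OF finite_set d'(1)])
      ultimately have "- ((?wt q + ?e q) + (\<Sum>p\<in>set a1. wt p + e p)) = c + of_nat n" using n by (simp only:)
      then have c': "c = - ((?wt q + ?e q) + (\<Sum>p\<in>set a1. wt p + e p)) - of_nat n" by (simp only: eq_diff_eq)
      show ?thesis by (intro exI[of _ n], subst c') (simp add: algebra_simps)
    qed
    note bound = this
    have "{(i, m). ?a q i m \<noteq> 0} \<subseteq> {i. \<exists>n::nat. ?Z - of_nat i = of_nat n} \<times> {m. \<exists>e. corr (hit q (int m) \<sigma>) e \<noteq> 0}"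
    proof (rule subrelI)
      fix i m assume "(i, m) \<in> {(i, m). ?a q i m \<noteq> 0}"
      then have nz: "?a q i m \<noteq> 0" by blast
      then have "\<exists>e. corr (hit q (int m) \<sigma>) e \<noteq> 0" by (metis mult_zero_right)
      then show "(i, m) \<in> {i. \<exists>n::nat. ?Z - of_nat i = of_nat n} \<times> {m. \<exists>e. corr (hit q (int m) \<sigma>) e \<noteq> 0}"
        using bound[OF nz] by (intro SigmaI CollectI)
    qed
    then show ?thesis
      by (rule finite_subset) (rule finite_cartesian_product[OF finite_nat_below hit_finite[OF \<sigma> qps]])
  qed
  have fb: "finite {(i, m). ?b q i m \<noteq> 0}" if q: "q \<in> set bs" for q
  proof -
    have qps: "q \<in> set ps" using q ps by simp
    have psa: "ps = (as @ [p]) @ bs" using ps by simp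
    obtain c where c: "\<And>\<sigma> wt e. homog \<sigma> wt \<Longrightarrow> corr \<sigma> e \<noteq> 0 \<Longrightarrow> (\<exists>n::nat. - (\<Sum>p\<in>set (as @ [p]). wt p + e p) = c + of_nat n)"
      using corr_prefix[OF psa] by blast
    have d': "q \<notin> set as" "p \<notin> set as" "q \<noteq> p" using d q by auto
    let ?Z = "- (\<Sum>p\<in>set as. wt p + e p) - (wt p + e p) - 1 - of_nat r - c"
    have "\<exists>n::nat. ?Z - of_nat i = of_nat n" if "?b q i m \<noteq> 0" for i m
    proof -
      let ?e = "e(p := e p + 1 + of_nat i + of_nat r, q := e q - of_nat i + of_nat m)"
      let ?wt = "wt(q := wt q - of_int (int m) + 1)"
      have nz: "corr (hit q (int m) \<sigma>) ?e \<noteq> 0" using that by auto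
      obtain n :: nat where n: "- (\<Sum>p\<in>set (as @ [p]). ?wt p + ?e p) = c + of_nat n"
        using c[OF hit_homog[OF h, of q "int m"] nz] by blast
      have "(\<Sum>p\<in>set as. ?wt p + ?e p) = (\<Sum>p\<in>set as. wt p + e p)"
        by (rule sum.cong) (use d' in auto)
      moreover have "(\<Sum>p\<in>set (as @ [p]). ?wt p + ?e p) = (?wt p + ?e p) + (\<Sum>p\<in>set as. ?wt p + ?e p)"
        using d' by (simp only: set_append list.set Un_insert_right Un_empty_right sum.insert[OF finite_set d'(2)])
      ultimately have "- ((?wt p + ?e p) + (\<Sum>p\<in>set as. wt p + e p)) = c + of_nat n" using n by (simp only:)
      then have c': "c = - ((?wt p + ?e p) + (\<Sum>p\<in>set as. wt p + e p)) - of_nat n" by (simp only: eq_diff_eq)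
      show ?thesis using d'(3) by (intro exI[of _ n], subst c') (simp add: algebra_simps)
    qed
    note bound = this
    have "{(i, m). ?b q i m \<noteq> 0} \<subseteq> {i. \<exists>n::nat. ?Z - of_nat i = of_nat n} \<times> {m. \<exists>e. corr (hit q (int m) \<sigma>) e \<noteq> 0}"
    proof (rule subrelI)
      fix i m assume "(i, m) \<in> {(i, m). ?b q i m \<noteq> 0}"
      then have nz: "?b q i m \<noteq> 0" by blast
      then have "\<exists>e. corr (hit q (int m) \<sigma>) e \<noteq> 0" by (metis mult_zero_right)
      then show "(i, m) \<in> {i. \<exists>n::nat. ?Z - of_nat i = of_nat n} \<times> {m. \<exists>e. corr (hit q (int m) \<sigma>) e \<noteq> 0}"
        using bound[OF nz] by (intro SigmaI CollectI)
    qed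
    then show ?thesis
      by (rule finite_subset) (rule finite_cartesian_product[OF finite_nat_below hit_finite[OF \<sigma> qps]])
  qed
  \<comment> \<open>Exchange of the sums over \<open>i\<close>, \<open>q\<close> and \<open>m\<close>; the sum over \<open>i\<close> is then the expansion of the pole.\<close>
  define t where "t q i m = (if q \<in> set as then - (K i * ?a q i m) else ((- 1) ^ r * K i) * ?b q i m)" for q i m
  have ft: "finite {(i, m). t q i m \<noteq> 0}" if "q \<in> set ps - {p}" for q
  proof (cases "q \<in> set as")
    case True
    show ?thesis by (rule finite_subset[OF _ fa[OF True]]) (use True in \<open>auto simp: t_def\<close>)
  next
    case False
    then have "q \<in> set bs" using that ps by auto
    then show ?thesis by (intro finite_subset[OF _ fb]) (use False in \<open>auto simp: t_def\<close>)
  qed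
  have set_ps: "set ps - {p} = set as \<union> set bs" using ps d by auto
  have "K i * (vacuum_value (?A (?L i)) + (- 1) ^ r * vacuum_value (?A (?R i))) = (\<Sum>q\<in>set ps - {p}. Sum_any (t q i))" for i
  proof -
    have "(\<Sum>q\<in>set as. Sum_any (t q i)) = - K i * (\<Sum>q\<in>set as. Sum_any (?a q i))"
      unfolding sum_distrib_left Sum_any_cmult[symmetric]
      by (intro sum.cong refl arg_cong[of _ _ Sum_any] ext) (simp add: t_def)
    moreover have "(\<Sum>q\<in>set bs. Sum_any (t q i)) = (- 1) ^ r * K i * (\<Sum>q\<in>set bs. Sum_any (?b q i))"
      unfolding sum_distrib_left Sum_any_cmult[symmetric]
      by (intro sum.cong refl arg_cong[of _ _ Sum_any] ext) (use d in \<open>auto simp: t_def\<close>)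
    moreover have "(\<Sum>q\<in>set ps - {p}. Sum_any (t q i)) = (\<Sum>q\<in>set as. Sum_any (t q i)) + (\<Sum>q\<in>set bs. Sum_any (t q i))"
      unfolding set_ps by (rule sum.union_disjoint) (use d in auto)
    moreover have "k * (- x + z * y) = - k * x + z * k * y" for k x y z :: complex
      by (simp add: algebra_simps)
    ultimately show ?thesis unfolding left right by (simp only:)
  qed
  then have "corr (hit p (- int r - 1) \<sigma>) e = Sum_any (\<lambda>i. \<Sum>q\<in>set ps - {p}. Sum_any (t q i))"
    using 1 by (simp only:)
  also have "\<dots> = (\<Sum>q\<in>set ps - {p}. Sum_any (\<lambda>i. Sum_any (t q i)))"
  proof (rule Sum_any_sum)
    fix q assume "q \<in> set ps - {p}"
    show "finite {i. Sum_any (t q i) \<noteq> 0}"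
      by (rule finite_subset[OF _ finite_imageI[OF ft[OF \<open>q \<in> set ps - {p}\<close>], of fst]])
         (force dest: Sum_any_nonzero simp: image_iff)
  qed simp
  also have "\<dots> = (\<Sum>q\<in>set ps - {p}. Sum_any (\<lambda>m. Sum_any (\<lambda>i. t q i m)))"
  proof (intro sum.cong refl)
    fix q assume q: "q \<in> set ps - {p}"
    show "Sum_any (\<lambda>i. Sum_any (t q i)) = Sum_any (\<lambda>m. Sum_any (\<lambda>i. t q i m))"
      by (rule Sum_any.swap[OF finite_cartesian_product[OF finite_imageI[OF ft[OF q], of fst] finite_imageI[OF ft[OF q], of snd]]])
         (force simp: image_iff)
  qed
  also have "\<dots> = (\<Sum>q\<in>set ps - {p}. Sum_any (\<lambda>m. (pole_deriv p q r m \<star> corr (hit q (int m) \<sigma>)) e))"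
  proof (intro sum.cong refl arg_cong[of _ _ Sum_any] ext)
    fix q m assume q: "q \<in> set ps - {p}"
    show "Sum_any (\<lambda>i. t q i m) = (pole_deriv p q r m \<star> corr (hit q (int m) \<sigma>)) e"
    proof (cases "q \<in> set as")
      case True
      show ?thesis unfolding pole_deriv_inner[OF op[OF True]]
        by (intro arg_cong[of _ _ Sum_any] ext) (simp only: t_def True if_True K_def mult.assoc)
    next
      case False
      then have "q \<in> set bs" using q ps by auto
      show ?thesis unfolding pole_deriv_outer[OF po[OF \<open>q \<in> set bs\<close>]]
        by (intro arg_cong[of _ _ Sum_any] ext) (simp only: t_def False if_False K_def gchoose_signs mult.assoc)
    qed
  qed
  finally show ?thesis .
qed

end

section \<open>Insertion points and states at genus g\<close>

definition handles :: "nat list \<Rightarrow> fvar list" where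
  "handles as = concat (map (\<lambda>a. [Wv (int a), Wv (- int a)]) as)"

text \<open>
  The points in operator order. The position \<open>Xv\<close> belongs to the list also for the
  form without insertion at \<open>x\<close>, and then carries the vacuum.
\<close>
definition positions :: "nat \<Rightarrow> nat \<Rightarrow> fvar list" where
  "positions n g = Xv # map Yv [1..<Suc n] @ handles [1..<Suc g]"

lemma set_handles: "set (handles [1..<Suc g]) = Wv ` idx g"
proof -
  have "x \<in> Wv ` idx g \<longleftrightarrow> (\<exists>a\<in>{1..g}. x = Wv (int a) \<or> x = Wv (- int a))" for x
  proof
    assume "x \<in> Wv ` idx g"
    then obtain a where a: "x = Wv a" "a \<noteq> 0" "\<bar>a\<bar> \<le> int g" by (auto simp: idx_def)
    then show "\<exists>a\<in>{1..g}. x = Wv (int a) \<or> x = Wv (- int a)"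
      by (intro bexI[of _ "nat \<bar>a\<bar>"]) auto
  qed (auto simp: idx_def)
  then have "Wv ` idx g = {x. \<exists>a\<in>{1..<Suc g}. x = Wv (int a) \<or> x = Wv (- int a)}"
    by (auto simp: atLeastLessThanSuc_atLeastAtMost)
  also have "\<dots> = set (handles [1..<Suc g])"
    by (auto simp: handles_def simp del: upt_Suc One_nat_def)
  finally show ?thesis ..
qed

lemma set_positions: "set (positions n g) = insert Xv (Yv ` {1..n} \<union> Wv ` idx g)"
  by (simp add: positions_def set_handles atLeastLessThanSuc_atLeastAtMost del: upt_Suc One_nat_def)

lemma finite_idx: "finite (idx g)"
  by (rule finite_subset[of _ "{- int g..int g}"]) (auto simp: idx_def)

lemma sorted_handles: "sorted_wrt outer (handles [k..<Suc g])" if "k \<ge> 1"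
  using that
proof (induction "Suc g - k" arbitrary: k)
  case (Suc x)
  then have k: "[k..<Suc g] = k # [Suc k..<Suc g]" by (simp add: upt_conv_Cons del: upt_Suc)
  have "sorted_wrt outer (handles [Suc k..<Suc g])" using Suc by simp
  moreover have "outer (Wv (int k)) y \<and> outer (Wv (- int k)) y" if "y \<in> set (handles [Suc k..<Suc g])" for y
    using that Suc.prems by (auto simp: handles_def outer_def simp del: upt_Suc)
  moreover have "handles [k..<Suc g] = Wv (int k) # Wv (- int k) # handles [Suc k..<Suc g]"
    by (simp add: k handles_def del: upt_Suc)
  moreover have "outer (Wv (int k)) (Wv (- int k))" using Suc.prems by (simp add: outer_def)
  ultimately show ?case by simp
qed (simp add: handles_def)

lemma sorted_positions: "sorted_wrt outer (positions n g)"
proof -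
  have "sorted_wrt outer (map Yv [1..<Suc n])"
    by (simp add: sorted_wrt_map outer_def sorted_wrt_upt del: upt_Suc)
  moreover have "outer x y" if "x = Xv \<or> x \<in> range Yv" "y \<in> set (handles [1..<Suc g])" for x y
    using that unfolding set_handles by (auto simp: outer_def)
  moreover have "outer Xv y" if "y \<in> range Yv" for y using that by (auto simp: outer_def)
  ultimately show ?thesis
    using sorted_handles[of 1 g] by (auto simp: positions_def sorted_wrt_append simp del: upt_Suc One_nat_def)
qed

lemma distinct_positions: "distinct (positions n g)"
proof -
  have "sorted_wrt outer xs \<Longrightarrow> distinct xs" for xs
    by (induction xs) (auto simp: outer_def)
  then show ?thesis using sorted_positions by blast
qed

text \<open>
  Identifies the sets on which heights are measured with the initial segments of the product.
\<close>
lemma outer_closed_prefix: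
  assumes "sorted_wrt outer ps" "U \<subseteq> set ps" "\<forall>p\<in>U. \<forall>q\<in>set ps. outer q p \<longrightarrow> q \<in> U"
  shows "\<exists>as bs. ps = as @ bs \<and> set as = U"
proof (intro exI conjI)
  let ?as = "takeWhile (\<lambda>p. p \<in> U) ps" and ?bs = "dropWhile (\<lambda>p. p \<in> U) ps"
  show ps: "ps = ?as @ ?bs" by simp
  have "p \<notin> U" if p: "p \<in> set ?bs" for p
  proof (cases ?bs)
    case (Cons x xs)
    have "x \<in> set ?bs" by (simp add: Cons)
    then have x: "x \<notin> U" "x \<in> set ps" using hd_dropWhile[of "\<lambda>p. p \<in> U" ps] Cons set_dropWhileD[of x "\<lambda>p. p \<in> U" ps] by auto
    show ?thesis
    proof (cases "p = x")
      case False
      have "sorted_wrt outer (?as @ ?bs)" using assms(1) ps by (simp only:)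
      then have "sorted_wrt outer (x # xs)" unfolding Cons sorted_wrt_append by blast
      moreover have "p \<in> set xs" using p False unfolding Cons by simp
      ultimately have "outer x p" by simp
      then show ?thesis using assms(3) x by blast
    qed (use x in simp)
  next
    case Nil
    show ?thesis using p unfolding Nil by simp
  qed
  moreover have "set ps = set ?as \<union> set ?bs" unfolding set_append[symmetric] by simp
  ultimately have "U \<subseteq> set ?as" using assms(2) by blast
  moreover have "set ?as \<subseteq> U" using set_takeWhileD[of _ "\<lambda>p. p \<in> U" ps] by blast
  ultimately show "set ?as = U" by (rule equalityI[rotated])
qed

locale genus_data = voa_data D for D :: "('i, 'a::ab_group_add) voa_family" +
  fixes n g :: nat and \<alpha> \<beta> :: "nat \<Rightarrow> 'i" and B :: "nat \<Rightarrow> 'a set" and B' :: "nat \<Rightarrow> 'a \<Rightarrow> 'a"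
  assumes g: "g \<ge> 1"
    and \<alpha>: "\<And>a. a \<in> {1..g} \<Longrightarrow> \<alpha> a \<in> labels D"
    and \<beta>: "\<And>k. k \<in> {1..2 * g - 1} \<Longrightarrow> \<beta> k \<in> labels D"
    and bases: "\<And>a. a \<in> {1..g} \<Longrightarrow> dual_homogeneous_bases D (\<alpha> a) (B a) (B' a)"
begin

text \<open>
  The sequence of intermediate modules, closed by the vacuum module at both ends.
\<close>
definition mid_label :: "nat \<Rightarrow> 'i" where "mid_label k = (if k = 0 \<or> k = 2 * g then one else \<beta> k)"

definition state_label :: "fvar \<Rightarrow> 'i" where
  "state_label p = (case p of Wv a \<Rightarrow> if a > 0 then \<alpha> (nat a) else contra D (\<alpha> (nat (- a))) | _ \<Rightarrow> one)"

text \<open>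
  The module on which the operator at a point acts. Pairs of operators at the handle
  \<open>a\<close> lead through the modules with indices \<open>2a - 2, 2a - 1, 2a\<close>.
\<close>
definition source_label :: "fvar \<Rightarrow> 'i" where
  "source_label p = (case p of Wv a \<Rightarrow> if a > 0 then mid_label (2 * nat a - 1) else mid_label (2 * nat (- a)) | _ \<Rightarrow> one)"

definition insertion_op :: "fvar \<Rightarrow> 'a modes" where
  "insertion_op p = (case p of Wv a \<Rightarrow>
      if a > 0 then iop D (\<alpha> (nat a)) (mid_label (2 * nat a - 1)) (mid_label (2 * nat a - 2))
      else iop D (contra D (\<alpha> (nat (- a)))) (mid_label (2 * nat (- a))) (mid_label (2 * nat (- a) - 1))
    | _ \<Rightarrow> vop D one)"

lemma mid_label_label: "k \<le> 2 * g \<Longrightarrow> mid_label k \<in> labels D"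
  using one_label \<beta>[of k] by (auto simp: mid_label_def)

lemma chain_handles: "1 \<le> k \<Longrightarrow> k \<le> Suc g \<Longrightarrow> chain D insertion_op state_label source_label (handles [k..<Suc g]) (mid_label (2 * k - 2)) one"
proof (induction "Suc g - k" arbitrary: k)
  case 0
  then have "k = Suc g" by simp
  then show ?case using one_label by (simp add: handles_def mid_label_def)
next
  case (Suc x)
  then have k: "k \<le> g" "[k..<Suc g] = k # [Suc k..<Suc g]" by (auto simp: upt_conv_Cons simp del: upt_Suc)
  have IH: "chain D insertion_op state_label source_label (handles [Suc k..<Suc g]) (mid_label (2 * Suc k - 2)) one"
    by (rule Suc.hyps(1)) (use Suc k in auto)
  have h: "handles [k..<Suc g] = Wv (int k) # Wv (- int k) # handles [Suc k..<Suc g]"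
    by (simp add: k(2) handles_def del: upt_Suc)
  have l: "\<alpha> k \<in> labels D" "contra D (\<alpha> k) \<in> labels D" "mid_label (2 * k - 2) \<in> labels D" "mid_label (2 * k - 1) \<in> labels D"
    "mid_label (2 * k) \<in> labels D" using \<alpha>[of k] contra_label mid_label_label k(1) Suc.prems by auto
  have "\<not> int k < 0" "0 < int k" using Suc.prems by auto
  then show ?case unfolding h using IH l
    by (simp add: insertion_op_def state_label_def source_label_def iop_int)
qed

lemma chain_positions: "chain D insertion_op state_label source_label (positions n g) one one"
proof -
  have "chain D insertion_op state_label source_label (map Yv ks @ handles [1..<Suc g]) one one" for ks
  proof (induction ks)
    case Nil
    show ?case using chain_handles[of 1] by (simp add: mid_label_def)
  next
    case (Cons k ks)
    then show ?case using vop_int[OF one_label] one_label by (simp add: insertion_op_def state_label_def source_label_def)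
  qed
  then show ?thesis using vop_int[OF one_label] one_label by (simp add: positions_def insertion_op_def state_label_def source_label_def)
qed

sublocale correlator D insertion_op state_label source_label "positions n g"
  by unfold_locales (rule chain_positions distinct_positions sorted_positions)+

definition inserted :: "(nat \<Rightarrow> 'a) \<Rightarrow> fvar \<Rightarrow> 'a" where
  "inserted b p = (case p of Yv k \<Rightarrow> conformal D
    | Wv a \<Rightarrow> if a > 0 then b (nat a) else B' (nat (- a)) (b (nat (- a))) | _ \<Rightarrow> vac)"

text \<open>
  At a handle the weight of the state is the exponent of \<open>\<rho>\<^sub>a\<close>, because
  \<open>b\<^sub>-\<^sub>a\<close> contains the factor \<open>\<rho>\<^sub>a\<close> to the
  power of the weight.
\<close>
definition inserted_weight :: "(fvar \<Rightarrow> complex) \<Rightarrow> fvar \<Rightarrow> complex" where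
  "inserted_weight e p = (case p of Yv k \<Rightarrow> 2 | Wv a \<Rightarrow> e (Rv \<bar>a\<bar>) | _ \<Rightarrow> 0)"

text \<open>
  A fixed exponent of \<open>\<rho>\<^sub>a\<close> fixes the weight of the basis vector, so
  each coefficient of the form is a finite sum.
\<close>
definition basis_choices :: "(fvar \<Rightarrow> complex) \<Rightarrow> (nat \<Rightarrow> 'a) set" where
  "basis_choices e = PiE {1..g} (\<lambda>a. B a \<inter> wp (\<alpha> a) (e (Rv (int a))))"

abbreviation P :: "fvar set" where "P \<equiv> set (positions n g)"
abbreviation R :: "fvar set" where "R \<equiv> Rv ` {1..int g}"

text \<open>
  Only the points and the variables \<open>\<rho>\<^sub>a\<close> may occur in a monomial;
  without this condition a coefficient would not see the exponents of foreign variables.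
\<close>
definition admissible :: "(fvar \<Rightarrow> complex) \<Rightarrow> bool" where
  "admissible e \<longleftrightarrow> (\<forall>p. p \<notin> P \<union> R \<longrightarrow> e p = 0)"

text \<open>
  The form with \<open>\<omega>\<close> at \<open>y\<^sub>1, \<dots>, y\<^sub>n\<close> and the
  vacuum at \<open>x\<close>.
\<close>
definition base_series :: fseries where
  "base_series e = (if admissible e then \<Sum>b\<in>basis_choices e. corr (inserted b) e else 0)"

definition hit_series :: "fvar \<Rightarrow> int \<Rightarrow> fseries" where
  "hit_series p m e = (if admissible e then \<Sum>b\<in>basis_choices e. corr (hit p m (inserted b)) e else 0)"

sublocale variables P R
  by unfold_locales (auto simp: set_positions finite_idx)

section \<open>Traces over dual bases\<close>

context
  fixes a assumes a: "a \<in> {1..g}"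
begin

lemma base_facts:
  shows "B a \<subseteq> (\<Union>h. wp (\<alpha> a) h)" "\<not> VS.dependent (B a)" "VS.span (B a) = space D (\<alpha> a)"
    "b \<in> B a \<Longrightarrow> B' a b \<in> space D (contra D (\<alpha> a))"
    "b \<in> B a \<Longrightarrow> c \<in> B a \<Longrightarrow> pairing D (\<alpha> a) b (B' a c) = (if b = c then 1 else 0)"
  using bases[OF a] by (auto simp: dual_homogeneous_bases_def)

lemma base_space: "b \<in> B a \<Longrightarrow> b \<in> space D (\<alpha> a)"
  using base_facts(1) by (auto simp: wp_iff)

lemma base_finite: "finite (B a \<inter> wp (\<alpha> a) h)"
proof -
  have "\<exists>T. finite T \<and> wp (\<alpha> a) h = VS.span T"
    using module_hw[OF \<alpha>[OF a]] by (simp add: ordinary_module_def weight_part_def)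
  then obtain T where T: "finite T" "wp (\<alpha> a) h = VS.span T" by blast
  have "VS.independent (B a \<inter> wp (\<alpha> a) h)"
    using base_facts(2) VS.dependent_mono by blast
  then show ?thesis using VS.independent_span_bound[OF T(1)] T(2) by blast
qed

text \<open>
  The difference of the two sides pairs to zero with the basis, hence with the whole module, and
  the pairing is non-degenerate.
\<close>
lemma dual_expand:
  assumes "finite X" "X \<subseteq> B a" "\<And>b. b \<in> B a \<Longrightarrow> b \<notin> X \<Longrightarrow> pairing D (\<alpha> a) b u = 0"
    "u \<in> space D (contra D (\<alpha> a))"
  shows "u = (\<Sum>x\<in>X. sc (pairing D (\<alpha> a) x u) (B' a x))"
proof -
  note lab = \<alpha>[OF a] contra_label[OF \<alpha>[OF a]]
  let ?v = "\<Sum>x\<in>X. sc (pairing D (\<alpha> a) x u) (B' a x)"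
  have vs: "?v \<in> space D (contra D (\<alpha> a))"
    by (intro sum_space[OF lab(2)] scale_space[OF lab(2)] base_facts(4)) (use assms(2) in blast)
  have dv: "u - ?v \<in> space D (contra D (\<alpha> a))" by (rule diff_space[OF lab(2) assms(4) vs])
  have base: "pairing D (\<alpha> a) b (u - ?v) = 0" if b: "b \<in> B a" for b
  proof -
    have ao: "additive_on (space D (contra D (\<alpha> a))) (pairing D (\<alpha> a) b)"
      using pairing_facts(3)[OF lab(1) base_space[OF b]] by (simp add: additive_on_def)
    have "pairing D (\<alpha> a) b ?v = (\<Sum>x\<in>X. pairing D (\<alpha> a) b (sc (pairing D (\<alpha> a) x u) (B' a x)))"
      by (rule additive_on_sum[OF ao lab(2)]) (use assms(2) base_facts(4) scale_space[OF lab(2)] in blast)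
    also have "\<dots> = (\<Sum>x\<in>X. if x = b then pairing D (\<alpha> a) x u else 0)"
      using assms(2) base_facts(4,5) pairing_facts(4)[OF lab(1) base_space[OF b]] b
      by (intro sum.cong refl) (auto simp: subset_iff)
    also have "\<dots> = pairing D (\<alpha> a) b u" using assms(1) assms(3)[OF b] by auto
    finally show ?thesis using additive_on_diff[OF ao lab(2) assms(4) vs] by simp
  qed
  have "VS.subspace {x \<in> space D (\<alpha> a). pairing D (\<alpha> a) x (u - ?v) = 0}"
    by (rule VS.subspaceI)
       (use pairing_facts(1,2)[OF lab(1)] dv pairing_zero[OF lab(1) dv] zero_space add_space scale_space lab in auto)
  then have "VS.span (B a) \<subseteq> {x \<in> space D (\<alpha> a). pairing D (\<alpha> a) x (u - ?v) = 0}"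
    by (rule VS.span_minimal[rotated]) (use base base_space in auto)
  then have "pairing D (\<alpha> a) x (u - ?v) = 0" if "x \<in> space D (\<alpha> a)" for x
    using that base_facts(3) by auto
  then have "u - ?v = 0" by (rule pairing_facts(5)[OF lab(1) dv])
  then show ?thesis by simp
qed

lemma expand:
  assumes "finite X" "X \<subseteq> B a" "u \<in> VS.span X"
  shows "u = (\<Sum>x\<in>X. sc (pairing D (\<alpha> a) u (B' a x)) x)"
proof -
  note lab = \<alpha>[OF a] contra_label[OF \<alpha>[OF a]]
  obtain c where c: "u = (\<Sum>x\<in>X. sc (c x) x)" using assms(1,3) VS.span_finite by auto
  have "pairing D (\<alpha> a) u (B' a y) = c y" if y: "y \<in> X" for y
  proof -
    have By: "B' a y \<in> space D (contra D (\<alpha> a))" using base_facts(4) y assms(2) by blast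
    have ao: "additive_on (space D (\<alpha> a)) (\<lambda>u. pairing D (\<alpha> a) u (B' a y))"
      using pairing_facts(1)[OF lab(1) _ _ By] by (simp add: additive_on_def)
    have "pairing D (\<alpha> a) u (B' a y) = (\<Sum>x\<in>X. pairing D (\<alpha> a) (sc (c x) x) (B' a y))"
      unfolding c by (rule additive_on_sum[OF ao lab(1)]) (use assms(2) base_space scale_space[OF lab(1)] in blast)
    also have "\<dots> = (\<Sum>x\<in>X. if x = y then c x else 0)"
      using assms(2) base_facts(5) pairing_facts(2)[OF lab(1) base_space By] y
      by (intro sum.cong refl) (auto simp: subset_iff)
    finally show ?thesis using y assms(1) by simp
  qed
  then show ?thesis using c by simp
qed

text \<open>
  The components of a weight vector along basis vectors of other weights vanish by independence
  of the weight spaces.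
\<close>
lemma weight_span:
  assumes "u \<in> wp (\<alpha> a) h"
  shows "u \<in> VS.span (B a \<inter> wp (\<alpha> a) h)"
proof -
  note lab = \<alpha>[OF a]
  have "u \<in> VS.span (B a)" using assms base_facts(3) by (simp add: wp_iff)
  then obtain T c where T: "finite T" "T \<subseteq> B a" "u = (\<Sum>x\<in>T. sc (c x) x)"
    unfolding VS.span_explicit by blast
  define T1 where "T1 = {x\<in>T. x \<in> wp (\<alpha> a) h}"
  define T2 where "T2 = {x\<in>T. x \<notin> wp (\<alpha> a) h}"
  let ?s = "\<lambda>T. \<Sum>x\<in>T. sc (c x) x"
  have spl: "u = ?s T1 + ?s T2"
  proof -
    have "T = T1 \<union> T2" "T1 \<inter> T2 = {}" by (auto simp: T1_def T2_def)
    then show ?thesis using T by (metis finite_Un sum.union_disjoint)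
  qed
  have s1: "?s T1 \<in> wp (\<alpha> a) h"
    by (rule VS.subspace_sum[OF wp_subspace[OF lab]])
       (auto simp: T1_def intro: VS.subspace_scale[OF wp_subspace[OF lab]])
  have T2: "finite T2" "T2 \<subseteq> B a" using T by (auto simp: T2_def)
  have "\<forall>x\<in>T2. \<exists>h'. x \<in> wp (\<alpha> a) h' \<and> h' \<noteq> h" using T2 base_facts(1) by (auto simp: T2_def)
  then obtain w where w: "\<And>x. x \<in> T2 \<Longrightarrow> x \<in> wp (\<alpha> a) (w x) \<and> w x \<noteq> h" by metis
  have s2: "?s T2 \<in> wp (\<alpha> a) h"
    using VS.subspace_diff[OF wp_subspace[OF lab] assms s1] spl by (simp add: algebra_simps)
  have "0 = om (\<alpha> a) 1 (?s T2) - sc h (?s T2)" using s2 by (simp add: wp_iff)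
  also have "om (\<alpha> a) 1 (?s T2) = (\<Sum>x\<in>T2. om (\<alpha> a) 1 (sc (c x) x))"
    by (rule additive_on_sum[OF om_additive_on[OF lab] lab]) (use T2 base_space scale_space[OF lab] in blast)
  also have "\<dots> = (\<Sum>x\<in>T2. sc (w x * c x) x)"
  proof (rule sum.cong[OF refl])
    fix x assume x: "x \<in> T2"
    then have "x \<in> space D (\<alpha> a)" "vop D (\<alpha> a) (conformal D) 1 x = sc (w x) x" using w[OF x] by (auto simp: wp_iff)
    then show "om (\<alpha> a) 1 (sc (c x) x) = sc (w x * c x) x"
      using L0_scale[OF lab] by (simp add: mult.commute)
  qed
  also have "\<dots> - sc h (?s T2) = (\<Sum>x\<in>T2. sc ((w x - h) * c x) x)"
    unfolding VS.scale_sum_right sum_subtractf[symmetric]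
    by (intro sum.cong refl) (simp only: VS.scale_scale VS.scale_left_diff_distrib left_diff_distrib)
  finally have z: "(\<Sum>x\<in>T2. sc ((w x - h) * c x) x) = 0" by simp
  have "(w x - h) * c x = 0" if "x \<in> T2" for x
    using VS.independentD[OF base_facts(2) T2 z that] .
  then have "c x = 0" if "x \<in> T2" for x using w[OF that] that by force
  then have "?s T2 = 0" by simp
  then have "u = ?s T1" using spl by simp
  also have "\<dots> \<in> VS.span (B a \<inter> wp (\<alpha> a) h)"
    using T by (intro VS.span_sum VS.span_scale VS.span_base) (auto simp: T1_def)
  finally show ?thesis .
qed

lemma dual_weight:
  assumes b: "b \<in> B a" "b \<in> wp (\<alpha> a) h"
  shows "B' a b \<in> wp (contra D (\<alpha> a)) h"
proof -
  note lab = \<alpha>[OF a] contra_label[OF \<alpha>[OF a]]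
  have s: "B' a b \<in> space D (contra D (\<alpha> a))" using base_facts(4) b by blast
  let ?u = "om (contra D (\<alpha> a)) 1 (B' a b)"
  have us: "?u \<in> space D (contra D (\<alpha> a))" by (rule om_space[OF lab(2) s])
  have p: "pairing D (\<alpha> a) x ?u = (if x = b then h else 0)" if x: "x \<in> B a" for x
  proof -
    obtain h' where h': "x \<in> wp (\<alpha> a) h'" using base_facts(1) x by blast
    have "pairing D (\<alpha> a) x ?u = pairing D (\<alpha> a) (om (\<alpha> a) 1 x) (B' a b)"
      using pairing_adjoint[OF lab(1) base_space[OF x] s, of 1] by simp
    also have "om (\<alpha> a) 1 x = sc h' x" using h' by (simp add: wp_iff)
    also have "pairing D (\<alpha> a) (sc h' x) (B' a b) = h' * (if x = b then 1 else 0)"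
      using pairing_facts(2)[OF lab(1) base_space[OF x] s] base_facts(5)[OF x b(1)] by simp
    finally have *: "pairing D (\<alpha> a) x ?u = h' * (if x = b then 1 else 0)" .
    show ?thesis
    proof (cases "x = b")
      case True
      have "x \<noteq> 0" using base_facts(2) x VS.dependent_zero by blast
      have "sc h' x = sc h x" using h' b True by (simp add: wp_iff)
      then have "h' = h" using \<open>x \<noteq> 0\<close> VS.scale_right_imp_eq by blast
      then show ?thesis using * True by simp
    qed (use * in simp)
  qed
  have "?u = (\<Sum>x\<in>{b}. sc (pairing D (\<alpha> a) x ?u) (B' a x))"
    by (rule dual_expand) (use b p us in auto)
  then have "?u = sc h (B' a b)" using p[OF b(1)] by simp
  then show ?thesis using s by (simp add: wp_iff)
qed

text \<open>
  Expanding \<open>\<omega>\<^sub>m x\<close> in the basis and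
  \<open>\<omega>\<^sub>2\<^sub>-\<^sub>m\<close> of a dual vector in the dual basis gives the
  same matrix, by adjointness of the two modes. The weights of the basis vectors shift by
  \<open>1 - m\<close>, which accounts for the power of \<open>\<rho>\<^sub>a\<close> later on.
\<close>
lemma trace_adjoint:
  fixes \<Phi> :: "'a \<Rightarrow> 'a \<Rightarrow> complex"
  assumes add1: "\<And>y. y \<in> space D (contra D (\<alpha> a)) \<Longrightarrow> additive_on (space D (\<alpha> a)) (\<lambda>x. \<Phi> x y)"
    and sc1: "\<And>c x y. x \<in> space D (\<alpha> a) \<Longrightarrow> y \<in> space D (contra D (\<alpha> a)) \<Longrightarrow> \<Phi> (sc c x) y = c * \<Phi> x y"
    and add2: "\<And>x. x \<in> space D (\<alpha> a) \<Longrightarrow> additive_on (space D (contra D (\<alpha> a))) (\<lambda>y. \<Phi> x y)"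
    and sc2: "\<And>c x y. x \<in> space D (\<alpha> a) \<Longrightarrow> y \<in> space D (contra D (\<alpha> a)) \<Longrightarrow> \<Phi> x (sc c y) = c * \<Phi> x y"
    and h': "h' = h - of_int m + 1"
  shows "(\<Sum>x\<in>B a \<inter> wp (\<alpha> a) h. \<Phi> (om (\<alpha> a) m x) (B' a x)) =
    (\<Sum>z\<in>B a \<inter> wp (\<alpha> a) h'. \<Phi> z (om (contra D (\<alpha> a)) (2 - m) (B' a z)))"
proof -
  note lab = \<alpha>[OF a] contra_label[OF \<alpha>[OF a]]
  let ?B = "\<lambda>h. B a \<inter> wp (\<alpha> a) h"
  let ?p = "pairing D (\<alpha> a)"
  have "\<Phi> (om (\<alpha> a) m x) (B' a x) = (\<Sum>z\<in>?B h'. ?p (om (\<alpha> a) m x) (B' a z) * \<Phi> z (B' a x))" if x: "x \<in> ?B h" for x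
  proof -
    have Bx: "B' a x \<in> space D (contra D (\<alpha> a))" using base_facts(4) x by blast
    have "om (\<alpha> a) m x \<in> wp (\<alpha> a) h'" unfolding h' by (rule om_weight[OF lab(1)]) (use x in blast)
    then have "om (\<alpha> a) m x = (\<Sum>z\<in>?B h'. sc (?p (om (\<alpha> a) m x) (B' a z)) z)"
      by (intro expand weight_span base_finite) auto
    then have "\<Phi> (om (\<alpha> a) m x) (B' a x) = \<Phi> (\<Sum>z\<in>?B h'. sc (?p (om (\<alpha> a) m x) (B' a z)) z) (B' a x)"
      by (rule arg_cong[of _ _ "\<lambda>u. \<Phi> u (B' a x)"])
    also have "\<dots> = (\<Sum>z\<in>?B h'. \<Phi> (sc (?p (om (\<alpha> a) m x) (B' a z)) z) (B' a x))"
      by (rule additive_on_sum[OF add1[OF Bx] lab(1)]) (use base_space scale_space[OF lab(1)] in blast)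
    also have "\<dots> = (\<Sum>z\<in>?B h'. ?p (om (\<alpha> a) m x) (B' a z) * \<Phi> z (B' a x))"
      by (intro sum.cong refl sc1 Bx) (use base_space in blast)
    finally show ?thesis .
  qed
  then have "(\<Sum>x\<in>?B h. \<Phi> (om (\<alpha> a) m x) (B' a x)) = (\<Sum>x\<in>?B h. \<Sum>z\<in>?B h'. ?p (om (\<alpha> a) m x) (B' a z) * \<Phi> z (B' a x))"
    by (rule sum.cong[OF refl])
  also have "\<dots> = (\<Sum>z\<in>?B h'. \<Sum>x\<in>?B h. ?p (om (\<alpha> a) m x) (B' a z) * \<Phi> z (B' a x))"
    by (rule sum.swap)
  also have "\<dots> = (\<Sum>z\<in>?B h'. \<Phi> z (om (contra D (\<alpha> a)) (2 - m) (B' a z)))"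
  proof (rule sum.cong[OF refl])
    fix z assume z: "z \<in> ?B h'"
    have zs: "z \<in> space D (\<alpha> a)" and Bz: "B' a z \<in> space D (contra D (\<alpha> a))" using base_space base_facts(4) z by auto
    let ?u = "om (contra D (\<alpha> a)) (2 - m) (B' a z)"
    have us: "?u \<in> space D (contra D (\<alpha> a))" by (rule om_space[OF lab(2) Bz])
    have adj: "?p x ?u = ?p (om (\<alpha> a) m x) (B' a z)" if "x \<in> B a" for x
      by (rule pairing_adjoint[symmetric, OF lab(1) base_space[OF that] Bz])
    have "?u = (\<Sum>x\<in>?B h. sc (?p x ?u) (B' a x))"
    proof (rule dual_expand)
      \<comment> \<open>Basis vectors outside the weight \<open>h\<close> do not contribute, because the pairing is homogeneous: \<open>L(0)\<close> is self-adjoint, being the mode \<open>m = 1\<close>.\<close>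
      fix x assume x: "x \<in> B a" "x \<notin> ?B h"
      obtain k where k: "x \<in> wp (\<alpha> a) k" using x base_facts(1) by blast
      have kh: "k \<noteq> h" using x k by blast
      have 1: "om (\<alpha> a) m x \<in> wp (\<alpha> a) (k - of_int m + 1)" by (rule om_weight[OF lab(1) k])
      have 2: "om (contra D (\<alpha> a)) 1 (B' a z) = sc h' (B' a z)" using dual_weight[of z h'] z by (simp add: wp_iff)
      have "(k - of_int m + 1) * ?p (om (\<alpha> a) m x) (B' a z) = ?p (om (\<alpha> a) 1 (om (\<alpha> a) m x)) (B' a z)"
        using 1 pairing_facts(2)[OF lab(1) _ Bz] by (simp add: wp_iff)
      also have "\<dots> = h' * ?p (om (\<alpha> a) m x) (B' a z)"
        using pairing_adjoint[OF lab(1) om_space[OF lab(1) base_space[OF x(1)], of m] Bz, of 1] 2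
          pairing_facts(4)[OF lab(1) om_space[OF lab(1) base_space[OF x(1)], of m] Bz] by simp
      finally have "(k - h) * ?p (om (\<alpha> a) m x) (B' a z) = 0" unfolding h' by (simp add: algebra_simps)
      then show "?p x ?u = 0" using kh adj[OF x(1)] by simp
    qed (use base_finite us in auto)
    then have "\<Phi> z ?u = \<Phi> z (\<Sum>x\<in>?B h. sc (?p x ?u) (B' a x))" by (rule arg_cong)
    also have "\<dots> = (\<Sum>x\<in>?B h. \<Phi> z (sc (?p x ?u) (B' a x)))"
      by (rule additive_on_sum[OF add2[OF zs] lab(2)]) (use base_facts(4) scale_space[OF lab(2)] in blast)
    also have "\<dots> = (\<Sum>x\<in>?B h. ?p (om (\<alpha> a) m x) (B' a z) * \<Phi> z (B' a x))"
    proof (rule sum.cong[OF refl])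
      fix x assume x: "x \<in> ?B h"
      then have "B' a x \<in> space D (contra D (\<alpha> a))" using base_facts(4) by blast
      then show "\<Phi> z (sc (?p x ?u) (B' a x)) = ?p (om (\<alpha> a) m x) (B' a z) * \<Phi> z (B' a x)"
        using sc2[OF zs] adj x by simp
    qed
    finally show "(\<Sum>x\<in>?B h. ?p (om (\<alpha> a) m x) (B' a z) * \<Phi> z (B' a x)) = \<Phi> z ?u" by simp
  qed
  finally show ?thesis .
qed

end

end

section \<open>Ward identities for the series summed over bases\<close>

context variables begin

lemma cone_bounded_convolvable: "cone_bounded (supp F) \<Longrightarrow> cone_bounded (supp G) \<Longrightarrow> convolvable F G"
  unfolding convolvable_def using cone_bounded_decomp[of "supp F" "supp G"] by (simp add: supp_def)

lemma sum_upd: "finite U \<Longrightarrow> (\<Sum>x\<in>U. ((\<lambda>_. 0)(p := c)) x) = (if p \<in> U then c else (0::complex))"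
  by (simp add: fun_upd_def)

lemma sum_upd2: "finite U \<Longrightarrow> p \<noteq> q \<Longrightarrow>
   (\<Sum>x\<in>U. ((\<lambda>_. 0)(p := c, q := c')) x) = (if p \<in> U then c else (0::complex)) + (if q \<in> U then c' else 0)"
proof -
  assume U: "finite U" "p \<noteq> q"
  have "((\<lambda>_. 0)(p := c, q := c')) x = ((\<lambda>_. 0)(p := c)) x + ((\<lambda>_. 0)(q := c')) x" for x
    using U by auto
  then show ?thesis using U by (simp only: sum.distrib sum_upd)
qed

text \<open>
  Expanded for the outer variable, a pole carries at most the power \<open>-1\<close> in that
  variable, and the sum of both exponents is negative as well.
\<close>
lemma pole_deriv_height:
  assumes "p \<in> P" "q \<in> P" "outer p q \<or> outer q p" "pole_deriv p q r m d \<noteq> 0" "outer_closed U"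
  shows "\<exists>k::nat. height U d = of_nat k"
proof -
  have pq: "p \<noteq> q" using assms(3) by (auto simp: outer_def)
  have U: "finite U" using assms(5) fin(1) by (auto simp: outer_closed_def intro: finite_subset)
  from assms(3) show ?thesis
  proof
    assume o: "outer p q"
    obtain i where d: "d = (\<lambda>_. 0)(p := - 1 - of_nat i - of_nat r, q := of_nat i - of_nat m)"
      using pole_deriv_outer_supp[OF o assms(4)] by blast
    have "q \<in> U \<Longrightarrow> p \<in> U" using o assms(1,5) by (auto simp: outer_closed_def)
    then have "height U d = (if q \<in> U then of_nat (1 + r + m) else if p \<in> U then of_nat (1 + i + r) else of_nat 0)"
      unfolding d height_def sum_upd2[OF U pq] by simp
    then show ?thesis by (cases "q \<in> U"; cases "p \<in> U"; (simp only: if_True if_False; blast))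
  next
    assume o: "outer q p"
    obtain i where d: "d = (\<lambda>_. 0)(p := of_nat i, q := - 1 - of_nat r - of_nat i - of_nat m)"
      using pole_deriv_inner_supp[OF o assms(4)] by blast
    have "p \<in> U \<Longrightarrow> q \<in> U" using o assms(2,5) by (auto simp: outer_closed_def)
    then have "height U d = (if p \<in> U then of_nat (1 + r + m) else if q \<in> U then of_nat (1 + i + r + m) else of_nat 0)"
      unfolding d height_def sum_upd2[OF U pq] by simp
    then show ?thesis by (cases "q \<in> U"; cases "p \<in> U"; (simp only: if_True if_False; blast))
  qed
qed

lemma pole_deriv_outside:
  assumes "outer p q \<or> outer q p" "pole_deriv p q r m d \<noteq> 0" "x \<noteq> p" "x \<noteq> q"
  shows "d x = 0"
  using assms(1)
proof
  assume "outer p q"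
  then obtain i where "d = (\<lambda>_. 0)(p := - 1 - of_nat i - of_nat r, q := of_nat i - of_nat m)"
    using pole_deriv_outer_supp[OF _ assms(2)] by blast
  then show ?thesis using assms by simp
next
  assume "outer q p"
  then obtain i where "d = (\<lambda>_. 0)(p := of_nat i, q := - 1 - of_nat r - of_nat i - of_nat m)"
    using pole_deriv_inner_supp[OF _ assms(2)] by blast
  then show ?thesis using assms by simp
qed

lemma pole_deriv_sum:
  assumes "outer p q \<or> outer q p" "pole_deriv p q r m d \<noteq> 0"
  shows "d p + d q = - 1 - of_nat r - of_nat m"
  using assms(1)
proof
  assume o: "outer p q"
  then obtain i where "d = (\<lambda>_. 0)(p := - 1 - of_nat i - of_nat r, q := of_nat i - of_nat m)"
    using pole_deriv_outer_supp[OF _ assms(2)] by blast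
  moreover have "p \<noteq> q" using o by (auto simp: outer_def)
  ultimately show ?thesis by simp
next
  assume o: "outer q p"
  then obtain i where "d = (\<lambda>_. 0)(p := of_nat i, q := - 1 - of_nat r - of_nat i - of_nat m)"
    using pole_deriv_inner_supp[OF _ assms(2)] by blast
  moreover have "p \<noteq> q" using o by (auto simp: outer_def)
  ultimately show ?thesis by simp
qed

lemma pole_deriv_total_degree:
  assumes "p \<in> P" "q \<in> P" "outer p q \<or> outer q p" "pole_deriv p q r m d \<noteq> 0"
  shows "total_degree d = - 1 - of_nat r - of_nat m"
proof -
  have pq: "p \<noteq> q" using assms(3) by (auto simp: outer_def)
  have 0: "d x = 0" if "x \<noteq> p" "x \<noteq> q" for x using pole_deriv_outside[OF assms(3,4) that] .
  have "(\<Sum>x\<in>P. d x) = (\<Sum>x\<in>{p, q}. d x)" using assms fin 0 by (intro sum.mono_neutral_right) auto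
  moreover have "(\<Sum>x\<in>R. d x) = 0"
  proof (rule sum.neutral, rule ballI)
    fix x assume "x \<in> R"
    then have "x \<noteq> p" "x \<noteq> q" using assms(1,2) disj by blast+
    then show "d x = 0" by (rule 0)
  qed
  ultimately show ?thesis using pole_deriv_sum[OF assms(3,4)] pq by (simp add: total_degree_def)
qed

lemma pole_deriv_cone_bounded:
  assumes "p \<in> P" "q \<in> P" "outer p q \<or> outer q p"
  shows "cone_bounded (supp (pole_deriv p q r m))"
  unfolding cone_bounded_def
proof (intro conjI ballI allI impI)
  fix d x assume d: "d \<in> supp (pole_deriv p q r m)" "x \<notin> P \<union> R"
  show "d x = 0" by (rule pole_deriv_outside[OF assms(3)]) (use d assms in \<open>auto simp: supp_def\<close>)
next
  fix U assume U: "outer_closed U"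
  show "discrete_below (height U ` supp (pole_deriv p q r m))"
  proof (rule discrete_belowI[of "{0}"])
    fix x assume "x \<in> height U ` supp (pole_deriv p q r m)"
    then obtain d where d: "pole_deriv p q r m d \<noteq> 0" "x = height U d" by (auto simp: supp_def)
    obtain k :: nat where "x = of_nat k" using pole_deriv_height[OF assms d(1) U] d(2) by blast
    then show "\<exists>c\<in>{0}. \<exists>k::nat. x = c + of_nat k / 2" by (auto intro: exI[of _ "2 * k"])
  qed simp
next
  fix r' assume r': "r' \<in> R"
  have "d r' = 0" if "d \<in> supp (pole_deriv p q r m)" for d
    by (rule pole_deriv_outside[OF assms(3)]) (use that assms r' disj in \<open>auto simp: supp_def\<close>)
  then have "(\<lambda>d. d r') ` supp (pole_deriv p q r m) \<subseteq> {0}" by blast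
  then show "discrete_below ((\<lambda>d. d r') ` supp (pole_deriv p q r m))" by (intro discrete_below_finite) (rule finite_subset, auto)
qed

end

context genus_data begin

lemma outer_total: "p \<in> P \<Longrightarrow> q \<in> P \<Longrightarrow> p \<noteq> q \<Longrightarrow> outer p q \<or> outer q p"
proof -
  have "sorted_wrt outer xs \<Longrightarrow> p \<in> set xs \<Longrightarrow> q \<in> set xs \<Longrightarrow> p \<noteq> q \<Longrightarrow> outer p q \<or> outer q p" for xs
    by (induction xs) auto
  then show "p \<in> P \<Longrightarrow> q \<in> P \<Longrightarrow> p \<noteq> q \<Longrightarrow> outer p q \<or> outer q p" using sorted_positions by blast
qed

lemma basis_choices_cong: "(\<And>r. r \<in> R \<Longrightarrow> e r = e' r) \<Longrightarrow> basis_choices e = basis_choices e'"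
  unfolding basis_choices_def by (rule PiE_cong) simp

lemma basis_choices_finite: "finite (basis_choices e)"
  unfolding basis_choices_def by (intro finite_PiE base_finite) auto

lemma basis_choices_mem: "b \<in> basis_choices e \<Longrightarrow> a \<in> {1..g} \<Longrightarrow> b a \<in> B a \<and> b a \<in> wp (\<alpha> a) (e (Rv (int a)))"
  by (auto simp: basis_choices_def)

lemma inserted_homog:
  assumes b: "b \<in> basis_choices e" shows "homog (inserted b) (inserted_weight e)"
  unfolding homog_def
proof
  fix p assume p: "p \<in> P"
  show "inserted b p \<in> wp (state_label p) (inserted_weight e p)"
  proof (cases p)
    case (Wv a)
    then have a: "a \<noteq> 0" "\<bar>a\<bar> \<le> int g" using p by (auto simp: set_positions idx_def)
    show ?thesis
    proof (cases "a > 0")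
      case True
      then have "nat a \<in> {1..g}" using a by auto
      then have "b (nat a) \<in> wp (\<alpha> (nat a)) (e (Rv (int (nat a))))" using basis_choices_mem[OF b] by blast
      then show ?thesis using True Wv by (simp add: inserted_def state_label_def inserted_weight_def)
    next
      case False
      then have m: "nat (- a) \<in> {1..g}" using a by auto
      have "B' (nat (- a)) (b (nat (- a))) \<in> wp (contra D (\<alpha> (nat (- a)))) (e (Rv (int (nat (- a)))))"
        using dual_weight[OF m] basis_choices_mem[OF b m] by blast
      then show ?thesis using False Wv a by (simp add: inserted_def state_label_def inserted_weight_def)
    qed
  qed (use p omega_wp vac_wp in \<open>auto simp: inserted_def state_label_def inserted_weight_def set_positions\<close>)
qed

text \<open>
  The weights of the inserted states are bounded below as well, so the bound on the weights of
  the intermediate states becomes a bound on the exponents that is uniform in the states.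
\<close>
lemma corr_height:
  assumes "outer_closed U"
  shows "\<exists>c. \<forall>\<sigma> wt e. homog \<sigma> wt \<longrightarrow> corr \<sigma> e \<noteq> 0 \<longrightarrow> (\<exists>k::nat. height U e = c + of_nat k)"
proof -
  obtain as bs where as: "positions n g = as @ bs" "set as = U"
    using outer_closed_prefix[OF sorted_positions, of U n g] assms unfolding outer_closed_def by blast
  obtain c where c: "\<And>\<sigma> wt e. homog \<sigma> wt \<Longrightarrow> corr \<sigma> e \<noteq> 0 \<Longrightarrow> (\<exists>n::nat. - (\<Sum>p\<in>set as. wt p + e p) = c + of_nat n)"
    using corr_prefix[OF as(1)] by blast
  have UP: "U \<subseteq> P" using assms by (simp add: outer_closed_def)
  show ?thesis
  proof (intro exI[of _ "c + (\<Sum>p\<in>U. hw (state_label p))"] allI impI)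
    fix \<sigma> wt e assume h: "homog \<sigma> wt" and nz: "corr \<sigma> e \<noteq> 0"
    obtain k :: nat where k: "- (\<Sum>p\<in>U. wt p + e p) = c + of_nat k" using c[OF h nz] as by blast
    have "\<exists>j::nat. wt p = hw (state_label p) + of_nat j" if "p \<in> U" for p
    proof -
      have p: "p \<in> P" using that UP by blast
      have "\<sigma> p \<noteq> 0" using corr_zero[OF homog_states[OF h] p] nz by blast
      moreover have "\<sigma> p \<in> wp (state_label p) (wt p)" using h p by (simp add: homog_def)
      ultimately show ?thesis using wp_hw[OF lab_label[OF p]] by blast
    qed
    then obtain j :: "fvar \<Rightarrow> nat" where j: "\<And>p. p \<in> U \<Longrightarrow> wt p = hw (state_label p) + of_nat (j p)" by metis
    have "(\<Sum>p\<in>U. wt p) = (\<Sum>p\<in>U. hw (state_label p) + of_nat (j p))" by (rule sum.cong) (use j in auto)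
    then have wt: "(\<Sum>p\<in>U. wt p) = (\<Sum>p\<in>U. hw (state_label p)) + of_nat (\<Sum>p\<in>U. j p)" by (simp add: sum.distrib)
    have "height U e = c + of_nat k + (\<Sum>p\<in>U. wt p)"
      unfolding height_def k[symmetric] sum.distrib by simp
    then show "\<exists>k::nat. height U e = c + (\<Sum>p\<in>U. hw (state_label p)) + of_nat k"
      unfolding wt by (intro exI[of _ "k + (\<Sum>p\<in>U. j p)"]) simp
  qed
qed

lemma hit_series_nonzero:
  assumes "hit_series q m e \<noteq> 0"
  obtains b where "admissible e" "b \<in> basis_choices e" "homog (hit q m (inserted b)) ((inserted_weight e)(q := inserted_weight e q - of_int m + 1))"
    "corr (hit q m (inserted b)) e \<noteq> 0"
proof -
  have ok: "admissible e" using assms by (auto simp: hit_series_def split: if_splits)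
  then have "(\<Sum>b\<in>basis_choices e. corr (hit q m (inserted b)) e) \<noteq> 0" using assms by (simp add: hit_series_def)
  then obtain b where b: "b \<in> basis_choices e" "corr (hit q m (inserted b)) e \<noteq> 0"
    by (blast dest: sum.not_neutral_contains_not_neutral)
  show ?thesis by (rule that[OF ok b(1) hit_homog[OF inserted_homog[OF b(1)]] b(2)])
qed

lemma discrete_below_shift: "(\<And>x. x \<in> C \<Longrightarrow> \<exists>k::nat. x = c + of_nat k) \<Longrightarrow> discrete_below C"
proof (rule discrete_belowI[of "{c}"])
  fix x assume "\<And>x. x \<in> C \<Longrightarrow> \<exists>k::nat. x = c + of_nat k" "x \<in> C"
  then obtain k :: nat where "x = c + of_nat k" by blast
  then show "\<exists>c\<in>{c}. \<exists>k::nat. x = c + of_nat k / 2" by (auto intro: exI[of _ "2 * k"])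
qed simp

lemma hit_series_height: "outer_closed U \<Longrightarrow> \<exists>c. \<forall>q m e. hit_series q m e \<noteq> 0 \<longrightarrow> (\<exists>k::nat. height U e = c + of_nat k)"
proof -
  assume "outer_closed U"
  then obtain c where c: "\<And>\<sigma> wt e. homog \<sigma> wt \<Longrightarrow> corr \<sigma> e \<noteq> 0 \<Longrightarrow> (\<exists>k::nat. height U e = c + of_nat k)"
    using corr_height by blast
  show ?thesis by (rule exI[of _ c]) (blast elim: hit_series_nonzero dest: c)
qed

lemma hit_series_rho:
  assumes "hit_series q m e \<noteq> 0" "a \<in> {1..g}"
  shows "\<exists>k::nat. e (Rv (int a)) = hw (\<alpha> a) + of_nat k"
proof -
  obtain b where b: "admissible e" "b \<in> basis_choices e" "homog (hit q m (inserted b)) ((inserted_weight e)(q := inserted_weight e q - of_int m + 1))"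
    "corr (hit q m (inserted b)) e \<noteq> 0" using assms(1) by (rule hit_series_nonzero)
  have W: "Wv (int a) \<in> P" using assms(2) by (auto simp: set_positions idx_def)
  have l: "state_label (Wv (int a)) = \<alpha> a" "inserted b (Wv (int a)) = b a" using assms(2) by (auto simp: state_label_def inserted_def)
  have "hit q m (inserted b) (Wv (int a)) \<noteq> 0" using corr_zero[OF homog_states[OF b(3)] W] b(4) by blast
  then have "b a \<noteq> 0" using l additive_on_0[OF om_additive_on[OF \<alpha>[OF assms(2)], of m] zero_space[OF \<alpha>[OF assms(2)]]]
    by (auto split: if_splits)
  then show ?thesis using wp_hw[OF \<alpha>[OF assms(2)]] basis_choices_mem[OF b(2) assms(2)] by blast
qed

text \<open>
  The state after the action of the mode has weight \<open>e - m + 1\<close>, where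
  \<open>e\<close> is the exponent of \<open>\<rho>\<close>, and this weight is bounded below;
  so the exponent grows with \<open>m\<close>. This makes the infinite column of modes summable.
\<close>
lemma hit_series_rho':
  assumes "hit_series (Wv a) m e \<noteq> 0" "a \<in> idx g"
  shows "\<exists>k::nat. e (Rv \<bar>a\<bar>) = hw (state_label (Wv a)) + of_int m - 1 + of_nat k"
proof -
  obtain b where b: "admissible e" "b \<in> basis_choices e" "homog (hit (Wv a) m (inserted b)) ((inserted_weight e)(Wv a := inserted_weight e (Wv a) - of_int m + 1))"
    "corr (hit (Wv a) m (inserted b)) e \<noteq> 0" using assms(1) by (rule hit_series_nonzero)
  have W: "Wv a \<in> P" using assms(2) by (auto simp: set_positions)
  have "hit (Wv a) m (inserted b) (Wv a) \<noteq> 0" using corr_zero[OF homog_states[OF b(3)] W] b(4) by blast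
  moreover have "hit (Wv a) m (inserted b) (Wv a) \<in> wp (state_label (Wv a)) (e (Rv \<bar>a\<bar>) - of_int m + 1)"
    using b(3) W by (force simp: homog_def inserted_weight_def)
  ultimately obtain k :: nat where "e (Rv \<bar>a\<bar>) - of_int m + 1 = hw (state_label (Wv a)) + of_nat k"
    using wp_hw[OF lab_label[OF W]] by blast
  then show ?thesis by (intro exI[of _ k]) (simp add: algebra_simps)
qed

lemma sum_idx: "(\<Sum>a\<in>idx g. f a) = (\<Sum>a\<in>{1..int g}. f a + (f (- a) :: complex))"
proof -
  have "idx g = {1..int g} \<union> uminus ` {1..int g}"
  proof (intro equalityI subsetI)
    fix a assume a: "a \<in> idx g"
    show "a \<in> {1..int g} \<union> uminus ` {1..int g}"
    proof (cases "a > 0")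
      case False
      then have "a = - (- a)" "- a \<in> {1..int g}" using a by (auto simp: idx_def)
      then show ?thesis by blast
    qed (use a in \<open>auto simp: idx_def\<close>)
  qed (auto simp: idx_def)
  then have "(\<Sum>a\<in>idx g. f a) = (\<Sum>a\<in>{1..int g}. f a) + (\<Sum>a\<in>uminus ` {1..int g}. f a)"
    by (simp only:) (rule sum.union_disjoint, auto)
  also have "(\<Sum>a\<in>uminus ` {1..int g}. f a) = (\<Sum>a\<in>{1..int g}. f (- a))"
    by (subst sum.reindex) auto
  finally show ?thesis by (simp add: sum.distrib)
qed

lemma sum_R: "(\<Sum>r\<in>R. e r) = (\<Sum>a\<in>{1..int g}. e (Rv a))"
  by (subst sum.reindex) (auto simp: inj_on_def)

lemma sum_P: "(\<Sum>p\<in>P. f p) = f Xv + (\<Sum>k\<in>{1..n}. f (Yv k)) + (\<Sum>a\<in>idx g. f (Wv a) :: complex)"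
proof -
  have "(\<Sum>p\<in>P. f p) = f Xv + (\<Sum>p\<in>Yv ` {1..n} \<union> Wv ` idx g. f p)"
    unfolding set_positions by (rule sum.insert) (auto simp: finite_idx)
  also have "(\<Sum>p\<in>Yv ` {1..n} \<union> Wv ` idx g. f p) = (\<Sum>p\<in>Yv ` {1..n}. f p) + (\<Sum>p\<in>Wv ` idx g. f p)"
    by (rule sum.union_disjoint) (auto simp: finite_idx)
  also have "(\<Sum>p\<in>Yv ` {1..n}. f p) = (\<Sum>k\<in>{1..n}. f (Yv k))" by (subst sum.reindex) (auto simp: inj_on_def)
  also have "(\<Sum>p\<in>Wv ` idx g. f p) = (\<Sum>a\<in>idx g. f (Wv a))" by (subst sum.reindex) (auto simp: inj_on_def)
  finally show ?thesis by (simp add: add.assoc)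
qed

text \<open>
  All weights and exponents sum to zero, and the weight of the two states at the handle
  \<open>a\<close> is twice the exponent of \<open>\<rho>\<^sub>a\<close>.
\<close>
lemma hit_series_total_degree:
  assumes "hit_series q m e \<noteq> 0" "q \<in> P"
  shows "total_degree e = - 2 * of_nat n + of_int m - 1"
proof -
  obtain b where b: "admissible e" "b \<in> basis_choices e" "homog (hit q m (inserted b)) ((inserted_weight e)(q := inserted_weight e q - of_int m + 1))"
    "corr (hit q m (inserted b)) e \<noteq> 0" using assms(1) by (rule hit_series_nonzero)
  let ?wt = "(inserted_weight e)(q := inserted_weight e q - of_int m + 1)"
  have t: "(\<Sum>p\<in>P. ?wt p) + (\<Sum>p\<in>P. e p) = 0"
    unfolding sum.distrib[symmetric] by (rule corr_total[OF b(3,4)])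
  have w: "(\<Sum>p\<in>P. ?wt p) = (\<Sum>p\<in>P. inserted_weight e p) - of_int m + 1"
  proof -
    have "(\<Sum>p\<in>P. ?wt p) = ?wt q + (\<Sum>p\<in>P - {q}. ?wt p)" using assms(2) by (simp add: sum.remove)
    also have "(\<Sum>p\<in>P - {q}. ?wt p) = (\<Sum>p\<in>P - {q}. inserted_weight e p)" by (rule sum.cong) auto
    finally show ?thesis using assms(2) by (simp add: sum.remove[of P q])
  qed
  have "(\<Sum>p\<in>P. inserted_weight e p) = 2 * of_nat n + 2 * (\<Sum>r\<in>R. e r)"
    unfolding sum_P sum_R by (simp add: inserted_weight_def sum_idx sum_distrib_left)
  then have "(\<Sum>p\<in>P. e p) = - (2 * of_nat n + 2 * (\<Sum>r\<in>R. e r) - of_int m + 1)"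
    using t unfolding w by (simp only: eq_neg_iff_add_eq_0 add.commute)
  then show ?thesis by (simp add: total_degree_def)
qed

lemma hit_series_cone_bounded: "cone_bounded (\<Union>q. \<Union>m. supp (hit_series q m))"
  unfolding cone_bounded_def
proof (intro conjI ballI allI impI)
  fix d x assume "d \<in> (\<Union>q. \<Union>m. supp (hit_series q m))" "x \<notin> P \<union> R"
  then show "d x = 0" by (auto simp: supp_def admissible_def elim!: hit_series_nonzero)
next
  fix U assume "outer_closed U"
  then obtain c where "\<And>q m e. hit_series q m e \<noteq> 0 \<Longrightarrow> (\<exists>k::nat. height U e = c + of_nat k)" using hit_series_height by blast
  then show "discrete_below (height U ` (\<Union>q. \<Union>m. supp (hit_series q m)))" by (intro discrete_below_shift[of _ c]) (auto simp: supp_def)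
next
  fix r assume "r \<in> R"
  then obtain a where a: "r = Rv (int a)" "a \<in> {1..g}" by (force simp: image_iff intro: that[of "nat x" for x])
  show "discrete_below ((\<lambda>d. d r) ` (\<Union>q. \<Union>m. supp (hit_series q m)))"
    by (rule discrete_below_shift[of _ "hw (\<alpha> a)"]) (use a hit_series_rho in \<open>auto simp: supp_def\<close>)
qed

lemma hit_series_tame:
  assumes "q \<in> P" shows "tame (supp (hit_series q m))"
proof -
  have "cone_bounded (supp (hit_series q m))" by (rule cone_bounded_subset[OF hit_series_cone_bounded]) blast
  moreover have "total_degree ` supp (hit_series q m) \<subseteq> {- 2 * of_nat n + of_int m - 1}"
    using hit_series_total_degree assms by (auto simp: supp_def)
  ultimately show ?thesis unfolding tame_def using finite_subset by blast
qed

text \<open>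
  The local Ward identity for each choice of basis vectors, summed. The kernel involves no
  \<open>\<rho>\<close>, so the set of choices, which depends only on the exponents of
  \<open>\<rho>\<close>, is the same for all terms of the convolution.
\<close>
lemma hit_series_ward:
  assumes p: "p \<in> P"
  shows "hit_series p (- int r - 1) e = (\<Sum>q\<in>P - {p}. Sum_any (\<lambda>m. (pole_deriv p q r m \<star> hit_series q (int m)) e))"
proof (cases "admissible e")
  case False
  have "(pole_deriv p q r m \<star> hit_series q (int m)) e = 0" if q: "q \<in> P - {p}" for q m
  proof (rule ccontr)
    assume "(pole_deriv p q r m \<star> hit_series q (int m)) e \<noteq> 0"
    then obtain d where d: "pole_deriv p q r m d \<noteq> 0" "hit_series q (int m) (esub e d) \<noteq> 0" by (blast dest: fmult_nonzero)
    have "admissible (esub e d)" using d(2) by (rule hit_series_nonzero)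
    moreover have "d x = 0" if "x \<notin> P \<union> R" for x
      using pole_deriv_outside[OF outer_total[OF p, of q] d(1), of x] q p that by auto
    ultimately show False using False by (auto simp: admissible_def)
  qed
  then show ?thesis using False by (simp add: hit_series_def)
next
  case ok: True
  \<comment> \<open>The correlator at \<open>b\<close> without the restriction on the exponents of \<open>\<rho>\<close> is constant in them, so it is not a series to which the product estimates apply; \<open>C\<close> restricts it to the exponents of \<open>e\<close>.\<close>
  define C where "C b q m = (\<lambda>e'. if admissible e' \<and> (\<forall>r\<in>R. e' r = e r) then corr (hit q m (inserted b)) e' else 0)" for b q m
  have q_facts: "outer p q \<or> outer q p" "q \<in> P" if "q \<in> P - {p}" for q using outer_total[OF p, of q] that by auto
  have main: "(pole_deriv p q r m \<star> hit_series q (int m)) e = (\<Sum>b\<in>basis_choices e. (pole_deriv p q r m \<star> corr (hit q (int m) (inserted b))) e)"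
    if q: "q \<in> P - {p}" for q m
  proof -
    note qf = q_facts[OF q]
    have shift: "admissible (esub e d)" "\<forall>r\<in>R. esub e d r = e r" "basis_choices (esub e d) = basis_choices e" if "pole_deriv p q r m d \<noteq> 0" for d
    proof -
      have 0: "d x = 0" if "x \<notin> P" for x
        using pole_deriv_outside[OF qf(1) \<open>pole_deriv p q r m d \<noteq> 0\<close>, of x] that p qf(2) by auto
      show "admissible (esub e d)" using ok 0 by (auto simp: admissible_def)
      show "\<forall>r\<in>R. esub e d r = e r" using 0 disj by auto
      then show "basis_choices (esub e d) = basis_choices e" by (intro basis_choices_cong) auto
    qed
    have conv: "convolvable (pole_deriv p q r m) (C b q (int m))" if b: "b \<in> basis_choices e" for b
    proof (rule cone_bounded_convolvable[OF pole_deriv_cone_bounded[OF p qf(2,1)]])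
      have h: "homog (hit q (int m) (inserted b)) ((inserted_weight e)(q := inserted_weight e q - of_int (int m) + 1))"
        by (rule hit_homog[OF inserted_homog[OF b]])
      show "cone_bounded (supp (C b q (int m)))"
        unfolding cone_bounded_def
      proof (intro conjI ballI allI impI)
        fix d x assume "d \<in> supp (C b q (int m))" "x \<notin> P \<union> R"
        then show "d x = 0" by (auto simp: supp_def C_def admissible_def split: if_splits)
      next
        fix U assume "outer_closed U"
        then obtain c where "\<And>\<sigma> wt e. homog \<sigma> wt \<Longrightarrow> corr \<sigma> e \<noteq> 0 \<Longrightarrow> (\<exists>k::nat. height U e = c + of_nat k)"
          using corr_height by blast
        then show "discrete_below (height U ` supp (C b q (int m)))"
          using h by (intro discrete_below_shift[of _ c]) (auto simp: supp_def C_def split: if_splits)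
      next
        fix r assume "r \<in> R"
        then have "(\<lambda>d. d r) ` supp (C b q (int m)) \<subseteq> {e r}" by (auto simp: supp_def C_def split: if_splits)
        then show "discrete_below ((\<lambda>d. d r) ` supp (C b q (int m)))" by (intro discrete_below_finite) (rule finite_subset, auto)
      qed
    qed
    have "(pole_deriv p q r m \<star> hit_series q (int m)) e = (pole_deriv p q r m \<star> (\<lambda>e'. \<Sum>b\<in>basis_choices e. 1 * C b q (int m) e')) e"
      unfolding fmult_def
    proof (intro arg_cong[of _ _ Sum_any] ext)
      fix d
      show "pole_deriv p q r m d * hit_series q (int m) (esub e d) = pole_deriv p q r m d * (\<Sum>b\<in>basis_choices e. 1 * C b q (int m) (esub e d))"
        using shift[of d] by (cases "pole_deriv p q r m d = 0") (simp_all add: hit_series_def C_def)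
    qed
    also have "\<dots> = (\<Sum>b\<in>basis_choices e. 1 * (pole_deriv p q r m \<star> C b q (int m)) e)"
      by (rule fmult_sum_right[OF basis_choices_finite conv])
    also have "\<dots> = (\<Sum>b\<in>basis_choices e. (pole_deriv p q r m \<star> corr (hit q (int m) (inserted b))) e)"
    proof (rule sum.cong[OF refl])
      fix b
      have "pole_deriv p q r m d * C b q (int m) (esub e d) = pole_deriv p q r m d * corr (hit q (int m) (inserted b)) (esub e d)" for d
        using shift(1,2)[of d] by (cases "pole_deriv p q r m d = 0") (simp_all add: C_def)
      then show "1 * (pole_deriv p q r m \<star> C b q (int m)) e = (pole_deriv p q r m \<star> corr (hit q (int m) (inserted b))) e"
        by (simp only: fmult_def mult_1)
    qed
    finally show ?thesis .
  qed
  have fin: "finite {m. (pole_deriv p q r m \<star> corr (hit q (int m) (inserted b))) e \<noteq> 0}" if "q \<in> P - {p}" "b \<in> basis_choices e" for q b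
  proof (rule finite_subset[OF _ hit_finite[OF homog_states[OF inserted_homog[OF that(2)]], of q]])
    show "{m. (pole_deriv p q r m \<star> corr (hit q (int m) (inserted b))) e \<noteq> 0} \<subseteq> {m. \<exists>e. corr (hit q (int m) (inserted b)) e \<noteq> 0}"
      by (blast dest: fmult_nonzero)
  qed (use that in blast)
  have "hit_series p (- int r - 1) e = (\<Sum>b\<in>basis_choices e. corr (hit p (- int r - 1) (inserted b)) e)" using ok by (simp only: hit_series_def if_True)
  also have "\<dots> = (\<Sum>b\<in>basis_choices e. \<Sum>q\<in>P - {p}. Sum_any (\<lambda>m. (pole_deriv p q r m \<star> corr (hit q (int m) (inserted b))) e))"
    by (intro sum.cong refl local_ward[OF inserted_homog p])
  also have "\<dots> = (\<Sum>q\<in>P - {p}. \<Sum>b\<in>basis_choices e. Sum_any (\<lambda>m. (pole_deriv p q r m \<star> corr (hit q (int m) (inserted b))) e))"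
    by (rule sum.swap)
  also have "\<dots> = (\<Sum>q\<in>P - {p}. Sum_any (\<lambda>m. \<Sum>b\<in>basis_choices e. (pole_deriv p q r m \<star> corr (hit q (int m) (inserted b))) e))"
    by (intro sum.cong refl Sum_any_sum[symmetric] basis_choices_finite fin)
  also have "\<dots> = (\<Sum>q\<in>P - {p}. Sum_any (\<lambda>m. (pole_deriv p q r m \<star> hit_series q (int m)) e))"
    by (intro sum.cong refl arg_cong[of _ _ Sum_any] ext main[symmetric])
  finally show ?thesis .
qed

text \<open>
  The global Ward identity summed over the bases; multiplication by a power of \<open>q\<close>
  shifts an exponent and leaves the set of basis choices unchanged.
\<close>
lemma hit_series_global:
  assumes l: "l \<le> 2"
  shows "(\<Sum>q\<in>P. \<Sum>m\<le>2. of_nat (l choose m) * (monom1 q (of_nat l - of_nat m) \<star> hit_series q (int m)) e) = 0"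
proof -
  have ch0: "(of_nat l gchoose m :: complex) = of_nat (l choose m)" for m
    by (simp add: binomial_gbinomial)
  let ?e = "\<lambda>q m. e(q := e q - of_nat l + of_nat m)"
  have hit_shift: "hit_series q (int m) (?e q m) = (if admissible e then \<Sum>b\<in>basis_choices e. corr (hit q (int m) (inserted b)) (?e q m) else 0)" if "q \<in> P" for q m
  proof -
    have "q \<notin> R" using that disj by auto
    then have "basis_choices (?e q m) = basis_choices e" by (intro basis_choices_cong) auto
    moreover have "admissible (?e q m) = admissible e" using that by (auto simp: admissible_def)
    ultimately show ?thesis by (simp add: hit_series_def)
  qed
  have "(\<Sum>q\<in>P. \<Sum>m\<le>2. of_nat (l choose m) * hit_series q (int m) (?e q m)) = 0"
  proof (cases "admissible e")
    case True
    have "(\<Sum>q\<in>P. \<Sum>m\<le>2. of_nat (l choose m) * hit_series q (int m) (?e q m))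
       = (\<Sum>q\<in>P. \<Sum>m\<le>2. \<Sum>b\<in>basis_choices e. of_nat (l choose m) * corr (hit q (int m) (inserted b)) (?e q m))"
      using True by (intro sum.cong refl) (simp add: hit_shift sum_distrib_left)
    also have "\<dots> = (\<Sum>q\<in>P. \<Sum>b\<in>basis_choices e. \<Sum>m\<le>2. of_nat (l choose m) * corr (hit q (int m) (inserted b)) (?e q m))"
      by (intro sum.cong refl sum.swap)
    also have "\<dots> = (\<Sum>b\<in>basis_choices e. \<Sum>q\<in>P. \<Sum>m\<le>2. of_nat (l choose m) * corr (hit q (int m) (inserted b)) (?e q m))"
      by (rule sum.swap)
    also have "\<dots> = (\<Sum>b\<in>basis_choices e. \<Sum>q\<in>P. Sum_any (\<lambda>m. (of_nat l gchoose m) * corr (hit q (int m) (inserted b)) (?e q m)))"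
    proof (intro sum.cong refl Sum_any.expand_superset[symmetric, folded ch0])
      fix b q
      show "(\<Sum>m\<le>2. of_nat (l choose m) * corr (hit q (int m) (inserted b)) (?e q m)) =
        Sum_any (\<lambda>m. (of_nat l gchoose m) * corr (hit q (int m) (inserted b)) (?e q m))"
        unfolding ch0
        by (rule Sum_any.expand_superset[symmetric]) (use l in \<open>auto simp: not_le intro: ccontr\<close>)
    qed
    also have "\<dots> = 0" by (intro sum.neutral ballI global_ward[OF homog_states[OF inserted_homog] l])
    finally show ?thesis .
  qed (simp add: hit_shift)
  moreover have "(monom1 q (of_nat l - of_nat m) \<star> hit_series q (int m)) e = hit_series q (int m) (?e q m)" for q m
  proof -
    have "e q - (of_nat l - of_nat m) = e q - of_nat l + of_nat m" by simp
    then show ?thesis by (simp only: monom1_fmult)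
  qed
  ultimately show ?thesis by (simp only:)
qed

end

section \<open>Low modes, adjointness and the correlation forms\<close>

context correlator begin

text \<open>
  \<open>\<omega>\<^sub>0 = L(-1)\<close> is the derivative with respect to the insertion point.
\<close>
lemma corr_hit0:
  assumes "states \<sigma>" "p \<in> set ps"
  shows "corr (hit p 0 \<sigma>) e = (e p + 1) * corr \<sigma> (e(p := e p + 1))"
proof -
  from assms(2) obtain as bs where ps: "ps = as @ p # bs" by (blast dest: split_list)
  obtain \<gamma> where \<gamma>: "chain D op lab src as one \<gamma>" "chain D op lab src bs (src p) one"
    "lab p \<in> labels D" "src p \<in> labels D" "\<gamma> \<in> labels D" "op p \<in> intertwiner_space D (lab p) (src p) \<gamma>"
    using ch ps by (auto simp: chain_append)
  have sas: "\<sigma> q \<in> space D (lab q)" if "q \<in> set ps" for q using assms(1) that by (simp add: states_def)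
  have d: "p \<notin> set as" "p \<notin> set bs" using dist ps by auto
  have corr_ps: "corr \<tau> e' = vacuum_value (apply_ops op \<tau> e' as (apply_ops op \<tau> e' (p # bs) vac))" for \<tau> e'
    unfolding corr_def by (simp only: ps apply_ops_append)
  let ?u = "apply_ops op \<sigma> e bs vac"
  have u: "?u \<in> space D (src p)" by (rule apply_ops_space[OF \<gamma>(2) _ vac_space]) (use sas ps in auto)
  let ?x = "op p (\<sigma> p) (- (e p + 1) - 1) ?u"
  have xs: "?x \<in> space D \<gamma>" by (rule int_closed[OF \<gamma>(6,3,4,5) sas[OF assms(2)] u])
  have "op p (om (lab p) 0 (\<sigma> p)) (- e p - 1) ?u = sc (- (- e p - 1)) (op p (\<sigma> p) (- e p - 1 - 1) ?u)"
    by (rule int_Lm1[OF \<gamma>(6,3,4,5) sas[OF assms(2)] u])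
  then have 1: "op p (om (lab p) 0 (\<sigma> p)) (- e p - 1) ?u = sc (e p + 1) ?x" by (simp add: algebra_simps)
  have "apply_ops op \<sigma> e as (sc (e p + 1) ?x) = sc (e p + 1) (apply_ops op \<sigma> e as ?x)"
    by (rule apply_ops_scale[OF \<gamma>(1) _ xs]) (use sas ps in auto)
  moreover have "apply_ops op \<sigma> e as ?x \<in> space D one"
    by (rule apply_ops_space[OF \<gamma>(1) _ xs]) (use sas ps in auto)
  ultimately have "vacuum_value (apply_ops op \<sigma> e as (sc (e p + 1) ?x)) = (e p + 1) * vacuum_value (apply_ops op \<sigma> e as ?x)"
    by (simp add: vacuum_value_scale)
  then show ?thesis using d 1 by (simp only: corr_ps apply_ops_Cons apply_ops_upd fun_upd_same not_False_eq_True)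
qed

lemma corr_hit1:
  assumes "homog \<sigma> wt" "p \<in> set ps"
  shows "corr (hit p 1 \<sigma>) e = wt p * corr \<sigma> e"
proof -
  have "om (lab p) 1 (\<sigma> p) = sc (wt p) (\<sigma> p)" using assms by (simp add: homog_def wp_iff)
  then have "corr (hit p 1 \<sigma>) e = wt p * corr (\<sigma>(p := \<sigma> p)) e"
    using corr_scale[OF homog_states[OF assms(1)] assms(2), of "\<sigma> p" "wt p" e] homog_states[OF assms(1)] assms(2)
    by (simp add: states_def)
  then show ?thesis by simp
qed

end

lemma sum_PiE_coord:
  assumes "a \<in> I"
  shows "(\<Sum>b\<in>PiE I X. f b) = (\<Sum>b\<in>PiE (I - {a}) X. \<Sum>x\<in>X a. f (b(a := x)))"
proof -
  have I: "I = insert a (I - {a})" using assms by blast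
  have "(\<Sum>b\<in>PiE I X. f b) = (\<Sum>b\<in>(\<lambda>(y, g). g(a := y)) ` (X a \<times> PiE (I - {a}) X). f b)"
    by (subst I) (simp only: PiE_insert_eq)
  also have "\<dots> = (\<Sum>(y, g)\<in>X a \<times> PiE (I - {a}) X. f (g(a := y)))"
    by (subst sum.reindex[OF inj_combinator]) (simp_all add: case_prod_unfold)
  also have "\<dots> = (\<Sum>x\<in>X a. \<Sum>b\<in>PiE (I - {a}) X. f (b(a := x)))"
    by (simp add: sum.cartesian_product)
  also have "\<dots> = (\<Sum>b\<in>PiE (I - {a}) X. \<Sum>x\<in>X a. f (b(a := x)))" by (rule sum.swap)
  finally show ?thesis .
qed

context genus_data begin

lemma admissible_upd: "p \<in> P \<union> R \<Longrightarrow> admissible (e(p := c)) = admissible e"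
  by (auto simp: admissible_def)

lemma P_R: "p \<in> P \<Longrightarrow> p \<notin> R" using disj by blast

lemma basis_choices_upd: "p \<in> P \<Longrightarrow> basis_choices (e(p := c)) = basis_choices e"
  by (rule basis_choices_cong) (use P_R in auto)

lemma hit_series_0: "p \<in> P \<Longrightarrow> hit_series p 0 = deriv_series p base_series"
proof
  fix e assume p: "p \<in> P"
  have "corr (hit p 0 (inserted b)) e = (e p + 1) * corr (inserted b) (e(p := e p + 1))" if "b \<in> basis_choices e" for b
    by (rule corr_hit0[OF homog_states[OF inserted_homog[OF that]] p])
  then show "hit_series p 0 e = deriv_series p base_series e"
    using p by (simp add: hit_series_def base_series_def deriv_series_def admissible_upd basis_choices_upd sum_distrib_left)
qed

lemma hit_series_1: "p \<in> P \<Longrightarrow> hit_series p 1 e = inserted_weight e p * base_series e"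
  using corr_hit1[OF inserted_homog, of _ e p e] by (simp add: hit_series_def base_series_def sum_distrib_left)

text \<open>
  Non-negative modes annihilate the vacuum, so the point \<open>x\<close> itself contributes no
  terms to a Ward identity.
\<close>
lemma hit_series_vac: "hit_series Xv (int m) = (\<lambda>_. 0)"
proof
  fix e
  have "corr (hit Xv (int m) (inserted b)) e = 0" if "b \<in> basis_choices e" for b
  proof (rule corr_zero[OF hit_states[OF homog_states[OF inserted_homog[OF that]]], of Xv])
    show "hit Xv (int m) (inserted b) Xv = 0"
      using vac_om_nonneg[of m] by (simp add: state_label_def inserted_def)
  qed (simp add: set_positions)
  then show "hit_series Xv (int m) e = 0" by (simp add: hit_series_def)
qed

text \<open>
  The form with \<open>\<omega>\<close> removed at \<open>y\<^sub>k\<close>: inserting the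
  vacuum there is the identity operator.
\<close>
definition drop_series :: "nat \<Rightarrow> fseries" where
  "drop_series k e = (if admissible e then \<Sum>b\<in>basis_choices e. corr ((inserted b)(Yv k := vac)) e else 0)"

text \<open>
  The operator product of \<open>\<omega>\<close> with \<open>\<omega>\<close>.
\<close>
lemma hit_series_Y:
  assumes k: "k \<in> {1..n}"
  shows "hit_series (Yv k) (int m) = (if m = 0 then deriv_series (Yv k) base_series else if m = 1 then (\<lambda>e. 2 * base_series e)
     else if m = 3 then (\<lambda>e. central_charge D / 2 * drop_series k e) else (\<lambda>_. 0))"
proof -
  have p: "Yv k \<in> P" using k by (simp add: set_positions)
  have l: "state_label (Yv k) = one" "inserted b (Yv k) = conformal D" for b by (simp_all add: state_label_def inserted_def)
  consider "m = 0" | "m = 1" | "m = 3" | "m \<noteq> 0 \<and> m \<noteq> 1 \<and> m \<noteq> 3" by blast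
  then show ?thesis
  proof cases
    case 1
    then show ?thesis using hit_series_0[OF p] by simp
  next
    case 2
    then show ?thesis using hit_series_1[OF p] by (auto simp: fun_eq_iff inserted_weight_def)
  next
    case 3
    show ?thesis
    proof
      fix e
      have "corr (hit (Yv k) (int m) (inserted b)) e = central_charge D / 2 * corr ((inserted b)(Yv k := vac)) e"
        if "b \<in> basis_choices e" for b
      proof -
        have "hit (Yv k) (int m) (inserted b) = (inserted b)(Yv k := sc (central_charge D / 2) vac)"
          unfolding l om_omega using 3 by simp
        then show ?thesis
          using corr_scale[OF homog_states[OF inserted_homog[OF that]] p, of vac] vac_space l by simp
      qed
      then have eq: "(\<Sum>b\<in>basis_choices e. corr (hit (Yv k) (int m) (inserted b)) e)
          = central_charge D / 2 * (\<Sum>b\<in>basis_choices e. corr ((inserted b)(Yv k := vac)) e)"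
        unfolding sum_distrib_left by (rule sum.cong[OF refl])
      have "hit_series (Yv k) (int m) e = central_charge D / 2 * drop_series k e"
        unfolding hit_series_def drop_series_def by (cases "admissible e") (simp_all only: eq if_True if_False mult_zero_right)
      then show "hit_series (Yv k) (int m) e = (if m = 0 then deriv_series (Yv k) base_series else if m = 1 then (\<lambda>e. 2 * base_series e)
     else if m = 3 then (\<lambda>e. central_charge D / 2 * drop_series k e) else (\<lambda>_. 0)) e"
        using 3 by simp
    qed
  next
    case 4
    show ?thesis
    proof
      fix e
      have "corr (hit (Yv k) (int m) (inserted b)) e = 0" if "b \<in> basis_choices e" for b
      proof (rule corr_zero[OF hit_states[OF homog_states[OF inserted_homog[OF that]]] p])
        have "om one (int m) (conformal D) = 0" unfolding om_omega using 4 by simp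
        then show "hit (Yv k) (int m) (inserted b) (Yv k) = 0" using l by simp
      qed
      then show "hit_series (Yv k) (int m) e = (if m = 0 then deriv_series (Yv k) base_series else if m = 1 then (\<lambda>e. 2 * base_series e)
     else if m = 3 then (\<lambda>e. central_charge D / 2 * drop_series k e) else (\<lambda>_. 0)) e"
        unfolding hit_series_def using 4 by simp
    qed
  qed
qed

text \<open>
  The trace identity for one handle. The sum over the basis vector at the handle
  \<open>a\<close> is separated from the choices at the other handles, and the correlator is a
  bilinear function of the two states at \<open>w\<^sub>a\<close> and
  \<open>w\<^sub>-\<^sub>a\<close>.
\<close>
lemma hit_series_adj_pos:
  assumes a: "a \<in> {1..g}"
  shows "hit_series (Wv (int a)) m e = hit_series (Wv (- int a)) (2 - m) (e(Rv (int a) := e (Rv (int a)) - of_int m + 1))"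
proof -
  let ?e = "e(Rv (int a) := e (Rv (int a)) - of_int m + 1)"
  let ?p = "Wv (int a)" and ?q = "Wv (- int a)"
  let ?X = "\<lambda>a. B a \<inter> wp (\<alpha> a) (e (Rv (int a)))" and ?X' = "\<lambda>a. B a \<inter> wp (\<alpha> a) (?e (Rv (int a)))"
  have pq: "?p \<in> P" "?q \<in> P" "?p \<noteq> ?q" using a by (auto simp: set_positions idx_def)
  have l: "state_label ?p = \<alpha> a" "state_label ?q = contra D (\<alpha> a)" using a by (auto simp: state_label_def)
  have ok: "admissible ?e = admissible e" by (rule admissible_upd) (use a in auto)
  have corr_e: "corr \<tau> ?e = corr \<tau> e" for \<tau>
    by (rule corr_cong) (auto simp: set_positions)
  have in1: "inserted (b(a := x)) = (inserted b)(?p := x, ?q := B' a x)" for b x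
  proof
    fix r
    show "inserted (b(a := x)) r = ((inserted b)(?p := x, ?q := B' a x)) r"
    proof (cases r)
      case (Wv c)
      have "nat c = a \<longleftrightarrow> c = int a" if "c > 0" using that by auto
      moreover have "nat (- c) = a \<longleftrightarrow> c = - int a" if "\<not> c > 0" using that by auto
      ultimately show ?thesis using a Wv by (cases "c > 0") (auto simp: inserted_def)
    qed (simp_all add: inserted_def)
  qed
  have "(\<Sum>b\<in>basis_choices e. corr (hit ?p m (inserted b)) e) = (\<Sum>b\<in>PiE ({1..g} - {a}) ?X. \<Sum>x\<in>?X a. corr (hit ?p m (inserted (b(a := x)))) e)"
    unfolding basis_choices_def by (rule sum_PiE_coord[OF a])
  also have "\<dots> = (\<Sum>b\<in>PiE ({1..g} - {a}) ?X. \<Sum>x\<in>?X' a. corr (hit ?q (2 - m) (inserted (b(a := x)))) e)"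
  proof (rule sum.cong[OF refl])
    fix b assume b: "b \<in> PiE ({1..g} - {a}) ?X"
    define \<Phi> where "\<Phi> x y = corr ((inserted b)(?p := x, ?q := y)) e" for x y
    have bc: "b c \<in> B c" if "c \<in> {1..g}" "c \<noteq> a" for c
    proof -
      have "c \<in> {1..g} - {a}" using that by simp
      from PiE_mem[OF b this] show ?thesis by (rule IntD1)
    qed
    have other: "inserted b r \<in> space D (state_label r)" if r: "r \<in> P" "r \<noteq> ?p" "r \<noteq> ?q" for r
    proof (cases r)
      case (Wv c)
      then have c: "c \<noteq> 0" "\<bar>c\<bar> \<le> int g" "c \<noteq> int a" "c \<noteq> - int a" using r by (auto simp: set_positions idx_def)
      show ?thesis
      proof (cases "c > 0")
        case True
        then have "nat c \<in> {1..g}" "nat c \<noteq> a" using c by auto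
        then show ?thesis using base_space[of "nat c"] bc[of "nat c"] True Wv by (simp add: inserted_def state_label_def)
      next
        case False
        then have "nat (- c) \<in> {1..g}" "nat (- c) \<noteq> a" using c by auto
        then show ?thesis using base_facts(4)[of "nat (- c)"] bc[of "nat (- c)"] False Wv by (simp add: inserted_def state_label_def)
      qed
    qed (use r omega_space vac_space in \<open>auto simp: inserted_def state_label_def set_positions\<close>)
    have st: "states ((inserted b)(?p := x, ?q := y))" if "x \<in> space D (\<alpha> a)" "y \<in> space D (contra D (\<alpha> a))" for x y
      unfolding states_def
    proof
      fix r assume r: "r \<in> P"
      show "((inserted b)(?p := x, ?q := y)) r \<in> space D (state_label r)"
        using that other[OF r] l by (cases "r = ?q"; cases "r = ?p") simp_all
    qed
    have tw: "(inserted b)(?p := x, ?q := y, ?p := x') = (inserted b)(?p := x', ?q := y)" for x y x'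
      using pq(3) by (auto simp: fun_eq_iff)
    have z: "0 \<in> space D (\<alpha> a)" "0 \<in> space D (contra D (\<alpha> a))"
      using zero_space \<alpha>[OF a] contra_label by auto
    have a1: "additive_on (space D (\<alpha> a)) (\<lambda>x. \<Phi> x y)" if "y \<in> space D (contra D (\<alpha> a))" for y
      using corr_additive_on[OF st[OF z(1) that] pq(1), of e] unfolding l \<Phi>_def tw .
    have s1: "\<Phi> (sc c x) y = c * \<Phi> x y" if "x \<in> space D (\<alpha> a)" "y \<in> space D (contra D (\<alpha> a))" for c x y
      using corr_scale[OF st[OF z(1) that(2)] pq(1), of x c e] that unfolding l \<Phi>_def tw by simp
    have a2: "additive_on (space D (contra D (\<alpha> a))) (\<lambda>y. \<Phi> x y)" if "x \<in> space D (\<alpha> a)" for x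
      using corr_additive_on[OF st[OF that z(2)] pq(2), of e] unfolding l \<Phi>_def fun_upd_upd .
    have s2: "\<Phi> x (sc c y) = c * \<Phi> x y" if "x \<in> space D (\<alpha> a)" "y \<in> space D (contra D (\<alpha> a))" for c x y
      using corr_scale[OF st[OF that(1) z(2)] pq(2), of y c e] that unfolding l \<Phi>_def fun_upd_upd by simp
    have "(\<Sum>x\<in>?X a. corr (hit ?p m (inserted (b(a := x)))) e) = (\<Sum>x\<in>?X a. \<Phi> (om (\<alpha> a) m x) (B' a x))"
    proof (rule sum.cong[OF refl])
      fix x
      have "inserted (b(a := x)) ?p = x" using a by (simp add: inserted_def)
      then have "hit ?p m (inserted (b(a := x))) = (inserted b)(?p := om (\<alpha> a) m x, ?q := B' a x)"
        unfolding in1 l using tw by simp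
      then show "corr (hit ?p m (inserted (b(a := x)))) e = \<Phi> (om (\<alpha> a) m x) (B' a x)" by (simp only: \<Phi>_def)
    qed
    also have "\<dots> = (\<Sum>z\<in>?X' a. \<Phi> z (om (contra D (\<alpha> a)) (2 - m) (B' a z)))"
      by (rule trace_adjoint[OF a a1 s1 a2 s2]) simp_all
    also have "\<dots> = (\<Sum>x\<in>?X' a. corr (hit ?q (2 - m) (inserted (b(a := x)))) e)"
    proof (rule sum.cong[OF refl])
      fix x
      have "hit ?q (2 - m) (inserted (b(a := x))) = (inserted b)(?p := x, ?q := om (contra D (\<alpha> a)) (2 - m) (B' a x))"
        unfolding in1 l by simp
      then show "\<Phi> x (om (contra D (\<alpha> a)) (2 - m) (B' a x)) = corr (hit ?q (2 - m) (inserted (b(a := x)))) e"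
        by (simp only: \<Phi>_def)
    qed
    finally show "(\<Sum>x\<in>?X a. corr (hit ?p m (inserted (b(a := x)))) e) = (\<Sum>x\<in>?X' a. corr (hit ?q (2 - m) (inserted (b(a := x)))) e)" .
  qed
  also have "PiE ({1..g} - {a}) ?X = PiE ({1..g} - {a}) ?X'" by (rule PiE_cong) auto
  also have "(\<Sum>b\<in>PiE ({1..g} - {a}) ?X'. \<Sum>x\<in>?X' a. corr (hit ?q (2 - m) (inserted (b(a := x)))) e)
     = (\<Sum>b\<in>basis_choices ?e. corr (hit ?q (2 - m) (inserted b)) e)"
    unfolding basis_choices_def by (rule sum_PiE_coord[OF a, symmetric])
  finally show ?thesis by (simp only: hit_series_def ok corr_e)
qed

lemma hit_series_adj:
  assumes a: "a \<in> idx g"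
  shows "hit_series (Wv a) m = rho_pow a (of_int m - 1) \<star> hit_series (Wv (- a)) (2 - m)"
proof
  fix e
  show "hit_series (Wv a) m e = (rho_pow a (of_int m - 1) \<star> hit_series (Wv (- a)) (2 - m)) e"
  proof (cases "a > 0")
    case True
    have "nat a \<in> {1..g}" using a True by (auto simp: idx_def)
    from hit_series_adj_pos[OF this, of m e] show ?thesis
      using True by (simp add: rho_pow_def monom1_fmult algebra_simps)
  next
    case False
    then have m: "nat (- a) \<in> {1..g}" using a by (auto simp: idx_def)
    show ?thesis
      using hit_series_adj_pos[OF m, of "2 - m" "e(Rv \<bar>a\<bar> := e (Rv \<bar>a\<bar>) - (of_int m - 1))"] False
      by (simp add: rho_pow_def monom1_fmult algebra_simps fun_upd_idem)
  qed
qed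

lemma handle_modes_eq:
  "handle_modes D g \<alpha> \<beta> B' b e = map (\<lambda>p. insertion_op p (inserted b p) (- e p - 1)) (handles [1..<Suc g])"
  unfolding handle_modes_def handles_def map_concat map_map Let_def
  by (intro arg_cong[of _ _ concat] map_cong refl) (auto simp: insertion_op_def inserted_def mid_label_def o_def)

text \<open>
  A point that carries the vacuum contributes the identity operator, whose only non-zero mode
  forces the exponent of that point to be 0. Hence forms with fewer insertions are correlators
  on the full list of points. The predicate \<open>K\<close> selects the points of the form.
\<close>
lemma correlation_corr:
  assumes \<tau>: "\<And>p. K p \<Longrightarrow> \<tau> p \<in> space D one"
  shows "correlation D g \<alpha> \<beta> B B' (map (\<lambda>p. (\<tau> p, p)) (filter K (Xv # map Yv [1..<Suc n]))) e =
    (if admissible e then \<Sum>b\<in>basis_choices e. corr (\<lambda>p. case p of Wv a \<Rightarrow> inserted b p | _ \<Rightarrow> if K p then \<tau> p else vac) e else 0)"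
proof -
  let ?xs = "Xv # map Yv [1..<Suc n]"
  let ?st = "\<lambda>b p. case p of Wv a \<Rightarrow> inserted b p | _ \<Rightarrow> if K p then \<tau> p else vac"
  let ?Z = "\<lambda>xs. \<forall>p\<in>set xs. \<not> K p \<longrightarrow> e p = 0"
  let ?h = "\<lambda>b. apply_ops insertion_op (inserted b) e (handles [1..<Suc g]) vac"
  \<comment> \<open>The condition \<open>?Z\<close> says that the exponents of the vacuum points vanish.\<close>
  have val: "apply_ops insertion_op (?st b) e xs u = (if ?Z xs then foldr (\<lambda>T u. T u)
      (map (\<lambda>(v, p). algebra_vop D v (- e p - 1)) (map (\<lambda>p. (\<tau> p, p)) (filter K xs))) u else 0) \<and>
     apply_ops insertion_op (?st b) e xs u \<in> space D one"
    if "u \<in> space D one" "set xs \<subseteq> insert Xv (range Yv)" for b u xs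
    using that(2)
  proof (induction xs)
    case Nil
    then show ?case using that by simp
  next
    case (Cons x xs)
    let ?w = "apply_ops insertion_op (?st b) e xs u"
    have IH: "?w = (if ?Z xs then foldr (\<lambda>T u. T u)
      (map (\<lambda>(v, p). algebra_vop D v (- e p - 1)) (map (\<lambda>p. (\<tau> p, p)) (filter K xs))) u else 0)"
      "?w \<in> space D one"
    proof -
      have "set xs \<subseteq> insert Xv (range Yv)" using Cons.prems by simp
      from Cons.IH[OF this] show "?w = (if ?Z xs then foldr (\<lambda>T u. T u)
      (map (\<lambda>(v, p). algebra_vop D v (- e p - 1)) (map (\<lambda>p. (\<tau> p, p)) (filter K xs))) u else 0)"
      "?w \<in> space D one" by blast+
    qed
    have x: "insertion_op x = vop D one" "?st b x = (if K x then \<tau> x else vac)"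
      using Cons.prems by (auto simp: insertion_op_def)
    show ?case
    proof (cases "K x")
      case True
      then have "apply_ops insertion_op (?st b) e (x # xs) u = vop D one (\<tau> x) (- e x - 1) ?w" using x by simp
      moreover have "vop D one (\<tau> x) (- e x - 1) ?w \<in> space D one"
        by (rule int_closed[OF vop_int[OF one_label] one_label one_label one_label \<tau>[OF True] IH(2)])
      moreover have "vop D one (\<tau> x) (- e x - 1) 0 = 0"
        by (rule int_zero2[OF vop_int[OF one_label] one_label one_label one_label \<tau>[OF True]])
      ultimately show ?thesis using True IH(1) zero_space[OF one_label]
        by (cases "?Z xs") (auto simp: case_prod_unfold)
    next
      case False
      have "apply_ops insertion_op (?st b) e (x # xs) u = vop D one vac (- e x - 1) ?w" using x False by simp
      also have "\<dots> = (if e x = 0 then ?w else 0)" using vac_mode[OF one_label IH(2)] by auto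
      finally have "apply_ops insertion_op (?st b) e (x # xs) u = (if e x = 0 then ?w else 0)" .
      then show ?thesis using False IH zero_space[OF one_label]
        by (cases "?Z xs"; cases "e x = 0") (auto simp del: apply_ops_Cons)
    qed
  qed
  have ok: "(\<forall>p. p \<notin> snd ` set (map (\<lambda>p. (\<tau> p, p)) (filter K ?xs)) \<union> Wv ` idx g \<union> Rv ` {1..int g} \<longrightarrow> e p = 0)
     \<longleftrightarrow> admissible e \<and> ?Z ?xs"
  proof -
    have "snd ` set (map (\<lambda>p. (\<tau> p, p)) (filter K ?xs)) = {p \<in> set ?xs. K p}" by (auto simp: image_iff)
    moreover have "P = set ?xs \<union> Wv ` idx g" unfolding positions_def by (simp only: set_append append_Cons[symmetric] set_handles)
    moreover have "set ?xs \<inter> (Wv ` idx g \<union> Rv ` {1..int g}) = {}" by auto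
    ultimately show ?thesis unfolding admissible_def by blast
  qed
  have cors: "corr (?st b) e = (if ?Z ?xs then vacuum_value (foldr (\<lambda>T u. T u)
      (map (\<lambda>(v, p). algebra_vop D v (- e p - 1)) (map (\<lambda>p. (\<tau> p, p)) (filter K ?xs)) @ handle_modes D g \<alpha> \<beta> B' b e) vac) else 0)"
    if b: "b \<in> basis_choices e" for b
  proof -
    have "apply_ops insertion_op (?st b) e (handles [1..<Suc g]) vac = ?h b"
      by (rule apply_ops_cong) (auto simp only: set_handles fvar.case)
    moreover have h: "?h b \<in> space D one"
    proof (rule apply_ops_space)
      show "chain D insertion_op state_label source_label (handles [1..<Suc g]) one one"
        using chain_handles[of 1] by (simp add: mid_label_def del: upt_Suc)
      fix p assume "p \<in> set (handles [1..<Suc g])"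
      then have "p \<in> P" unfolding set_handles set_positions by blast
      then show "inserted b p \<in> space D (state_label p)" using homog_states[OF inserted_homog[OF b]] by (simp add: states_def)
    qed (rule vac_space)
    moreover have "foldr (\<lambda>T u. T u) (handle_modes D g \<alpha> \<beta> B' b e) vac = ?h b"
      by (simp only: handle_modes_eq foldr_map apply_ops_def o_def)
    moreover have "corr (?st b) e = vacuum_value (apply_ops insertion_op (?st b) e ?xs (apply_ops insertion_op (?st b) e (handles [1..<Suc g]) vac))"
      by (rule trans[OF corr_def]) (simp only: positions_def append_Cons[symmetric] apply_ops_append)
    moreover have "vacuum_value 0 = 0" by (rule additive_on_0[OF vacuum_value_additive_on zero_space[OF one_label]])
    moreover have "apply_ops insertion_op (?st b) e ?xs (?h b) = (if ?Z ?xs then foldr (\<lambda>T u. T u)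
      (map (\<lambda>(v, p). algebra_vop D v (- e p - 1)) (map (\<lambda>p. (\<tau> p, p)) (filter K ?xs))) (?h b) else 0)"
      by (rule conjunct1[OF val[OF h]]) (auto simp del: upt_Suc)
    ultimately show ?thesis by (simp only: foldr_append if_distrib[of vacuum_value])
  qed
  define Z where "Z = ?Z ?xs"
  define V where "V b = vacuum_value (foldr (\<lambda>T u. T u)
      (map (\<lambda>(v, p). algebra_vop D v (- e p - 1)) (map (\<lambda>p. (\<tau> p, p)) (filter K ?xs)) @ handle_modes D g \<alpha> \<beta> B' b e) vac)" for b
  have "correlation D g \<alpha> \<beta> B B' (map (\<lambda>p. (\<tau> p, p)) (filter K ?xs)) e = (if admissible e \<and> Z then \<Sum>b\<in>basis_choices e. V b else 0)"
    unfolding correlation_def ok basis_choices_def V_def Z_def vacuum_value_def by (rule refl)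
  moreover have "(\<Sum>b\<in>basis_choices e. corr (?st b) e) = (\<Sum>b\<in>basis_choices e. if Z then V b else 0)"
    unfolding V_def Z_def by (rule sum.cong[OF refl cors])
  ultimately show ?thesis by (cases "admissible e"; cases Z) (simp_all only: if_True if_False simp_thms sum.neutral_const)
qed

lemma base_series_correlation:
  "base_series = correlation D g \<alpha> \<beta> B B' (map (\<lambda>k. (conformal D, Yv k)) [1..<Suc n])"
proof
  fix e
  have "filter (\<lambda>p. p \<noteq> Xv) (Xv # map Yv [1..<Suc n]) = map Yv [1..<Suc n]"
    by (simp add: filter_map o_def del: upt_Suc)
  moreover have "corr (\<lambda>p. case p of Wv a \<Rightarrow> inserted b p | _ \<Rightarrow> if p \<noteq> Xv then conformal D else vac) e = corr (inserted b) e" for b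
    by (rule corr_cong) (auto simp: set_positions inserted_def)
  ultimately show "base_series e = correlation D g \<alpha> \<beta> B B' (map (\<lambda>k. (conformal D, Yv k)) [1..<Suc n]) e"
    using correlation_corr[of "\<lambda>p. p \<noteq> Xv" "\<lambda>_. conformal D" e] omega_space
    by (simp only: base_series_def map_map o_def)
qed

lemma hit_series_correlation:
  "hit_series Xv (- 1) = correlation D g \<alpha> \<beta> B B' ((conformal D, Xv) # map (\<lambda>k. (conformal D, Yv k)) [1..<Suc n])"
proof
  fix e
  have "corr (\<lambda>p. case p of Wv a \<Rightarrow> inserted b p | _ \<Rightarrow> if True then conformal D else vac) e = corr (hit Xv (- 1) (inserted b)) e" for b
  proof (rule corr_cong)
    fix p assume "p \<in> P"
    then show "(case p of Wv a \<Rightarrow> inserted b p | _ \<Rightarrow> if True then conformal D else vac) = hit Xv (- 1) (inserted b) p"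
      using vac_om_m1 by (auto simp: set_positions inserted_def state_label_def)
  qed simp
  moreover have "map (\<lambda>p. (conformal D, p)) (filter (\<lambda>p. True) (Xv # map Yv [1..<Suc n]))
      = (conformal D, Xv) # map (\<lambda>k. (conformal D, Yv k)) [1..<Suc n]"
    by (simp add: o_def del: upt_Suc)
  ultimately show "hit_series Xv (- 1) e = correlation D g \<alpha> \<beta> B B' ((conformal D, Xv) # map (\<lambda>k. (conformal D, Yv k)) [1..<Suc n]) e"
    using correlation_corr[of "\<lambda>p. True" "\<lambda>_. conformal D" e, OF omega_space]
    by (simp only: hit_series_def)
qed

lemma drop_series_correlation:
  assumes "k \<in> {1..n}"
  shows "drop_series k = correlation D g \<alpha> \<beta> B B' (map (\<lambda>j. (conformal D, Yv j)) (filter (\<lambda>j. j \<noteq> k) [1..<Suc n]))"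
proof
  fix e
  have "filter (\<lambda>p. p \<noteq> Xv \<and> p \<noteq> Yv k) (Xv # map Yv [1..<Suc n]) = map Yv (filter (\<lambda>j. j \<noteq> k) [1..<Suc n])"
    by (simp add: filter_map o_def del: upt_Suc)
  moreover have "corr (\<lambda>p. case p of Wv a \<Rightarrow> inserted b p | _ \<Rightarrow> if p \<noteq> Xv \<and> p \<noteq> Yv k then conformal D else vac) e
      = corr ((inserted b)(Yv k := vac)) e" for b
    by (rule corr_cong) (auto simp: set_positions inserted_def)
  ultimately show "drop_series k e = correlation D g \<alpha> \<beta> B B' (map (\<lambda>j. (conformal D, Yv j)) (filter (\<lambda>j. j \<noteq> k) [1..<Suc n])) e"
    using correlation_corr[of "\<lambda>p. p \<noteq> Xv \<and> p \<noteq> Yv k" "\<lambda>_. conformal D" e] omega_space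
    by (simp only: drop_series_def map_map o_def)
qed

end

section \<open>The Ward identity with the Bers kernel\<close>

lemma hderiv_commute: "p \<noteq> q \<Longrightarrow> hderiv p r (hderiv q m F) = hderiv q m (hderiv p r F)"
  by (rule ext) (simp add: hderiv_eq fun_upd_twist mult_ac)

lemma hderiv_monom1: "hderiv q m (monom1 q (of_nat l)) = (\<lambda>e. of_nat (l choose m) * monom1 q (of_nat l - of_nat m) e)"
proof
  fix e :: "fvar \<Rightarrow> complex"
  have "e(q := e q + of_nat m) = (\<lambda>_. 0)(q := of_nat l) \<longleftrightarrow> e = (\<lambda>_. 0)(q := of_nat l - of_nat m)"
  proof
    assume a: "e(q := e q + of_nat m) = (\<lambda>_. 0)(q := of_nat l)"
    have "e q + of_nat m = of_nat l" using fun_cong[OF a, of q] by simp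
    then have "e q = of_nat l - of_nat m" by (simp only: eq_diff_eq)
    moreover have "e x = 0" if "x \<noteq> q" for x using fun_cong[OF a, of x] that by simp
    ultimately show "e = (\<lambda>_. 0)(q := of_nat l - of_nat m)" by (auto simp: fun_eq_iff)
  qed (auto simp: fun_eq_iff)
  then show "hderiv q m (monom1 q (of_nat l)) e = of_nat (l choose m) * monom1 q (of_nat l - of_nat m) e"
    by (auto simp: hderiv_eq monom1_def binomial_gbinomial)
qed

lemma laurent_outside: "laurent p c d \<noteq> 0 \<Longrightarrow> x \<noteq> p \<Longrightarrow> d x = 0"
  by (auto simp: laurent_def split: if_splits)

text \<open>
  The derivatives of the coefficient \<open>f\<^sub>l\<close> of \<open>q\<^sup>l\<close> in
  \<open>\<pi>\<^sub>2(p,q)\<close>.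
\<close>
definition f_deriv :: "(fvar \<Rightarrow> nat \<Rightarrow> int \<Rightarrow> complex) \<Rightarrow> fvar \<Rightarrow> nat \<Rightarrow> nat \<Rightarrow> fseries" where
  "f_deriv f p r l = hderiv p r (laurent p (f p l))"

lemma f_deriv_supp: "f_deriv f p r l d \<noteq> 0 \<Longrightarrow> \<exists>z. d = (\<lambda>_. 0)(p := z)"
proof -
  assume "f_deriv f p r l d \<noteq> 0"
  then have "laurent p (f p l) (d(p := d p + of_nat r)) \<noteq> 0" by (simp add: f_deriv_def hderiv_eq)
  then have "d x = 0" if "x \<noteq> p" for x using laurent_outside[of p "f p l" "d(p := d p + of_nat r)" x] that by simp
  then show ?thesis by (intro exI[of _ "d p"]) (auto simp: fun_eq_iff)
qed

text \<open>
  The mixed derivatives of the polynomial \<open>\<pi>\<^sub>2(p,q) - 1/(p - q)\<close> of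
  degree 2 in \<open>q\<close>. Unlike the pole it makes sense for \<open>q = p\<close>, where
  it is the entry \<open>A\<^sub>a\<^sub>,\<^sub>-\<^sub>a\<close> of the moment matrix.
\<close>
definition quadratic_part :: "(fvar \<Rightarrow> nat \<Rightarrow> int \<Rightarrow> complex) \<Rightarrow> fvar \<Rightarrow> nat \<Rightarrow> fvar \<Rightarrow> nat \<Rightarrow> fseries" where
  "quadratic_part f p r q m = (\<lambda>e. \<Sum>l\<le>2. of_nat (l choose m) * (f_deriv f p r l \<star> monom1 q (of_nat l - of_nat m)) e)"

text \<open>
  The reason for the truncation of the moment matrix by \<open>\<Delta>\<close>: the modes at
  least 3 see only the pole.
\<close>
lemma quadratic_part_zero: "m \<ge> 3 \<Longrightarrow> quadratic_part f p r q m = (\<lambda>_. 0)"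
  by (rule ext) (auto simp: quadratic_part_def binomial_eq_0 intro!: sum.neutral)

lemma pi2_deriv_eq:
  assumes "p \<noteq> q"
  shows "pi2_deriv f r m p q = (\<lambda>e. pole_deriv p q r m e + quadratic_part f p r q m e)"
proof -
  have 1: "hderiv q m (laurent p (f p l) \<star> monom1 q (of_nat l)) = (\<lambda>e. of_nat (l choose m) * (laurent p (f p l) \<star> monom1 q (of_nat l - of_nat m)) e)" for l
  proof -
    have "hderiv q m (laurent p (f p l) \<star> monom1 q (of_nat l)) = laurent p (f p l) \<star> hderiv q m (monom1 q (of_nat l))"
      by (rule hderiv_fmult_const) (rule laurent_outside[OF _ not_sym[OF assms]])
    then show ?thesis by (simp only: hderiv_monom1) (rule ext, rule fmult_cmult_right)
  qed
  have 2: "hderiv p r (laurent p (f p l) \<star> monom1 q c) = f_deriv f p r l \<star> monom1 q c" for l c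
  proof -
    have "hderiv p r (monom1 q c \<star> laurent p (f p l)) = monom1 q c \<star> hderiv p r (laurent p (f p l))"
      by (rule hderiv_fmult_const) (use assms in \<open>auto simp: monom1_def split: if_splits\<close>)
    then show ?thesis by (simp only: f_deriv_def fmult_commute[of _ "monom1 q c"])
  qed
  have "hderiv q m (pi2 f p q) = (\<lambda>e. hderiv q m (inv_diff p q) e + (\<Sum>l\<le>2. 1 * hderiv q m (laurent p (f p l) \<star> monom1 q (of_nat l)) e))"
    unfolding pi2_def hderiv_add using hderiv_sum[where p = q and m = m and X = "{..2::nat}" and c = "\<lambda>_. 1" and F = "\<lambda>l. laurent p (f p l) \<star> monom1 q (of_nat l)"] by simp
  also have "\<dots> = (\<lambda>e. hderiv q m (inv_diff p q) e + (\<Sum>l\<le>2. of_nat (l choose m) * (laurent p (f p l) \<star> monom1 q (of_nat l - of_nat m)) e))"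
    by (simp only: 1 mult_1)
  finally show ?thesis unfolding pi2_deriv_def
    by (simp only: hderiv_add hderiv_sum 2 quadratic_part_def)
qed

context variables begin

lemma height_single: "outer_closed U \<Longrightarrow> height U ((\<lambda>_. 0)(p := c)) = (if p \<in> U then - c else 0)"
proof -
  assume "outer_closed U"
  then have "finite U" using fin(1) by (auto simp: outer_closed_def intro: finite_subset)
  then show ?thesis unfolding height_def sum_upd[OF \<open>finite U\<close>] by simp
qed

lemma total_degree_single: "total_degree ((\<lambda>_. 0)(p := c)) = (if p \<in> P then c else 0) + (if p \<in> R then 2 * c else 0)"
  unfolding total_degree_def sum_upd[OF fin(1)] sum_upd[OF fin(2)] by simp

lemma tame_monom: "p \<in> P \<union> R \<Longrightarrow> tame (supp (monom1 p c))"
proof (rule tame_finite)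
  show "finite (supp (monom1 p c))"
    by (rule finite_subset[of _ "{(\<lambda>_. 0)(p := c)}"]) (auto simp: supp_def monom1_def split: if_splits)
qed (auto simp: supp_def monom1_def split: if_splits)

lemma tame_monom_mult: "p \<in> P \<union> R \<Longrightarrow> tame (supp F) \<Longrightarrow> tame (supp (monom1 p c \<star> F))"
  by (rule tame_subset[OF tame_add[OF tame_monom] supp_fmult])

lemma slice_tame_monom_mult: "p \<in> P \<union> R \<Longrightarrow> slice_tame (supp F) \<Longrightarrow> slice_tame (supp (monom1 p c \<star> F))"
  by (rule slice_tame_subset[OF slice_tame_add[OF tame_monom] supp_fmult])

text \<open>
  One variable in both directions together with growing powers of one \<open>\<rho>\<close>: at
  a fixed total degree the power of \<open>\<rho>\<close> determines the exponent of the point,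
  which then decreases to minus infinity only, the direction that heights allow.
\<close>
lemma slice_tame_ray:
  assumes p: "p \<in> P" and r: "r \<in> R"
    and S: "\<And>d. d \<in> S \<Longrightarrow> \<exists>(m::nat) z. d = (\<lambda>x. ((\<lambda>_. 0)(p := z)) x + ((\<lambda>_. 0)(r := (of_nat m + 1) / 2)) x)"
  shows "slice_tame S"
  unfolding slice_tame_def tame_def cone_bounded_def
proof (intro allI conjI ballI impI)
  fix c
  have pr: "p \<notin> R" "r \<notin> P" "p \<noteq> r" using p r disj by auto
  let ?S = "{d \<in> S. total_degree d = c}"
  have form: "\<exists>m::nat. d = (\<lambda>x. ((\<lambda>_. 0)(p := c - of_nat m - 1)) x + ((\<lambda>_. 0)(r := (of_nat m + 1) / 2)) x)" if "d \<in> ?S" for d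
  proof -
    have "d \<in> S" using that by simp
    from S[OF this] obtain m :: nat and z where d: "d = (\<lambda>x. ((\<lambda>_. 0)(p := z)) x + ((\<lambda>_. 0)(r := (of_nat m + 1) / 2)) x)" by blast
    have "total_degree d = z + (of_nat m + 1)" unfolding d total_degree_add total_degree_single using p r pr by simp
    then have "z = c - of_nat m - 1" using that by (simp add: algebra_simps)
    then show ?thesis using d by blast
  qed
  {
    fix d x assume "d \<in> ?S" "x \<notin> P \<union> R"
    then show "d x = 0" using form[of d] p r by auto
  }
  {
    fix U assume U: "outer_closed U"
    have "r \<notin> U" using U pr by (auto simp: outer_closed_def)
    show "discrete_below (height U ` ?S)"
    proof (cases "p \<in> U")
      case True
      show ?thesis
      proof (rule discrete_belowI[of "{1 - c}"])
        fix x assume "x \<in> height U ` ?S"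
        then obtain d where d: "d \<in> ?S" "x = height U d" by blast
        obtain m :: nat where m: "d = (\<lambda>x. ((\<lambda>_. 0)(p := c - of_nat m - 1)) x + ((\<lambda>_. 0)(r := (of_nat m + 1) / 2)) x)"
          using form[OF d(1)] by blast
        have "x = (1 - c) + of_nat (2 * m) / 2"
          unfolding d(2) m height_add height_single[OF U] using True \<open>r \<notin> U\<close> by (simp add: algebra_simps)
        then show "\<exists>c\<in>{1 - c}. \<exists>k::nat. x = c + of_nat k / 2" by blast
      qed simp
    next
      case False
      have "height U d = 0" if "d \<in> ?S" for d
      proof -
        obtain m :: nat where m: "d = (\<lambda>x. ((\<lambda>_. 0)(p := c - of_nat m - 1)) x + ((\<lambda>_. 0)(r := (of_nat m + 1) / 2)) x)"
          using form[OF \<open>d \<in> ?S\<close>] by blast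
        show ?thesis unfolding m height_add height_single[OF U] using False \<open>r \<notin> U\<close> by simp
      qed
      then have "height U ` ?S \<subseteq> {0}" by blast
      then show ?thesis by (intro discrete_below_finite) (rule finite_subset, auto)
    qed
  }
  {
    fix r' assume r': "r' \<in> R"
    show "discrete_below ((\<lambda>d. d r') ` ?S)"
    proof (rule discrete_belowI[of "{0}"])
      fix x assume "x \<in> (\<lambda>d. d r') ` ?S"
      then obtain d where d: "d \<in> ?S" "x = d r'" by blast
      obtain m :: nat where m: "d = (\<lambda>x. ((\<lambda>_. 0)(p := c - of_nat m - 1)) x + ((\<lambda>_. 0)(r := (of_nat m + 1) / 2)) x)"
        using form[OF d(1)] by blast
      have "r' \<noteq> p" using r' pr by auto
      then have "x = 0 + of_nat (if r' = r then m + 1 else 0) / 2" unfolding d(2) m by simp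
      then show "\<exists>c\<in>{0}. \<exists>k::nat. x = c + of_nat k / 2" by blast
    qed simp
  }
  have "total_degree ` ?S \<subseteq> {c}" by blast
  then show "finite (total_degree ` ?S)" by (rule finite_subset) simp
qed

lemma slice_tame_line:
  assumes p: "p \<in> P" and S: "\<And>d. d \<in> S \<Longrightarrow> \<exists>z. d = (\<lambda>_. 0)(p := z)"
  shows "slice_tame S"
  unfolding slice_tame_def
proof
  fix c
  have "p \<notin> R" using p disj by blast
  have "{d \<in> S. total_degree d = c} \<subseteq> {(\<lambda>_. 0)(p := c)}"
  proof
    fix d assume d: "d \<in> {d \<in> S. total_degree d = c}"
    then obtain z where "d = (\<lambda>_. 0)(p := z)" using S by blast
    then show "d \<in> {(\<lambda>_. 0)(p := c)}" using d total_degree_single[of p z] p \<open>p \<notin> R\<close> by simp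
  qed
  moreover have "tame {(\<lambda>_. 0)(p := c)}" by (rule tame_finite) (use p in auto)
  ultimately show "tame {d \<in> S. total_degree d = c}" by (rule tame_subset[rotated])
qed

lemma slice_tame_f_deriv: "p \<in> P \<Longrightarrow> slice_tame (supp (f_deriv f p r l))"
  by (rule slice_tame_line[of p]) (use f_deriv_supp in \<open>auto simp: supp_def\<close>)

lemma supp_sum: "supp (\<lambda>e. \<Sum>x\<in>X. c x * F x e) \<subseteq> (\<Union>x\<in>X. supp (F x))"
  by (force simp: supp_def dest: sum.not_neutral_contains_not_neutral)

lemma supp_add: "supp (\<lambda>e. F e + G e) \<subseteq> supp F \<union> supp G"
  by (auto simp: supp_def)

lemma slice_tame_quadratic_part: "p \<in> P \<Longrightarrow> q \<in> P \<Longrightarrow> slice_tame (supp (quadratic_part f p r q m))"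
proof -
  assume "p \<in> P" "q \<in> P"
  then have "slice_tame (\<Union>l\<in>{..2}. supp (f_deriv f p r l \<star> monom1 q (of_nat l - of_nat m)))"
    by (intro slice_tame_UN) (auto simp: fmult_commute[of _ "monom1 q c" for c] intro!: slice_tame_monom_mult slice_tame_f_deriv)
  then show ?thesis unfolding quadratic_part_def by (rule slice_tame_subset[OF _ supp_sum])
qed

lemma pole_deriv_tame:
  assumes "p \<in> P" "q \<in> P" "outer p q \<or> outer q p"
  shows "tame (supp (pole_deriv p q r m))"
proof -
  have "total_degree ` supp (pole_deriv p q r m) \<subseteq> {- 1 - of_nat r - of_nat m}" using pole_deriv_total_degree[OF assms] by (auto simp: supp_def)
  then show ?thesis unfolding tame_def using pole_deriv_cone_bounded[OF assms] finite_subset by blast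
qed

lemma slice_tame_pi2_deriv:
  assumes "p \<in> P" "q \<in> P" "outer p q \<or> outer q p"
  shows "slice_tame (supp (pi2_deriv f r m p q))"
proof -
  have "p \<noteq> q" using assms by (auto simp: outer_def)
  have "slice_tame (supp (pole_deriv p q r m) \<union> supp (quadratic_part f p r q m))"
    by (intro slice_tame_Un tame_slice_tame pole_deriv_tame slice_tame_quadratic_part assms)
  then show ?thesis unfolding pi2_deriv_eq[OF \<open>p \<noteq> q\<close>] by (rule slice_tame_subset[OF _ supp_add])
qed

lemma pole_deriv_family_cone_bounded:
  assumes "p \<in> P" "q \<in> P" "outer p q \<or> outer q p"
  shows "cone_bounded (\<Union>m. supp (pole_deriv p q r m))"
  unfolding cone_bounded_def
proof (intro conjI ballI allI impI)
  fix d x assume d: "d \<in> (\<Union>m. supp (pole_deriv p q r m))" "x \<notin> P \<union> R"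
  then obtain m where "pole_deriv p q r m d \<noteq> 0" by (auto simp: supp_def)
  then show "d x = 0" by (rule pole_deriv_outside[OF assms(3)]) (use d assms in auto)
next
  fix U assume U: "outer_closed U"
  show "discrete_below (height U ` (\<Union>m. supp (pole_deriv p q r m)))"
  proof (rule discrete_belowI[of "{0}"])
    fix x assume "x \<in> height U ` (\<Union>m. supp (pole_deriv p q r m))"
    then obtain m d where d: "pole_deriv p q r m d \<noteq> 0" "x = height U d" by (auto simp: supp_def)
    obtain k :: nat where "x = of_nat k" using pole_deriv_height[OF assms d(1) U] d(2) by blast
    then show "\<exists>c\<in>{0}. \<exists>k::nat. x = c + of_nat k / 2" by (auto intro: exI[of _ "2 * k"])
  qed simp
next
  fix r' assume r': "r' \<in> R"
  have "d r' = 0" if "pole_deriv p q r m d \<noteq> 0" for d m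
    by (rule pole_deriv_outside[OF assms(3) that]) (use assms r' disj in auto)
  then have "(\<lambda>d. d r') ` (\<Union>m. supp (pole_deriv p q r m)) \<subseteq> {0}" by (auto simp: supp_def)
  then show "discrete_below ((\<lambda>d. d r') ` (\<Union>m. supp (pole_deriv p q r m)))" by (intro discrete_below_finite) (rule finite_subset, auto)
qed

end

context genus_data begin

lemma pole_deriv_hit_series_finite:
  assumes p: "p \<in> P" and q: "q \<in> P - {p}"
  shows "finite {m. (pole_deriv p q r m \<star> hit_series q (int m)) e \<noteq> 0}"
proof -
  have o: "outer p q \<or> outer q p" "q \<in> P" using outer_total[OF p, of q] q by auto
  let ?D = "{d \<in> (\<Union>m. supp (pole_deriv p q r m)). esub e d \<in> (\<Union>q. \<Union>m. supp (hit_series q m))}"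
  have "finite ?D" by (intro cone_bounded_decomp pole_deriv_family_cone_bounded hit_series_cone_bounded p o)
  moreover have "finite {m::nat. of_nat m = - 1 - of_nat r - d p - d q}" for d :: "fvar \<Rightarrow> complex"
    using finite_vimageI[of "{- 1 - of_nat r - d p - d q}" "of_nat :: nat \<Rightarrow> complex"] inj_of_nat
    by (simp add: vimage_def)
  ultimately have "finite (\<Union>d\<in>?D. {m::nat. of_nat m = - 1 - of_nat r - d p - d q})" by blast
  then show ?thesis
  proof (rule rev_finite_subset, intro subsetI)
    fix m assume "m \<in> {m. (pole_deriv p q r m \<star> hit_series q (int m)) e \<noteq> 0}"
    then obtain d where d: "pole_deriv p q r m d \<noteq> 0" "hit_series q (int m) (esub e d) \<noteq> 0" by (blast dest: fmult_nonzero)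
    have "d p + d q = - 1 - of_nat r - of_nat m" by (rule pole_deriv_sum[OF o(1) d(1)])
    then have "of_nat m = - 1 - of_nat r - d p - d q" by (simp add: algebra_simps)
    then show "m \<in> (\<Union>d\<in>?D. {m::nat. of_nat m = - 1 - of_nat r - d p - d q})" using d by (auto simp: supp_def)
  qed
qed

text \<open>
  Expanding the polynomial in powers of \<open>q\<close> gives for each \<open>l \<le> 2\<close>
  the series \<open>f\<^sub>l\<close> times the global Ward identity. The product with
  \<open>f\<^sub>l\<close> distributes over the sum because \<open>f\<^sub>l\<close> is
  slice-tame and the other factors are tame.
\<close>
lemma quadratic_part_hit_series_sum:
  assumes p: "p \<in> P"
  shows "(\<Sum>q\<in>P. \<Sum>m\<le>2. (quadratic_part f p r q m \<star> hit_series q (int m)) e) = 0"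
proof -
  let ?g = "\<lambda>l q m. monom1 q (of_nat l - of_nat m) \<star> hit_series q (int m)"
  have tg: "tame (supp (?g l q m))" if "q \<in> P" for l q m
    by (rule tame_monom_mult[OF _ hit_series_tame]) (use that in auto)
  have cl: "convolvable (f_deriv f p r l) (?g l q m)" if "q \<in> P" for l q m
    by (intro tame_convolvable slice_tame_f_deriv p tg that)
  have "(quadratic_part f p r q m \<star> hit_series q (int m)) e = (\<Sum>l\<le>2. of_nat (l choose m) * (f_deriv f p r l \<star> ?g l q m) e)" if q: "q \<in> P" for q m
  proof -
    have "(quadratic_part f p r q m \<star> hit_series q (int m)) e = (\<Sum>l\<le>2. of_nat (l choose m) * ((f_deriv f p r l \<star> monom1 q (of_nat l - of_nat m)) \<star> hit_series q (int m)) e)"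
      unfolding quadratic_part_def
    proof (rule fmult_sum_left)
      fix l
      show "convolvable (f_deriv f p r l \<star> monom1 q (of_nat l - of_nat m)) (hit_series q (int m))"
        by (subst fmult_commute) (intro tame_convolvable slice_tame_monom_mult slice_tame_f_deriv p hit_series_tame q UnI1)
    qed simp
    also have "\<dots> = (\<Sum>l\<le>2. of_nat (l choose m) * (f_deriv f p r l \<star> ?g l q m) e)"
      by (simp only: fmult_monom1_assoc fmult_commute[of _ "monom1 q c" for c])
    finally show ?thesis .
  qed
  then have "(\<Sum>q\<in>P. \<Sum>m\<le>2. (quadratic_part f p r q m \<star> hit_series q (int m)) e) =
     (\<Sum>q\<in>P. \<Sum>m\<le>2. \<Sum>l\<le>2. of_nat (l choose m) * (f_deriv f p r l \<star> ?g l q m) e)"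
    by (intro sum.cong refl)
  also have "\<dots> = (\<Sum>l\<le>2. \<Sum>q\<in>P. \<Sum>m\<le>2. of_nat (l choose m) * (f_deriv f p r l \<star> ?g l q m) e)"
  proof -
    have "(\<Sum>q\<in>P. \<Sum>m\<le>2. \<Sum>l\<le>2. of_nat (l choose m) * (f_deriv f p r l \<star> ?g l q m) e)
       = (\<Sum>q\<in>P. \<Sum>l\<le>2. \<Sum>m\<le>2. of_nat (l choose m) * (f_deriv f p r l \<star> ?g l q m) e)"
      by (intro sum.cong refl sum.swap)
    also have "\<dots> = (\<Sum>l\<le>2. \<Sum>q\<in>P. \<Sum>m\<le>2. of_nat (l choose m) * (f_deriv f p r l \<star> ?g l q m) e)" by (rule sum.swap)
    finally show ?thesis .
  qed
  also have "\<dots> = 0"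
  proof (rule sum.neutral, rule ballI)
    fix l :: nat assume l: "l \<in> {..2}"
    have z: "(\<lambda>e. \<Sum>(q, m)\<in>P \<times> {..2}. of_nat (l choose m) * ?g l q m e) = (\<lambda>_. 0)"
      using hit_series_global[of l] l by (simp add: sum.cartesian_product[symmetric])
    have "(\<Sum>q\<in>P. \<Sum>m\<le>2. of_nat (l choose m) * (f_deriv f p r l \<star> ?g l q m) e)
       = (\<Sum>x\<in>P \<times> {..2}. of_nat (l choose snd x) * (f_deriv f p r l \<star> ?g l (fst x) (snd x)) e)"
      by (simp add: sum.cartesian_product case_prod_unfold)
    also have "\<dots> = (f_deriv f p r l \<star> (\<lambda>e. \<Sum>x\<in>P \<times> {..2}. of_nat (l choose snd x) * ?g l (fst x) (snd x) e)) e"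
      by (rule fmult_sum_right[symmetric]) (auto intro!: cl)
    also have "\<dots> = 0" using z by (simp add: case_prod_unfold)
    finally show "(\<Sum>q\<in>P. \<Sum>m\<le>2. of_nat (l choose m) * (f_deriv f p r l \<star> ?g l q m) e) = 0" .
  qed
  finally show ?thesis .
qed

lemma pi2_hit_series:
  assumes p: "p \<in> P" and q: "q \<in> P - {p}"
  shows "(pi2_deriv f r m p q \<star> hit_series q (int m)) e = (pole_deriv p q r m \<star> hit_series q (int m)) e + (quadratic_part f p r q m \<star> hit_series q (int m)) e"
proof -
  have o: "outer p q \<or> outer q p" "q \<in> P" "p \<noteq> q" using outer_total[OF p, of q] q by auto
  show ?thesis unfolding pi2_deriv_eq[OF o(3)]
    by (rule fmult_add_left) (intro tame_convolvable tame_slice_tame pole_deriv_tame slice_tame_quadratic_part hit_series_tame p o)+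
qed

lemma pi2_hit_series_finite:
  assumes p: "p \<in> P" and q: "q \<in> P - {p}"
  shows "finite {m. (pi2_deriv f r m p q \<star> hit_series q (int m)) e \<noteq> 0}"
proof (rule finite_subset)
  show "{m. (pi2_deriv f r m p q \<star> hit_series q (int m)) e \<noteq> 0} \<subseteq> {m. (pole_deriv p q r m \<star> hit_series q (int m)) e \<noteq> 0} \<union> {..2}"
    using pi2_hit_series[OF p q] quadratic_part_zero[of m f p r q for m] by (auto simp: not_le Suc_le_eq numeral_eq_Suc)
qed (use pole_deriv_hit_series_finite[OF p q] in simp)

text \<open>
  The quadratic part summed over all points vanishes, so adding it over the points \<open>q
  \<noteq> p\<close> is compensated by the single term at \<open>p\<close> itself. For \<open>p
  = w\<^sub>-\<^sub>a\<close> that term produces the special entries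
  \<open>A\<^sub>a\<^sub>,\<^sub>-\<^sub>a\<close>.
\<close>
lemma pi2_ward:
  assumes p: "p \<in> P"
  shows "hit_series p (- int r - 1) e = (\<Sum>q\<in>P - {p}. Sum_any (\<lambda>m. (pi2_deriv f r m p q \<star> hit_series q (int m)) e))
     + (\<Sum>m\<le>2. (quadratic_part f p r p m \<star> hit_series p (int m)) e)"
proof -
  have "Sum_any (\<lambda>m. (pi2_deriv f r m p q \<star> hit_series q (int m)) e)
     = Sum_any (\<lambda>m. (pole_deriv p q r m \<star> hit_series q (int m)) e) + (\<Sum>m\<le>2. (quadratic_part f p r q m \<star> hit_series q (int m)) e)"
    if q: "q \<in> P - {p}" for q
  proof -
    have z: "{m. (quadratic_part f p r q m \<star> hit_series q (int m)) e \<noteq> 0} \<subseteq> {..2}"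
      using quadratic_part_zero[of m f p r q for m] by (auto simp: not_le Suc_le_eq numeral_eq_Suc intro!: leI)
    have "Sum_any (\<lambda>m. (pi2_deriv f r m p q \<star> hit_series q (int m)) e)
       = Sum_any (\<lambda>m. (pole_deriv p q r m \<star> hit_series q (int m)) e + (quadratic_part f p r q m \<star> hit_series q (int m)) e)"
      by (simp only: pi2_hit_series[OF p q])
    also have "\<dots> = Sum_any (\<lambda>m. (pole_deriv p q r m \<star> hit_series q (int m)) e) + Sum_any (\<lambda>m. (quadratic_part f p r q m \<star> hit_series q (int m)) e)"
      by (rule Sum_any.distrib[OF pole_deriv_hit_series_finite[OF p q] finite_subset[OF z]]) simp
    also have "Sum_any (\<lambda>m. (quadratic_part f p r q m \<star> hit_series q (int m)) e) = (\<Sum>m\<le>2. (quadratic_part f p r q m \<star> hit_series q (int m)) e)"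
      by (rule Sum_any.expand_superset[OF _ z]) simp
    finally show ?thesis .
  qed
  then have "(\<Sum>q\<in>P - {p}. Sum_any (\<lambda>m. (pi2_deriv f r m p q \<star> hit_series q (int m)) e))
     = (\<Sum>q\<in>P - {p}. Sum_any (\<lambda>m. (pole_deriv p q r m \<star> hit_series q (int m)) e)) + (\<Sum>q\<in>P - {p}. \<Sum>m\<le>2. (quadratic_part f p r q m \<star> hit_series q (int m)) e)"
    by (simp add: sum.distrib)
  moreover have "(\<Sum>m\<le>2. (quadratic_part f p r p m \<star> hit_series p (int m)) e) + (\<Sum>q\<in>P - {p}. \<Sum>m\<le>2. (quadratic_part f p r q m \<star> hit_series q (int m)) e) = 0"
    using quadratic_part_hit_series_sum[OF p, of f r e] by (simp add: sum.remove[OF fin(1) p])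
  ultimately show ?thesis using hit_series_ward[OF p, of r e] by (simp add: algebra_simps)
qed

end

section \<open>Supports of the moment matrix\<close>

lemma const1_fmult: "const_series 1 \<star> F = F" "F \<star> const_series 1 = F"
  by (rule ext, simp add: const_fmult fmult_const)+

lemma monom1_0_fmult: "monom1 p 0 \<star> F = F"
  by (rule ext) (simp add: monom1_fmult)

lemma monom1_left_commute: "monom1 p c \<star> (monom1 q d \<star> F) = monom1 q d \<star> (monom1 p c \<star> F)"
proof -
  have "monom1 p c \<star> (monom1 q d \<star> F) = (monom1 p c \<star> monom1 q d) \<star> F" by (rule monom1_fmult_assoc[symmetric])
  also have "\<dots> = (monom1 q d \<star> monom1 p c) \<star> F" by (simp only: fmult_commute[of "monom1 p c"])
  finally show ?thesis by (simp only: monom1_fmult_assoc)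
qed

lemma monom1_nonzero:
  assumes "(monom1 r x \<star> F) d \<noteq> 0"
  shows "\<exists>d0. F d0 \<noteq> 0 \<and> d = (\<lambda>q. d0 q + ((\<lambda>_. 0)(r := x)) q)"
  using assms by (intro exI[of _ "d(r := d r - x)"]) (auto simp: monom1_fmult)

lemma Sum_any_3:
  fixes h :: "nat \<Rightarrow> complex"
  assumes "finite {m. h m \<noteq> 0}"
  shows "Sum_any h = (\<Sum>m\<le>2. h m) + Sum_any (\<lambda>m. h (m + 3))"
proof -
  have f: "finite {m. h (m + c) \<noteq> 0}" for c
    using finite_vimageI[OF assms, of "\<lambda>m. m + c"] by (simp add: vimage_def inj_on_def)
  have "Sum_any h = h 0 + Sum_any (\<lambda>m. h (Suc m))" by (rule Sum_any_Suc[OF assms])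
  also have "Sum_any (\<lambda>m. h (Suc m)) = h (Suc 0) + Sum_any (\<lambda>m. h (Suc (Suc m)))"
    by (rule Sum_any_Suc) (use f[of 1] in simp)
  also have "Sum_any (\<lambda>m. h (Suc (Suc m))) = h (Suc (Suc 0)) + Sum_any (\<lambda>m. h (Suc (Suc (Suc m))))"
    by (rule Sum_any_Suc) (use f[of 2] in simp)
  finally show ?thesis by (simp add: numeral_eq_Suc)
qed

lemma Sum_any_pairs:
  fixes h :: "int \<times> nat \<Rightarrow> complex"
  assumes "finite I" "\<And>b. b \<in> I \<Longrightarrow> finite {m. h (b, m) \<noteq> 0}"
  shows "finite {j. (if fst j \<in> I then h j else 0) \<noteq> 0}"
    and "(\<Sum>b\<in>I. Sum_any (\<lambda>m. h (b, m))) = Sum_any (\<lambda>j. if fst j \<in> I then h j else 0)"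
proof -
  have eq: "{j. (if fst j \<in> I then h j else 0) \<noteq> 0} = (SIGMA b:I. {m. h (b, m) \<noteq> 0})" by auto
  show "finite {j. (if fst j \<in> I then h j else 0) \<noteq> 0}"
    unfolding eq by (rule finite_SigmaI[OF assms])
  have "(\<Sum>b\<in>I. Sum_any (\<lambda>m. h (b, m))) = (\<Sum>b\<in>I. \<Sum>m\<in>{m. h (b, m) \<noteq> 0}. h (b, m))"
    by (simp add: Sum_any.expand_set)
  also have "\<dots> = (\<Sum>j\<in>(SIGMA b:I. {m. h (b, m) \<noteq> 0}). h j)"
    by (subst sum.Sigma) (use assms in \<open>auto simp: case_prod_unfold\<close>)
  also have "\<dots> = Sum_any (\<lambda>j. if fst j \<in> I then h j else 0)"
    unfolding Sum_any.expand_set eq by (rule sum.cong) auto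
  finally show "(\<Sum>b\<in>I. Sum_any (\<lambda>m. h (b, m))) = Sum_any (\<lambda>j. if fst j \<in> I then h j else 0)" .
qed

lemma row_times_Delta:
  "row_times_mat g r Delta j = (if fst j \<in> idx g then r (fst j, snd j + 3) else (\<lambda>_. 0))"
proof
  fix e
  let ?h = "\<lambda>i. if fst i \<in> idx g then (r i \<star> Delta i j) e else 0"
  have D: "(r i \<star> Delta i j) e = (if snd i = snd j + 3 \<and> fst i = fst j then r i e else 0)" for i
    by (cases i; cases j) (simp add: Delta_def fmult_const)
  have "Sum_any ?h = ?h (fst j, snd j + 3)"
    by (rule Sum_any_single) (auto simp: D prod_eq_iff)
  then show "row_times_mat g r Delta j e = (if fst j \<in> idx g then r (fst j, snd j + 3) else (\<lambda>_. 0)) e"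
    by (simp add: row_times_mat_def row_times_col_def D)
qed

context genus_data begin

text \<open>
  A monoid of exponents that contains the supports of the poles and of the positive half-powers
  of \<open>\<rho>\<close>, and therefore those of all products of entries of \<open>A~\<close>
  and \<open>L~\<close>. The points \<open>y\<^sub>k\<close> do not occur in the matrices.
\<close>
definition cone_monoid :: "(fvar \<Rightarrow> complex) set" where
  "cone_monoid = {d. (\<forall>p. p \<notin> P \<union> R \<longrightarrow> d p = 0) \<and> (\<forall>k. d (Yv k) = 0) \<and>
     (\<forall>U. outer_closed U \<longrightarrow> (\<exists>k::nat. height U d = of_nat k)) \<and> (\<forall>r\<in>R. \<exists>k::nat. d r = of_nat k / 2)}"

text \<open>
  Every entry of the matrices is homogeneous in the \<open>\<rho>\<^sub>a\<close> together; the
  degree counts the matrix indices and thereby makes the matrix sums finite.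
\<close>
definition rho_degree :: "(fvar \<Rightarrow> complex) \<Rightarrow> complex" where "rho_degree d = (\<Sum>r\<in>R. d r)"

lemma rho_degree_add: "rho_degree (\<lambda>q. a q + b q) = rho_degree a + rho_degree b"
  by (simp add: rho_degree_def sum.distrib)

lemma rho_degree_single: "r \<in> R \<Longrightarrow> rho_degree ((\<lambda>_. 0)(r := c)) = c"
  unfolding rho_degree_def sum_upd[OF fin(2)] by simp

lemma cone_monoid_height: "d \<in> cone_monoid \<Longrightarrow> outer_closed U \<Longrightarrow> \<exists>k::nat. height U d = of_nat k"
  unfolding cone_monoid_def by blast

lemma cone_monoid_half: "d \<in> cone_monoid \<Longrightarrow> r \<in> R \<Longrightarrow> \<exists>k::nat. d r = of_nat k / 2"
  unfolding cone_monoid_def by blast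

lemma cone_monoid_add: "a \<in> cone_monoid \<Longrightarrow> b \<in> cone_monoid \<Longrightarrow> (\<lambda>q. a q + b q) \<in> cone_monoid"
proof -
  assume a: "a \<in> cone_monoid" and b: "b \<in> cone_monoid"
  have "\<exists>k::nat. height U (\<lambda>q. a q + b q) = of_nat k" if "outer_closed U" for U
  proof -
    obtain k k' :: nat where "height U a = of_nat k" "height U b = of_nat k'"
      using cone_monoid_height[OF a \<open>outer_closed U\<close>] cone_monoid_height[OF b \<open>outer_closed U\<close>] by blast
    then show ?thesis by (intro exI[of _ "k + k'"]) (simp add: height_add)
  qed
  moreover have "\<exists>k::nat. a r + b r = of_nat k / 2" if "r \<in> R" for r
  proof -
    obtain k k' :: nat where "a r = of_nat k / 2" "b r = of_nat k' / 2"
      using cone_monoid_half[OF a \<open>r \<in> R\<close>] cone_monoid_half[OF b \<open>r \<in> R\<close>] by blast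
    then show ?thesis by (intro exI[of _ "k + k'"]) (simp only: add_divide_distrib of_nat_add)
  qed
  ultimately show ?thesis using a b by (simp add: cone_monoid_def)
qed

lemma cone_monoid_0: "(\<lambda>_. 0) \<in> cone_monoid"
  by (auto simp: cone_monoid_def height_def intro: exI[of _ 0])

lemma cone_monoid_rho:
  assumes r: "r \<in> R" shows "(\<lambda>_. 0)(r := of_nat k / 2) \<in> cone_monoid"
proof -
  have U: "r \<notin> U" if "outer_closed U" for U using that r disj by (auto simp: outer_closed_def)
  have "\<exists>k'::nat. ((\<lambda>_. 0)(r := of_nat k / 2)) r' = of_nat k' / (2::complex)" for r'
    by (cases "r' = r") (auto intro: exI[of _ 0])
  moreover have "\<exists>k'::nat. height U ((\<lambda>_. 0)(r := of_nat k / 2)) = of_nat k'" if "outer_closed U" for U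
    using U[OF that] by (simp add: height_single[OF that] exI[of _ 0])
  ultimately show ?thesis using r by (auto simp: cone_monoid_def)
qed

lemma cone_monoid_pole_deriv:
  assumes "p \<in> P" "q \<in> P" "p \<noteq> q" "p \<notin> range Yv" "q \<notin> range Yv" "pole_deriv p q r m d \<noteq> 0"
  shows "d \<in> cone_monoid" "rho_degree d = 0"
proof -
  have o: "outer p q \<or> outer q p" by (rule outer_total[OF assms(1-3)])
  have 0: "d x = 0" if "x \<noteq> p" "x \<noteq> q" for x by (rule pole_deriv_outside[OF o assms(6) that])
  have R0: "d x = 0" if "x \<in> R" for x by (rule 0) (use that assms(1,2) disj in auto)
  have "d x = 0" if "x \<notin> P \<union> R" for x by (rule 0) (use that assms(1,2) in auto)
  moreover have "d (Yv k) = 0" for k by (rule 0) (use assms(4,5) in auto)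
  moreover have "\<exists>k::nat. d r = of_nat k / 2" if "r \<in> R" for r using R0[OF that] by (auto intro: exI[of _ 0])
  ultimately show "d \<in> cone_monoid" using pole_deriv_height[OF assms(1,2) o assms(6)] by (simp add: cone_monoid_def)
  show "rho_degree d = 0" using R0 by (simp add: rho_degree_def)
qed

lemma tame_cone_monoid: "tame {d \<in> cone_monoid. total_degree d = c}"
  unfolding tame_def cone_bounded_def
proof (intro conjI ballI allI impI)
  fix U assume U: "outer_closed U"
  show "discrete_below (height U ` {d \<in> cone_monoid. total_degree d = c})"
    by (rule discrete_below_shift[of _ 0]) (use U in \<open>auto simp: cone_monoid_def\<close>)
next
  fix r assume r: "r \<in> R"
  show "discrete_below ((\<lambda>d. d r) ` {d \<in> cone_monoid. total_degree d = c})"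
    by (rule discrete_belowI[of "{0}"]) (use r in \<open>auto simp: cone_monoid_def\<close>)
next
  have "total_degree ` {d \<in> cone_monoid. total_degree d = c} \<subseteq> {c}" by blast
  then show "finite (total_degree ` {d \<in> cone_monoid. total_degree d = c})" by (rule finite_subset) simp
qed (auto simp: cone_monoid_def)

lemma W_facts: "a \<in> idx g \<Longrightarrow> Wv a \<in> P" "a \<in> idx g \<Longrightarrow> Wv (- a) \<in> P" "a \<in> idx g \<Longrightarrow> Rv \<bar>a\<bar> \<in> R"
  "a \<in> idx g \<Longrightarrow> - a \<in> idx g"
  by (auto simp: set_positions idx_def)

lemma Xv_P: "Xv \<in> P"
  by (simp add: set_positions)

text \<open>
  The matrix \<open>A\<Delta>\<close>, extended by zero to all index pairs so that sums over
  \<open>Sum_any\<close> need no side conditions.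
\<close>
definition A_tilde :: "(fvar \<Rightarrow> nat \<Rightarrow> int \<Rightarrow> complex) \<Rightarrow> int \<times> nat \<Rightarrow> int \<times> nat \<Rightarrow> fseries" where
  "A_tilde f i j = (if fst i \<in> idx g \<and> fst j \<in> idx g then Amat f i (fst j, snd j + 3) else (\<lambda>_. 0))"

definition L_tilde :: "(fvar \<Rightarrow> nat \<Rightarrow> int \<Rightarrow> complex) \<Rightarrow> int \<times> nat \<Rightarrow> fseries" where
  "L_tilde f j = (if fst j \<in> idx g then Lrow f (fst j, snd j + 3) else (\<lambda>_. 0))"

lemma Amat_ne: "b \<noteq> - a \<Longrightarrow> Amat f (a, m) (b, l) =
    monom1 (Rv \<bar>a\<bar>) ((of_nat m + 1) / 2) \<star> (monom1 (Rv \<bar>b\<bar>) (of_nat l / 2) \<star> pi2_deriv f m l (Wv (- a)) (Wv b))"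
  by (simp add: Amat_def rho_pow_def monom1_fmult_assoc)

lemma Amat_eq: "Amat f (a, m) (- a, l) =
    monom1 (Rv \<bar>a\<bar>) ((of_nat m + of_nat l + 1) / 2) \<star> quadratic_part f (Wv (- a)) m (Wv (- a)) l"
  by (simp add: Amat_def rho_pow_def quadratic_part_def f_deriv_def)

lemma half_nat: "(of_nat m + 1) / 2 = (of_nat (m + 1) / 2 :: complex)" by simp

text \<open>
  The entries with \<open>b = -a\<close> vanish after the shift by 3, since they come from
  polynomials of degree 2. The total degree is 0 because the power of \<open>\<rho>\<close>
  compensates the derivatives of the pole.
\<close>
lemma A_tilde_supp:
  assumes "A_tilde f i j d \<noteq> 0"
  shows "fst i \<in> idx g \<and> fst j \<in> idx g \<and> d \<in> cone_monoid \<and> total_degree d = 0 \<and> rho_degree d = of_nat (snd i + snd j + 4) / 2"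
proof -
  obtain a m b l where ij: "i = (a, m)" "j = (b, l)" by (metis surj_pair)
  have ab: "a \<in> idx g" "b \<in> idx g" "Amat f (a, m) (b, l + 3) d \<noteq> 0"
    using assms by (auto simp: A_tilde_def ij split: if_splits)
  note W = W_facts[OF ab(1)] W_facts[OF ab(2)]
  have ba: "b \<noteq> - a"
  proof
    assume b: "b = - a"
    have "Amat f (a, m) (b, l + 3) = (\<lambda>_. 0)" unfolding b Amat_eq by (simp add: quadratic_part_zero)
    then show False using ab(3) by simp
  qed
  then have ne: "Wv (- a) \<noteq> Wv b" by auto
  have "pi2_deriv f m (l + 3) (Wv (- a)) (Wv b) = pole_deriv (Wv (- a)) (Wv b) m (l + 3)"
    unfolding pi2_deriv_eq[OF ne] by (simp add: quadratic_part_zero)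
  with ab(3) have "(monom1 (Rv \<bar>a\<bar>) (of_nat (m + 1) / 2) \<star> (monom1 (Rv \<bar>b\<bar>) (of_nat (l + 3) / 2) \<star> pole_deriv (Wv (- a)) (Wv b) m (l + 3))) d \<noteq> 0"
    by (simp only: Amat_ne[OF ba] half_nat not_False_eq_True)
  then obtain d1 where d1: "(monom1 (Rv \<bar>b\<bar>) (of_nat (l + 3) / 2) \<star> pole_deriv (Wv (- a)) (Wv b) m (l + 3)) d1 \<noteq> 0"
    "d = (\<lambda>q. d1 q + ((\<lambda>_. 0)(Rv \<bar>a\<bar> := of_nat (m + 1) / 2)) q)" by (blast dest: monom1_nonzero)
  from d1(1) obtain d0 where d0: "pole_deriv (Wv (- a)) (Wv b) m (l + 3) d0 \<noteq> 0"
    "d1 = (\<lambda>q. d0 q + ((\<lambda>_. 0)(Rv \<bar>b\<bar> := of_nat (l + 3) / 2)) q)" by (blast dest: monom1_nonzero)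
  have p: "d0 \<in> cone_monoid" "rho_degree d0 = 0" using cone_monoid_pole_deriv[OF W(2,5) ne _ _ d0(1)] by auto
  have dg: "total_degree d0 = - 1 - of_nat m - of_nat (l + 3)" by (rule pole_deriv_total_degree[OF W(2,5) outer_total[OF W(2,5) ne] d0(1)])
  have nP: "Rv \<bar>a\<bar> \<notin> P" "Rv \<bar>b\<bar> \<notin> P" using W disj by auto
  have "d \<in> cone_monoid" unfolding d1(2) d0(2) by (intro cone_monoid_add cone_monoid_rho p W)
  moreover have "total_degree d = 0"
    unfolding d1(2) d0(2) total_degree_add total_degree_single dg using nP W by (simp add: field_simps)
  moreover have "rho_degree d = of_nat (m + l + 4) / 2"
    unfolding d1(2) d0(2) rho_degree_add rho_degree_single[OF W(3)] rho_degree_single[OF W(7)] p(2) by (simp add: field_simps)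
  ultimately show ?thesis using ab ij by simp
qed

lemma L_tilde_supp:
  assumes "L_tilde f j d \<noteq> 0"
  shows "fst j \<in> idx g \<and> d \<in> cone_monoid \<and> total_degree d = - 1 \<and> rho_degree d = of_nat (snd j + 3) / 2"
proof -
  obtain b l where j: "j = (b, l)" by (metis surj_pair)
  have b: "b \<in> idx g" "Lrow f (b, l + 3) d \<noteq> 0" using assms by (auto simp: L_tilde_def j split: if_splits)
  note W = W_facts[OF b(1)]
  have ne: "Xv \<noteq> Wv b" by simp
  have "pi2_deriv f 0 (l + 3) Xv (Wv b) = pole_deriv Xv (Wv b) 0 (l + 3)"
    unfolding pi2_deriv_eq[OF ne] by (simp add: quadratic_part_zero)
  with b(2) have "(monom1 (Rv \<bar>b\<bar>) (of_nat (l + 3) / 2) \<star> pole_deriv Xv (Wv b) 0 (l + 3)) d \<noteq> 0"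
    by (simp only: Lrow_def rho_pow_def prod.case not_False_eq_True)
  then obtain d0 where d0: "pole_deriv Xv (Wv b) 0 (l + 3) d0 \<noteq> 0"
    "d = (\<lambda>q. d0 q + ((\<lambda>_. 0)(Rv \<bar>b\<bar> := of_nat (l + 3) / 2)) q)" by (blast dest: monom1_nonzero)
  have p: "d0 \<in> cone_monoid" "rho_degree d0 = 0" using cone_monoid_pole_deriv[OF Xv_P W(1) ne _ _ d0(1)] by auto
  have dg: "total_degree d0 = - 1 - of_nat 0 - of_nat (l + 3)" by (rule pole_deriv_total_degree[OF Xv_P W(1) outer_total[OF Xv_P W(1) ne] d0(1)])
  have nP: "Rv \<bar>b\<bar> \<notin> P" using W disj by auto
  have "d \<in> cone_monoid" unfolding d0(2) by (intro cone_monoid_add cone_monoid_rho p W)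
  moreover have "total_degree d = - 1"
    unfolding d0(2) total_degree_add total_degree_single dg using nP W by (simp add: field_simps)
  moreover have "rho_degree d = of_nat (l + 3) / 2"
    unfolding d0(2) rho_degree_add rho_degree_single[OF W(3)] p(2) by simp
  ultimately show ?thesis using b j by simp
qed

lemma half_bound:
  assumes "s = of_nat k / (2::complex)" shows "k \<le> nat \<lfloor>2 * Re s\<rfloor>"
proof -
  have "2 * Re s = real k" unfolding assms by simp
  then show ?thesis by simp
qed

text \<open>
  The index of a row entry is bounded by the \<open>\<rho>\<close>-degree of the exponent.
\<close>
lemma tame_family_row:
  assumes "\<And>j d. x j d \<noteq> 0 \<Longrightarrow> fst j \<in> idx g \<and> d \<in> cone_monoid \<and> total_degree d = c \<and> (\<exists>t::nat. rho_degree d = of_nat (t + snd j) / 2)"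
  shows "tame_family x"
  unfolding tame_family_def
proof (intro conjI allI)
  have "(\<Union>j. supp (x j)) \<subseteq> {d \<in> cone_monoid. total_degree d = c}" using assms by (auto simp: supp_def)
  then show "tame (\<Union>j. supp (x j))" by (rule tame_subset[OF tame_cone_monoid])
  fix d
  have "{j. x j d \<noteq> 0} \<subseteq> idx g \<times> {..nat \<lfloor>2 * Re (rho_degree d)\<rfloor>}"
  proof
    fix j assume "j \<in> {j. x j d \<noteq> 0}"
    then obtain t :: nat where "fst j \<in> idx g" "rho_degree d = of_nat (t + snd j) / 2" using assms[of j d] by auto
    then show "j \<in> idx g \<times> {..nat \<lfloor>2 * Re (rho_degree d)\<rfloor>}" using half_bound[of "rho_degree d" "t + snd j"] by (cases j) auto
  qed
  then show "finite {j. x j d \<noteq> 0}" by (rule finite_subset) (simp add: finite_idx)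
qed

lemma L_tilde_family: "tame_family (L_tilde f)"
proof (rule tame_family_row)
  fix j d assume "L_tilde f j d \<noteq> 0"
  from L_tilde_supp[OF this] show "fst j \<in> idx g \<and> d \<in> cone_monoid \<and> total_degree d = - 1 \<and> (\<exists>t::nat. rho_degree d = of_nat (t + snd j) / 2)"
    by (auto intro!: exI[of _ 3] simp: add.commute)
qed

lemma A_tilde_family: "tame_family (\<lambda>(i, j). A_tilde f i j)"
  unfolding tame_family_def
proof (intro conjI allI)
  have "(\<Union>x. supp ((\<lambda>(i, j). A_tilde f i j) x)) \<subseteq> {d \<in> cone_monoid. total_degree d = 0}" using A_tilde_supp by (auto simp: supp_def)
  then show "tame (\<Union>x. supp ((\<lambda>(i, j). A_tilde f i j) x))" by (rule tame_subset[OF tame_cone_monoid])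
  fix d
  let ?N = "nat \<lfloor>2 * Re (rho_degree d)\<rfloor>"
  have "{x. (\<lambda>(i, j). A_tilde f i j) x d \<noteq> 0} \<subseteq> (idx g \<times> {..?N}) \<times> (idx g \<times> {..?N})"
  proof
    fix x assume "x \<in> {x. (\<lambda>(i, j). A_tilde f i j) x d \<noteq> 0}"
    then have x: "A_tilde f (fst x) (snd x) d \<noteq> 0" by (simp add: case_prod_unfold)
    note s = A_tilde_supp[OF x]
    have "snd (fst x) + snd (snd x) + 4 \<le> ?N" by (rule half_bound) (use s in blast)
    then have "snd (fst x) \<le> ?N" "snd (snd x) \<le> ?N" by linarith+
    then show "x \<in> (idx g \<times> {..?N}) \<times> (idx g \<times> {..?N})" using s unfolding mem_Times_iff by blast
  qed
  then show "finite {x. (\<lambda>(i, j). A_tilde f i j) x d \<noteq> 0}" by (rule finite_subset) (simp add: finite_idx)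
qed

section \<open>The resolvent of the moment matrix\<close>

definition right_mult_A :: "(fvar \<Rightarrow> nat \<Rightarrow> int \<Rightarrow> complex) \<Rightarrow> (int \<times> nat \<Rightarrow> fseries) \<Rightarrow> int \<times> nat \<Rightarrow> fseries" where
  "right_mult_A f r = (\<lambda>j e. Sum_any (\<lambda>i. (r i \<star> A_tilde f i j) e))"

text \<open>
  The powers of \<open>A~\<close> as they occur in the geometric series, set to zero for row
  indices that do not belong to a handle.
\<close>
definition A_power :: "(fvar \<Rightarrow> nat \<Rightarrow> int \<Rightarrow> complex) \<Rightarrow> nat \<Rightarrow> int \<times> nat \<Rightarrow> int \<times> nat \<Rightarrow> fseries" where
  "A_power f k i j = (if fst i \<in> idx g then mat_pow g (mat_times_mat g (Amat f) Delta) k i j else (\<lambda>_. 0))"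

lemma right_mult_A_family: "tame_family r \<Longrightarrow> tame_family (right_mult_A f r)"
  unfolding right_mult_A_def by (rule tame_family_row_mat[OF _ A_tilde_family])

lemma A_power_Suc:
  assumes "fst i \<in> idx g"
  shows "A_power f (Suc k) i j = (\<lambda>e. Sum_any (\<lambda>l. (A_tilde f i l \<star> A_power f k l j) e))"
proof
  fix e
  have "(if fst l \<in> idx g then (mat_times_mat g (Amat f) Delta i l \<star> mat_pow g (mat_times_mat g (Amat f) Delta) k l j) e else 0)
     = (A_tilde f i l \<star> A_power f k l j) e" for l
    using assms by (simp add: mat_times_mat_def row_times_Delta A_tilde_def A_power_def)
  then have "mat_pow g (mat_times_mat g (Amat f) Delta) (Suc k) i j e = Sum_any (\<lambda>l. (A_tilde f i l \<star> A_power f k l j) e)"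
    unfolding mat_pow.simps mat_times_mat_def[of g "mat_times_mat g (Amat f) Delta"]
      row_times_mat_def[of g "mat_times_mat g (Amat f) Delta i"] row_times_col_def
    by (simp only:)
  then show "A_power f (Suc k) i j e = Sum_any (\<lambda>l. (A_tilde f i l \<star> A_power f k l j) e)"
    using assms by (simp only: A_power_def if_True)
qed

lemma A_power_supp:
  assumes "A_power f k i j d \<noteq> 0"
  shows "d \<in> cone_monoid \<and> total_degree d = 0 \<and> (\<exists>t::nat. rho_degree d = of_nat (4 * k + t) / 2)"
  using assms
proof (induction k arbitrary: i d)
  case 0
  then have "d = (\<lambda>_. 0)" by (auto simp: A_power_def const_series_def split: if_splits)
  then show ?case using cone_monoid_0 by (auto simp: total_degree_def rho_degree_def intro: exI[of _ 0])
next
  case (Suc k)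
  have i: "fst i \<in> idx g" using Suc.prems by (auto simp: A_power_def split: if_splits)
  obtain l where "(A_tilde f i l \<star> A_power f k l j) d \<noteq> 0" using Suc.prems unfolding A_power_Suc[OF i] by (blast dest: Sum_any_nonzero)
  then obtain d1 where d1: "A_tilde f i l d1 \<noteq> 0" "A_power f k l j (esub d d1) \<noteq> 0" by (blast dest: fmult_nonzero)
  note s1 = A_tilde_supp[OF d1(1)] and s2 = Suc.IH[OF d1(2)]
  obtain t :: nat where t: "rho_degree (esub d d1) = of_nat (4 * k + t) / 2" using s2 by blast
  have d: "d = (\<lambda>q. d1 q + esub d d1 q)" by auto
  have "d \<in> cone_monoid" by (subst d) (intro cone_monoid_add; use s1 s2 in blast)
  moreover have "total_degree d = 0" using s1 s2 by (subst d) (simp only: total_degree_add, simp)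
  moreover have "rho_degree d = of_nat (4 * Suc k + (t + snd i + snd l)) / 2"
    using s1 t by (subst d) (simp only: rho_degree_add, simp add: field_simps)
  ultimately show ?case by blast
qed

lemma A_power_tame: "tame (\<Union>l. supp (A_power f k l j))"
proof (rule tame_subset[OF tame_cone_monoid[of 0]], rule subsetI)
  fix d assume "d \<in> (\<Union>l. supp (A_power f k l j))"
  then obtain l where "A_power f k l j d \<noteq> 0" unfolding supp_def by blast
  from A_power_supp[OF this] show "d \<in> {d \<in> cone_monoid. total_degree d = 0}" by blast
qed

text \<open>
  Multiplying the row repeatedly by \<open>A~\<close> from the right avoids the powers of the
  matrix. Since these powers are defined by multiplication from the left, the induction
  generalises the row and uses associativity.
\<close>
lemma row_A_power:
  assumes "tame_family r" "\<And>i. fst i \<notin> idx g \<Longrightarrow> r i = (\<lambda>_. 0)"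
  shows "(\<lambda>e. Sum_any (\<lambda>i. (r i \<star> A_power f k i j) e)) = (right_mult_A f ^^ k) r j"
  using assms
proof (induction k arbitrary: r)
  case 0
  have "Sum_any (\<lambda>i. (r i \<star> A_power f 0 i j) e) = (r j \<star> A_power f 0 j j) e" for e
    by (rule Sum_any_single) (auto simp: A_power_def fmult_const)
  moreover have "(r j \<star> A_power f 0 j j) e = r j e" for e
    using 0 by (cases "fst j \<in> idx g") (simp_all add: A_power_def fmult_const)
  ultimately show ?case by simp
next
  case (Suc k)
  have "Sum_any (\<lambda>i. (r i \<star> A_power f (Suc k) i j) e) = (right_mult_A f ^^ k) (right_mult_A f r) j e" for e
  proof -
    have "Sum_any (\<lambda>i. (r i \<star> A_power f (Suc k) i j) e) = Sum_any (\<lambda>i. (r i \<star> (\<lambda>e. Sum_any (\<lambda>l. (A_tilde f i l \<star> A_power f k l j) e))) e)"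
    proof (intro arg_cong[of _ _ Sum_any] ext)
      fix i
      show "(r i \<star> A_power f (Suc k) i j) e = (r i \<star> (\<lambda>e. Sum_any (\<lambda>l. (A_tilde f i l \<star> A_power f k l j) e))) e"
      proof (cases "fst i \<in> idx g")
        case True
        show ?thesis by (simp only: A_power_Suc[OF True])
      next
        case False
        show ?thesis by (simp only: Suc.prems(2)[OF False] fmult_zero)
      qed
    qed
    also have "\<dots> = Sum_any (\<lambda>l. ((\<lambda>e. Sum_any (\<lambda>i. (r i \<star> A_tilde f i l) e)) \<star> A_power f k l j) e)"
      by (rule fmult_Sum_any_assoc[OF row_mat_finite[OF Suc.prems(1) A_tilde_family A_power_tame]])
    also have "\<dots> = (right_mult_A f ^^ k) (right_mult_A f r) j e"
    proof -
      have "right_mult_A f r i = (\<lambda>_. 0)" if "fst i \<notin> idx g" for i using that by (simp add: right_mult_A_def A_tilde_def)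
      note IH = fun_cong[OF Suc.IH[OF right_mult_A_family[OF Suc.prems(1)] this], of e]
      have "(\<lambda>e. Sum_any (\<lambda>i. (r i \<star> A_tilde f i l) e)) = right_mult_A f r l" for l by (simp only: right_mult_A_def)
      then show ?thesis using IH by (simp only: simp_thms)
    qed
    finally show ?thesis .
  qed
  then show ?case by (simp add: funpow_swap1)
qed

abbreviation L_A_power :: "(fvar \<Rightarrow> nat \<Rightarrow> int \<Rightarrow> complex) \<Rightarrow> nat \<Rightarrow> int \<times> nat \<Rightarrow> fseries" where
  "L_A_power f k \<equiv> (right_mult_A f ^^ k) (L_tilde f)"

lemma L_A_power_supp:
  assumes "L_A_power f k j d \<noteq> 0"
  shows "fst j \<in> idx g \<and> d \<in> cone_monoid \<and> total_degree d = - 1 \<and> (\<exists>t::nat. rho_degree d = of_nat (4 * k + t + snd j) / 2)"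
  using assms
proof (induction k arbitrary: j d)
  case 0
  then have "L_tilde f j d \<noteq> 0" by simp
  from L_tilde_supp[OF this] show ?case by (auto intro!: exI[of _ 3] simp: add.commute)
next
  case (Suc k)
  have "right_mult_A f (L_A_power f k) j d \<noteq> 0" using Suc.prems by simp
  then obtain i where "(L_A_power f k i \<star> A_tilde f i j) d \<noteq> 0" unfolding right_mult_A_def by (blast dest: Sum_any_nonzero)
  then obtain d1 where d1: "L_A_power f k i d1 \<noteq> 0" "A_tilde f i j (esub d d1) \<noteq> 0" by (blast dest: fmult_nonzero)
  note s2 = A_tilde_supp[OF d1(2)] and s1 = Suc.IH[OF d1(1)]
  obtain t :: nat where t: "rho_degree d1 = of_nat (4 * k + t + snd i) / 2" using s1 by blast
  have d: "d = (\<lambda>q. d1 q + esub d d1 q)" by auto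
  have "d \<in> cone_monoid" by (subst d) (intro cone_monoid_add; use s1 s2 in blast)
  moreover have "total_degree d = - 1" using s1 s2 by (subst d) (simp only: total_degree_add, simp)
  moreover have "rho_degree d = of_nat (4 * Suc k + (t + snd i + snd i) + snd j) / 2"
    using s2 t by (subst d) (simp only: rho_degree_add, simp add: field_simps)
  ultimately show ?case using s2 by blast
qed

abbreviation resolvent_row :: "(fvar \<Rightarrow> nat \<Rightarrow> int \<Rightarrow> complex) \<Rightarrow> int \<times> nat \<Rightarrow> fseries" where
  "resolvent_row f \<equiv> Ltilde_resolvent g f"

lemma const1_nonzero: "const_series 1 d \<noteq> 0 \<Longrightarrow> d = (\<lambda>_. 0)"
  by (auto simp: const_series_def split: if_splits)

text \<open>
  The entry \<open>A~\<^sup>k\<close> has \<open>\<rho>\<close>-degree at least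
  \<open>2k\<close>, so for a given exponent only finitely many \<open>k\<close> contribute and
  the row distributes over the geometric series.
\<close>
lemma resolvent_row_eq: "resolvent_row f j e = Sum_any (\<lambda>k. L_A_power f k j e)"
proof -
  have "resolvent_row f j e = Sum_any (\<lambda>i. (L_tilde f i \<star> (\<lambda>e. Sum_any (\<lambda>k. (A_power f k i j \<star> const_series 1) e))) e)"
    unfolding Ltilde_resolvent_def row_times_mat_def[of g "row_times_mat g (Lrow f) Delta"] row_times_col_def
  proof (intro arg_cong[of _ _ Sum_any] ext)
    fix i
    show "(if fst i \<in> idx g then (row_times_mat g (Lrow f) Delta i \<star> geometric g (mat_times_mat g (Amat f) Delta) i j) e else 0)
      = (L_tilde f i \<star> (\<lambda>e. Sum_any (\<lambda>k. (A_power f k i j \<star> const_series 1) e))) e"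
      by (cases "fst i \<in> idx g") (simp_all add: row_times_Delta L_tilde_def geometric_def A_power_def const1_fmult)
  qed
  \<comment> \<open>The exchange of the row sum with the geometric series is the associativity law with the constant column 1.\<close>
  also have "\<dots> = Sum_any (\<lambda>k. ((\<lambda>e. Sum_any (\<lambda>i. (L_tilde f i \<star> A_power f k i j) e)) \<star> const_series 1) e)"
  proof (rule fmult_Sum_any_assoc)
    let ?D = "{(d, d'). d \<in> (\<Union>i. supp (L_tilde f i)) \<and> d' \<in> {d \<in> cone_monoid. total_degree d = 0} \<and> (\<lambda>q. e q - d q - d' q) \<in> {\<lambda>_. 0}}"
    have "finite ?D"
    proof (rule cone_bounded_decomp3)
      show "cone_bounded (\<Union>i. supp (L_tilde f i))" using L_tilde_family by (simp add: tame_family_def tame_def)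
      show "cone_bounded {d \<in> cone_monoid. total_degree d = 0}" using tame_cone_monoid by (simp add: tame_def)
      have "tame {\<lambda>_. 0 :: complex}" by (rule tame_finite) auto
      then show "cone_bounded {\<lambda>_. 0 :: complex}" by (simp add: tame_def)
    qed
    then have "finite (SIGMA dd:?D. {i. L_tilde f i (fst dd) \<noteq> 0} \<times> {..nat \<lfloor>2 * Re (rho_degree (snd dd))\<rfloor>})"
      by (rule finite_SigmaI) (use L_tilde_family in \<open>auto simp: tame_family_def\<close>)
    from finite_imageI[OF this, of "\<lambda>((d, d'), (i, k)). (i, d, k, d')"]
    show "finite {(i, d, k, d'). L_tilde f i d \<noteq> 0 \<and> A_power f k i j d' \<noteq> 0 \<and> const_series 1 (\<lambda>q. e q - d q - d' q) \<noteq> 0}"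
    proof (rule rev_finite_subset, intro subsetI)
      fix x assume "x \<in> {(i, d, k, d'). L_tilde f i d \<noteq> 0 \<and> A_power f k i j d' \<noteq> 0 \<and> const_series 1 (\<lambda>q. e q - d q - d' q) \<noteq> 0}"
      then obtain i d k d' where x: "x = (i, d, k, d')" "L_tilde f i d \<noteq> 0" "A_power f k i j d' \<noteq> 0"
        "const_series 1 (\<lambda>q. e q - d q - d' q) \<noteq> 0" by auto
      obtain t :: nat where t: "rho_degree d' = of_nat (4 * k + t) / 2" and m: "d' \<in> cone_monoid" "total_degree d' = 0" using A_power_supp[OF x(3)] by blast
      have "d \<in> (\<Union>i. supp (L_tilde f i))" using x(2) unfolding supp_def by blast
      then have "(d, d') \<in> ?D" using m const1_nonzero[OF x(4)]
        by (simp only: mem_Collect_eq prod.case singleton_iff simp_thms)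
      moreover have "k \<le> nat \<lfloor>2 * Re (rho_degree d')\<rfloor>" using half_bound[OF t] by simp
      ultimately have "((d, d'), (i, k)) \<in> (SIGMA dd:?D. {i. L_tilde f i (fst dd) \<noteq> 0} \<times> {..nat \<lfloor>2 * Re (rho_degree (snd dd))\<rfloor>})"
        using x(2) by (intro SigmaI) auto
      then show "x \<in> (\<lambda>((d, d'), (i, k)). (i, d, k, d')) ` (SIGMA dd:?D. {i. L_tilde f i (fst dd) \<noteq> 0} \<times> {..nat \<lfloor>2 * Re (rho_degree (snd dd))\<rfloor>})"
        unfolding x(1) by (rule rev_image_eqI) simp
    qed
  qed
  also have "\<dots> = Sum_any (\<lambda>k. L_A_power f k j e)"
  proof -
    have "(\<lambda>e. Sum_any (\<lambda>i. (L_tilde f i \<star> A_power f k i j) e)) = L_A_power f k j" for k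
      by (rule row_A_power[OF L_tilde_family]) (simp add: L_tilde_def)
    then show ?thesis by (simp only: const1_fmult)
  qed
  finally show ?thesis .
qed

lemma resolvent_row_supp:
  assumes "resolvent_row f j d \<noteq> 0"
  shows "fst j \<in> idx g \<and> d \<in> cone_monoid \<and> total_degree d = - 1 \<and> (\<exists>t::nat. rho_degree d = of_nat (t + snd j) / 2)"
proof -
  obtain k where k: "L_A_power f k j d \<noteq> 0" using assms unfolding resolvent_row_eq by (blast dest: Sum_any_nonzero)
  from L_A_power_supp[OF k] show ?thesis by blast
qed

lemma resolvent_row_family: "tame_family (resolvent_row f)"
  by (rule tame_family_row) (rule resolvent_row_supp)

text \<open>
  The first term of the geometric series is split off.
\<close>
lemma resolvent_row_rec: "resolvent_row f j e = L_tilde f j e + Sum_any (\<lambda>i. (resolvent_row f i \<star> A_tilde f i j) e)"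
proof -
  have "finite {k. L_A_power f k j e \<noteq> 0}"
  proof (rule finite_subset)
    show "{k. L_A_power f k j e \<noteq> 0} \<subseteq> {..nat \<lfloor>2 * Re (rho_degree e)\<rfloor>}"
    proof
      fix k assume "k \<in> {k. L_A_power f k j e \<noteq> 0}"
      then have nz: "L_A_power f k j e \<noteq> 0" by simp
      obtain t :: nat where "rho_degree e = of_nat (4 * k + t + snd j) / 2" using L_A_power_supp[OF nz] by blast
      from half_bound[OF this] show "k \<in> {..nat \<lfloor>2 * Re (rho_degree e)\<rfloor>}" by simp
    qed
  qed simp
  from Sum_any_Suc[OF this] have "resolvent_row f j e = L_tilde f j e + Sum_any (\<lambda>k. right_mult_A f (L_A_power f k) j e)"
    by (simp add: resolvent_row_eq)
  also have "Sum_any (\<lambda>k. right_mult_A f (L_A_power f k) j e)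
     = Sum_any (\<lambda>k. (const_series 1 \<star> (\<lambda>e. Sum_any (\<lambda>i. (L_A_power f k i \<star> A_tilde f i j) e))) e)"
    by (simp only: const1_fmult right_mult_A_def)
  also have "\<dots> = Sum_any (\<lambda>i. ((\<lambda>e. Sum_any (\<lambda>k. (const_series 1 \<star> L_A_power f k i) e)) \<star> A_tilde f i j) e)"
  proof (rule fmult_Sum_any_assoc)
    let ?D = "{d \<in> {d \<in> cone_monoid. total_degree d = - 1}. esub e d \<in> {d \<in> cone_monoid. total_degree d = 0}}"
    let ?N = "\<lambda>d. nat \<lfloor>2 * Re (rho_degree d)\<rfloor>"
    have "finite ?D" using tame_cone_monoid by (intro cone_bounded_decomp) (auto simp: tame_def)
    then have "finite (SIGMA d:?D. {..?N d} \<times> (idx g \<times> {..?N d}))"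
      by (rule finite_SigmaI) (simp add: finite_idx)
    from finite_imageI[OF this, of "\<lambda>(d, (k, i)). (k, \<lambda>_. 0, i, d)"]
    show "finite {(k, d, i, d'). const_series 1 d \<noteq> 0 \<and> L_A_power f k i d' \<noteq> 0 \<and> A_tilde f i j (\<lambda>q. e q - d q - d' q) \<noteq> 0}"
    proof (rule rev_finite_subset, intro subsetI)
      fix x assume "x \<in> {(k, d, i, d'). const_series 1 d \<noteq> 0 \<and> L_A_power f k i d' \<noteq> 0 \<and> A_tilde f i j (\<lambda>q. e q - d q - d' q) \<noteq> 0}"
      then obtain i d k d' where x: "x = (k, d, i, d')" "const_series 1 d \<noteq> 0" "L_A_power f k i d' \<noteq> 0"
        "A_tilde f i j (\<lambda>q. e q - d q - d' q) \<noteq> 0" by auto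
      have d: "d = (\<lambda>_. 0)" by (rule const1_nonzero[OF x(2)])
      have A: "A_tilde f i j (esub e d') \<noteq> 0" using x(4) d by simp
      obtain t :: nat where t: "rho_degree d' = of_nat (4 * k + t + snd i) / 2" and m: "d' \<in> cone_monoid" "total_degree d' = - 1" "fst i \<in> idx g"
        using L_A_power_supp[OF x(3)] by blast
      have "d' \<in> ?D" using m A_tilde_supp[OF A] by simp
      moreover have "k \<le> ?N d'" "snd i \<le> ?N d'" using half_bound[OF t] by simp_all
      ultimately have "(d', (k, i)) \<in> (SIGMA d:?D. {..?N d} \<times> (idx g \<times> {..?N d}))"
        using m(3) by (cases i) auto
      then show "x \<in> (\<lambda>(d, (k, i)). (k, \<lambda>_. 0, i, d)) ` (SIGMA d:?D. {..?N d} \<times> (idx g \<times> {..?N d}))"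
        unfolding x(1) d by (rule rev_image_eqI) simp
    qed
  qed
  also have "\<dots> = Sum_any (\<lambda>i. (resolvent_row f i \<star> A_tilde f i j) e)"
    by (simp only: const1_fmult resolvent_row_eq[symmetric])
  finally show ?thesis .
qed

end

section \<open>The linear system for the modes at the handles\<close>

context genus_data begin

text \<open>
  The normalisation by a half-power of \<open>\<rho>\<close> balances the half-powers in the
  entries of \<open>L\<close> and \<open>A\<close>.
\<close>
definition column :: "int \<times> nat \<Rightarrow> fseries" where
  "column i = rho_pow (fst i) (- of_nat (snd i) / 2) \<star> hit_series (Wv (fst i)) (int (snd i))"

text \<open>
  The modes at least 3; the index shift is that of \<open>\<Delta>\<close>.
\<close>
definition high_column :: "int \<times> nat \<Rightarrow> fseries" where
  "high_column j = (if fst j \<in> idx g then column (fst j, snd j + 3) else (\<lambda>_. 0))"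

lemma mult_column: "F \<star> column (b, m) = (rho_pow b (- of_nat m / 2) \<star> F) \<star> hit_series (Wv b) (int m)"
  unfolding column_def rho_pow_def by (simp add: fmult_monom1_assoc)

lemma rho_cancel: "rho_pow b (- c) \<star> (rho_pow b c \<star> F) = F"
  unfolding rho_pow_def by (simp add: monom1_monom1 monom1_0_fmult)

lemma Lrow_column: "Lrow f (b, m) \<star> column (b, m) = pi2_deriv f 0 m Xv (Wv b) \<star> hit_series (Wv b) (int m)"
  unfolding mult_column Lrow_def prod.case by (simp only: minus_divide_left[symmetric] rho_cancel)

lemma Amat_column_ne:
  assumes "b \<noteq> - a"
  shows "Amat f (a, r) (b, m) \<star> column (b, m)
    = rho_pow a ((of_nat r + 1) / 2) \<star> (pi2_deriv f r m (Wv (- a)) (Wv b) \<star> hit_series (Wv b) (int m))"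
proof -
  have "rho_pow b (- of_nat m / 2) \<star> Amat f (a, r) (b, m)
     = monom1 (Rv \<bar>a\<bar>) ((of_nat r + 1) / 2) \<star> (monom1 (Rv \<bar>b\<bar>) (- of_nat m / 2) \<star> (monom1 (Rv \<bar>b\<bar>) (of_nat m / 2) \<star> pi2_deriv f r m (Wv (- a)) (Wv b)))"
    unfolding Amat_ne[OF assms] rho_pow_def by (rule monom1_left_commute)
  also have "\<dots> = rho_pow a ((of_nat r + 1) / 2) \<star> pi2_deriv f r m (Wv (- a)) (Wv b)"
    unfolding rho_pow_def by (simp add: monom1_monom1 monom1_0_fmult)
  finally show ?thesis unfolding mult_column rho_pow_def by (simp only: monom1_fmult_assoc)
qed

lemma Amat_column_eq:
  "Amat f (a, r) (- a, m) \<star> column (- a, m)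
    = rho_pow a ((of_nat r + 1) / 2) \<star> (quadratic_part f (Wv (- a)) r (Wv (- a)) m \<star> hit_series (Wv (- a)) (int m))"
proof -
  have "rho_pow (- a) (- of_nat m / 2) \<star> Amat f (a, r) (- a, m)
     = monom1 (Rv \<bar>a\<bar>) (- of_nat m / 2 + (of_nat r + of_nat m + 1) / 2) \<star> quadratic_part f (Wv (- a)) r (Wv (- a)) m"
    unfolding Amat_eq rho_pow_def by (simp add: monom1_monom1)
  also have "- of_nat m / 2 + (of_nat r + of_nat m + 1) / 2 = ((of_nat r + 1) / 2 :: complex)"
    by (simp add: field_simps)
  finally show ?thesis unfolding mult_column rho_pow_def by (simp only: monom1_fmult_assoc)
qed

lemma column_tame: "b \<in> idx g \<Longrightarrow> tame (supp (column (b, m)))"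
  unfolding column_def fst_conv snd_conv rho_pow_def
  by (intro tame_monom_mult hit_series_tame W_facts UnI2)

lemma column_supp:
  assumes "column (b, m) d \<noteq> 0" "b \<in> idx g"
  shows "\<exists>d0. hit_series (Wv b) (int m) d0 \<noteq> 0 \<and> d = (\<lambda>q. d0 q + ((\<lambda>_. 0)(Rv \<bar>b\<bar> := - of_nat m / 2)) q)"
  using monom1_nonzero[of "Rv \<bar>b\<bar>" "- of_nat m / 2"] assms(1) by (simp add: column_def rho_pow_def)

text \<open>
  The half-power of \<open>\<rho>\<^sub>a\<close> removed by the normalisation is
  \<open>m/2\<close>, while the exponent of \<open>\<rho>\<^sub>a\<close> in the mode
  \<open>m\<close> grows like \<open>m\<close>; so the exponents stay bounded below over the
  whole infinite column. The total degree of the entries does not depend on \<open>m\<close> for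
  the same reason.
\<close>
lemma high_column_tame: "tame (\<Union>j. supp (high_column j))"
proof -
  have key: "\<exists>a m d0. a \<in> idx g \<and> hit_series (Wv a) (int m) d0 \<noteq> 0 \<and> d = (\<lambda>q. d0 q + ((\<lambda>_. 0)(Rv \<bar>a\<bar> := - of_nat m / 2)) q)"
    if d: "d \<in> (\<Union>j. supp (high_column j))" for d
  proof -
    obtain j where j: "high_column j d \<noteq> 0" using d unfolding supp_def by blast
    then have b: "fst j \<in> idx g" "column (fst j, snd j + 3) d \<noteq> 0" by (auto simp: high_column_def split: if_splits)
    from column_supp[OF b(2,1)] b(1) show ?thesis by blast
  qed
  have nP: "Rv c \<notin> P" for c by (auto simp: set_positions)
  have "cone_bounded (\<Union>j. supp (high_column j))"
    unfolding cone_bounded_def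
  proof (intro conjI ballI allI impI)
    fix d x assume d: "d \<in> (\<Union>j. supp (high_column j))" "x \<notin> P \<union> R"
    obtain a m d0 where k: "a \<in> idx g" "hit_series (Wv a) (int m) d0 \<noteq> 0" "d = (\<lambda>q. d0 q + ((\<lambda>_. 0)(Rv \<bar>a\<bar> := - of_nat m / 2)) q)"
      using key[OF d(1)] by blast
    have "admissible d0" using k(2) by (rule hit_series_nonzero)
    then have "d0 x = 0" using d(2) by (simp add: admissible_def)
    moreover have "x \<noteq> Rv \<bar>a\<bar>" using W_facts(3)[OF k(1)] d(2) by auto
    ultimately show "d x = 0" unfolding k(3) by simp
  next
    fix U assume U: "outer_closed U"
    obtain c where c: "\<And>q m e. hit_series q m e \<noteq> 0 \<Longrightarrow> (\<exists>k::nat. height U e = c + of_nat k)" using hit_series_height[OF U] by blast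
    show "discrete_below (height U ` (\<Union>j. supp (high_column j)))"
    proof (rule discrete_below_shift[of _ c])
      fix x assume "x \<in> height U ` (\<Union>j. supp (high_column j))"
      then obtain d where d: "d \<in> (\<Union>j. supp (high_column j))" "x = height U d" by blast
      obtain a m d0 where k: "a \<in> idx g" "hit_series (Wv a) (int m) d0 \<noteq> 0" "d = (\<lambda>q. d0 q + ((\<lambda>_. 0)(Rv \<bar>a\<bar> := - of_nat m / 2)) q)"
        using key[OF d(1)] by blast
      have "Rv \<bar>a\<bar> \<notin> U" using U nP by (auto simp: outer_closed_def)
      then have "x = height U d0" unfolding d(2) k(3) height_add height_single[OF U] by simp
      then show "\<exists>k::nat. x = c + of_nat k" using c[OF k(2)] by simp
    qed
  next
    fix r assume "r \<in> R"
    then obtain c where c: "r = Rv (int c)" "c \<in> {1..g}" by (force simp: image_iff intro: that[of "nat x" for x])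
    let ?F = "insert (hw (\<alpha> c)) ((\<lambda>a. hw (state_label (Wv a)) - 1) ` idx g)"
    show "discrete_below ((\<lambda>d. d r) ` (\<Union>j. supp (high_column j)))"
    proof (rule discrete_belowI[of ?F])
      show "finite ?F" by (simp add: finite_idx)
      fix x assume "x \<in> (\<lambda>d. d r) ` (\<Union>j. supp (high_column j))"
      then obtain d where d: "d \<in> (\<Union>j. supp (high_column j))" "x = d r" by blast
      obtain a m d0 where k: "a \<in> idx g" "hit_series (Wv a) (int m) d0 \<noteq> 0" "d = (\<lambda>q. d0 q + ((\<lambda>_. 0)(Rv \<bar>a\<bar> := - of_nat m / 2)) q)"
        using key[OF d(1)] by blast
      show "\<exists>c\<in>?F. \<exists>k::nat. x = c + of_nat k / 2"
      proof (cases "r = Rv \<bar>a\<bar>")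
        case True
        obtain t :: nat where t: "d0 (Rv \<bar>a\<bar>) = hw (state_label (Wv a)) + of_int (int m) - 1 + of_nat t"
          using hit_series_rho'[OF k(2,1)] by blast
        have "x = (hw (state_label (Wv a)) - 1) + of_nat (m + 2 * t) / 2"
        proof -
          have gen: "(h + of_int (int m) - 1 + of_nat t) + - of_nat m / 2 = (h - 1) + of_nat (m + 2 * t) / (2::complex)" for h
            by (simp add: field_simps)
          show ?thesis unfolding d(2) k(3) True fun_upd_same t by (rule gen)
        qed
        then show ?thesis using k(1) by blast
      next
        case False
        obtain t :: nat where t: "d0 (Rv (int c)) = hw (\<alpha> c) + of_nat t" using hit_series_rho[OF k(2) c(2)] by blast
        have "x = hw (\<alpha> c) + of_nat (2 * t) / 2" unfolding d(2) k(3) using False t c(1) by simp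
        then show ?thesis by blast
      qed
    qed
  qed
  moreover have "total_degree ` (\<Union>j. supp (high_column j)) \<subseteq> {- 2 * of_nat n - 1}"
  proof
    fix x assume "x \<in> total_degree ` (\<Union>j. supp (high_column j))"
    then obtain d where d: "d \<in> (\<Union>j. supp (high_column j))" "x = total_degree d" by blast
    obtain a m d0 where k: "a \<in> idx g" "hit_series (Wv a) (int m) d0 \<noteq> 0" "d = (\<lambda>q. d0 q + ((\<lambda>_. 0)(Rv \<bar>a\<bar> := - of_nat m / 2)) q)"
      using key[OF d(1)] by blast
    have "total_degree d0 = - 2 * of_nat n + of_int (int m) - 1" by (rule hit_series_total_degree[OF k(2) W_facts(1)[OF k(1)]])
    then show "x \<in> {- 2 * of_nat n - 1}"
      unfolding d(2) k(3) total_degree_add total_degree_single using nP W_facts(3)[OF k(1)] by simp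
  qed
  ultimately show ?thesis unfolding tame_def using finite_subset by blast
qed

text \<open>
  The kernels of the Ward identity at \<open>p\<close>, including the exceptional one at
  \<open>p\<close> itself.
\<close>
definition ward_coeff :: "(fvar \<Rightarrow> nat \<Rightarrow> int \<Rightarrow> complex) \<Rightarrow> fvar \<Rightarrow> nat \<Rightarrow> fvar \<Rightarrow> nat \<Rightarrow> fseries" where
  "ward_coeff f p r q m = (if q = p then quadratic_part f p r p m else pi2_deriv f r m p q)"

lemma ward_coeff_finite:
  assumes p: "p \<in> P" and q: "q \<in> P"
  shows "finite {m. (ward_coeff f p r q m \<star> hit_series q (int m)) e \<noteq> 0}"
proof (cases "q = p")
  case True
  have "{m. (ward_coeff f p r q m \<star> hit_series q (int m)) e \<noteq> 0} \<subseteq> {..2}"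
    using quadratic_part_zero[of m f p r p for m] True by (auto simp: ward_coeff_def not_le Suc_le_eq numeral_eq_Suc intro!: leI)
  then show ?thesis by (rule finite_subset) simp
next
  case False
  then show ?thesis using pi2_hit_series_finite[OF p, of q f r e] q by (simp add: ward_coeff_def)
qed

lemma ward_coeff_ward:
  assumes p: "p \<in> P"
  shows "hit_series p (- int r - 1) e = (\<Sum>q\<in>P. Sum_any (\<lambda>m. (ward_coeff f p r q m \<star> hit_series q (int m)) e))"
proof -
  have "Sum_any (\<lambda>m. (ward_coeff f p r p m \<star> hit_series p (int m)) e) = (\<Sum>m\<le>2. (quadratic_part f p r p m \<star> hit_series p (int m)) e)"
    unfolding ward_coeff_def
    by (simp, rule Sum_any.expand_superset) (use quadratic_part_zero[of m f p r p for m] in \<open>auto simp: not_le Suc_le_eq numeral_eq_Suc intro!: leI\<close>)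
  moreover have "(\<Sum>q\<in>P - {p}. Sum_any (\<lambda>m. (ward_coeff f p r q m \<star> hit_series q (int m)) e))
     = (\<Sum>q\<in>P - {p}. Sum_any (\<lambda>m. (pi2_deriv f r m p q \<star> hit_series q (int m)) e))"
    by (rule sum.cong) (auto simp: ward_coeff_def)
  ultimately show ?thesis unfolding pi2_ward[OF p, of r e f]
    by (simp add: sum.remove[OF fin(1) p] add.commute)
qed

text \<open>
  Separates the modes that are known, that is those at most 2 at the handles and all those at
  the points \<open>y\<^sub>k\<close>, from the unknown modes at the handles.
\<close>
lemma ward_coeff_split:
  assumes p: "p \<in> P"
  shows "hit_series p (- int r - 1) e = (\<Sum>b\<in>idx g. \<Sum>l\<le>2. (ward_coeff f p r (Wv b) l \<star> hit_series (Wv b) (int l)) e)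
     + Sum_any (\<lambda>j. if fst j \<in> idx g then (ward_coeff f p r (Wv (fst j)) (snd j + 3) \<star> hit_series (Wv (fst j)) (int (snd j + 3))) e else 0)
     + (\<Sum>k\<in>{1..n}. \<Sum>m\<le>3. (ward_coeff f p r (Yv k) m \<star> hit_series (Yv k) (int m)) e)"
proof -
  let ?h = "\<lambda>b m. (ward_coeff f p r (Wv b) m \<star> hit_series (Wv b) (int m)) e"
  have W: "Sum_any (?h b) = (\<Sum>l\<le>2. ?h b l) + Sum_any (\<lambda>m. ?h b (m + 3))" if "b \<in> idx g" for b
    by (rule Sum_any_3[OF ward_coeff_finite[OF p W_facts(1)[OF that]]])
  have f3: "finite {m. ?h b (m + 3) \<noteq> 0}" if "b \<in> idx g" for b
    using finite_vimageI[OF ward_coeff_finite[OF p W_facts(1)[OF that], of f r e], of "\<lambda>m. m + 3"]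
    by (simp add: vimage_def inj_on_def)
  have Y: "Sum_any (\<lambda>m. (ward_coeff f p r (Yv k) m \<star> hit_series (Yv k) (int m)) e) = (\<Sum>m\<le>3. (ward_coeff f p r (Yv k) m \<star> hit_series (Yv k) (int m)) e)"
    if k: "k \<in> {1..n}" for k
  proof (rule Sum_any.expand_superset)
    show "{m. (ward_coeff f p r (Yv k) m \<star> hit_series (Yv k) (int m)) e \<noteq> 0} \<subseteq> {..3}"
    proof
      fix m assume m: "m \<in> {m. (ward_coeff f p r (Yv k) m \<star> hit_series (Yv k) (int m)) e \<noteq> 0}"
      show "m \<in> {..3}"
      proof (rule ccontr)
        assume "m \<notin> {..3}"
        then have "hit_series (Yv k) (int m) = (\<lambda>_. 0)" unfolding hit_series_Y[OF k] by simp
        then show False using m by simp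
      qed
    qed
  qed simp
  have "Sum_any (\<lambda>m. (ward_coeff f p r Xv m \<star> hit_series Xv (int m)) e) = 0" by (simp add: hit_series_vac)
  then have "hit_series p (- int r - 1) e = (\<Sum>k\<in>{1..n}. \<Sum>m\<le>3. (ward_coeff f p r (Yv k) m \<star> hit_series (Yv k) (int m)) e)
      + ((\<Sum>b\<in>idx g. \<Sum>l\<le>2. ?h b l) + (\<Sum>b\<in>idx g. Sum_any (\<lambda>m. ?h b (m + 3))))"
    unfolding ward_coeff_ward[OF p, of r e f] sum_P using W Y by (simp add: sum.distrib)
  also have "(\<Sum>b\<in>idx g. Sum_any (\<lambda>m. ?h b (m + 3))) = Sum_any (\<lambda>j. if fst j \<in> idx g then ?h (fst j) (snd j + 3) else 0)"
    using Sum_any_pairs(2)[OF finite_idx, of g "\<lambda>j. ?h (fst j) (snd j + 3)"] f3 by simp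
  finally show ?thesis by (simp only: add.commute add.left_commute)
qed

type_synonym term_idx = "(int \<times> nat) + (nat \<times> nat)"

text \<open>
  The known terms: low modes at the handles and the modes at the points
  \<open>y\<^sub>k\<close>.
\<close>
definition source_indices :: "term_idx set" where "source_indices = (idx g \<times> {..2}) <+> ({1..n} \<times> {..3})"

definition source_series :: "term_idx \<Rightarrow> fseries" where
  "source_series z = (case z of Inl (b, l) \<Rightarrow> column (b, l) | Inr (k, m) \<Rightarrow> hit_series (Yv k) (int m))"

definition direct_coeff :: "(fvar \<Rightarrow> nat \<Rightarrow> int \<Rightarrow> complex) \<Rightarrow> term_idx \<Rightarrow> fseries" where
  "direct_coeff f z = (case z of Inl (b, l) \<Rightarrow> Lrow f (b, l) | Inr (k, m) \<Rightarrow> hderiv (Yv k) m (pi2 f Xv (Yv k)))"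

definition source_coeff :: "(fvar \<Rightarrow> nat \<Rightarrow> int \<Rightarrow> complex) \<Rightarrow> term_idx \<Rightarrow> int \<times> nat \<Rightarrow> fseries" where
  "source_coeff f z i = (if fst i \<in> idx g then (case z of Inl (b, l) \<Rightarrow> Amat f i (b, l) | Inr (k, m) \<Rightarrow> hderiv (Yv k) m (Rcol f (Yv k) i)) else (\<lambda>_. 0))"

lemma source_indices_finite: "finite source_indices"
  by (simp add: source_indices_def finite_idx)

lemma sum_source_indices: "(\<Sum>z\<in>source_indices. h z :: complex) = (\<Sum>b\<in>idx g. \<Sum>l\<le>2. h (Inl (b, l))) + (\<Sum>k\<in>{1..n}. \<Sum>m\<le>3. h (Inr (k, m)))"
  unfolding source_indices_def by (subst sum.Plus) (simp_all add: finite_idx sum.cartesian_product case_prod_unfold o_def)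

lemma Yv_P: "1 \<le> k \<Longrightarrow> k \<le> n \<Longrightarrow> Yv k \<in> P"
  by (simp add: set_positions)

lemma source_series_tame: "z \<in> source_indices \<Longrightarrow> tame (supp (source_series z))"
  by (auto simp: source_indices_def source_series_def intro!: column_tame hit_series_tame Yv_P)

text \<open>
  The Ward identity at \<open>x\<close>.
\<close>
lemma row_equation:
  "hit_series Xv (- 1) e = (\<Sum>z\<in>source_indices. (direct_coeff f z \<star> source_series z) e) + Sum_any (\<lambda>j. (L_tilde f j \<star> high_column j) e)"
proof -
  have W: "ward_coeff f Xv 0 (Wv b) m \<star> hit_series (Wv b) (int m) = Lrow f (b, m) \<star> column (b, m)" for b m
    by (simp add: ward_coeff_def Lrow_column)
  have Y: "ward_coeff f Xv 0 (Yv k) m = hderiv (Yv k) m (pi2 f Xv (Yv k))" for k m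
    by (simp add: ward_coeff_def pi2_deriv_def)
  have "(if fst j \<in> idx g then (Lrow f (fst j, snd j + 3) \<star> column (fst j, snd j + 3)) e else 0) = (L_tilde f j \<star> high_column j) e" for j
    by (simp add: L_tilde_def high_column_def)
  then show ?thesis
    using ward_coeff_split[OF Xv_P, of 0 e f] unfolding W Y sum_source_indices by (simp add: direct_coeff_def source_series_def)
qed

text \<open>
  Adjointness turns the mode \<open>r + 3\<close> at \<open>w\<^sub>a\<close> into the mode
  \<open>-r-1\<close> at \<open>w\<^sub>-\<^sub>a\<close>, and the Ward identity at
  \<open>w\<^sub>-\<^sub>a\<close> applies. The powers of \<open>\<rho>\<^sub>a\<close> combine
  to \<open>(r+1)/2\<close>, the normalisation of the rows of \<open>A\<close> and
  \<open>R\<close>.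
\<close>
lemma column_equation:
  assumes i: "fst i \<in> idx g"
  shows "high_column i e = Sum_any (\<lambda>j. (A_tilde f i j \<star> high_column j) e) + (\<Sum>z\<in>source_indices. (source_coeff f z i \<star> source_series z) e)"
proof -
  obtain a r where ar: "i = (a, r)" "a \<in> idx g" using i by (cases i) auto
  let ?p = "Wv (- a)" and ?c = "(of_nat r + 1) / 2 :: complex"
  let ?e = "e(Rv \<bar>a\<bar> := e (Rv \<bar>a\<bar>) - ?c)"
  have p: "?p \<in> P" by (rule W_facts(2)[OF ar(2)])
  have rho: "(rho_pow a ?c \<star> F) e = F ?e" for F by (simp add: rho_pow_def monom1_fmult)
  have "high_column i = rho_pow a (- of_nat (r + 3) / 2) \<star> (rho_pow a (of_int (int (r + 3)) - 1) \<star> hit_series ?p (2 - int (r + 3)))"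
    unfolding ar(1) high_column_def column_def using ar(2) hit_series_adj[OF ar(2), of "int (r + 3)"] by simp
  also have "\<dots> = rho_pow a ?c \<star> hit_series ?p (- int r - 1)"
  proof -
    have "- of_nat (r + 3) / 2 + (of_int (int (r + 3)) - 1) = ?c" by (simp add: field_simps)
    moreover have "2 - int (r + 3) = - int r - 1" by simp
    ultimately show ?thesis unfolding rho_pow_def monom1_monom1 by (simp only:)
  qed
  finally have "high_column i e = hit_series ?p (- int r - 1) ?e" by (simp only: rho)
  moreover have W: "(ward_coeff f ?p r (Wv b) m \<star> hit_series (Wv b) (int m)) ?e = (Amat f i (b, m) \<star> column (b, m)) e" for b m
  proof (cases "b = - a")
    case True
    show ?thesis unfolding True ar(1) Amat_column_eq rho by (simp add: ward_coeff_def)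
  next
    case False
    then show ?thesis unfolding ar(1) Amat_column_ne[OF False] rho by (simp add: ward_coeff_def)
  qed
  moreover have Y: "(ward_coeff f ?p r (Yv k) m \<star> hit_series (Yv k) (int m)) ?e = (hderiv (Yv k) m (Rcol f (Yv k) i) \<star> hit_series (Yv k) (int m)) e" for k m
  proof -
    have "hderiv (Yv k) m (Rcol f (Yv k) i) = rho_pow a ?c \<star> hderiv (Yv k) m (hderiv ?p r (pi2 f ?p (Yv k)))"
      unfolding ar(1) Rcol_def prod.case pi2_deriv_def hderiv_0
      by (rule hderiv_fmult_const) (auto simp: rho_pow_def monom1_def split: if_splits)
    also have "hderiv (Yv k) m (hderiv ?p r (pi2 f ?p (Yv k))) = pi2_deriv f r m ?p (Yv k)"
      unfolding pi2_deriv_def by (rule hderiv_commute) simp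
    finally have eq: "hderiv (Yv k) m (Rcol f (Yv k) i) = rho_pow a ?c \<star> pi2_deriv f r m ?p (Yv k)" .
    show ?thesis unfolding eq rho_pow_def monom1_fmult_assoc monom1_fmult by (simp add: ward_coeff_def)
  qed
  moreover have "(if fst j \<in> idx g then (Amat f i (fst j, snd j + 3) \<star> column (fst j, snd j + 3)) e else 0) = (A_tilde f i j \<star> high_column j) e" for j
    using i by (simp add: A_tilde_def high_column_def)
  ultimately show ?thesis
    using ward_coeff_split[OF p, of r ?e f] i unfolding W Y sum_source_indices by (simp add: source_coeff_def source_series_def)
qed

lemma slice_tame_Lrow: "b \<in> idx g \<Longrightarrow> slice_tame (supp (Lrow f (b, l)))"
  unfolding Lrow_def prod.case rho_pow_def
  by (intro slice_tame_monom_mult slice_tame_pi2_deriv UnI2 W_facts Xv_P) (simp_all add: outer_def)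

lemma direct_coeff_slice_tame: "z \<in> source_indices \<Longrightarrow> slice_tame (supp (direct_coeff f z))"
proof -
  have "slice_tame (supp (hderiv (Yv k) m (pi2 f Xv (Yv k))))" if "k \<in> {1..n}" for k m
    using slice_tame_pi2_deriv[of Xv "Yv k" f 0 m] that Xv_P by (simp add: pi2_deriv_def outer_def set_positions)
  then show "z \<in> source_indices \<Longrightarrow> slice_tame (supp (direct_coeff f z))"
    by (auto simp: source_indices_def direct_coeff_def slice_tame_Lrow)
qed

text \<open>
  Uniformity in the row index \<open>r\<close> is the point: the union over all \<open>r\<close>
  is needed for products of the infinite row with this column, and \<open>slice_tame_ray\<close>
  provides it.
\<close>
lemma slice_tame_rho_quadratic_part:
  assumes a: "a \<in> idx g" and q: "q \<in> P"
  shows "slice_tame (\<Union>r. supp (rho_pow a ((of_nat r + 1) / 2) \<star> quadratic_part f (Wv (- a)) r q l))"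
proof -
  note W = W_facts[OF a]
  have ray: "slice_tame (\<Union>r. supp (rho_pow a ((of_nat r + 1) / 2) \<star> f_deriv f (Wv (- a)) r l'))" for l'
  proof (rule slice_tame_ray[OF W(2,3)])
    fix d assume "d \<in> (\<Union>r. supp (rho_pow a ((of_nat r + 1) / 2) \<star> f_deriv f (Wv (- a)) r l'))"
    then obtain r where "(monom1 (Rv \<bar>a\<bar>) ((of_nat r + 1) / 2) \<star> f_deriv f (Wv (- a)) r l') d \<noteq> 0"
      unfolding supp_def rho_pow_def by blast
    then obtain d0 where d0: "f_deriv f (Wv (- a)) r l' d0 \<noteq> 0" "d = (\<lambda>q. d0 q + ((\<lambda>_. 0)(Rv \<bar>a\<bar> := (of_nat r + 1) / 2)) q)"
      by (blast dest: monom1_nonzero)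
    from f_deriv_supp[OF d0(1)] obtain z where "d0 = (\<lambda>_. 0)(Wv (- a) := z)" by blast
    then show "\<exists>m z. d = (\<lambda>x. ((\<lambda>_. 0)(Wv (- a) := z)) x + ((\<lambda>_. 0)(Rv \<bar>a\<bar> := (of_nat m + 1) / 2)) x)"
      using d0(2) by blast
  qed
  have "slice_tame (\<Union>l'\<in>{..2}. esum (supp (monom1 q (of_nat l' - of_nat l))) (\<Union>r. supp (rho_pow a ((of_nat r + 1) / 2) \<star> f_deriv f (Wv (- a)) r l')))"
    by (intro slice_tame_UN slice_tame_add tame_monom ray) (use q in auto)
  moreover have "(\<Union>r. supp (rho_pow a ((of_nat r + 1) / 2) \<star> quadratic_part f (Wv (- a)) r q l))
    \<subseteq> (\<Union>l'\<in>{..2}. esum (supp (monom1 q (of_nat l' - of_nat l))) (\<Union>r. supp (rho_pow a ((of_nat r + 1) / 2) \<star> f_deriv f (Wv (- a)) r l')))"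
  proof
    fix d assume "d \<in> (\<Union>r. supp (rho_pow a ((of_nat r + 1) / 2) \<star> quadratic_part f (Wv (- a)) r q l))"
    then obtain r where r: "(rho_pow a ((of_nat r + 1) / 2) \<star> quadratic_part f (Wv (- a)) r q l) d \<noteq> 0" unfolding supp_def by blast
    let ?x = "(of_nat r + 1) / 2 :: complex"
    have "quadratic_part f (Wv (- a)) r q l (d(Rv \<bar>a\<bar> := d (Rv \<bar>a\<bar>) - ?x)) \<noteq> 0"
      using r by (simp add: rho_pow_def monom1_fmult)
    then obtain l' where l': "l' \<in> {..2}" "(f_deriv f (Wv (- a)) r l' \<star> monom1 q (of_nat l' - of_nat l)) (d(Rv \<bar>a\<bar> := d (Rv \<bar>a\<bar>) - ?x)) \<noteq> 0"
      unfolding quadratic_part_def by (metis (no_types, lifting) mult_zero_right sum.not_neutral_contains_not_neutral)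
    have "(monom1 q (of_nat l' - of_nat l) \<star> (rho_pow a ?x \<star> f_deriv f (Wv (- a)) r l')) d \<noteq> 0"
    proof -
      have "monom1 q (of_nat l' - of_nat l) \<star> (rho_pow a ?x \<star> f_deriv f (Wv (- a)) r l')
         = rho_pow a ?x \<star> (f_deriv f (Wv (- a)) r l' \<star> monom1 q (of_nat l' - of_nat l))"
        unfolding rho_pow_def fmult_commute[of _ "monom1 q (of_nat l' - of_nat l)"] by (rule monom1_left_commute)
      then show ?thesis using l'(2) unfolding rho_pow_def by (simp only: monom1_fmult not_False_eq_True)
    qed
    then have "d \<in> esum (supp (monom1 q (of_nat l' - of_nat l))) (supp (rho_pow a ?x \<star> f_deriv f (Wv (- a)) r l'))"
      using supp_fmult unfolding supp_def by blast
    then show "d \<in> (\<Union>l'\<in>{..2}. esum (supp (monom1 q (of_nat l' - of_nat l))) (\<Union>r. supp (rho_pow a ((of_nat r + 1) / 2) \<star> f_deriv f (Wv (- a)) r l')))"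
      using l'(1) unfolding esum_def by blast
  qed
  ultimately show ?thesis by (rule slice_tame_subset)
qed

text \<open>
  The power of \<open>\<rho>\<^sub>a\<close> compensates the growing order of the derivative in
  the total degree.
\<close>
lemma tame_rho_pole_deriv:
  assumes a: "a \<in> idx g" and q: "q \<in> P" "q \<noteq> Wv (- a)"
  shows "tame (\<Union>r. supp (rho_pow a ((of_nat r + 1) / 2) \<star> pole_deriv (Wv (- a)) q r l))"
proof -
  note W = W_facts[OF a]
  let ?S = "\<Union>r. supp (rho_pow a ((of_nat r + 1) / 2) \<star> pole_deriv (Wv (- a)) q r l)"
  have o: "outer (Wv (- a)) q \<or> outer q (Wv (- a))" by (rule outer_total[OF W(2) q(1)]) (use q in auto)
  have key: "\<exists>r d0. pole_deriv (Wv (- a)) q r l d0 \<noteq> 0 \<and> d = (\<lambda>q. d0 q + ((\<lambda>_. 0)(Rv \<bar>a\<bar> := of_nat (r + 1) / 2)) q)"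
    if "d \<in> ?S" for d
  proof -
    obtain r where "(monom1 (Rv \<bar>a\<bar>) (of_nat (r + 1) / 2) \<star> pole_deriv (Wv (- a)) q r l) d \<noteq> 0"
      using \<open>d \<in> ?S\<close> unfolding supp_def rho_pow_def half_nat by blast
    then show ?thesis by (blast dest: monom1_nonzero)
  qed
  have nP: "Rv \<bar>a\<bar> \<notin> P" using W disj by auto
  have pdR: "d0 x = 0" if "pole_deriv (Wv (- a)) q r l d0 \<noteq> 0" "x \<notin> P" for d0 r x
    by (rule pole_deriv_outside[OF o that(1)]) (use that(2) W q in auto)
  have "cone_bounded ?S"
    unfolding cone_bounded_def
  proof (intro conjI ballI allI impI)
    fix d x assume d: "d \<in> ?S" "x \<notin> P \<union> R"
    obtain r d0 where k: "pole_deriv (Wv (- a)) q r l d0 \<noteq> 0" "d = (\<lambda>q. d0 q + ((\<lambda>_. 0)(Rv \<bar>a\<bar> := of_nat (r + 1) / 2)) q)"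
      using key[OF d(1)] by blast
    have "d0 x = 0" using pdR[OF k(1)] d(2) by blast
    moreover have "x \<noteq> Rv \<bar>a\<bar>" using W(3) d(2) by blast
    ultimately show "d x = 0" unfolding k(2) by simp
  next
    fix U assume U: "outer_closed U"
    show "discrete_below (height U ` ?S)"
    proof (rule discrete_below_shift[of _ 0])
      fix x assume "x \<in> height U ` ?S"
      then obtain d where d: "d \<in> ?S" "x = height U d" by blast
      obtain r d0 where k: "pole_deriv (Wv (- a)) q r l d0 \<noteq> 0" "d = (\<lambda>q. d0 q + ((\<lambda>_. 0)(Rv \<bar>a\<bar> := of_nat (r + 1) / 2)) q)"
        using key[OF d(1)] by blast
      obtain k' :: nat where k': "height U d0 = of_nat k'" using pole_deriv_height[OF W(2) q(1) o k(1) U] by blast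
      have "Rv \<bar>a\<bar> \<notin> U" using U nP by (auto simp: outer_closed_def)
      then have "x = 0 + of_nat k'" unfolding d(2) k(2) height_add height_single[OF U] k' by simp
      then show "\<exists>k::nat. x = 0 + of_nat k" by blast
    qed
  next
    fix r' assume r': "r' \<in> R"
    show "discrete_below ((\<lambda>d. d r') ` ?S)"
    proof (rule discrete_belowI[of "{0}"])
      fix x assume "x \<in> (\<lambda>d. d r') ` ?S"
      then obtain d where d: "d \<in> ?S" "x = d r'" by blast
      obtain r d0 where k: "pole_deriv (Wv (- a)) q r l d0 \<noteq> 0" "d = (\<lambda>q. d0 q + ((\<lambda>_. 0)(Rv \<bar>a\<bar> := of_nat (r + 1) / 2)) q)"
        using key[OF d(1)] by blast
      have "d0 r' = 0" using pdR[OF k(1)] r' disj by blast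
      then have "x = 0 + of_nat (if r' = Rv \<bar>a\<bar> then r + 1 else 0) / 2" unfolding d(2) k(2) by simp
      then show "\<exists>c\<in>{0}. \<exists>k::nat. x = c + of_nat k / 2" by blast
    qed simp
  qed
  moreover have "total_degree ` ?S \<subseteq> {- of_nat l}"
  proof
    fix x assume "x \<in> total_degree ` ?S"
    then obtain d where d: "d \<in> ?S" "x = total_degree d" by blast
    obtain r d0 where k: "pole_deriv (Wv (- a)) q r l d0 \<noteq> 0" "d = (\<lambda>q. d0 q + ((\<lambda>_. 0)(Rv \<bar>a\<bar> := of_nat (r + 1) / 2)) q)"
      using key[OF d(1)] by blast
    have dg: "total_degree d0 = - 1 - of_nat r - of_nat l" by (rule pole_deriv_total_degree[OF W(2) q(1) o k(1)])
    show "x \<in> {- of_nat l}"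
      unfolding d(2) k(2) total_degree_add total_degree_single dg using nP W(3) by (simp add: field_simps)
  qed
  ultimately show ?thesis unfolding tame_def using finite_subset by blast
qed

lemma slice_tame_rho_pi2:
  assumes a: "a \<in> idx g" and q: "q \<in> P" "q \<noteq> Wv (- a)"
  shows "slice_tame (\<Union>r. supp (rho_pow a ((of_nat r + 1) / 2) \<star> pi2_deriv f r l (Wv (- a)) q))"
proof -
  have ne: "Wv (- a) \<noteq> q" using q by auto
  have "slice_tame ((\<Union>r. supp (rho_pow a ((of_nat r + 1) / 2) \<star> pole_deriv (Wv (- a)) q r l)) \<union>
     (\<Union>r. supp (rho_pow a ((of_nat r + 1) / 2) \<star> quadratic_part f (Wv (- a)) r q l)))"
    by (intro slice_tame_Un tame_slice_tame tame_rho_pole_deriv slice_tame_rho_quadratic_part a q)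
  moreover have "(\<Union>r. supp (rho_pow a ((of_nat r + 1) / 2) \<star> pi2_deriv f r l (Wv (- a)) q)) \<subseteq>
     (\<Union>r. supp (rho_pow a ((of_nat r + 1) / 2) \<star> pole_deriv (Wv (- a)) q r l)) \<union>
     (\<Union>r. supp (rho_pow a ((of_nat r + 1) / 2) \<star> quadratic_part f (Wv (- a)) r q l))"
    unfolding pi2_deriv_eq[OF ne] by (auto simp: supp_def rho_pow_def monom1_fmult)
  ultimately show ?thesis by (rule slice_tame_subset)
qed

lemma source_coeff_slice_tame:
  assumes z: "z \<in> source_indices" shows "slice_tame (\<Union>i. supp (source_coeff f z i))"
proof -
  have "slice_tame (\<Union>r. supp (source_coeff f z (a, r)))" if a: "a \<in> idx g" for a
  proof (cases z)
    case (Inl bl)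
    then obtain b l where bl: "z = Inl (b, l)" "b \<in> idx g" using z by (cases bl) (auto simp: source_indices_def)
    have M: "source_coeff f z (a, r) = Amat f (a, r) (b, l)" for r using a bl by (simp add: source_coeff_def)
    have mon: "tame (supp (monom1 (Rv \<bar>b\<bar>) (of_nat l / 2)))" by (rule tame_monom) (use W_facts(3)[OF bl(2)] in blast)
    have sub: "(\<Union>r. supp (monom1 (Rv \<bar>b\<bar>) (of_nat l / 2) \<star> F r)) \<subseteq> esum (supp (monom1 (Rv \<bar>b\<bar>) (of_nat l / 2))) (\<Union>r. supp (F r))"
      for F :: "nat \<Rightarrow> fseries"
      using supp_fmult[of "monom1 (Rv \<bar>b\<bar>) (of_nat l / 2)" "F r" for r] unfolding esum_def by fast
    show ?thesis
    proof (cases "b = - a")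
      case True
      have "(of_nat r + of_nat l + 1) / 2 = of_nat l / 2 + ((of_nat r + 1) / 2 :: complex)" for r by (simp add: field_simps)
      then have "source_coeff f z (a, r) = monom1 (Rv \<bar>b\<bar>) (of_nat l / 2) \<star> (rho_pow a ((of_nat r + 1) / 2) \<star> quadratic_part f (Wv (- a)) r (Wv (- a)) l)" for r
        unfolding M unfolding True Amat_eq rho_pow_def by (simp only: abs_minus_cancel monom1_monom1)
      then have "(\<Union>r. supp (source_coeff f z (a, r))) \<subseteq> esum (supp (monom1 (Rv \<bar>b\<bar>) (of_nat l / 2)))
          (\<Union>r. supp (rho_pow a ((of_nat r + 1) / 2) \<star> quadratic_part f (Wv (- a)) r (Wv (- a)) l))"
        using sub by (simp only:)
      then show ?thesis
        by (rule slice_tame_subset[rotated]) (intro slice_tame_add mon slice_tame_rho_quadratic_part a W_facts)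
    next
      case False
      have "source_coeff f z (a, r) = monom1 (Rv \<bar>b\<bar>) (of_nat l / 2) \<star> (rho_pow a ((of_nat r + 1) / 2) \<star> pi2_deriv f r l (Wv (- a)) (Wv b))" for r
        unfolding M Amat_ne[OF False] rho_pow_def by (rule monom1_left_commute)
      then have "(\<Union>r. supp (source_coeff f z (a, r))) \<subseteq> esum (supp (monom1 (Rv \<bar>b\<bar>) (of_nat l / 2)))
          (\<Union>r. supp (rho_pow a ((of_nat r + 1) / 2) \<star> pi2_deriv f r l (Wv (- a)) (Wv b)))"
        using sub by (simp only:)
      then show ?thesis
        by (rule slice_tame_subset[rotated]) (intro slice_tame_add mon slice_tame_rho_pi2 a W_facts bl; use False in simp)
    qed
  next
    case (Inr km)
    then obtain k m where km: "z = Inr (k, m)" "k \<in> {1..n}" using z by (cases km) (auto simp: source_indices_def)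
    have "source_coeff f z (a, r) = rho_pow a ((of_nat r + 1) / 2) \<star> pi2_deriv f r m (Wv (- a)) (Yv k)" for r
    proof -
      have "source_coeff f z (a, r) = hderiv (Yv k) m (Rcol f (Yv k) (a, r))" using a km by (simp add: source_coeff_def)
      also have "\<dots> = rho_pow a ((of_nat r + 1) / 2) \<star> hderiv (Yv k) m (hderiv (Wv (- a)) r (pi2 f (Wv (- a)) (Yv k)))"
        unfolding Rcol_def prod.case pi2_deriv_def hderiv_0
        by (rule hderiv_fmult_const) (auto simp: rho_pow_def monom1_def split: if_splits)
      also have "hderiv (Yv k) m (hderiv (Wv (- a)) r (pi2 f (Wv (- a)) (Yv k))) = pi2_deriv f r m (Wv (- a)) (Yv k)"
        unfolding pi2_deriv_def by (rule hderiv_commute) simp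
      finally show ?thesis .
    qed
    then show ?thesis using slice_tame_rho_pi2[OF a, of "Yv k" f m] km(2) by (simp add: set_positions)
  qed
  then have "slice_tame (\<Union>a\<in>idx g. \<Union>r. supp (source_coeff f z (a, r)))" by (rule slice_tame_UN[OF finite_idx])
  moreover have "(\<Union>i. supp (source_coeff f z i)) \<subseteq> (\<Union>a\<in>idx g. \<Union>r. supp (source_coeff f z (a, r)))"
  proof
    fix d assume "d \<in> (\<Union>i. supp (source_coeff f z i))"
    then obtain a r where ar: "source_coeff f z (a, r) d \<noteq> 0" unfolding supp_def by auto
    then have "a \<in> idx g" by (auto simp: source_coeff_def split: if_splits)
    then show "d \<in> (\<Union>a\<in>idx g. \<Union>r. supp (source_coeff f z (a, r)))" using ar unfolding supp_def by blast
  qed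
  ultimately show ?thesis by (rule slice_tame_subset)
qed

end

section \<open>Solution of the system and the genus g Ward identity\<close>

context genus_data begin

lemma tame_conv: "tame (supp F) \<Longrightarrow> slice_tame (supp G) \<Longrightarrow> convolvable F G"
  by (rule convolvable_commute) (rule tame_convolvable)

lemma esum_commute: "esum S T = esum T S"
  unfolding esum_def by (force simp: add.commute)

lemma slice_tame_add': "slice_tame S \<Longrightarrow> tame T \<Longrightarrow> slice_tame (esum S T)"
  using slice_tame_add[of T S] by (simp add: esum_commute[of S T])

definition source_column :: "(fvar \<Rightarrow> nat \<Rightarrow> int \<Rightarrow> complex) \<Rightarrow> int \<times> nat \<Rightarrow> fseries" where
  "source_column f i = (\<lambda>e. \<Sum>z\<in>source_indices. (source_coeff f z i \<star> source_series z) e)"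

definition A_column :: "(fvar \<Rightarrow> nat \<Rightarrow> int \<Rightarrow> complex) \<Rightarrow> int \<times> nat \<Rightarrow> fseries" where
  "A_column f i = (\<lambda>e. Sum_any (\<lambda>j. (A_tilde f i j \<star> high_column j) e))"

lemma high_column_eq: "high_column i e = A_column f i e + source_column f i e"
proof (cases "fst i \<in> idx g")
  case True
  then show ?thesis unfolding A_column_def source_column_def by (rule column_equation)
next
  case False
  then show ?thesis by (simp add: high_column_def A_column_def source_column_def A_tilde_def source_coeff_def)
qed

lemma A_column_tame: "tame (\<Union>i. supp (A_column f i))"
proof -
  have "supp (A_column f i) \<subseteq> esum (\<Union>x. supp ((\<lambda>(i, j). A_tilde f i j) x)) (\<Union>j. supp (high_column j))" for i
  proof -
    have "supp (A_column f i) \<subseteq> esum (\<Union>j. supp (A_tilde f i j)) (\<Union>j. supp (high_column j))"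
      unfolding A_column_def by (rule supp_row_col)
    also have "\<dots> \<subseteq> esum (\<Union>x. supp ((\<lambda>(i, j). A_tilde f i j) x)) (\<Union>j. supp (high_column j))"
    proof (rule esum_mono[OF UN_least order_refl])
      fix j
      show "supp (A_tilde f i j) \<subseteq> (\<Union>x. supp ((\<lambda>(i, j). A_tilde f i j) x))"
        using UN_upper[of "(i, j)" UNIV "\<lambda>x. supp ((\<lambda>(i, j). A_tilde f i j) x)"] by simp
    qed
    finally show ?thesis .
  qed
  then have "(\<Union>i. supp (A_column f i)) \<subseteq> esum (\<Union>x. supp ((\<lambda>(i, j). A_tilde f i j) x)) (\<Union>j. supp (high_column j))" by blast
  moreover have "tame (esum (\<Union>x. supp ((\<lambda>(i, j). A_tilde f i j) x)) (\<Union>j. supp (high_column j)))"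
    by (intro tame_add high_column_tame) (use A_tilde_family in \<open>simp add: tame_family_def\<close>)
  ultimately show ?thesis by (rule tame_subset[rotated])
qed

text \<open>
  A product of slice-tame coefficients with tame series would only be slice-tame. The column
  equation gives more, because it writes the source as a difference of two tame columns.
\<close>
lemma source_column_tame: "tame (\<Union>i. supp (source_column f i))"
proof (rule tame_subset[OF tame_Un[OF high_column_tame A_column_tame[of f]]], rule subsetI)
  fix d assume "d \<in> (\<Union>i. supp (source_column f i))"
  then obtain i where "source_column f i d \<noteq> 0" unfolding supp_def by blast
  then have "high_column i d \<noteq> 0 \<or> A_column f i d \<noteq> 0" using high_column_eq[of i d f] by auto
  then show "d \<in> (\<Union>j. supp (high_column j)) \<union> (\<Union>i. supp (A_column f i))" unfolding supp_def by blast
qed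

lemma tame_member: "tame (\<Union>i. supp (x i)) \<Longrightarrow> tame (supp (x i))"
  by (erule tame_subset) (rule UN_upper, rule UNIV_I)

text \<open>
  With \<open>Q\<close> the resolvent row, \<open>H\<close> the column and \<open>S\<close> the
  source, \<open>Q H = L~ H + (Q A~) H\<close> and \<open>Q H = Q (A~ H) + Q S\<close>; the
  triple products agree by associativity and cancel.
\<close>
lemma resolvent_solves: "Sum_any (\<lambda>j. (L_tilde f j \<star> high_column j) e) = Sum_any (\<lambda>i. (resolvent_row f i \<star> source_column f i) e)"
proof -
  let ?QA = "\<lambda>j e. Sum_any (\<lambda>i. (resolvent_row f i \<star> A_tilde f i j) e)"
  have QAf: "tame_family ?QA" by (rule tame_family_row_mat[OF resolvent_row_family A_tilde_family])
  have 1: "Sum_any (\<lambda>i. (resolvent_row f i \<star> A_column f i) e) = Sum_any (\<lambda>j. (?QA j \<star> high_column j) e)"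
    unfolding A_column_def by (rule fmult_Sum_any_assoc[OF row_mat_finite[OF resolvent_row_family A_tilde_family high_column_tame]])
  have "Sum_any (\<lambda>j. (resolvent_row f j \<star> high_column j) e) = Sum_any (\<lambda>j. (L_tilde f j \<star> high_column j) e + (?QA j \<star> high_column j) e)"
  proof (intro arg_cong[of _ _ Sum_any] ext)
    fix j
    have "resolvent_row f j = (\<lambda>e. L_tilde f j e + ?QA j e)" by (rule ext) (rule resolvent_row_rec)
    moreover have "((\<lambda>e. L_tilde f j e + ?QA j e) \<star> high_column j) e = (L_tilde f j \<star> high_column j) e + (?QA j \<star> high_column j) e"
      by (intro fmult_add_left tame_convolvable tame_slice_tame tame_member[OF high_column_tame] tame_familyD L_tilde_family QAf)
    ultimately show "(resolvent_row f j \<star> high_column j) e = (L_tilde f j \<star> high_column j) e + (?QA j \<star> high_column j) e" by (simp only:)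
  qed
  also have "\<dots> = Sum_any (\<lambda>j. (L_tilde f j \<star> high_column j) e) + Sum_any (\<lambda>j. (?QA j \<star> high_column j) e)"
    by (intro Sum_any.distrib row_col_summable' L_tilde_family QAf tame_slice_tame high_column_tame)
  finally have 2: "Sum_any (\<lambda>j. (resolvent_row f j \<star> high_column j) e) = Sum_any (\<lambda>j. (L_tilde f j \<star> high_column j) e) + Sum_any (\<lambda>j. (?QA j \<star> high_column j) e)" .
  have "Sum_any (\<lambda>j. (resolvent_row f j \<star> high_column j) e) = Sum_any (\<lambda>j. (resolvent_row f j \<star> A_column f j) e + (resolvent_row f j \<star> source_column f j) e)"
  proof (intro arg_cong[of _ _ Sum_any] ext)
    fix j
    have "high_column j = (\<lambda>e. A_column f j e + source_column f j e)" by (rule ext) (rule high_column_eq)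
    moreover have "(resolvent_row f j \<star> (\<lambda>e. A_column f j e + source_column f j e)) e = (resolvent_row f j \<star> A_column f j) e + (resolvent_row f j \<star> source_column f j) e"
      by (intro fmult_add_right tame_convolvable tame_slice_tame tame_member[OF A_column_tame] tame_member[OF source_column_tame] tame_familyD resolvent_row_family)
    ultimately show "(resolvent_row f j \<star> high_column j) e = (resolvent_row f j \<star> A_column f j) e + (resolvent_row f j \<star> source_column f j) e" by (simp only:)
  qed
  also have "\<dots> = Sum_any (\<lambda>j. (resolvent_row f j \<star> A_column f j) e) + Sum_any (\<lambda>j. (resolvent_row f j \<star> source_column f j) e)"
    by (intro Sum_any.distrib row_col_summable' resolvent_row_family tame_slice_tame A_column_tame source_column_tame)
  finally show ?thesis using 1 2 by simp
qed

definition resolved_coeff :: "(fvar \<Rightarrow> nat \<Rightarrow> int \<Rightarrow> complex) \<Rightarrow> term_idx \<Rightarrow> fseries" where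
  "resolved_coeff f z = (\<lambda>e. Sum_any (\<lambda>i. (resolvent_row f i \<star> source_coeff f z i) e))"

lemma resolved_coeff_slice_tame: "z \<in> source_indices \<Longrightarrow> slice_tame (supp (resolved_coeff f z))"
  unfolding resolved_coeff_def
  by (rule slice_tame_subset[OF slice_tame_add supp_row_col]) (use resolvent_row_family source_coeff_slice_tame in \<open>auto simp: tame_family_def\<close>)

lemma resolvent_row_source_column: "Sum_any (\<lambda>i. (resolvent_row f i \<star> source_column f i) e) = (\<Sum>z\<in>source_indices. (resolved_coeff f z \<star> source_series z) e)"
proof -
  have "Sum_any (\<lambda>i. (resolvent_row f i \<star> source_column f i) e) = Sum_any (\<lambda>i. \<Sum>z\<in>source_indices. (resolvent_row f i \<star> (source_coeff f z i \<star> source_series z)) e)"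
  proof (intro arg_cong[of _ _ Sum_any] ext)
    fix i
    have "(resolvent_row f i \<star> (\<lambda>e. \<Sum>z\<in>source_indices. 1 * (source_coeff f z i \<star> source_series z) e)) e = (\<Sum>z\<in>source_indices. 1 * (resolvent_row f i \<star> (source_coeff f z i \<star> source_series z)) e)"
    proof (rule fmult_sum_right[OF source_indices_finite])
      fix z assume z: "z \<in> source_indices"
      have "slice_tame (supp (source_coeff f z i))" by (rule slice_tame_subset[OF source_coeff_slice_tame[OF z, of f]]) blast
      then have "slice_tame (supp (source_coeff f z i \<star> source_series z))"
        by (intro slice_tame_subset[OF slice_tame_add' supp_fmult] source_series_tame z)
      then show "convolvable (resolvent_row f i) (source_coeff f z i \<star> source_series z)"
        by (intro tame_conv tame_familyD resolvent_row_family)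
    qed
    then show "(resolvent_row f i \<star> source_column f i) e = (\<Sum>z\<in>source_indices. (resolvent_row f i \<star> (source_coeff f z i \<star> source_series z)) e)"
      unfolding source_column_def by (simp only: mult_1)
  qed
  also have "\<dots> = (\<Sum>z\<in>source_indices. Sum_any (\<lambda>i. (resolvent_row f i \<star> (source_coeff f z i \<star> source_series z)) e))"
    by (intro Sum_any_sum source_indices_finite row_col_summable resolvent_row_family source_coeff_slice_tame source_series_tame)
  also have "\<dots> = (\<Sum>z\<in>source_indices. (resolved_coeff f z \<star> source_series z) e)"
    unfolding resolved_coeff_def by (intro sum.cong refl row_slice_tame_assoc resolvent_row_family source_coeff_slice_tame source_series_tame)
  finally show ?thesis .
qed

lemma main_expansion: "hit_series Xv (- 1) e = (\<Sum>z\<in>source_indices. ((\<lambda>e. direct_coeff f z e + resolved_coeff f z e) \<star> source_series z) e)"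
proof -
  have "((\<lambda>e. direct_coeff f z e + resolved_coeff f z e) \<star> source_series z) e = (direct_coeff f z \<star> source_series z) e + (resolved_coeff f z \<star> source_series z) e" if "z \<in> source_indices" for z
    by (intro fmult_add_left tame_convolvable direct_coeff_slice_tame resolved_coeff_slice_tame source_series_tame that)
  then show ?thesis
    unfolding row_equation[of e f] resolvent_solves resolvent_row_source_column by (simp add: sum.distrib)
qed

text \<open>
  Cancels the normalisation of the column against that in the definition of
  \<open>T\<^sub>a\<close>.
\<close>
lemma coeff_W:
  assumes "b \<in> idx g" "l \<le> 2"
  shows "(\<lambda>e. direct_coeff f (Inl (b, l)) e + resolved_coeff f (Inl (b, l)) e) \<star> source_series (Inl (b, l)) = T2 g f b l \<star> hit_series (Wv b) (int l)"
proof -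
  have "resolved_coeff f (Inl (b, l)) = row_times_mat g (resolvent_row f) (Amat f) (b, l)"
    unfolding resolved_coeff_def row_times_mat_def row_times_col_def
  proof (intro ext arg_cong[of _ _ Sum_any])
    fix e i
    show "(resolvent_row f i \<star> source_coeff f (Inl (b, l)) i) e = (if fst i \<in> idx g then (resolvent_row f i \<star> Amat f i (b, l)) e else 0)"
      by (simp add: source_coeff_def)
  qed
  moreover have "- of_nat l / 2 = - (of_nat l / 2 :: complex)" by simp
  ultimately show ?thesis
    by (simp add: direct_coeff_def source_series_def mult_column T2_def)
qed

text \<open>
  The resolvent row does not involve \<open>y\<^sub>k\<close>, so the derivatives act on the
  column \<open>R(y\<^sub>k)\<close> alone.
\<close>
lemma coeff_Y:
  assumes k: "k \<in> {1..n}"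
  shows "(\<lambda>e. direct_coeff f (Inr (k, m)) e + resolved_coeff f (Inr (k, m)) e) = hderiv (Yv k) m (psi2 g f (Yv k))"
proof -
  have "resolved_coeff f (Inr (k, m)) = hderiv (Yv k) m (\<lambda>e. row_times_col g (resolvent_row f) (Rcol f (Yv k)) e)"
    unfolding resolved_coeff_def row_times_col_def hderiv_Sum_any
  proof (intro ext arg_cong[of _ _ Sum_any])
    fix e i
    have h: "hderiv (Yv k) m (resolvent_row f i \<star> Rcol f (Yv k) i) = resolvent_row f i \<star> hderiv (Yv k) m (Rcol f (Yv k) i)"
    proof (rule hderiv_fmult_const)
      fix d assume "resolvent_row f i d \<noteq> 0"
      then have "d \<in> cone_monoid" using resolvent_row_supp by blast
      then show "d (Yv k) = 0" unfolding cone_monoid_def by blast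
    qed
    show "(resolvent_row f i \<star> source_coeff f (Inr (k, m)) i) e
       = hderiv (Yv k) m (\<lambda>e. if fst i \<in> idx g then (resolvent_row f i \<star> Rcol f (Yv k) i) e else 0) e"
    proof (cases "fst i \<in> idx g")
      case True
      then show ?thesis using h by (simp add: source_coeff_def)
    next
      case False
      then show ?thesis by (simp add: source_coeff_def hderiv_eq)
    qed
  qed
  then show ?thesis unfolding psi2_def hderiv_add by (simp add: direct_coeff_def)
qed

lemma T2_slice_tame:
  assumes b: "b \<in> idx g" and l: "l \<le> 2"
  shows "slice_tame (supp (T2 g f b l))"
proof -
  have z: "Inl (b, l) \<in> source_indices" using b l by (auto simp: source_indices_def)
  have "resolved_coeff f (Inl (b, l)) = row_times_mat g (resolvent_row f) (Amat f) (b, l)"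
    unfolding resolved_coeff_def row_times_mat_def row_times_col_def
    by (intro ext arg_cong[of _ _ Sum_any]) (simp add: source_coeff_def)
  then have "T2 g f b l = rho_pow b (- of_nat l / 2) \<star> (\<lambda>e. direct_coeff f (Inl (b, l)) e + resolved_coeff f (Inl (b, l)) e)"
    by (simp add: T2_def direct_coeff_def)
  then show ?thesis unfolding rho_pow_def
    using slice_tame_subset[OF slice_tame_Un[OF direct_coeff_slice_tame[OF z, of f] resolved_coeff_slice_tame[OF z, of f]] supp_add]
    by (simp add: slice_tame_monom_mult W_facts[OF b])
qed

text \<open>
  The mode 0 is the derivative at the point \<open>w\<^sub>a\<close>, the mode 1 gives the
  weight and hence the Euler operator of \<open>\<rho>\<^sub>a\<close>, and the mode 2 is by
  adjointness \<open>\<rho>\<^sub>a\<close> times the mode 0 at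
  \<open>w\<^sub>-\<^sub>a\<close>.
\<close>
lemma moduli_deriv_hit_series:
  assumes a: "a \<in> {1..int g}" and l: "l \<le> 2"
  shows "moduli_deriv a l base_series = hit_series (Wv a) (int l)"
proof -
  have ai: "a \<in> idx g" using a by (auto simp: idx_def)
  consider "l = 0" | "l = 1" | "l = 2" using l by linarith
  then show ?thesis
  proof cases
    case 1
    then show ?thesis using hit_series_0[OF W_facts(1)[OF ai]] by (simp add: moduli_deriv_def)
  next
    case 2
    have "(rho_pow a 1 \<star> deriv_series (Rv a) base_series) e = hit_series (Wv a) 1 e" for e
      using a unfolding hit_series_1[OF W_facts(1)[OF ai]] by (simp add: rho_pow_def monom1_fmult deriv_series_def inserted_weight_def)
    then show ?thesis using 2 by (auto simp: moduli_deriv_def)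
  next
    case 3
    then show ?thesis using hit_series_adj[OF ai, of 2] hit_series_0[OF W_facts(2)[OF ai]] by (simp add: moduli_deriv_def)
  qed
qed

text \<open>
  Adjointness rewrites the mode \<open>l\<close> at \<open>w\<^sub>-\<^sub>a\<close> as the mode
  \<open>2 - l\<close> at \<open>w\<^sub>a\<close> with the factor \<open>\<rho>\<^sub>a\<close>
  to the power \<open>1 - l\<close> after reversing the summation, which is the definition of
  \<open>\<Theta>\<close>.
\<close>
lemma Theta_sum:
  assumes a: "a \<in> {1..int g}"
  shows "(\<Sum>l\<le>2. (T2 g f a l \<star> hit_series (Wv a) (int l)) e) + (\<Sum>l\<le>2. (T2 g f (- a) l \<star> hit_series (Wv (- a)) (int l)) e)
    = (\<Sum>l\<le>2. (Theta2 g f a l \<star> moduli_deriv a l base_series) e)"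
proof -
  have ai: "a \<in> idx g" using a by (auto simp: idx_def)
  note W = W_facts[OF ai]
  have "(\<Sum>l\<le>2. (T2 g f (- a) l \<star> hit_series (Wv (- a)) (int l)) e) = (\<Sum>l\<le>2. (T2 g f (- a) (2 - l) \<star> hit_series (Wv (- a)) (int (2 - l))) e)"
    by (simp add: numeral_2_eq_2)
  also have "\<dots> = (\<Sum>l\<le>2. ((rho_pow a (1 - of_nat l) \<star> T2 g f (- a) (2 - l)) \<star> hit_series (Wv a) (int l)) e)"
  proof (rule sum.cong[OF refl])
    fix l :: nat assume l: "l \<in> {..2}"
    have "hit_series (Wv (- a)) (int (2 - l)) = rho_pow (- a) (of_int (int (2 - l)) - 1) \<star> hit_series (Wv (- (- a))) (2 - int (2 - l))"
      by (rule hit_series_adj[OF W(4)])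
    moreover have "of_int (int (2 - l)) - 1 = (1 - of_nat l :: complex)" "2 - int (2 - l) = int l"
      using l by (simp_all add: of_nat_diff)
    ultimately have "hit_series (Wv (- a)) (int (2 - l)) = monom1 (Rv \<bar>a\<bar>) (1 - of_nat l) \<star> hit_series (Wv a) (int l)"
      by (simp only: rho_pow_def abs_minus_cancel minus_minus)
    then show "(T2 g f (- a) (2 - l) \<star> hit_series (Wv (- a)) (int (2 - l))) e
        = ((rho_pow a (1 - of_nat l) \<star> T2 g f (- a) (2 - l)) \<star> hit_series (Wv a) (int l)) e"
      by (simp only: rho_pow_def fmult_monom1_assoc)
  qed
  finally have "(\<Sum>l\<le>2. (T2 g f a l \<star> hit_series (Wv a) (int l)) e) + (\<Sum>l\<le>2. (T2 g f (- a) l \<star> hit_series (Wv (- a)) (int l)) e)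
    = (\<Sum>l\<le>2. (T2 g f a l \<star> hit_series (Wv a) (int l)) e + ((rho_pow a (1 - of_nat l) \<star> T2 g f (- a) (2 - l)) \<star> hit_series (Wv a) (int l)) e)"
    by (simp only: sum.distrib)
  also have "\<dots> = (\<Sum>l\<le>2. (Theta2 g f a l \<star> moduli_deriv a l base_series) e)"
  proof (rule sum.cong[OF refl])
    fix l :: nat assume l: "l \<in> {..2}"
    have "slice_tame (supp (rho_pow a (1 - of_nat l) \<star> T2 g f (- a) (2 - l)))"
      unfolding rho_pow_def by (intro slice_tame_monom_mult T2_slice_tame W UnI2) simp
    then have "(Theta2 g f a l \<star> hit_series (Wv a) (int l)) e
      = (T2 g f a l \<star> hit_series (Wv a) (int l)) e + ((rho_pow a (1 - of_nat l) \<star> T2 g f (- a) (2 - l)) \<star> hit_series (Wv a) (int l)) e"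
      unfolding Theta2_def using l by (intro fmult_add_left tame_convolvable T2_slice_tame hit_series_tame W ai) auto
    then show "(T2 g f a l \<star> hit_series (Wv a) (int l)) e + ((rho_pow a (1 - of_nat l) \<star> T2 g f (- a) (2 - l)) \<star> hit_series (Wv a) (int l)) e
      = (Theta2 g f a l \<star> moduli_deriv a l base_series) e"
      using moduli_deriv_hit_series[OF a, of l] l by simp
  qed
  finally show ?thesis .
qed

text \<open>
  The four modes at \<open>y\<^sub>k\<close> produce the two terms of the covariant derivative
  on 2-forms and, through the third derivative of \<open>\<psi>\<^sub>2\<close>, the form
  \<open>\<omega>\<^sub>2\<close>.
\<close>
lemma Y_sum:
  assumes k: "k \<in> {1..n}"
  shows "(\<Sum>m\<le>3. (hderiv (Yv k) m (psi2 g f (Yv k)) \<star> hit_series (Yv k) (int m)) e)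
    = (psi2 g f (Yv k) \<star> deriv_series (Yv k) base_series) e + 2 * (deriv_series (Yv k) (psi2 g f (Yv k)) \<star> base_series) e
      + central_charge D / 2 * (omega2 g f (Yv k) \<star> drop_series k) e"
proof -
  have sum4: "(\<Sum>m\<le>3. (hderiv (Yv k) m (psi2 g f (Yv k)) \<star> hit_series (Yv k) (int m)) e)
    = (hderiv (Yv k) 0 (psi2 g f (Yv k)) \<star> hit_series (Yv k) (int 0)) e + (hderiv (Yv k) 1 (psi2 g f (Yv k)) \<star> hit_series (Yv k) (int 1)) e
      + (hderiv (Yv k) 2 (psi2 g f (Yv k)) \<star> hit_series (Yv k) (int 2)) e + (hderiv (Yv k) 3 (psi2 g f (Yv k)) \<star> hit_series (Yv k) (int 3)) e"
    by (simp add: numeral_eq_Suc)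
  have X0: "hit_series (Yv k) (int 0) = deriv_series (Yv k) base_series" and X1: "hit_series (Yv k) (int 1) = (\<lambda>e. 2 * base_series e)"
    and X2: "hit_series (Yv k) (int 2) = (\<lambda>_. 0)" and X3: "hit_series (Yv k) (int 3) = (\<lambda>e. central_charge D / 2 * drop_series k e)"
    unfolding hit_series_Y[OF k] by simp_all
  show ?thesis
    unfolding sum4 X0 X1 X2 X3 hderiv_0 hderiv_1 omega2_def fmult_cmult_right fmult_zero by simp
qed

theorem genus_ward:
  "hit_series Xv (- 1) e = nabla g f n (\<lambda>_. 2) base_series e
     + central_charge D / 2 * (\<Sum>k\<in>{1..n}. (omega2 g f (Yv k) \<star> drop_series k) e)"
proof -
  have "hit_series Xv (- 1) e = (\<Sum>b\<in>idx g. \<Sum>l\<le>2. (T2 g f b l \<star> hit_series (Wv b) (int l)) e)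
     + (\<Sum>k\<in>{1..n}. \<Sum>m\<le>3. (hderiv (Yv k) m (psi2 g f (Yv k)) \<star> hit_series (Yv k) (int m)) e)"
    unfolding main_expansion[of e f] sum_source_indices
  proof (intro arg_cong2[of _ _ _ _ "(+)"] sum.cong refl)
    fix b l assume "b \<in> idx g" "l \<in> {..2::nat}"
    then show "((\<lambda>e. direct_coeff f (Inl (b, l)) e + resolved_coeff f (Inl (b, l)) e) \<star> source_series (Inl (b, l))) e = (T2 g f b l \<star> hit_series (Wv b) (int l)) e"
      using coeff_W by simp
  next
    fix k m assume "k \<in> {1..n}"
    from coeff_Y[OF this]
    show "((\<lambda>e. direct_coeff f (Inr (k, m)) e + resolved_coeff f (Inr (k, m)) e) \<star> source_series (Inr (k, m))) e = (hderiv (Yv k) m (psi2 g f (Yv k)) \<star> hit_series (Yv k) (int m)) e"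
      by (simp add: source_series_def)
  qed
  also have "(\<Sum>b\<in>idx g. \<Sum>l\<le>2. (T2 g f b l \<star> hit_series (Wv b) (int l)) e)
     = (\<Sum>a\<in>{1..int g}. \<Sum>l\<le>2. (Theta2 g f a l \<star> moduli_deriv a l base_series) e)"
    unfolding sum_idx by (intro sum.cong refl Theta_sum)
  also have "(\<Sum>k\<in>{1..n}. \<Sum>m\<le>3. (hderiv (Yv k) m (psi2 g f (Yv k)) \<star> hit_series (Yv k) (int m)) e)
     = (\<Sum>k\<in>{1..n}. (psi2 g f (Yv k) \<star> deriv_series (Yv k) base_series) e + 2 * (deriv_series (Yv k) (psi2 g f (Yv k)) \<star> base_series) e
      + central_charge D / 2 * (omega2 g f (Yv k) \<star> drop_series k) e)"
    by (intro sum.cong refl Y_sum)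
  finally show ?thesis
    by (simp add: nabla_def sum.distrib sum_distrib_left)
qed

end

theorem proposition6p5:
  fixes D :: "('i, 'a::ab_group_add) voa_family"
    and g n :: nat
    and w \<rho> :: "int \<Rightarrow> complex"
    and A :: "nat \<Rightarrow> complex"
    and f :: "fvar \<Rightarrow> nat \<Rightarrow> int \<Rightarrow> complex"
    and \<alpha> \<beta> :: "nat \<Rightarrow> 'i"
    and B :: "nat \<Rightarrow> 'a set"
    and B' :: "nat \<Rightarrow> 'a \<Rightarrow> 'a"
  assumes "voa_setting D"
    and "g \<ge> 2"
    and "schottky_parameters g w \<rho>"
    and "\<forall>l\<le>2. A l \<in> limit_set g w \<rho>"
    and "inj_on A {..2}"
    and "\<forall>p \<in> insert Xv (Wv ` idx g). bers_coefficients A (f p)"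
    and "\<forall>a\<in>{1..g}. \<alpha> a \<in> labels D"
    and "\<forall>k\<in>{1..2 * g - 1}. \<beta> k \<in> labels D"
    and "\<beta> 1 = contra D (\<alpha> 1)"
    and "\<beta> (2 * g - 1) = contra D (\<alpha> g)"
    and "\<forall>a\<in>{1..g}. dual_homogeneous_bases D (\<alpha> a) (B a) (B' a)"
  defines "F \<equiv> correlation D g \<alpha> \<beta> B B'"
    and "\<omega> \<equiv> conformal D"
  shows "F ((\<omega>, Xv) # map (\<lambda>k. (\<omega>, Yv k)) [1..<Suc n]) =
    (\<lambda>e. nabla g f n (\<lambda>_. 2) (F (map (\<lambda>k. (\<omega>, Yv k)) [1..<Suc n])) e
       + central_charge D / 2 * (\<Sum>k\<in>{1..n}.
           (omega2 g f (Yv k) \<star> F (map (\<lambda>j. (\<omega>, Yv j)) (filter (\<lambda>j. j \<noteq> k) [1..<Suc n]))) e))"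
proof -
  interpret genus_data D n g \<alpha> \<beta> B B'
    by unfold_locales (use assms(1,2,7,8,11) in auto)
  show ?thesis
  proof
    fix e
    have "(\<Sum>k\<in>{1..n}. (omega2 g f (Yv k) \<star> drop_series k) e) =
      (\<Sum>k\<in>{1..n}. (omega2 g f (Yv k) \<star> F (map (\<lambda>j. (\<omega>, Yv j)) (filter (\<lambda>j. j \<noteq> k) [1..<Suc n]))) e)"
      unfolding F_def \<omega>_def by (intro sum.cong refl) (simp only: drop_series_correlation)
    then show "F ((\<omega>, Xv) # map (\<lambda>k. (\<omega>, Yv k)) [1..<Suc n]) e =
      nabla g f n (\<lambda>_. 2) (F (map (\<lambda>k. (\<omega>, Yv k)) [1..<Suc n])) e
       + central_charge D / 2 * (\<Sum>k\<in>{1..n}.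
           (omega2 g f (Yv k) \<star> F (map (\<lambda>j. (\<omega>, Yv j)) (filter (\<lambda>j. j \<noteq> k) [1..<Suc n]))) e)"
      using genus_ward[of e f] unfolding F_def \<omega>_def hit_series_correlation base_series_correlation by (simp only:)
  qed
qed

end
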